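(* Let $1<p<\infty$ with $p\neq 2$, and let $L_p([0,1],\mathbb{C})$ be the complex Banach space of (classes of) $p$-integrable complex-valued functions on $[0,1]$ with Lebesgue measure. Then there are no nontrivial $M$-ideals in $\mathcal{L}(L_p([0,1],\mathbb{C}))$; that is, if $\mathcal{J}$ is an $M$-ideal in $\mathcal{L}(L_p([0,1],\mathbb{C}))$, then $\mathcal{J}=\{0\}$ or $\mathcal{J}=\mathcal{L}(L_p([0,1],\mathbb{C}))$.
   Context: For a Banach space $X$, $\mathcal{L}(X)$ denotes the Banach space of bounded linear operators on $X$ with the operator norm. A closed subspace $J$ of a Banach space $Y$ is called an $M$-ideal in $Y$ if there is a subspace $V\subset Y^*$ such that $Y^*=J^\perp\oplus_1 V$, i.e. $Y^*$ is the direct sum of the annihilator $J^\perp=\{y^*\in Y^*: y^*|_J=0\}$ and $V$, and $\|y^*+v\|=\|y^*\|+\|v\|$ for all $y^*\in J^\perp$, $v\in V$. An $M$-ideal $J$ is nontrivial if $\{0\}\neq J\neq Y$. *)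

theory Defs
  imports "HOL-Analysis.Analysis" "HOL-Library.Function_Algebras"
begin

section \<open>Complex vector spaces\<close>

class complex_vector = ab_group_add +
  fixes scaleC :: "complex \<Rightarrow> 'a \<Rightarrow> 'a"  (infixr \<open>*\<^sub>C\<close> 75)
  assumes scaleC_add_right: "c *\<^sub>C (x + y) = c *\<^sub>C x + c *\<^sub>C y"
    and scaleC_add_left: "(c + d) *\<^sub>C x = c *\<^sub>C x + d *\<^sub>C x"
    and scaleC_scaleC: "c *\<^sub>C d *\<^sub>C x = (c * d) *\<^sub>C x"
    and scaleC_one: "1 *\<^sub>C x = x"

global_interpretation complex_vector:
  vector_space "scaleC :: complex \<Rightarrow> 'a \<Rightarrow> 'a::complex_vector"
  defines csubspace = complex_vector.subspace
  by unfold_locales (simp_all add: scaleC_add_right scaleC_add_left scaleC_scaleC scaleC_one)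

instantiation complex :: complex_vector
begin
definition scaleC_complex :: "complex \<Rightarrow> complex \<Rightarrow> complex"
  where "scaleC_complex c z = c * z"
instance
  by standard (simp_all add: scaleC_complex_def algebra_simps)
end

instantiation "fun" :: (type, complex_vector) complex_vector
begin
definition scaleC_fun :: "complex \<Rightarrow> ('a \<Rightarrow> 'b) \<Rightarrow> 'a \<Rightarrow> 'b"
  where "scaleC_fun c f = (\<lambda>x. c *\<^sub>C f x)"
instance
  by standard
    (simp_all add: scaleC_fun_def fun_eq_iff scaleC_add_right scaleC_add_left scaleC_scaleC scaleC_one)
end


section \<open>Normed spaces, operators and duals\<close>

text \<open>
  A normed space is a linear subspace of a type together with a norm that only matters on
  that subspace.  It cannot simply be a type, since \<open>L\<^sub>p\<close> depends on the real number \<open>p\<close>.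
\<close>

record 'a cnspace =
  vectors :: "'a set"
  nrm :: "'a \<Rightarrow> real"

text \<open>
  An operator is represented by the total function that agrees with it on \<^term>\<open>vectors X\<close> and
  is \<open>0\<close> elsewhere, so that operators are determined by their values on \<^term>\<open>vectors X\<close> and
  their vector space operations are those of the function type.
\<close>

definition bounded_ops :: "'a::complex_vector cnspace \<Rightarrow> 'b::complex_vector cnspace \<Rightarrow> ('a \<Rightarrow> 'b) cnspace"
  where "bounded_ops X Y =
    \<lparr> vectors = {T. (\<forall>x\<in>vectors X. T x \<in> vectors Y) \<and> (\<forall>x. x \<notin> vectors X \<longrightarrow> T x = 0) \<and>
        (\<forall>x\<in>vectors X. \<forall>y\<in>vectors X. T (x + y) = T x + T y) \<and>
        (\<forall>c. \<forall>x\<in>vectors X. T (c *\<^sub>C x) = c *\<^sub>C T x) \<and>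
        (\<exists>B. \<forall>x\<in>vectors X. nrm Y (T x) \<le> B * nrm X x)},
      nrm = (\<lambda>T. SUP x\<in>{x \<in> vectors X. nrm X x \<le> 1}. nrm Y (T x)) \<rparr>"

definition scalar_field :: "complex cnspace"
  where "scalar_field = \<lparr> vectors = UNIV, nrm = cmod \<rparr>"

abbreviation operators :: "'a::complex_vector cnspace \<Rightarrow> ('a \<Rightarrow> 'a) cnspace"
  where "operators X \<equiv> bounded_ops X X"

abbreviation dual :: "'a::complex_vector cnspace \<Rightarrow> ('a \<Rightarrow> complex) cnspace"
  where "dual X \<equiv> bounded_ops X scalar_field"


section \<open>\<open>M\<close>-ideals\<close>

definition closed_subspace :: "'a::complex_vector set \<Rightarrow> 'a cnspace \<Rightarrow> bool"
  where "closed_subspace J Y \<longleftrightarrow> csubspace J \<and> J \<subseteq> vectors Y \<and>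
    (\<forall>u. \<forall>y\<in>vectors Y. (\<forall>n::nat. u n \<in> J) \<and> (\<lambda>n. nrm Y (u n - y)) \<longlonglongrightarrow> 0 \<longrightarrow> y \<in> J)"

definition annihilator :: "'a::complex_vector cnspace \<Rightarrow> 'a set \<Rightarrow> ('a \<Rightarrow> complex) set"
  where "annihilator Y J = {f \<in> vectors (dual Y). \<forall>y\<in>J. f y = 0}"

definition M_ideal :: "'a::complex_vector set \<Rightarrow> 'a cnspace \<Rightarrow> bool"
  where "M_ideal J Y \<longleftrightarrow> closed_subspace J Y \<and>
    (\<exists>V. csubspace V \<and> V \<subseteq> vectors (dual Y) \<and>
      annihilator Y J \<inter> V = {0} \<and>
      {f + v |f v. f \<in> annihilator Y J \<and> v \<in> V} = vectors (dual Y) \<and>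
      (\<forall>f\<in>annihilator Y J. \<forall>v\<in>V. nrm (dual Y) (f + v) = nrm (dual Y) f + nrm (dual Y) v))"


section \<open>The spaces \<open>L\<^sub>p([0,1],\<complex>)\<close>\<close>

abbreviation unit_measure :: "real measure"
  where "unit_measure \<equiv> lebesgue_on {0..1}"

text \<open>
  Classes of measurable functions modulo equality almost everywhere on \<open>[0,1]\<close>; the values of
  representatives outside \<open>[0,1]\<close> are irrelevant.  This type does not depend on \<open>p\<close>.
\<close>

definition ae_eq :: "(real \<Rightarrow> complex) \<Rightarrow> (real \<Rightarrow> complex) \<Rightarrow> bool"
  where "ae_eq f g \<longleftrightarrow> f \<in> borel_measurable unit_measure \<and> g \<in> borel_measurable unit_measure \<and>
    (AE x in unit_measure. f x = g x)"

quotient_type fclass = "real \<Rightarrow> complex" / partial: ae_eq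
proof (rule part_equivpI)
  show "\<exists>f. ae_eq f f"
    by (rule exI[of _ "\<lambda>_. 0"]) (simp add: ae_eq_def)
  show "symp ae_eq"
    by (rule sympI) (auto simp: ae_eq_def elim: AE_mp)
  show "transp ae_eq"
    by (rule transpI) (auto simp: ae_eq_def elim: AE_mp)
qed

instantiation fclass :: complex_vector
begin

lift_definition zero_fclass :: fclass is "\<lambda>_. 0"
  by (simp add: ae_eq_def)

lift_definition plus_fclass :: "fclass \<Rightarrow> fclass \<Rightarrow> fclass" is "\<lambda>f g x. f x + g x"
  by (auto simp: ae_eq_def)

lift_definition minus_fclass :: "fclass \<Rightarrow> fclass \<Rightarrow> fclass" is "\<lambda>f g x. f x - g x"
  by (auto simp: ae_eq_def)

lift_definition uminus_fclass :: "fclass \<Rightarrow> fclass" is "\<lambda>f x. - f x"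
  by (auto simp: ae_eq_def)

lift_definition scaleC_fclass :: "complex \<Rightarrow> fclass \<Rightarrow> fclass" is "\<lambda>c f x. c * f x"
  by (auto simp: ae_eq_def)

instance
  by standard (transfer; auto simp: ae_eq_def algebra_simps)+

end

lift_definition p_integrable :: "real \<Rightarrow> fclass \<Rightarrow> bool"
  is "\<lambda>p f. integrable unit_measure (\<lambda>x. cmod (f x) powr p)"
  by (rule integrable_cong_AE) (auto simp: ae_eq_def)

lift_definition p_norm :: "real \<Rightarrow> fclass \<Rightarrow> real"
  is "\<lambda>p f. (\<integral>x. cmod (f x) powr p \<partial>unit_measure) powr (1 / p)"
  by (rule arg_cong[where f = "\<lambda>t. t powr _"], rule integral_cong_AE) (auto simp: ae_eq_def)

definition Lp :: "real \<Rightarrow> fclass cnspace"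
  where "Lp p = \<lparr> vectors = {f. p_integrable p f}, nrm = p_norm p \<rparr>"

end

theory Submission
  imports Defs "HOL-Library.Discrete_Functions"
begin

text \<open>
  Let \<open>Y = \<L>(L\<^sub>p)\<close> and let \<open>Y\<^sup>* = W \<oplus>\<^sub>1 V\<close> with \<open>W\<close> the annihilator of \<open>J\<close>.  An isometry of \<open>Y\<^sup>*\<close> at
  distance less than \<open>2\<close> from the identity preserves \<open>W\<close>, in particular so does composition with left or
  right multiplication by \<open>1 + (i - 1) 1\<^sub>E\<close>; a first order expansion of norms of corners then shows that
  \<open>W\<close> is stable under composition with all left and right multiplications by operators.

  Let \<open>\<Psi>\<close> be a cluster point of the functionals \<open>T \<mapsto> \<Sum>\<langle>T h, h\<rangle>\<close>, the sum ranging over the Haar functions of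
  one dyadic level.  If \<open>\<Psi> K \<noteq> 0\<close> for some \<open>K \<in> J\<close>, then random signs yield a tree of sets, distributed like the
  dyadic intervals, along which \<open>K\<close> is almost diagonal with diagonal entries almost \<open>\<Psi> K\<close>; hence
  \<open>a K b = \<Psi> K id + rank one + small\<close> for suitable \<open>a\<close> and \<open>b\<close>.  As \<open>W\<close> annihilates rank one operators when
  \<open>J \<noteq> 0\<close>, it annihilates the identity and thus everything, that is, \<open>W = 0\<close> and \<open>J = Y\<close>.

  Otherwise \<open>\<Psi> \<in> W\<close>, and so is \<open>\<Psi>'(T) = \<Psi>(1\<^sub>L T)\<close>, where \<open>L\<close> and \<open>R\<close> are the halves of the interval.  The
  functional \<open>\<phi>(T) = \<integral>\<^sub>R T 1\<^sub>L\<close> (for \<open>p < 2\<close>; the halves are exchanged for \<open>p > 2\<close>) attains its norm \<open>1/2\<close> on a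
  rank one operator, so it lies in \<open>V\<close> and \<open>\<parallel>\<phi> + \<Psi>'\<parallel> = \<parallel>\<phi>\<parallel> + \<parallel>\<Psi>'\<parallel> \<ge> 1\<close>.  But \<open>\<phi> + \<Psi>'\<close> is a limit of averages over
  signs of \<open>\<langle>T(1\<^sub>L + h), 1\<^sub>R + h\<rangle>\<close> with \<open>h\<close> a random sign on \<open>L\<close>; as \<open>1\<^sub>L + h\<close> is concentrated on a set of measure
  \<open>1/4\<close>, the norm is at most \<open>2 (1/4)\<close> to the power \<open>1/p\<close>, which is less than \<open>1\<close>.
\<close>

section \<open>Seminormed spaces and L-decompositions\<close>

text \<open>The expansion of corners rests on a norm \<open>1 + o(t)\<close> for a projection plus
  \<open>t\<close> times a corner. Off-diagonal corners have this property when
  \<open>1 < p\<close>; for columns it fails at exponent 1. Diagonal corners do not have it, so they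
  are written as products of two off-diagonal ones. The exponent 2 must drop out somewhere, since
  there the compact operators form a nontrivial M-ideal. It does so in the last inequality:
  \<open>2 (1/4)^s < 1\<close> holds exactly for \<open>s > 1/2\<close>, and \<open>s\<close> is
  \<open>1/p\<close> for \<open>p < 2\<close> and \<open>1 - 1/p\<close> for \<open>p > 2\<close>.
  The sets diagonalizing \<open>K\<close> cannot be fixed beforehand, because entries of
  \<open>K\<close> between given Haar functions need not be small. On a fine level, however, single
  coefficients tend to 0 while the sums of their moduli stay bounded, so sums with random signs have
  small mean square; only the diagonal terms, where each sign occurs squared, survive. Splitting
  node \<open>k\<close> involves only the \<open>k\<close> current leaves and costs at most a
  multiple of \<open>k^3\<close> times a tolerance, so tolerances prescribed in advance make the
  total error small.\<close>

locale seminormed =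
  fixes X :: "'a::complex_vector cnspace"
  assumes csubspace_vectors: "csubspace (vectors X)"
    and nrm_nonneg: "x \<in> vectors X \<Longrightarrow> 0 \<le> nrm X x"
    and nrm_scaleC: "x \<in> vectors X \<Longrightarrow> nrm X (c *\<^sub>C x) = cmod c * nrm X x"
    and nrm_add: "x \<in> vectors X \<Longrightarrow> y \<in> vectors X \<Longrightarrow> nrm X (x + y) \<le> nrm X x + nrm X y"
begin

lemma zero_mem: "0 \<in> vectors X"
  and add_mem: "x \<in> vectors X \<Longrightarrow> y \<in> vectors X \<Longrightarrow> x + y \<in> vectors X"
  and scale_mem: "x \<in> vectors X \<Longrightarrow> c *\<^sub>C x \<in> vectors X"
  and diff_mem: "x \<in> vectors X \<Longrightarrow> y \<in> vectors X \<Longrightarrow> x - y \<in> vectors X"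
  and uminus_mem: "x \<in> vectors X \<Longrightarrow> - x \<in> vectors X"
  and sum_mem: "(\<And>i. i \<in> I \<Longrightarrow> f i \<in> vectors X) \<Longrightarrow> sum f I \<in> vectors X"
  using csubspace_vectors
  by (auto intro: complex_vector.subspace_0 complex_vector.subspace_add complex_vector.subspace_scale
      complex_vector.subspace_diff complex_vector.subspace_neg complex_vector.subspace_sum)

lemma nrm_zero: "nrm X 0 = 0"
  using nrm_scaleC[OF zero_mem, of 0] by simp

lemma nrm_uminus: "x \<in> vectors X \<Longrightarrow> nrm X (- x) = nrm X x"
  using nrm_scaleC[of x "-1"] by simp

lemma nrm_diff: "x \<in> vectors X \<Longrightarrow> y \<in> vectors X \<Longrightarrow> nrm X (x - y) \<le> nrm X x + nrm X y"
  using nrm_add[of x "- y"] nrm_uminus[of y] uminus_mem[of y] by simp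

lemma nrm_diff_commute: "x \<in> vectors X \<Longrightarrow> y \<in> vectors X \<Longrightarrow> nrm X (x - y) = nrm X (y - x)"
  using nrm_uminus[of "x - y"] diff_mem[of x y] by simp

lemma nrm_sum: "(\<And>i. i \<in> I \<Longrightarrow> f i \<in> vectors X) \<Longrightarrow> nrm X (sum f I) \<le> (\<Sum>i\<in>I. nrm X (f i))"
proof (induction I rule: infinite_finite_induct)
  case (insert i I)
  then show ?case
    using nrm_add[of "f i" "sum f I"] sum_mem[of I f] by fastforce
qed (auto simp: nrm_zero)

end

lemma scaleC_apply: "(c *\<^sub>C f) x = c *\<^sub>C f x"
  by (simp add: scaleC_fun_def)

lemma scaleC_complex [simp]: "c *\<^sub>C z = c * (z::complex)"
  by (simp add: scaleC_complex_def)

lemma seminormed_scalar_field: "seminormed scalar_field"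
  by standard (auto simp: scalar_field_def complex_vector.subspace_def norm_mult norm_triangle_ineq)

section \<open>Bounded operators between seminormed spaces and their norm\<close>

lemma vectors_bounded_ops:
  "T \<in> vectors (bounded_ops X Y) \<longleftrightarrow> (\<forall>x\<in>vectors X. T x \<in> vectors Y) \<and> (\<forall>x. x \<notin> vectors X \<longrightarrow> T x = 0) \<and>
        (\<forall>x\<in>vectors X. \<forall>y\<in>vectors X. T (x + y) = T x + T y) \<and>
        (\<forall>c. \<forall>x\<in>vectors X. T (c *\<^sub>C x) = c *\<^sub>C T x) \<and>
        (\<exists>B. \<forall>x\<in>vectors X. nrm Y (T x) \<le> B * nrm X x)"
  by (simp add: bounded_ops_def)

lemma nrm_bounded_ops: "nrm (bounded_ops X Y) T = (SUP x\<in>{x \<in> vectors X. nrm X x \<le> 1}. nrm Y (T x))"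
  by (simp add: bounded_ops_def)

lemma op_maps: "T \<in> vectors (bounded_ops X Y) \<Longrightarrow> x \<in> vectors X \<Longrightarrow> T x \<in> vectors Y"
  and op_outside: "T \<in> vectors (bounded_ops X Y) \<Longrightarrow> x \<notin> vectors X \<Longrightarrow> T x = 0"
  and op_add: "T \<in> vectors (bounded_ops X Y) \<Longrightarrow> x \<in> vectors X \<Longrightarrow> y \<in> vectors X \<Longrightarrow> T (x + y) = T x + T y"
  and op_scale: "T \<in> vectors (bounded_ops X Y) \<Longrightarrow> x \<in> vectors X \<Longrightarrow> T (c *\<^sub>C x) = c *\<^sub>C T x"
  by (auto simp: vectors_bounded_ops)

text \<open>Operators vanish outside \<open>vectors X\<close> by convention, so agreement on
  \<open>vectors X\<close> is equality of total functions.\<close>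

lemma op_eqI:
  assumes "T \<in> vectors (bounded_ops X Y)" "S \<in> vectors (bounded_ops X Y)"
    and "\<And>x. x \<in> vectors X \<Longrightarrow> T x = S x"
  shows "T = S"
  using assms by (metis ext op_outside)

text \<open>The bound in \<open>bounded_ops\<close> carries no sign; its maximum with 0 is still a
  bound.\<close>

lemma op_bounded:
  assumes "seminormed X" "T \<in> vectors (bounded_ops X Y)"
  obtains B where "0 \<le> B" "\<And>x. x \<in> vectors X \<Longrightarrow> nrm Y (T x) \<le> B * nrm X x"
proof -
  obtain B where B: "\<forall>x\<in>vectors X. nrm Y (T x) \<le> B * nrm X x"
    using assms(2) by (auto simp: vectors_bounded_ops)
  have "nrm Y (T x) \<le> max B 0 * nrm X x" if "x \<in> vectors X" for x
    using B that seminormed.nrm_nonneg[OF assms(1) that]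
    by (meson max.cobounded1 mult_right_mono order_trans)
  then show ?thesis
    using that[of "max B 0"] by simp
qed

context
  fixes X :: "'a::complex_vector cnspace" and Y :: "'b::complex_vector cnspace"
  assumes sX: "seminormed X" and sY: "seminormed Y"
begin

interpretation X: seminormed X by (rule sX)
interpretation Y: seminormed Y by (rule sY)

lemma op_zero: "T \<in> vectors (bounded_ops X Y) \<Longrightarrow> T 0 = 0"
  using op_scale[of T X Y 0 0] X.zero_mem by simp

lemma op_diff:
  assumes "T \<in> vectors (bounded_ops X Y)" "x \<in> vectors X" "y \<in> vectors X"
  shows "T (x - y) = T x - T y"
  using op_add[OF assms(1), of x "- y"] op_scale[OF assms(1,3), of "-1"] X.uminus_mem assms by simp

lemma op_sum:
  assumes "T \<in> vectors (bounded_ops X Y)" "\<And>i. i \<in> I \<Longrightarrow> f i \<in> vectors X"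
  shows "T (sum f I) = (\<Sum>i\<in>I. T (f i))"
  using assms(2)
  by (induction I rule: infinite_finite_induct)
    (simp_all add: op_zero[OF assms(1)] op_add[OF assms(1)] X.sum_mem)

lemma bdd_above_op:
  assumes "T \<in> vectors (bounded_ops X Y)"
  shows "bdd_above ((\<lambda>x. nrm Y (T x)) ` {x \<in> vectors X. nrm X x \<le> 1})"
proof -
  obtain B where B: "0 \<le> B" "\<And>x. x \<in> vectors X \<Longrightarrow> nrm Y (T x) \<le> B * nrm X x"
    using op_bounded[OF sX assms] by blast
  have "nrm Y (T x) \<le> B" if "x \<in> vectors X" "nrm X x \<le> 1" for x
    using B(2)[OF that(1)] mult_left_mono[OF that(2) B(1)] by simp
  then show ?thesis
    by (auto simp: bdd_above_def)
qed

lemma op_nrm_nonneg: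
  assumes "T \<in> vectors (bounded_ops X Y)"
  shows "0 \<le> nrm (bounded_ops X Y) T"
proof -
  have "nrm Y (T 0) \<le> nrm (bounded_ops X Y) T"
    unfolding nrm_bounded_ops
    by (rule cSUP_upper) (auto simp: X.zero_mem X.nrm_zero bdd_above_op[OF assms])
  then show ?thesis
    by (simp add: op_zero[OF assms] Y.nrm_zero)
qed

lemma op_bound:
  assumes "T \<in> vectors (bounded_ops X Y)" "x \<in> vectors X"
  shows "nrm Y (T x) \<le> nrm (bounded_ops X Y) T * nrm X x"
proof (cases "nrm X x = 0")
  case True
  \<comment> \<open>A vector of seminorm 0 cannot be normalised; here any finite bound forces the
    image to have seminorm 0 as well.\<close>
  obtain B where "0 \<le> B" "\<And>x. x \<in> vectors X \<Longrightarrow> nrm Y (T x) \<le> B * nrm X x"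
    using op_bounded[OF sX assms(1)] by blast
  then show ?thesis
    using True assms by fastforce
next
  case False
  then have pos: "nrm X x > 0"
    using X.nrm_nonneg[OF assms(2)] by simp
  define y where "y = of_real (1 / nrm X x) *\<^sub>C x"
  have y: "y \<in> vectors X" "nrm X y = 1"
    using assms pos by (auto simp: y_def X.scale_mem X.nrm_scaleC norm_divide)
  have "nrm Y (T y) \<le> nrm (bounded_ops X Y) T"
    unfolding nrm_bounded_ops by (rule cSUP_upper) (auto simp: y bdd_above_op[OF assms(1)])
  moreover have "nrm Y (T y) = nrm Y (T x) / nrm X x"
    using pos op_maps[OF assms] by (simp add: y_def op_scale[OF assms] Y.nrm_scaleC norm_divide)
  ultimately show ?thesis
    using pos by (simp add: field_simps)
qed

lemma op_nrm_le:
  assumes "0 \<le> B" "\<And>x. x \<in> vectors X \<Longrightarrow> nrm Y (T x) \<le> B * nrm X x"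
  shows "nrm (bounded_ops X Y) T \<le> B"
  unfolding nrm_bounded_ops
proof (rule cSUP_least)
  show "{x \<in> vectors X. nrm X x \<le> 1} \<noteq> {}"
    using X.zero_mem X.nrm_zero by force
  fix x assume "x \<in> {x \<in> vectors X. nrm X x \<le> 1}"
  then show "nrm Y (T x) \<le> B"
    using assms(2)[of x] mult_left_mono[of "nrm X x" 1 B] assms(1) by auto
qed

lemma seminormed_bounded_ops: "seminormed (bounded_ops X Y)"
proof
  show "csubspace (vectors (bounded_ops X Y))"
    unfolding complex_vector.subspace_def
  proof (intro conjI ballI allI)
    show "0 \<in> vectors (bounded_ops X Y)"
      by (auto simp: vectors_bounded_ops Y.zero_mem Y.nrm_zero X.nrm_nonneg intro!: exI[of _ 0])
  next
    fix S T assume S: "S \<in> vectors (bounded_ops X Y)" and T: "T \<in> vectors (bounded_ops X Y)"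
    obtain B where B: "0 \<le> B" "\<And>x. x \<in> vectors X \<Longrightarrow> nrm Y (T x) \<le> B * nrm X x"
      using op_bounded[OF sX T] by blast
    obtain C where C: "0 \<le> C" "\<And>x. x \<in> vectors X \<Longrightarrow> nrm Y (S x) \<le> C * nrm X x"
      using op_bounded[OF sX S] by blast
    have "nrm Y ((S + T) x) \<le> (C + B) * nrm X x" if "x \<in> vectors X" for x
      using B(2)[OF that] C(2)[OF that] Y.nrm_add[OF op_maps[OF S that] op_maps[OF T that]]
      by (simp add: distrib_right)
    then show "S + T \<in> vectors (bounded_ops X Y)"
      unfolding vectors_bounded_ops
      by (auto simp: op_maps[OF S] op_maps[OF T] Y.add_mem op_outside[OF S] op_outside[OF T]
          op_add[OF S] op_add[OF T] op_scale[OF S] op_scale[OF T] scaleC_add_right)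
  next
    fix c T assume T: "T \<in> vectors (bounded_ops X Y)"
    obtain B where B: "0 \<le> B" "\<And>x. x \<in> vectors X \<Longrightarrow> nrm Y (T x) \<le> B * nrm X x"
      using op_bounded[OF sX T] by blast
    have "nrm Y ((c *\<^sub>C T) x) \<le> (cmod c * B) * nrm X x" if "x \<in> vectors X" for x
      using B(2)[OF that] op_maps[OF T that] by (simp add: scaleC_apply Y.nrm_scaleC mult_left_mono mult.assoc)
    then have "\<exists>B. \<forall>x\<in>vectors X. nrm Y ((c *\<^sub>C T) x) \<le> B * nrm X x"
      by blast
    then show "c *\<^sub>C T \<in> vectors (bounded_ops X Y)"
      unfolding vectors_bounded_ops
      by (simp add: op_maps[OF T] Y.scale_mem op_outside[OF T] scaleC_apply
          op_add[OF T] op_scale[OF T] scaleC_add_right scaleC_scaleC mult.commute)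
  qed
next
  fix T assume T: "T \<in> vectors (bounded_ops X Y)"
  then show "0 \<le> nrm (bounded_ops X Y) T"
    by (rule op_nrm_nonneg)
  \<comment> \<open>One inequality for all scalars suffices: applied to \<open>1 / c\<close> and
    \<open>c *\<^sub>C T\<close> it gives the converse.\<close>
  have le: "nrm (bounded_ops X Y) (c *\<^sub>C T) \<le> cmod c * nrm (bounded_ops X Y) T"
    if T: "T \<in> vectors (bounded_ops X Y)" for c T
    by (rule op_nrm_le)
      (use op_nrm_nonneg[OF T] op_bound[OF T] op_maps[OF T]
        in \<open>auto simp: scaleC_apply Y.nrm_scaleC mult.assoc mult_left_mono\<close>)
  show "nrm (bounded_ops X Y) (c *\<^sub>C T) = cmod c * nrm (bounded_ops X Y) T" for c
  proof (cases "c = 0")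
    case True
    then show ?thesis
      using le[OF T, of 0] op_nrm_nonneg[of "0 *\<^sub>C T"] op_nrm_nonneg[OF T] T
      by (auto simp: vectors_bounded_ops Y.zero_mem Y.nrm_zero X.nrm_nonneg intro!: antisym op_nrm_nonneg exI[of _ 0])
  next
    case False
    have cT: "c *\<^sub>C T \<in> vectors (bounded_ops X Y)"
      unfolding vectors_bounded_ops
    proof (intro conjI)
      obtain B where B: "0 \<le> B" "\<And>x. x \<in> vectors X \<Longrightarrow> nrm Y (T x) \<le> B * nrm X x"
        using op_bounded[OF sX T] by blast
      show "\<exists>B. \<forall>x\<in>vectors X. nrm Y ((c *\<^sub>C T) x) \<le> B * nrm X x"
        using B(2) op_maps[OF T] by (intro exI[of _ "cmod c * B"]) (simp add: scaleC_apply Y.nrm_scaleC mult_left_mono mult.assoc)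
    qed (auto simp: op_maps[OF T] Y.scale_mem op_outside[OF T] scaleC_apply
          op_add[OF T] op_scale[OF T] scaleC_add_right scaleC_scaleC mult.commute)
    have "nrm (bounded_ops X Y) T \<le> cmod (1 / c) * nrm (bounded_ops X Y) (c *\<^sub>C T)"
      using le[OF cT, of "1 / c"] False by (simp add: scaleC_scaleC scaleC_one)
    then show ?thesis
      using le[OF T, of c] False by (simp add: norm_divide field_simps)
  qed
  fix S assume S: "S \<in> vectors (bounded_ops X Y)"
  show "nrm (bounded_ops X Y) (T + S) \<le> nrm (bounded_ops X Y) T + nrm (bounded_ops X Y) S"
  proof (rule op_nrm_le)
    show "0 \<le> nrm (bounded_ops X Y) T + nrm (bounded_ops X Y) S"
      using op_nrm_nonneg[OF T] op_nrm_nonneg[OF S] by simp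
    fix x assume x: "x \<in> vectors X"
    show "nrm Y ((T + S) x) \<le> (nrm (bounded_ops X Y) T + nrm (bounded_ops X Y) S) * nrm X x"
      using op_bound[OF T x] op_bound[OF S x] Y.nrm_add[OF op_maps[OF T x] op_maps[OF S x]]
      by (simp add: distrib_right)
  qed
qed

lemma opI:
  assumes "\<And>x. x \<in> vectors X \<Longrightarrow> T x \<in> vectors Y" "\<And>x. x \<notin> vectors X \<Longrightarrow> T x = 0"
    "\<And>x y. x \<in> vectors X \<Longrightarrow> y \<in> vectors X \<Longrightarrow> T (x + y) = T x + T y"
    "\<And>c x. x \<in> vectors X \<Longrightarrow> T (c *\<^sub>C x) = c *\<^sub>C T x"
    "\<And>x. x \<in> vectors X \<Longrightarrow> nrm Y (T x) \<le> B * nrm X x"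
  shows "T \<in> vectors (bounded_ops X Y)"
  unfolding vectors_bounded_ops using assms by blast

end

lemma op_comp:
  assumes sX: "seminormed X" and sY: "seminormed Y" and sZ: "seminormed Z"
    and T: "T \<in> vectors (bounded_ops X Y)" and S: "S \<in> vectors (bounded_ops Y Z)"
  shows op_comp_mem: "S \<circ> T \<in> vectors (bounded_ops X Z)"
    and op_comp_nrm: "nrm (bounded_ops X Z) (S \<circ> T) \<le> nrm (bounded_ops Y Z) S * nrm (bounded_ops X Y) T"
proof -
  have b: "nrm Z ((S \<circ> T) x) \<le> nrm (bounded_ops Y Z) S * nrm (bounded_ops X Y) T * nrm X x"
    if "x \<in> vectors X" for x
    using op_bound[OF sY sZ S op_maps[OF T that]]
      mult_left_mono[OF op_bound[OF sX sY T that] op_nrm_nonneg[OF sY sZ S]]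
    by (simp add: mult.assoc)
  show "S \<circ> T \<in> vectors (bounded_ops X Z)"
    by (rule opI[OF sX sZ _ _ _ _ b])
      (auto simp: op_maps[OF S] op_maps[OF T] op_outside[OF T] op_zero[OF sY sZ S] op_add[OF T] op_add[OF S]
        op_scale[OF S] op_scale[OF T])
  show "nrm (bounded_ops X Z) (S \<circ> T) \<le> nrm (bounded_ops Y Z) S * nrm (bounded_ops X Y) T"
    by (rule op_nrm_le[OF sX sZ _ b]) (auto simp: op_nrm_nonneg sX sY sZ S T)
qed

lemma op_nrm_zero_imp:
  assumes sX: "seminormed X" and T: "f \<in> vectors (dual X)" and "nrm (dual X) f = 0"
  shows "f = 0"
proof (rule ext)
  fix x
  show "f x = 0 x"
    using op_bound[OF sX seminormed_scalar_field T, of x] op_outside[OF T, of x] assms(3)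
    by (cases "x \<in> vectors X") (auto simp: scalar_field_def)
qed

lemma dual_bound:
  assumes sX: "seminormed X" and T: "f \<in> vectors (dual X)" and "x \<in> vectors X"
  shows "cmod (f x) \<le> nrm (dual X) f * nrm X x"
  using op_bound[OF sX seminormed_scalar_field T assms(3)] by (simp add: scalar_field_def)

lemma dual_nrm_le:
  assumes "seminormed X" "0 \<le> B" "\<And>x. x \<in> vectors X \<Longrightarrow> cmod (f x) \<le> B * nrm X x"
  shows "nrm (dual X) f \<le> B"
  by (rule op_nrm_le[OF assms(1) seminormed_scalar_field assms(2)])
    (simp add: scalar_field_def assms(3))

lemma dualI:
  assumes "seminormed X" "\<And>x. x \<notin> vectors X \<Longrightarrow> f x = 0"
    "\<And>x y. x \<in> vectors X \<Longrightarrow> y \<in> vectors X \<Longrightarrow> f (x + y) = f x + f y"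
    "\<And>c x. x \<in> vectors X \<Longrightarrow> f (c *\<^sub>C x) = c * f x"
    "\<And>x. x \<in> vectors X \<Longrightarrow> cmod (f x) \<le> B * nrm X x"
  shows "f \<in> vectors (dual X)"
  by (rule opI[OF assms(1) seminormed_scalar_field, where B = B])
    (simp_all add: scalar_field_def assms)

section \<open>L-decompositions and isometries\<close>

definition L_decomp :: "'a::complex_vector set \<Rightarrow> 'a set \<Rightarrow> 'a cnspace \<Rightarrow> bool"
  where "L_decomp W V Z \<longleftrightarrow> csubspace W \<and> csubspace V \<and> W \<subseteq> vectors Z \<and> V \<subseteq> vectors Z \<and>
    W \<inter> V = {0} \<and> (\<forall>z\<in>vectors Z. \<exists>w\<in>W. \<exists>v\<in>V. z = w + v) \<and>
    (\<forall>w\<in>W. \<forall>v\<in>V. nrm Z (w + v) = nrm Z w + nrm Z v)"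

lemma L_decompD:
  assumes "L_decomp W V Z"
  shows "W \<subseteq> vectors Z" "V \<subseteq> vectors Z" "z \<in> vectors Z \<Longrightarrow> \<exists>w\<in>W. \<exists>v\<in>V. z = w + v"
    "w \<in> W \<Longrightarrow> v \<in> V \<Longrightarrow> nrm Z (w + v) = nrm Z w + nrm Z v"
proof -
  have d: "W \<subseteq> vectors Z" "V \<subseteq> vectors Z" "\<forall>z\<in>vectors Z. \<exists>w\<in>W. \<exists>v\<in>V. z = w + v"
    "\<forall>w\<in>W. \<forall>v\<in>V. nrm Z (w + v) = nrm Z w + nrm Z v"
    using assms unfolding L_decomp_def by - (elim conjE, assumption)+
  show "W \<subseteq> vectors Z" "V \<subseteq> vectors Z" by (rule d)+
  show "z \<in> vectors Z \<Longrightarrow> \<exists>w\<in>W. \<exists>v\<in>V. z = w + v" by (rule bspec[OF d(3)])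
  show "w \<in> W \<Longrightarrow> v \<in> V \<Longrightarrow> nrm Z (w + v) = nrm Z w + nrm Z v" by (rule bspec[OF bspec[OF d(4)]])
qed

lemma L_decomp_unique:
  assumes "L_decomp W V Z" "w \<in> W" "w' \<in> W" "v \<in> V" "v' \<in> V" "w + v = w' + v'"
  shows "w = w' \<and> v = v'"
proof -
  have "w - w' = v' - v"
    using assms(6) by (simp add: algebra_simps)
  moreover have "w - w' \<in> W" "v' - v \<in> V"
    using assms by (auto simp: L_decomp_def intro: complex_vector.subspace_diff)
  ultimately have "w - w' \<in> W \<inter> V" by simp
  moreover have "W \<inter> V = {0}"
    using assms(1) by (simp add: L_decomp_def)
  ultimately have "w - w' = 0"
    by blast
  then show ?thesis
    using \<open>w - w' = v' - v\<close> by simp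
qed

lemma L_decomp_swap:
  assumes "L_decomp W V Z"
  shows "L_decomp V W Z"
proof -
  have "\<exists>v\<in>V. \<exists>w\<in>W. z = v + w" if "z \<in> vectors Z" for z
    using assms that unfolding L_decomp_def by (metis add.commute)
  moreover have "nrm Z (v + w) = nrm Z v + nrm Z w" if "w \<in> W" "v \<in> V" for v w
    using assms that unfolding L_decomp_def by (simp add: add.commute[of v w])
  ultimately show ?thesis
    using assms unfolding L_decomp_def by (simp add: Int_commute)
qed

text \<open>
  Two L-projections commute, and commuting projections at distance less than \<open>1\<close> coincide.
\<close>

lemma L_decomp_isometry_invariant:
  assumes "seminormed Z" and def: "\<And>z. z \<in> vectors Z \<Longrightarrow> nrm Z z = 0 \<Longrightarrow> z = 0"
    and L: "L_decomp W V Z"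
    and uZ: "\<And>z. z \<in> vectors Z \<Longrightarrow> u z \<in> vectors Z"
    and uadd: "\<And>z y. z \<in> vectors Z \<Longrightarrow> y \<in> vectors Z \<Longrightarrow> u (z + y) = u z + u y"
    and uiso: "\<And>z. z \<in> vectors Z \<Longrightarrow> nrm Z (u z) = nrm Z z"
    and usurj: "\<And>z. z \<in> vectors Z \<Longrightarrow> \<exists>y\<in>vectors Z. u y = z"
    and ulip: "\<And>z. z \<in> vectors Z \<Longrightarrow> nrm Z (u z - z) \<le> c * nrm Z z" and "c < 2"
    and w: "w \<in> W"
  shows "u w \<in> W"
proof -
  interpret seminormed Z by fact
  have sub: "W \<subseteq> vectors Z" "V \<subseteq> vectors Z" "csubspace W" "csubspace V" "W \<inter> V = {0}"
    and nadd: "\<And>w v. w \<in> W \<Longrightarrow> v \<in> V \<Longrightarrow> nrm Z (w + v) = nrm Z w + nrm Z v"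
    and ex: "\<And>z. z \<in> vectors Z \<Longrightarrow> \<exists>w\<in>W. \<exists>v\<in>V. z = w + v"
    using L by (auto simp: L_decomp_def)
  have usub: "u (z - y) = u z - u y" if "z \<in> vectors Z" "y \<in> vectors Z" for z y
    using uadd[of "z - y" y] that diff_mem by simp
  have uinj: "z = y" if "z \<in> vectors Z" "y \<in> vectors Z" "u z = u y" for z y
    using usub[of z y] uiso[of "z - y"] def[of "z - y"] that diff_mem nrm_zero by simp
  \<comment> \<open>The isometry transports the decomposition, so the space is also the L-sum of the
    images of \<open>W\<close> and \<open>V\<close>. Both decompositions are now applied to
    \<open>u w\<close>.\<close>
  have split: "\<exists>a\<in>W. \<exists>b\<in>V. z = u a + u b" if zZ: "z \<in> vectors Z" for z
  proof -
    obtain y where y: "y \<in> vectors Z" "u y = z" using usurj[OF zZ] by auto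
    obtain a b where "a \<in> W" "b \<in> V" "y = a + b" using ex[OF y(1)] by auto
    then show ?thesis using uadd[of a b] y sub by blast
  qed
  obtain zw zv where z: "zw \<in> W" "zv \<in> V" "u w = zw + zv"
    using ex[OF uZ[of w]] w sub(1) by auto
  obtain a b where ab: "a \<in> W" "b \<in> V" "zw = u a + u b"
    using split[of zw] z(1) sub(1) by auto
  obtain d e where de: "d \<in> W" "e \<in> V" "zv = u d + u e"
    using split[of zv] z(2) sub(2) by auto
  have mem: "a \<in> vectors Z" "b \<in> vectors Z" "d \<in> vectors Z" "e \<in> vectors Z" "w \<in> vectors Z"
    using ab de w sub by auto
  have ad: "a + d \<in> W" "b + e \<in> V"
    using ab de sub by (auto intro: complex_vector.subspace_add)
  have "u w = u ((a + d) + (b + e))"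
    using z ab de mem by (simp add: uadd add_mem ac_simps)
  then have "w + 0 = (a + d) + (b + e)"
    using uinj[of w "(a + d) + (b + e)"] mem by (simp add: add_mem)
  then have w_eq: "w = a + d"
    using L_decomp_unique[OF L w ad(1) complex_vector.subspace_0[OF sub(4)] ad(2)] by simp
  \<comment> \<open>Refining by both decompositions yields four pieces whose norms add up to that of
    \<open>w\<close>. As \<open>w = a + d\<close>, the norms of \<open>a\<close> and
    \<open>d\<close> already exhaust it, and the other two pieces vanish.\<close>
  have "nrm Z w = nrm Z zw + nrm Z zv"
    using uiso[OF mem(5)] z nadd by simp
  also have "nrm Z zw = nrm Z a + nrm Z b"
    using ab(3) uadd[OF mem(1,2)] uiso[OF add_mem[OF mem(1,2)]] nadd[OF ab(1,2)] by simp
  also have "nrm Z zv = nrm Z d + nrm Z e"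
    using de(3) uadd[OF mem(3,4)] uiso[OF add_mem[OF mem(3,4)]] nadd[OF de(1,2)] by simp
  finally have "nrm Z e = 0"
    using nrm_add[OF mem(1,3)] nrm_nonneg[OF mem(2)] nrm_nonneg[OF mem(4)] w_eq by simp
  then have "e = 0"
    using def mem by blast
  moreover have "u 0 = 0"
    using usub[OF zero_mem zero_mem] by simp
  ultimately have zv: "zv = u d"
    using de by simp
  \<comment> \<open>\<open>zv = u d\<close> lies in \<open>V\<close> and \<open>d\<close> in
    \<open>W\<close>, so \<open>u\<close> moves \<open>d\<close> by twice its norm; the Lipschitz
    constant \<open>c < 2\<close> allows this only for \<open>d = 0\<close>.\<close>
  have dV: "nrm Z (zv - d) = nrm Z zv + nrm Z d"
    using nadd[of "- d" zv] z de sub nrm_uminus[OF mem(3)] complex_vector.subspace_neg[of W d]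
    by (simp add: algebra_simps)
  have "2 * nrm Z d \<le> c * nrm Z d"
    using ulip[OF mem(3)] dV uiso[OF mem(3)] by (simp add: zv)
  then have "(2 - c) * nrm Z d \<le> 0"
    by (simp add: algebra_simps)
  then have "nrm Z d = 0"
    using \<open>c < 2\<close> nrm_nonneg[OF mem(3)] by (simp add: mult_le_0_iff)
  then have "d = 0"
    using def mem by blast
  then show ?thesis
    using z zv \<open>u 0 = 0\<close> by simp
qed

text \<open>For unimodular \<open>c\<close> the map in the last clause multiplies the range of
  \<open>P\<close> by \<open>c\<close> and fixes its kernel. The conjugate scalar gives the inverse
  map, so contractivity makes all these maps isometries.\<close>

definition hermitian_projection :: "'a::complex_vector cnspace \<Rightarrow> ('a \<Rightarrow> 'a) \<Rightarrow> bool"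
  where "hermitian_projection Y P \<longleftrightarrow> P \<in> vectors (operators Y) \<and> (\<forall>y\<in>vectors Y. P (P y) = P y) \<and>
    (\<forall>y\<in>vectors Y. \<forall>c. cmod c = 1 \<longrightarrow> nrm Y (y + (c - 1) *\<^sub>C P y) \<le> nrm Y y)"

text \<open>For \<open>c = - 1\<close> the reflection \<open>1 - 2 P\<close> is a contraction, and
  \<open>2 P\<close> is the identity minus this reflection.\<close>

lemma hermitian_projection_contractive:
  assumes "seminormed Y" "hermitian_projection Y P" "y \<in> vectors Y"
  shows "nrm Y (P y) \<le> nrm Y y"
proof -
  interpret seminormed Y by fact
  have herm: "nrm Y (y + (c - 1) *\<^sub>C P y) \<le> nrm Y y" if "cmod c = 1" for c
    using assms that unfolding hermitian_projection_def by blast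
  have P: "P \<in> vectors (operators Y)" "nrm Y (y + (- 1 - 1) *\<^sub>C P y) \<le> nrm Y y"
    using assms herm[of "- 1"] by (simp_all only: hermitian_projection_def norm_minus_cancel norm_one simp_thms)
  have mem: "P y \<in> vectors Y" "(- 1 - 1) *\<^sub>C P y \<in> vectors Y"
    by (rule op_maps[OF P(1) assms(3)], rule scale_mem[OF op_maps[OF P(1) assms(3)]])
  have "2 *\<^sub>C P y = y - (y + (- 1 - 1) *\<^sub>C P y)"
    by (simp add: complex_vector.scale_left_distrib[of 1 1, simplified] complex_vector.scale_left_diff_distrib)
  then have "2 * nrm Y (P y) = nrm Y (y - (y + (- 1 - 1) *\<^sub>C P y))"
    using nrm_scaleC[OF mem(1), of 2] by simp
  also have "\<dots> \<le> nrm Y y + nrm Y y"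
    using nrm_diff[OF assms(3) add_mem[OF assms(3) mem(2)]] P(2) by simp
  finally show ?thesis by simp
qed

text \<open>The induced isometries of the dual have distance at most \<open>cmod (c - 1)\<close>
  from the identity. The reflection \<open>c = - 1\<close> only gives the bound 2, so
  \<open>c = \<i>\<close> is taken, with bound \<open>sqrt 2\<close>. Then
  \<open>w \<circ> P\<close> is a multiple of the difference of \<open>w\<close> and its
  image.\<close>

lemma L_decomp_projection_invariant:
  assumes sY: "seminormed Y" and L: "L_decomp W V (dual Y)" and P: "hermitian_projection Y P" and w: "w \<in> W"
  shows "w \<circ> P \<in> W"
proof -
  interpret Y: seminormed Y by (rule sY)
  interpret Z: seminormed "dual Y"
    by (rule seminormed_bounded_ops[OF sY seminormed_scalar_field])
  have Pm: "P \<in> vectors (operators Y)" and idem: "\<And>y. y \<in> vectors Y \<Longrightarrow> P (P y) = P y"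
    and herm: "\<And>y c. y \<in> vectors Y \<Longrightarrow> cmod c = 1 \<Longrightarrow> nrm Y (y + (c - 1) *\<^sub>C P y) \<le> nrm Y y"
    using P by (auto simp: hermitian_projection_def)
  define u where "u = (\<lambda>c (f::'a \<Rightarrow> complex). f + (c - 1) *\<^sub>C (f \<circ> P))"
  have comp: "f \<circ> P \<in> vectors (dual Y)" if "f \<in> vectors (dual Y)" for f
    by (rule op_comp_mem[OF sY sY seminormed_scalar_field Pm that])
  have um: "u c f \<in> vectors (dual Y)" if "f \<in> vectors (dual Y)" for c f
    using comp[OF that] that by (auto simp: u_def intro: Z.add_mem Z.scale_mem)
  have uapp: "u c f y = f (y + (c - 1) *\<^sub>C P y)" if "f \<in> vectors (dual Y)" "y \<in> vectors Y" for c f y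
    using that op_maps[OF Pm that(2)]
    by (simp add: u_def scaleC_apply op_add[OF that(1)] op_scale[OF that(1)] Y.scale_mem)
  have ule: "nrm (dual Y) (u c f) \<le> nrm (dual Y) f" if f: "f \<in> vectors (dual Y)" and c: "cmod c = 1" for c f
  proof (rule dual_nrm_le[OF sY Z.nrm_nonneg[OF f]])
    fix y assume y: "y \<in> vectors Y"
    have m: "y + (c - 1) *\<^sub>C P y \<in> vectors Y"
      using y op_maps[OF Pm y] by (intro Y.add_mem Y.scale_mem)
    show "cmod (u c f y) \<le> nrm (dual Y) f * nrm Y y"
      using dual_bound[OF sY f m] mult_left_mono[OF herm[OF y c] Z.nrm_nonneg[OF f]]
      by (simp add: uapp[OF f y])
  qed
  have inv: "u (cnj c) (u c f) = f" if f: "f \<in> vectors (dual Y)" and c: "cmod c = 1" for c f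
  proof (rule op_eqI[OF um[OF um[OF f]] f])
    fix y assume y: "y \<in> vectors Y"
    define z where "z = y + (cnj c - 1) *\<^sub>C P y"
    have Py: "P y \<in> vectors Y" using op_maps[OF Pm y] .
    have z: "z \<in> vectors Y"
      unfolding z_def using y Py by (intro Y.add_mem Y.scale_mem)
    have Pz: "P z = cnj c *\<^sub>C P y"
      unfolding z_def op_add[OF Pm y Y.scale_mem[OF Py]] op_scale[OF Pm Py] idem[OF y]
      by (simp add: complex_vector.scale_left_diff_distrib)
    have "c * cnj c = 1"
      using c by (simp add: complex_norm_square[symmetric])
    then have "z + (c - 1) *\<^sub>C P z = y"
      unfolding Pz scaleC_scaleC by (simp add: z_def algebra_simps complex_vector.scale_left_diff_distrib)
    then show "u (cnj c) (u c f) y = f y"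
      using uapp[OF um[OF f] y, of "cnj c" c] uapp[OF f z, of c]
      unfolding z_def[symmetric] by simp
  qed
  have "u \<i> w \<in> W"
  proof (rule L_decomp_isometry_invariant[OF Z.seminormed_axioms _ L, of "u \<i>" "sqrt 2"])
    show "z = 0" if "z \<in> vectors (dual Y)" "nrm (dual Y) z = 0" for z
      using op_nrm_zero_imp[OF sY that] .
    show "u \<i> z \<in> vectors (dual Y)" if "z \<in> vectors (dual Y)" for z
      using um[OF that] .
    show "u \<i> (z + y) = u \<i> z + u \<i> y" for z y
      by (rule ext) (simp add: u_def scaleC_apply algebra_simps)
    show "nrm (dual Y) (u \<i> z) = nrm (dual Y) z" if "z \<in> vectors (dual Y)" for z
      using ule[OF that, of \<i>] ule[OF um[OF that], of "cnj \<i>" \<i>] inv[OF that, of \<i>] by simp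
    show "\<exists>y\<in>vectors (dual Y). u \<i> y = z" if "z \<in> vectors (dual Y)" for z
      using inv[OF that, of "- \<i>"] um[OF that, of "- \<i>"] by auto
    show "nrm (dual Y) (u \<i> z - z) \<le> sqrt 2 * nrm (dual Y) z" if z: "z \<in> vectors (dual Y)" for z
    proof -
      have "nrm (dual Y) (z \<circ> P) \<le> nrm (dual Y) z"
      proof (rule dual_nrm_le[OF sY Z.nrm_nonneg[OF z]])
        fix y assume y: "y \<in> vectors Y"
        show "cmod ((z \<circ> P) y) \<le> nrm (dual Y) z * nrm Y y"
          using dual_bound[OF sY z op_maps[OF Pm y]]
            mult_left_mono[OF hermitian_projection_contractive[OF sY P y] Z.nrm_nonneg[OF z]] by simp
      qed
      moreover have "cmod (\<i> - 1) = sqrt 2"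
        by (simp add: cmod_def)
      ultimately show ?thesis
        using Z.nrm_scaleC[OF comp[OF z], of "\<i> - 1"] by (simp add: u_def mult_left_mono)
    qed
    show "sqrt 2 < 2"
      by (simp add: sqrt2_less_2)
  qed (rule w)
  then have "(1 / (\<i> - 1)) *\<^sub>C (u \<i> w - w) \<in> W"
    using w L by (auto simp: L_decomp_def intro!: complex_vector.subspace_scale complex_vector.subspace_diff)
  moreover have "(\<i> - 1 :: complex) \<noteq> 0"
    by (simp add: complex_eq_iff)
  ultimately show ?thesis
    by (simp add: u_def scaleC_scaleC scaleC_one)
qed

text \<open>
  If \<open>\<psi> \<circ> B = w + v\<close>, then \<open>\<parallel>\<psi> \<circ> (P + tB)\<parallel>\<close> grows at least like \<open>t\<parallel>v\<parallel>\<close>, while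
  \<open>\<parallel>P + tB\<parallel> = 1 + o(t)\<close>.
\<close>

lemma L_decomp_corner:
  assumes sY: "seminormed Y" and L: "L_decomp W V (dual Y)" and P: "hermitian_projection Y P"
    and B: "B \<in> vectors (operators Y)"
    and BP: "\<And>y. y \<in> vectors Y \<Longrightarrow> B (P y) = 0" and PB: "\<And>y. y \<in> vectors Y \<Longrightarrow> P (B y) = B y"
    and small: "\<And>\<eta>. 0 < \<eta> \<Longrightarrow> \<exists>t>0. \<forall>y\<in>vectors Y. nrm Y (P y + of_real t *\<^sub>C B y) \<le> (1 + t * \<eta>) * nrm Y y"
    and psi: "\<psi> \<in> W"
  shows "\<psi> \<circ> B \<in> W"
proof -
  interpret Y: seminormed Y by (rule sY)
  interpret Z: seminormed "dual Y"
    by (rule seminormed_bounded_ops[OF sY seminormed_scalar_field])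
  have sub: "W \<subseteq> vectors (dual Y)" "V \<subseteq> vectors (dual Y)" "csubspace W" "csubspace V"
    and nadd: "\<And>w v. w \<in> W \<Longrightarrow> v \<in> V \<Longrightarrow> nrm (dual Y) (w + v) = nrm (dual Y) w + nrm (dual Y) v"
    and ex: "\<And>z. z \<in> vectors (dual Y) \<Longrightarrow> \<exists>w\<in>W. \<exists>v\<in>V. z = w + v"
    using L by (auto simp: L_decomp_def)
  have Pm: "P \<in> vectors (operators Y)" and idem: "\<And>y. y \<in> vectors Y \<Longrightarrow> P (P y) = P y"
    using P by (auto simp: hermitian_projection_def)
  have psiZ: "\<psi> \<in> vectors (dual Y)" using psi sub by blast
  have xiZ: "\<psi> \<circ> B \<in> vectors (dual Y)"
    by (rule op_comp_mem[OF sY sY seminormed_scalar_field B psiZ])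
  obtain w v where wv: "w \<in> W" "v \<in> V" "\<psi> \<circ> B = w + v"
    using ex[OF xiZ] by auto
  have wvZ: "w \<in> vectors (dual Y)" "v \<in> vectors (dual Y)"
    using wv sub by auto
  define \<psi>1 where "\<psi>1 = \<psi> \<circ> P"
  have psi1: "\<psi>1 \<in> W"
    unfolding \<psi>1_def by (rule L_decomp_projection_invariant[OF sY L P psi])
  then have psi1Z: "\<psi>1 \<in> vectors (dual Y)" using sub by blast
  have z0: "\<psi> 0 = 0"
    using op_zero[OF sY seminormed_scalar_field psiZ] by simp
  \<comment> \<open>\<open>B\<close> kills the range of \<open>P\<close>, so the compositions of
    \<open>w\<close> and \<open>v\<close> with \<open>P\<close> cancel; each stays in its own
    summand, hence each is 0.\<close>
  have "(w \<circ> P) + (v \<circ> P) = 0 + 0"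
  proof (rule ext)
    fix y
    show "((w \<circ> P) + (v \<circ> P)) y = (0 + 0) y"
    proof (cases "y \<in> vectors Y")
      case True
      then show ?thesis
        using fun_cong[OF wv(3), of "P y"] BP[OF True] z0 by simp
    next
      case False
      then have "P y = 0" by (rule op_outside[OF Pm])
      then show ?thesis
        using op_zero[OF sY seminormed_scalar_field wvZ(1)] op_zero[OF sY seminormed_scalar_field wvZ(2)] by simp
    qed
  qed
  then have wP: "w \<circ> P = 0"
    using L_decomp_unique[OF L L_decomp_projection_invariant[OF sY L P wv(1)]
        complex_vector.subspace_0[OF sub(3)]
        L_decomp_projection_invariant[OF sY L_decomp_swap[OF L] P wv(2)]
        complex_vector.subspace_0[OF sub(4)]] by blast
  have bound: "nrm (dual Y) v \<le> \<eta> * nrm (dual Y) \<psi>1" if eta: "0 < \<eta>" for \<eta>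
  proof -
    obtain t where t: "t > 0"
      "\<And>y. y \<in> vectors Y \<Longrightarrow> nrm Y (P y + of_real t *\<^sub>C B y) \<le> (1 + t * \<eta>) * nrm Y y"
      using small[OF eta] by auto
    \<comment> \<open>Composing \<open>\<zeta>\<close> with \<open>P\<close> gives
      \<open>\<psi>1\<close>, so \<open>\<zeta>\<close> is at least as large as
      \<open>\<psi>1\<close>. On the other hand \<open>\<zeta> + t v\<close> is
      \<open>\<psi>1\<close> composed with \<open>P + t B\<close>, hence hardly larger than
      \<open>\<psi>1\<close>. Additivity of the norm leaves little room for
      \<open>v\<close>.\<close>
    define \<zeta> where "\<zeta> = \<psi>1 + of_real t *\<^sub>C w"
    have zetaW: "\<zeta> \<in> W"
      unfolding \<zeta>_def using psi1 wv sub
      by (intro complex_vector.subspace_add complex_vector.subspace_scale) auto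
    then have zetaZ: "\<zeta> \<in> vectors (dual Y)" using sub by blast
    have tv: "of_real t *\<^sub>C v \<in> V" "nrm (dual Y) (of_real t *\<^sub>C v) = t * nrm (dual Y) v"
      using wv sub wvZ t by (auto simp: Z.nrm_scaleC intro: complex_vector.subspace_scale)
    have "nrm (dual Y) \<psi>1 \<le> nrm (dual Y) \<zeta>"
    proof (rule dual_nrm_le[OF sY Z.nrm_nonneg[OF zetaZ]])
      fix y assume y: "y \<in> vectors Y"
      have "\<psi>1 y = \<zeta> (P y)"
        using fun_cong[OF wP, of y] by (simp add: \<zeta>_def \<psi>1_def scaleC_apply idem[OF y])
      then show "cmod (\<psi>1 y) \<le> nrm (dual Y) \<zeta> * nrm Y y"
        using dual_bound[OF sY zetaZ op_maps[OF Pm y]]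
          mult_left_mono[OF hermitian_projection_contractive[OF sY P y] Z.nrm_nonneg[OF zetaZ]] by simp
    qed
    moreover have "nrm (dual Y) (\<zeta> + of_real t *\<^sub>C v) \<le> nrm (dual Y) \<psi>1 * (1 + t * \<eta>)"
    proof (rule dual_nrm_le[OF sY])
      show "0 \<le> nrm (dual Y) \<psi>1 * (1 + t * \<eta>)"
        using Z.nrm_nonneg[OF psi1Z] t eta by simp
      fix y assume y: "y \<in> vectors Y"
      have mem: "P y \<in> vectors Y" "B y \<in> vectors Y" "of_real t *\<^sub>C B y \<in> vectors Y"
        using op_maps[OF Pm y] op_maps[OF B y] Y.scale_mem by auto
      have "\<psi>1 (P y + of_real t *\<^sub>C B y) = \<psi> (P (P y)) + of_real t * \<psi> (P (B y))"
        unfolding op_add[OF psi1Z mem(1,3)] op_scale[OF psi1Z mem(2)] by (simp add: \<psi>1_def)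
      also have "\<dots> = \<psi>1 y + of_real t * (\<psi> \<circ> B) y"
        by (simp add: \<psi>1_def idem[OF y] PB[OF y])
      also have "\<dots> = (\<zeta> + of_real t *\<^sub>C v) y"
        by (simp add: wv(3) \<zeta>_def scaleC_apply distrib_left)
      finally have "(\<zeta> + of_real t *\<^sub>C v) y = \<psi>1 (P y + of_real t *\<^sub>C B y)" by simp
      then show "cmod ((\<zeta> + of_real t *\<^sub>C v) y) \<le> nrm (dual Y) \<psi>1 * (1 + t * \<eta>) * nrm Y y"
        using dual_bound[OF sY psi1Z Y.add_mem[OF mem(1,3)]]
          mult_left_mono[OF t(2)[OF y] Z.nrm_nonneg[OF psi1Z]] by (simp add: mult.assoc)
    qed
    ultimately have "t * nrm (dual Y) v \<le> t * (\<eta> * nrm (dual Y) \<psi>1)"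
      using nadd[OF zetaW tv(1)] tv(2) by (simp add: algebra_simps)
    then show ?thesis
      using t by simp
  qed
  have "nrm (dual Y) v = 0"
  proof (rule antisym[OF _ Z.nrm_nonneg[OF wvZ(2)]])
    show "nrm (dual Y) v \<le> 0"
    proof (rule field_le_epsilon)
      fix e :: real assume e: "0 < e"
      have n: "0 \<le> nrm (dual Y) \<psi>1" by (rule Z.nrm_nonneg[OF psi1Z])
      then have "nrm (dual Y) v \<le> e / (nrm (dual Y) \<psi>1 + 1) * nrm (dual Y) \<psi>1"
        using e by (intro bound) simp
      also have "\<dots> \<le> e"
        using e n by (simp add: field_simps)
      finally show "nrm (dual Y) v \<le> 0 + e" by simp
    qed
  qed
  then have "v = 0"
    by (rule op_nrm_zero_imp[OF sY wvZ(2)])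
  then show ?thesis
    using wv by simp
qed

section \<open>The Hahn--Banach theorem\<close>

definition sublinear_on :: "'a::complex_vector set \<Rightarrow> ('a \<Rightarrow> real) \<Rightarrow> bool"
  where "sublinear_on V p \<longleftrightarrow> (\<forall>x\<in>V. \<forall>y\<in>V. p (x + y) \<le> p x + p y) \<and>
    (\<forall>t\<ge>0. \<forall>x\<in>V. p (of_real t *\<^sub>C x) = t * p x)"

text \<open>A minimal sublinear functional \<open>p\<close> is linear: it is dominated by
  \<open>\<lambda>x. INF t\<in>{0..}. p (x + t y) - t p y\<close>, whose value at \<open>-y\<close> is at most \<open>- p y\<close>.\<close>

lemma sublinear_on_ray_inf:
  fixes V :: "'a::complex_vector set"
  assumes V: "csubspace V" and p: "sublinear_on V p" and y: "y \<in> V"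
  defines "p' \<equiv> \<lambda>x. if x \<in> V then INF t\<in>{0..}. p (x + of_real t *\<^sub>C y) - t * p y else 0"
  shows "sublinear_on V p'" "\<And>x. x \<in> V \<Longrightarrow> p' x \<le> p x" "p' (- y) \<le> - p y"
proof -
  have add: "\<And>x z. x \<in> V \<Longrightarrow> z \<in> V \<Longrightarrow> x + z \<in> V"
    and scale: "\<And>x c. x \<in> V \<Longrightarrow> c *\<^sub>C x \<in> V" and neg: "\<And>x. x \<in> V \<Longrightarrow> - x \<in> V" and zero: "0 \<in> V"
    using V by (auto intro: complex_vector.subspace_add complex_vector.subspace_scale
        complex_vector.subspace_neg complex_vector.subspace_0)
  have sub: "\<And>x z. x \<in> V \<Longrightarrow> z \<in> V \<Longrightarrow> p (x + z) \<le> p x + p z"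
    and hom: "\<And>t x. t \<ge> 0 \<Longrightarrow> x \<in> V \<Longrightarrow> p (of_real t *\<^sub>C x) = t * p x"
    using p by (auto simp: sublinear_on_def)
  have p0: "p 0 = 0"
    using hom[of 0 0] zero by simp
  have low: "- p (- x) \<le> p (x + of_real t *\<^sub>C y) - t * p y" if "t \<ge> 0" "x \<in> V" for t x
    using sub[of "x + of_real t *\<^sub>C y" "- x"] hom[of t y] that y add scale neg by simp
  have bdd: "bdd_below ((\<lambda>t. p (x + of_real t *\<^sub>C y) - t * p y) ` {0..})" if "x \<in> V" for x
    using low[OF _ that] by (auto simp: bdd_below_def)
  have upper: "p' x \<le> p (x + of_real t *\<^sub>C y) - t * p y" if "t \<ge> 0" "x \<in> V" for t x
    using cINF_lower[OF bdd[OF that(2)], of t] that by (simp add: p'_def)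
  have greatest: "m \<le> p' x" if "x \<in> V" "\<And>t. t \<ge> 0 \<Longrightarrow> m \<le> p (x + of_real t *\<^sub>C y) - t * p y" for m x
    unfolding p'_def using that by (auto intro!: cINF_greatest)
  show le: "p' x \<le> p x" if "x \<in> V" for x
    using upper[of 0 x] that by simp
  show "p' (- y) \<le> - p y"
    using upper[of 1 "- y"] y neg p0 by (simp add: scaleC_one)
  have hom': "p' (of_real s *\<^sub>C x) \<le> s * p' x" if s: "s > 0" and x: "x \<in> V" for s x
  proof -
    have "p' (of_real s *\<^sub>C x) / s \<le> p' x"
    proof (rule greatest[OF x])
      fix t :: real assume t: "t \<ge> 0"
      have "of_real s *\<^sub>C x + of_real (s * t) *\<^sub>C y = of_real s *\<^sub>C (x + of_real t *\<^sub>C y)"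
        by (simp add: scaleC_add_right scaleC_scaleC)
      then have "p (of_real s *\<^sub>C x + of_real (s * t) *\<^sub>C y) = s * p (x + of_real t *\<^sub>C y)"
        using hom[of s "x + of_real t *\<^sub>C y"] s x y add scale by simp
      then show "p' (of_real s *\<^sub>C x) / s \<le> p (x + of_real t *\<^sub>C y) - t * p y"
        using upper[of "s * t" "of_real s *\<^sub>C x"] s t scale[OF x] by (simp add: field_simps)
    qed
    then show ?thesis using s by (simp add: field_simps)
  qed
  show "sublinear_on V p'"
    unfolding sublinear_on_def
  proof (intro conjI ballI allI impI)
    fix x z assume x: "x \<in> V" and z: "z \<in> V"
    have "p' (x + z) - (p (x + of_real t *\<^sub>C y) - t * p y) \<le> p' z" if t: "t \<ge> 0" for t
    proof (rule greatest[OF z])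
      fix s :: real assume s: "s \<ge> 0"
      have "x + z + of_real (t + s) *\<^sub>C y = (x + of_real t *\<^sub>C y) + (z + of_real s *\<^sub>C y)"
        by (simp add: scaleC_add_left)
      then have "p (x + z + of_real (t + s) *\<^sub>C y) \<le> p (x + of_real t *\<^sub>C y) + p (z + of_real s *\<^sub>C y)"
        using sub x y z add scale by metis
      then show "p' (x + z) - (p (x + of_real t *\<^sub>C y) - t * p y) \<le> p (z + of_real s *\<^sub>C y) - s * p y"
        using upper[of "t + s" "x + z"] s t add[OF x z] by (simp add: algebra_simps)
    qed
    then have "p' (x + z) - p' z \<le> p' x"
      using x by (intro greatest) (auto simp: algebra_simps)
    then show "p' (x + z) \<le> p' x + p' z" by simp
  next
    fix t :: real and x assume t: "0 \<le> t" and x: "x \<in> V"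
    show "p' (of_real t *\<^sub>C x) = t * p' x"
    proof (cases "t = 0")
      case True
      have "0 \<le> p' 0"
        using hom[OF _ y] by (intro greatest) (auto simp: zero)
      then show ?thesis using True le[OF zero] p0 by simp
    next
      case False
      then have "p' x \<le> 1 / t * p' (of_real t *\<^sub>C x)"
        using hom'[of "1 / t" "of_real t *\<^sub>C x"] t x scale by (simp add: scaleC_scaleC scaleC_one)
      then show ?thesis
        using hom'[of t x] t x False by (simp add: field_simps)
    qed
  qed
qed

text \<open>A minimal sublinear functional below \<open>q0\<close> comes from Zorn's lemma and is
  linear. Starting from the ray infimum \<open>q0\<close> instead of \<open>q\<close> prescribes the
  value at \<open>y0\<close>: a linear \<open>f\<close> below \<open>q0\<close> satisfies
  \<open>f (- y0) \<le> - q y0\<close>.\<close>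

lemma real_Hahn_Banach:
  fixes V :: "'a::complex_vector set"
  assumes V: "csubspace V" and q: "sublinear_on V q" and y0: "y0 \<in> V"
  shows "\<exists>f. (\<forall>x\<in>V. \<forall>y\<in>V. f (x + y) = f x + f y) \<and> (\<forall>t. \<forall>x\<in>V. f (of_real t *\<^sub>C x) = t * f x) \<and>
    (\<forall>x\<in>V. f x \<le> q x) \<and> f y0 = q y0"
proof -
  have add: "\<And>x z. x \<in> V \<Longrightarrow> z \<in> V \<Longrightarrow> x + z \<in> V"
    and scale: "\<And>x c. x \<in> V \<Longrightarrow> c *\<^sub>C x \<in> V" and neg: "\<And>x. x \<in> V \<Longrightarrow> - x \<in> V" and zero: "0 \<in> V"
    using V by (auto intro: complex_vector.subspace_add complex_vector.subspace_scale
        complex_vector.subspace_neg complex_vector.subspace_0)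
  define q0 where "q0 = (\<lambda>x. if x \<in> V then INF t\<in>{0..}. q (x + of_real t *\<^sub>C y0) - t * q y0 else 0)"
  have q0: "sublinear_on V q0" "\<And>x. x \<in> V \<Longrightarrow> q0 x \<le> q x" "q0 (- y0) \<le> - q y0"
    unfolding q0_def by (rule sublinear_on_ray_inf[OF V q y0], assumption?)+
  \<comment> \<open>Vanishing outside \<open>V\<close> is imposed so that minimality yields equality
    of functions and not only agreement on \<open>V\<close>.\<close>
  define A where "A = {p. sublinear_on V p \<and> (\<forall>x\<in>V. p x \<le> q0 x) \<and> (\<forall>x. x \<notin> V \<longrightarrow> p x = 0)}"
  have p0: "p 0 = 0" if "sublinear_on V p" for p
    using that zero unfolding sublinear_on_def by (metis complex_vector.scale_zero_left mult_zero_left of_real_0 order_refl)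
  have neg_low: "- q0 (- x) \<le> p x" if "p \<in> A" "x \<in> V" for p x
  proof -
    have "p (x + - x) \<le> p x + p (- x)" "p (- x) \<le> q0 (- x)"
      using that neg unfolding A_def sublinear_on_def by blast+
    then show ?thesis using that p0[of p] by (simp add: A_def)
  qed
  \<comment> \<open>The order is reversed, so a maximal element is a minimal functional. Chains are
    bounded by pointwise infima, which are finite because every member is at least
    \<open>- q0 (- x)\<close>.\<close>
  have "\<exists>m\<in>A. \<forall>a\<in>A. a \<le> m \<longrightarrow> a = m"
  proof (rule predicate_Zorn)
    show "partial_order_on A (relation_of (\<lambda>x y. y \<le> x) A)"
      by (rule partial_order_on_relation_ofI) auto
    fix C assume C: "C \<in> Chains (relation_of (\<lambda>x y. y \<le> x) A)"
    have CA: "C \<subseteq> A" and lin: "\<And>p r. p \<in> C \<Longrightarrow> r \<in> C \<Longrightarrow> p \<le> r \<or> r \<le> p"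
      using C by (auto simp: Chains_def relation_of_def)
    show "\<exists>u\<in>A. \<forall>a\<in>C. u \<le> a"
    proof (cases "C = {}")
      case True
      have "q0 \<in> A" using q0(1) by (simp add: A_def) (simp add: q0_def)
      then show ?thesis using True by auto
    next
      case False
      define u where "u = (\<lambda>x. if x \<in> V then INF p\<in>C. p x else 0)"
      have bdd: "bdd_below ((\<lambda>p. p x) ` C)" if "x \<in> V" for x
        using neg_low[OF _ that] CA by (auto simp: bdd_below_def intro!: exI[of _ "- q0 (- x)"])
      have low: "u x \<le> p x" if "p \<in> C" "x \<in> V" for p x
        using cINF_lower[OF bdd[OF that(2)] that(1)] that by (simp add: u_def)
      have greatest: "m \<le> u x" if "x \<in> V" "\<And>p. p \<in> C \<Longrightarrow> m \<le> p x" for m x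
        using that False by (auto simp: u_def intro!: cINF_greatest)
      have "sublinear_on V u"
        unfolding sublinear_on_def
      proof (intro conjI ballI allI impI)
        fix x y assume x: "x \<in> V" and y: "y \<in> V"
        have "u (x + y) - p x \<le> u y" if p: "p \<in> C" for p
        proof (rule greatest[OF y])
          fix r assume r: "r \<in> C"
          \<comment> \<open>In a chain the smaller of \<open>p\<close> and \<open>r\<close> serves
            for both summands.\<close>
          obtain s where s: "s \<in> C" "s \<le> p" "s \<le> r"
            using lin[OF p r] p r by auto
          have "s (x + y) \<le> s x + s y"
            using s(1) CA x y by (auto simp: A_def sublinear_on_def)
          also have "\<dots> \<le> p x + r y"
            using s(2,3) by (intro add_mono) (auto simp: le_fun_def)
          finally show "u (x + y) - p x \<le> r y"
            using low[OF s(1) add[OF x y]] by simp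
        qed
        then have "u (x + y) - u y \<le> u x"
          using x by (intro greatest) (auto simp: algebra_simps)
        then show "u (x + y) \<le> u x + u y" by simp
      next
        fix t :: real and x assume t: "0 \<le> t" and x: "x \<in> V"
        have hom: "p (of_real t *\<^sub>C x) = t * p x" if "p \<in> C" for p
          using that CA t x by (auto simp: A_def sublinear_on_def)
        show "u (of_real t *\<^sub>C x) = t * u x"
        proof (rule antisym)
          show "t * u x \<le> u (of_real t *\<^sub>C x)"
            using low[OF _ x] t by (intro greatest scale x) (auto simp: hom mult_left_mono)
          show "u (of_real t *\<^sub>C x) \<le> t * u x"
          proof (cases "t = 0")
            case True
            obtain p where "p \<in> C" using False by auto
            then show ?thesis
              using low[of p 0] zero p0[of p] CA True by (auto simp: A_def)
          next
            case False
            have "u (of_real t *\<^sub>C x) / t \<le> p x" if "p \<in> C" for p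
              using low[OF that scale[OF x], of "of_real t"] hom[OF that] t False
              by (simp add: field_simps)
            then have "u (of_real t *\<^sub>C x) / t \<le> u x"
              by (rule greatest[OF x])
            then show ?thesis using t False by (simp add: field_simps)
          qed
        qed
      qed
      moreover have "u x \<le> q0 x" if "x \<in> V" for x
      proof -
        obtain p where "p \<in> C" using False by auto
        then show ?thesis using low[OF _ that, of p] CA that by (force simp: A_def)
      qed
      ultimately have "u \<in> A"
        by (simp add: A_def) (simp add: u_def)
      moreover have "u \<le> p" if "p \<in> C" for p
        using low[OF that] CA that by (auto simp: le_fun_def A_def u_def)
      ultimately show ?thesis by blast
    qed
  qed
  then obtain f where f: "f \<in> A" and min: "\<And>a. a \<in> A \<Longrightarrow> a \<le> f \<Longrightarrow> a = f" by auto
  have fs: "sublinear_on V f" and fq: "\<And>x. x \<in> V \<Longrightarrow> f x \<le> q0 x" and fout: "\<And>x. x \<notin> V \<Longrightarrow> f x = 0"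
    using f by (auto simp: A_def)
  have sub: "\<And>x z. x \<in> V \<Longrightarrow> z \<in> V \<Longrightarrow> f (x + z) \<le> f x + f z"
    and hom: "\<And>t x. t \<ge> 0 \<Longrightarrow> x \<in> V \<Longrightarrow> f (of_real t *\<^sub>C x) = t * f x"
    using fs by (auto simp: sublinear_on_def)
  \<comment> \<open>The ray infimum of \<open>f\<close> along \<open>y\<close> lies in
    \<open>A\<close> and below \<open>f\<close>, hence equals \<open>f\<close>. Its value at
    \<open>- y\<close> shows that \<open>f\<close> is odd, and an odd sublinear functional is
    linear.\<close>
  have fneg: "f (- y) = - f y" if y: "y \<in> V" for y
  proof -
    define f' where "f' = (\<lambda>x. if x \<in> V then INF t\<in>{0..}. f (x + of_real t *\<^sub>C y) - t * f y else 0)"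
    have f': "sublinear_on V f'" "\<And>x. x \<in> V \<Longrightarrow> f' x \<le> f x" "f' (- y) \<le> - f y"
      unfolding f'_def by (rule sublinear_on_ray_inf[OF V fs y], assumption?)+
    have "f' \<in> A"
      using f'(1) f'(2) fq by (simp add: A_def) (auto simp: f'_def intro: order_trans)
    moreover have "f' \<le> f"
      using f'(2) fout by (auto simp: le_fun_def f'_def)
    ultimately have "f' = f" by (rule min)
    then show ?thesis
      using f'(3) sub[OF y neg[OF y]] p0[OF fs] by simp
  qed
  have "f (x + y) = f x + f y" if "x \<in> V" "y \<in> V" for x y
    using sub[OF that] sub[OF neg neg, OF that] that add fneg[OF add[OF that]] by (simp add: fneg)
  moreover have "f (of_real t *\<^sub>C x) = t * f x" if "x \<in> V" for t x
  proof (cases "t \<ge> 0")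
    case False
    have "f (of_real t *\<^sub>C x) = f (- (of_real (- t) *\<^sub>C x))" by simp
    also have "\<dots> = - f (of_real (- t) *\<^sub>C x)"
      by (rule fneg[OF scale[OF that]])
    also have "\<dots> = t * f x"
      using hom[of "- t" x] False that by simp
    finally show ?thesis .
  qed (use hom that in auto)
  moreover have "f x \<le> q x" if "x \<in> V" for x
    using fq[OF that] q0(2)[OF that] by simp
  moreover have "f y0 \<ge> q y0"
    using fq[OF neg[OF y0]] q0(3) fneg[OF y0] by simp
  ultimately show ?thesis
    using y0 by (metis antisym)
qed

text \<open>A real linear \<open>f\<close> is the real part of the complex linear functional
  \<open>f x - \<i> f (\<i> x)\<close>. The bound on the modulus follows from the one on the real
  part by rotating \<open>x\<close> until the value is real and positive.\<close>

lemma Hahn_Banach_seminorm: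
  fixes V :: "'a::complex_vector set"
  assumes V: "csubspace V"
    and qadd: "\<And>x y. x \<in> V \<Longrightarrow> y \<in> V \<Longrightarrow> q (x + y) \<le> q x + q y"
    and qhom: "\<And>c x. x \<in> V \<Longrightarrow> q (c *\<^sub>C x) = cmod c * q x" and y0: "y0 \<in> V"
  shows "\<exists>g. (\<forall>x\<in>V. \<forall>y\<in>V. g (x + y) = g x + g y) \<and> (\<forall>c. \<forall>x\<in>V. g (c *\<^sub>C x) = c * g x) \<and>
    (\<forall>x\<in>V. cmod (g x) \<le> q x) \<and> Re (g y0) = q y0"
proof -
  have add: "\<And>x z. x \<in> V \<Longrightarrow> z \<in> V \<Longrightarrow> x + z \<in> V" and scale: "\<And>x c. x \<in> V \<Longrightarrow> c *\<^sub>C x \<in> V"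
    using V by (auto intro: complex_vector.subspace_add complex_vector.subspace_scale)
  have "sublinear_on V q"
    using qadd qhom by (simp add: sublinear_on_def)
  then obtain f where fadd: "\<And>x y. x \<in> V \<Longrightarrow> y \<in> V \<Longrightarrow> f (x + y) = f x + f y"
    and fhom: "\<And>t x. x \<in> V \<Longrightarrow> f (of_real t *\<^sub>C x) = t * f x"
    and fq: "\<And>x. x \<in> V \<Longrightarrow> f x \<le> q x" and fy: "f y0 = q y0"
    using real_Hahn_Banach[OF V _ y0] by metis
  define g where "g = (\<lambda>x. Complex (f x) (- f (\<i> *\<^sub>C x)))"
  have fsplit: "f (c *\<^sub>C x) = Re c * f x + Im c * f (\<i> *\<^sub>C x)" if x: "x \<in> V" for c x
  proof -
    have "c *\<^sub>C x = of_real (Re c) *\<^sub>C x + of_real (Im c) *\<^sub>C \<i> *\<^sub>C x"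
      unfolding scaleC_scaleC scaleC_add_left[symmetric] by (simp add: complex_eq mult.commute)
    then show ?thesis using fadd[OF scale scale, OF x scale, OF x] fhom x scale by metis
  qed
  have gadd: "g (x + y) = g x + g y" if "x \<in> V" "y \<in> V" for x y
    using that by (simp add: g_def fadd scale scaleC_add_right complex_eq_iff)
  have ghom: "g (c *\<^sub>C x) = c * g x" if x: "x \<in> V" for c x
    using fsplit[OF x, of c] fsplit[OF x, of "\<i> * c"]
    by (simp add: g_def complex_eq_iff scaleC_scaleC algebra_simps)
  have "cmod (g x) \<le> q x" if x: "x \<in> V" for x
  proof (cases "g x = 0")
    case True
    have "0 \<le> q x"
      using qadd[OF x scale[OF x, of "- 1"]] qhom[OF x, of "- 1"] qhom[OF x, of 0] by simp
    then show ?thesis using True by simp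
  next
    case False
    define c where "c = cnj (g x) / cmod (g x)"
    have "cmod c = 1" using False by (simp add: c_def norm_divide)
    have "g (c *\<^sub>C x) = of_real (cmod (g x))"
      using False by (simp add: ghom[OF x] c_def complex_norm_square[symmetric] power2_eq_square mult.commute)
    then have "cmod (g x) = f (c *\<^sub>C x)"
      by (simp add: g_def complex_eq_iff)
    also have "\<dots> \<le> q x"
      using fq[OF scale[OF x], of c] qhom[OF x, of c] \<open>cmod c = 1\<close> by simp
    finally show ?thesis .
  qed
  then show ?thesis
    using gadd ghom fy by (intro exI[of _ g]) (auto simp: g_def)
qed

text \<open>The distance to \<open>J\<close> is a seminorm vanishing on \<open>J\<close> and, as
  \<open>J\<close> is closed, positive at a point outside. A functional dominated by it and
  attaining it at that point annihilates \<open>J\<close> and is not 0.\<close>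

lemma annihilator_nontrivial:
  assumes sY: "seminormed Y" and J: "closed_subspace J Y" and ne: "J \<noteq> vectors Y"
  shows "\<exists>\<psi>\<in>annihilator Y J. \<psi> \<noteq> 0"
proof -
  interpret seminormed Y by (rule sY)
  have sub: "csubspace J" "J \<subseteq> vectors Y"
    and closed: "\<And>u y. y \<in> vectors Y \<Longrightarrow> (\<And>n::nat. u n \<in> J) \<Longrightarrow> (\<lambda>n. nrm Y (u n - y)) \<longlonglongrightarrow> 0 \<Longrightarrow> y \<in> J"
    using J by (auto simp: closed_subspace_def)
  obtain y0 where y0: "y0 \<in> vectors Y" "y0 \<notin> J" using ne sub by auto
  have J0: "0 \<in> J" using sub(1) by (rule complex_vector.subspace_0)
  define q where "q = (\<lambda>y. INF j\<in>J. nrm Y (y - j))"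
  have low: "q y \<le> nrm Y (y - j)" if "y \<in> vectors Y" "j \<in> J" for y j
    unfolding q_def using that sub
    by (intro cINF_lower bdd_belowI[of _ 0]) (auto intro!: nrm_nonneg diff_mem)
  have greatest: "m \<le> q y" if "\<And>j. j \<in> J \<Longrightarrow> m \<le> nrm Y (y - j)" for m y
    unfolding q_def using that J0 by (auto intro!: cINF_greatest)
  have q0: "0 \<le> q y" if "y \<in> vectors Y" for y
    using that sub by (intro greatest nrm_nonneg diff_mem) auto
  have qadd: "q (x + y) \<le> q x + q y" if x: "x \<in> vectors Y" and y: "y \<in> vectors Y" for x y
  proof -
    have "q (x + y) - nrm Y (x - j) \<le> q y" if j: "j \<in> J" for j
    proof (rule greatest)
      fix k assume k: "k \<in> J"
      have "q (x + y) \<le> nrm Y ((x + y) - (j + k))"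
        using low[OF add_mem[OF x y] complex_vector.subspace_add[OF sub(1) j k]] .
      also have "\<dots> = nrm Y ((x - j) + (y - k))"
        by (simp add: algebra_simps)
      also have "\<dots> \<le> nrm Y (x - j) + nrm Y (y - k)"
        using x y j k sub by (intro nrm_add diff_mem) auto
      finally show "q (x + y) - nrm Y (x - j) \<le> nrm Y (y - k)" by simp
    qed
    then have "q (x + y) - q y \<le> q x"
      by (intro greatest) (simp add: algebra_simps)
    then show ?thesis by simp
  qed
  have qle: "q (c *\<^sub>C x) \<le> cmod c * q x" if x: "x \<in> vectors Y" and c: "c \<noteq> 0" for c x
  proof -
    have "q (c *\<^sub>C x) / cmod c \<le> q x"
    proof (rule greatest)
      fix j assume j: "j \<in> J"
      have "q (c *\<^sub>C x) \<le> nrm Y (c *\<^sub>C x - c *\<^sub>C j)"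
        using low[OF scale_mem[OF x] complex_vector.subspace_scale[OF sub(1) j]] .
      also have "\<dots> = cmod c * nrm Y (x - j)"
        using x j sub by (subst nrm_scaleC[symmetric]) (auto intro!: diff_mem simp: complex_vector.scale_right_diff_distrib)
      finally show "q (c *\<^sub>C x) / cmod c \<le> nrm Y (x - j)"
        using c by (simp add: field_simps)
    qed
    then show ?thesis using c by (simp add: field_simps)
  qed
  have qJ: "q j = 0" if "j \<in> J" for j
    using low[of j j] q0[of j] that sub nrm_zero by auto
  have qhom: "q (c *\<^sub>C x) = cmod c * q x" if x: "x \<in> vectors Y" for c x
  proof (cases "c = 0")
    case False
    have "q ((1 / c) *\<^sub>C (c *\<^sub>C x)) \<le> cmod (1 / c) * q (c *\<^sub>C x)"
      by (rule qle[OF scale_mem[OF x]]) (use False in simp)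
    then show ?thesis
      using qle[OF x False] False by (simp add: scaleC_scaleC scaleC_one norm_divide field_simps)
  qed (simp add: qJ[OF J0])
  have "q y0 \<noteq> 0"
  proof
    assume q0: "q y0 = 0"
    have "\<exists>j\<in>J. nrm Y (j - y0) < inverse (real (Suc n))" for n
    proof (rule ccontr)
      assume "\<not> ?thesis"
      then have "inverse (real (Suc n)) \<le> q y0"
        using y0 sub by (intro greatest) (auto simp: nrm_diff_commute[OF y0(1)] not_less)
      then show False using q0 by simp
    qed
    then obtain u where u: "\<And>n. u n \<in> J" "\<And>n. nrm Y (u n - y0) < inverse (real (Suc n))"
      by metis
    have "(\<lambda>n. nrm Y (u n - y0)) \<longlonglongrightarrow> 0"
    proof (rule tendsto_sandwich[OF _ _ tendsto_const LIMSEQ_inverse_real_of_nat])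
      show "\<forall>\<^sub>F n in sequentially. 0 \<le> nrm Y (u n - y0)"
        using u(1) sub(2) y0 by (intro always_eventually allI nrm_nonneg diff_mem) auto
      show "\<forall>\<^sub>F n in sequentially. nrm Y (u n - y0) \<le> inverse (real (Suc n))"
        using u(2) by (intro always_eventually allI less_imp_le)
    qed
    then have "y0 \<in> J" using closed[OF y0(1) u(1)] by simp
    then show False using y0 by simp
  qed
  obtain g where g: "\<And>x y. x \<in> vectors Y \<Longrightarrow> y \<in> vectors Y \<Longrightarrow> g (x + y) = g x + g y"
    "\<And>c x. x \<in> vectors Y \<Longrightarrow> g (c *\<^sub>C x) = c * g x"
    "\<And>x. x \<in> vectors Y \<Longrightarrow> cmod (g x) \<le> q x" "Re (g y0) = q y0"
    using Hahn_Banach_seminorm[OF csubspace_vectors qadd qhom y0(1)] by metis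
  define \<psi> where "\<psi> = (\<lambda>y. if y \<in> vectors Y then g y else 0)"
  have "\<psi> \<in> vectors (dual Y)"
  proof (rule dualI[OF sY])
    fix y assume y: "y \<in> vectors Y"
    show "cmod (\<psi> y) \<le> 1 * nrm Y y"
      using g(3)[OF y] low[OF y J0] y by (simp add: \<psi>_def)
  qed (auto simp: \<psi>_def g add_mem scale_mem)
  moreover have "\<psi> j = 0" if "j \<in> J" for j
    using g(3)[of j] qJ[OF that] that sub by (auto simp: \<psi>_def)
  moreover have "\<psi> \<noteq> 0"
    using y0 \<open>q y0 \<noteq> 0\<close> g(4) by (auto simp: \<psi>_def fun_eq_iff intro!: exI[of _ y0])
  ultimately show ?thesis
    by (auto simp: annihilator_def)
qed

section \<open>Multiplication operators on a space with band projections\<close>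

text \<open>The cutoff outside the operators is what membership in
  \<open>operators (operators X)\<close> demands.\<close>

definition left_mult :: "'a::complex_vector cnspace \<Rightarrow> ('a \<Rightarrow> 'a) \<Rightarrow> ('a \<Rightarrow> 'a) \<Rightarrow> 'a \<Rightarrow> 'a"
  where "left_mult X a = (\<lambda>T. if T \<in> vectors (operators X) then a \<circ> T else 0)"

definition right_mult :: "'a::complex_vector cnspace \<Rightarrow> ('a \<Rightarrow> 'a) \<Rightarrow> ('a \<Rightarrow> 'a) \<Rightarrow> 'a \<Rightarrow> 'a"
  where "right_mult X b = (\<lambda>T. if T \<in> vectors (operators X) then T \<circ> b else 0)"

definition compl_op :: "'a::complex_vector cnspace \<Rightarrow> ('a \<Rightarrow> 'a) \<Rightarrow> 'a \<Rightarrow> 'a"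
  where "compl_op X e = (\<lambda>x. if x \<in> vectors X then x - e x else 0)"

text \<open>In \<open>L\<^sub>p\<close> these include the multiplications by indicator functions.\<close>

definition band_projection :: "'a::complex_vector cnspace \<Rightarrow> real \<Rightarrow> ('a \<Rightarrow> 'a) \<Rightarrow> bool"
  where "band_projection X p e \<longleftrightarrow> hermitian_projection X e \<and>
    (\<forall>x\<in>vectors X. nrm X x powr p = nrm X (e x) powr p + nrm X (x - e x) powr p)"

context
  fixes X :: "'a::complex_vector cnspace"
  assumes sX: "seminormed X"
begin

interpretation X: seminormed X by (rule sX)
interpretation Y: seminormed "operators X" by (rule seminormed_bounded_ops[OF sX sX])

lemma left_mult_mem:
  assumes a: "a \<in> vectors (operators X)"
  shows "left_mult X a \<in> vectors (operators (operators X))"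
proof (rule opI[OF Y.seminormed_axioms Y.seminormed_axioms, where B = "nrm (operators X) a"])
  fix T S c assume T: "T \<in> vectors (operators X)" and S: "S \<in> vectors (operators X)"
  show "left_mult X a (T + S) = left_mult X a T + left_mult X a S"
  proof
    fix x show "left_mult X a (T + S) x = (left_mult X a T + left_mult X a S) x"
      using op_add[OF a, of "T x" "S x"] op_maps[OF T] op_maps[OF S]
      by (cases "x \<in> vectors X")
        (auto simp: left_mult_def T S Y.add_mem op_outside[OF T] op_outside[OF S] op_zero[OF sX sX a])
  qed
next
  fix T c assume T: "T \<in> vectors (operators X)"
  show "left_mult X a (c *\<^sub>C T) = c *\<^sub>C left_mult X a T"
  proof
    fix x show "left_mult X a (c *\<^sub>C T) x = (c *\<^sub>C left_mult X a T) x"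
      using op_scale[OF a, of "T x" c] op_maps[OF T]
      by (cases "x \<in> vectors X")
        (auto simp: left_mult_def T Y.scale_mem scaleC_apply op_outside[OF T] op_zero[OF sX sX a])
  qed
qed (auto simp: left_mult_def op_comp_mem[OF sX sX sX _ a] op_comp_nrm[OF sX sX sX _ a])

lemma right_mult_mem:
  assumes b: "b \<in> vectors (operators X)"
  shows "right_mult X b \<in> vectors (operators (operators X))"
proof (rule opI[OF Y.seminormed_axioms Y.seminormed_axioms, where B = "nrm (operators X) b"])
  fix T S c assume T: "T \<in> vectors (operators X)" and S: "S \<in> vectors (operators X)"
  show "right_mult X b (T + S) = right_mult X b T + right_mult X b S"
    by (rule ext) (simp add: right_mult_def T S Y.add_mem)
next
  fix T c assume T: "T \<in> vectors (operators X)"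
  show "right_mult X b (c *\<^sub>C T) = c *\<^sub>C right_mult X b T"
    by (rule ext) (simp add: right_mult_def T Y.scale_mem scaleC_apply)
next
  fix T assume T: "T \<in> vectors (operators X)"
  show "nrm (operators X) (right_mult X b T) \<le> nrm (operators X) b * nrm (operators X) T"
    using op_comp_nrm[OF sX sX sX b T] by (simp add: right_mult_def T mult.commute)
qed (auto simp: right_mult_def op_comp_mem[OF sX sX sX b])

lemma left_mult_comp:
  assumes "a \<in> vectors (operators X)" "b \<in> vectors (operators X)"
  shows "left_mult X (a \<circ> b) = left_mult X a \<circ> left_mult X b"
  by (rule ext) (auto simp: left_mult_def op_comp_mem[OF sX sX sX _ assms(2)] op_zero[OF sX sX assms(1)]
      Y.zero_mem comp_assoc)

lemma right_mult_comp:
  assumes "a \<in> vectors (operators X)" "b \<in> vectors (operators X)"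
  shows "right_mult X (a \<circ> b) = right_mult X b \<circ> right_mult X a"
  by (rule ext) (auto simp: right_mult_def op_comp_mem[OF sX sX sX assms(1)] Y.zero_mem comp_assoc)

lemma compl_op_mem:
  assumes e: "e \<in> vectors (operators X)"
  shows "compl_op X e \<in> vectors (operators X)"
proof -
  have "nrm X (compl_op X e x) \<le> (1 + nrm (operators X) e) * nrm X x" if x: "x \<in> vectors X" for x
    using X.nrm_diff[OF x op_maps[OF e x]] op_bound[OF sX sX e x] x
    by (simp add: compl_op_def distrib_right)
  then show ?thesis
    by (rule opI[OF sX sX, rotated -1])
      (auto simp: compl_op_def X.diff_mem op_maps[OF e] X.add_mem X.scale_mem op_add[OF e] op_scale[OF e]
        complex_vector.scale_right_diff_distrib)
qed

lemma band_projectionD: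
  assumes "band_projection X p e"
  shows "e \<in> vectors (operators X)" "hermitian_projection X e" "x \<in> vectors X \<Longrightarrow> e (e x) = e x"
    "x \<in> vectors X \<Longrightarrow> cmod c = 1 \<Longrightarrow> nrm X (x + (c - 1) *\<^sub>C e x) \<le> nrm X x"
    "x \<in> vectors X \<Longrightarrow> nrm X x powr p = nrm X (e x) powr p + nrm X (x - e x) powr p"
  using assms unfolding band_projection_def hermitian_projection_def by blast+

lemma compl_op_compl_op:
  assumes "e \<in> vectors (operators X)"
  shows "compl_op X (compl_op X e) = e"
  by (rule ext) (simp add: compl_op_def op_outside[OF assms])

lemma band_projection_compl:
  assumes e: "band_projection X p e"
  shows "band_projection X p (compl_op X e)"
  unfolding band_projection_def hermitian_projection_def
proof (intro conjI ballI allI impI)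
  note eD = band_projectionD[OF e]
  show "compl_op X e \<in> vectors (operators X)"
    by (rule compl_op_mem[OF eD(1)])
  fix x assume x: "x \<in> vectors X"
  have ex: "e x \<in> vectors X" using op_maps[OF eD(1) x] .
  show "compl_op X e (compl_op X e x) = compl_op X e x"
    using x ex by (simp add: compl_op_def X.diff_mem op_diff[OF sX sX eD(1)] eD(3))
  show "nrm X x powr p = nrm X (compl_op X e x) powr p + nrm X (x - compl_op X e x) powr p"
    using eD(5)[OF x] x by (simp add: compl_op_def)
  fix c :: complex assume c: "cmod c = 1"
  then have c0: "c \<noteq> 0" by auto
  have "x + (c - 1) *\<^sub>C compl_op X e x = c *\<^sub>C (x + (1 / c - 1) *\<^sub>C e x)"
    using x c0 by (simp add: compl_op_def scaleC_add_right scaleC_scaleC complex_vector.scale_left_diff_distrib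
        complex_vector.scale_right_diff_distrib scaleC_one algebra_simps)
  then show "nrm X (x + (c - 1) *\<^sub>C compl_op X e x) \<le> nrm X x"
    using eD(4)[OF x, of "1 / c"] c ex x by (simp add: X.nrm_scaleC X.add_mem X.scale_mem norm_divide)
qed

lemma hermitian_projection_left_mult:
  assumes e: "hermitian_projection X e"
  shows "hermitian_projection (operators X) (left_mult X e)"
  unfolding hermitian_projection_def
proof (intro conjI ballI allI impI)
  have em: "e \<in> vectors (operators X)" and idem: "\<And>x. x \<in> vectors X \<Longrightarrow> e (e x) = e x"
    and herm: "\<And>x c. x \<in> vectors X \<Longrightarrow> cmod c = 1 \<Longrightarrow> nrm X (x + (c - 1) *\<^sub>C e x) \<le> nrm X x"
    using e unfolding hermitian_projection_def by blast+
  show "left_mult X e \<in> vectors (operators (operators X))"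
    by (rule left_mult_mem[OF em])
  fix T assume T: "T \<in> vectors (operators X)"
  show "left_mult X e (left_mult X e T) = left_mult X e T"
  proof
    fix x show "left_mult X e (left_mult X e T) x = left_mult X e T x"
      using idem[OF op_maps[OF T]] 
      by (cases "x \<in> vectors X") (simp_all add: left_mult_def T op_comp_mem[OF sX sX sX T em] op_outside[OF T] op_zero[OF sX sX em])
  qed
  fix c :: complex assume c: "cmod c = 1"
  show "nrm (operators X) (T + (c - 1) *\<^sub>C left_mult X e T) \<le> nrm (operators X) T"
  proof (rule op_nrm_le[OF sX sX Y.nrm_nonneg[OF T]])
    fix x assume x: "x \<in> vectors X"
    show "nrm X ((T + (c - 1) *\<^sub>C left_mult X e T) x) \<le> nrm (operators X) T * nrm X x"
      using order_trans[OF herm[OF op_maps[OF T x] c] op_bound[OF sX sX T x]]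
      by (simp add: left_mult_def T scaleC_apply)
  qed
qed

lemma hermitian_projection_right_mult:
  assumes e: "hermitian_projection X e"
  shows "hermitian_projection (operators X) (right_mult X e)"
  unfolding hermitian_projection_def
proof (intro conjI ballI allI impI)
  have em: "e \<in> vectors (operators X)" and idem: "\<And>x. x \<in> vectors X \<Longrightarrow> e (e x) = e x"
    and herm: "\<And>x c. x \<in> vectors X \<Longrightarrow> cmod c = 1 \<Longrightarrow> nrm X (x + (c - 1) *\<^sub>C e x) \<le> nrm X x"
    using e unfolding hermitian_projection_def by blast+
  show "right_mult X e \<in> vectors (operators (operators X))"
    by (rule right_mult_mem[OF em])
  fix T assume T: "T \<in> vectors (operators X)"
  show "right_mult X e (right_mult X e T) = right_mult X e T"
  proof
    fix x show "right_mult X e (right_mult X e T) x = right_mult X e T x"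
      using idem[of x]
      by (cases "x \<in> vectors X") (simp_all add: right_mult_def T op_comp_mem[OF sX sX sX em T] op_outside[OF em] op_zero[OF sX sX em])
  qed
  fix c :: complex assume c: "cmod c = 1"
  show "nrm (operators X) (T + (c - 1) *\<^sub>C right_mult X e T) \<le> nrm (operators X) T"
  proof (rule op_nrm_le[OF sX sX Y.nrm_nonneg[OF T]])
    fix x assume x: "x \<in> vectors X"
    have ex: "e x \<in> vectors X" using op_maps[OF em x] .
    have "(T + (c - 1) *\<^sub>C right_mult X e T) x = T (x + (c - 1) *\<^sub>C e x)"
      by (simp add: right_mult_def T scaleC_apply op_add[OF T x] op_scale[OF T] ex X.scale_mem)
    then show "nrm X ((T + (c - 1) *\<^sub>C right_mult X e T) x) \<le> nrm (operators X) T * nrm X x"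
      using op_bound[OF sX sX T X.add_mem[OF x X.scale_mem[OF ex]], of "c - 1"]
        mult_left_mono[OF herm[OF x c] Y.nrm_nonneg[OF T]] by simp
  qed
qed

text \<open>The cases differ in the size of the part of \<open>x\<close> outside the band. If it is
  at most \<open>\<eta>' * n\<close>, the operator \<open>a\<close> adds at most
  \<open>t * \<eta> * n\<close>. Otherwise additivity of the p-th powers keeps the norm of
  \<open>e x\<close> below \<open>r powr (1 / p) * n\<close>, and the gap absorbs the contribution
  of \<open>a\<close>.\<close>

lemma row_small:
  assumes p: "1 < p" and e: "band_projection X p e" and a: "a \<in> vectors (operators X)"
    and ae: "\<And>x. x \<in> vectors X \<Longrightarrow> a (e x) = 0" and eta: "0 < \<eta>"
  shows "\<exists>t>0. \<forall>x\<in>vectors X. nrm X (e x + of_real t *\<^sub>C a x) \<le> (1 + t * \<eta>) * nrm X x"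
proof -
  note eD = band_projectionD[OF e]
  define b where "b = nrm (operators X) a + 1"
  have b: "b > 0" "nrm (operators X) a \<le> b"
    using Y.nrm_nonneg[OF a] by (auto simp: b_def)
  define \<eta>' where "\<eta>' = \<eta> / b"
  have eta': "\<eta>' > 0" using b eta by (simp add: \<eta>'_def)
  \<comment> \<open>The maximum with 0 keeps the base nonnegative when \<open>\<eta>' > 1\<close>;
    below, \<open>t\<close> is chosen so that \<open>t * b\<close> equals the gap
    \<open>1 - r powr (1 / p)\<close>.\<close>
  define r where "r = max 0 (1 - \<eta>' powr p)"
  have r: "0 \<le> r" "r < 1" using eta' by (auto simp: r_def)
  define t where "t = (1 - r powr (1 / p)) / b"
  have "r powr (1 / p) < 1"
    using r p powr_less_mono2[of "1 / p" r 1] by simp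
  then have t: "t > 0" using b by (simp add: t_def)
  have "nrm X (e x + of_real t *\<^sub>C a x) \<le> (1 + t * \<eta>) * nrm X x" if x: "x \<in> vectors X" for x
  proof -
    define n \<alpha> \<beta> where "n = nrm X x" and "\<alpha> = nrm X (e x)" and "\<beta> = nrm X (x - e x)"
    have ex: "e x \<in> vectors X" and ax: "a x \<in> vectors X" using op_maps eD(1) a x by blast+
    have nonneg: "0 \<le> n" "0 \<le> \<alpha>" "0 \<le> \<beta>"
      unfolding n_def \<alpha>_def \<beta>_def using x ex X.diff_mem X.nrm_nonneg by auto
    have sum: "n powr p = \<alpha> powr p + \<beta> powr p"
      using eD(5)[OF x] by (simp add: n_def \<alpha>_def \<beta>_def)
    have "\<alpha> powr p \<le> n powr p" by (simp add: sum)
    then have an: "\<alpha> \<le> n"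
      using nonneg p by (meson linorder_not_le powr_less_mono2 zero_less_one order_less_trans)
    have "a x = a (x - e x)"
      using op_diff[OF sX sX a x ex] ae[OF x] by simp
    then have "nrm X (a x) \<le> b * \<beta>"
      using op_bound[OF sX sX a X.diff_mem[OF x ex]] mult_right_mono[OF b(2) nonneg(3)]
      by (simp add: \<beta>_def)
    then have "t * nrm X (a x) \<le> t * (b * \<beta>)"
      using t by (intro mult_left_mono) auto
    moreover have "nrm X (e x + of_real t *\<^sub>C a x) \<le> \<alpha> + t * nrm X (a x)"
      using X.nrm_add[OF ex X.scale_mem[OF ax], of "of_real t"] t
      by (simp add: X.nrm_scaleC[OF ax] \<alpha>_def)
    ultimately have main: "nrm X (e x + of_real t *\<^sub>C a x) \<le> \<alpha> + t * (b * \<beta>)"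
      by linarith
    show ?thesis
    proof (cases "\<beta> \<le> \<eta>' * n")
      case True
      then have "b * \<beta> \<le> \<eta> * n"
        using b mult_left_mono[OF True, of b] by (simp add: \<eta>'_def)
      then have "t * (b * \<beta>) \<le> t * (\<eta> * n)"
        using t by (intro mult_left_mono) auto
      then show ?thesis using main an by (simp add: n_def algebra_simps)
    next
      case False
      then have "(\<eta>' * n) powr p \<le> \<beta> powr p"
        using eta' nonneg p by (intro powr_mono2) auto
      then have "\<alpha> powr p \<le> (1 - \<eta>' powr p) * n powr p"
        using eta' nonneg by (simp add: sum powr_mult algebra_simps)
      also have "\<dots> \<le> r * n powr p"
        by (intro mult_right_mono) (auto simp: r_def)
      finally have "(\<alpha> powr p) powr (1 / p) \<le> (r * n powr p) powr (1 / p)"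
        using p by (intro powr_mono2) auto
      then have a1: "\<alpha> \<le> r powr (1 / p) * n"
        using p nonneg r by (simp add: powr_powr powr_mult)
      have "\<beta> powr p \<le> n powr p" by (simp add: sum)
      then have bn: "\<beta> \<le> n"
        using nonneg p by (meson linorder_not_le powr_less_mono2 zero_less_one order_less_trans)
      have "t * (b * \<beta>) = (1 - r powr (1 / p)) * \<beta>"
        using b by (simp add: t_def)
      also have "\<dots> \<le> (1 - r powr (1 / p)) * n"
        using bn \<open>r powr (1 / p) < 1\<close> by (intro mult_left_mono) auto
      finally have "\<alpha> + t * (b * \<beta>) \<le> n"
        using a1 by (simp add: algebra_simps)
      also have "n \<le> (1 + t * \<eta>) * n"
        using t eta nonneg by (simp add: algebra_simps)
      finally show ?thesis using main by (simp add: n_def)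
    qed
  qed
  then show ?thesis using t by blast
qed

text \<open>The added term lies in the complementary band, so p-th powers of norms add and the
  growth is of order \<open>t powr p\<close>, which for \<open>p > 1\<close> is smaller than any
  multiple of \<open>t\<close>.\<close>

lemma column_small:
  assumes p: "1 < p" and e: "band_projection X p e" and b: "b \<in> vectors (operators X)"
    and eb: "\<And>x. x \<in> vectors X \<Longrightarrow> e (b x) = 0" and be: "\<And>x. x \<in> vectors X \<Longrightarrow> b (e x) = b x" and eta: "0 < \<eta>"
  shows "\<exists>t>0. \<forall>x\<in>vectors X. nrm X (e x + of_real t *\<^sub>C b x) \<le> (1 + t * \<eta>) * nrm X x"
proof -
  note eD = band_projectionD[OF e]
  define c where "c = nrm (operators X) b + 1"
  have c: "c > 0" "nrm (operators X) b \<le> c"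
    using Y.nrm_nonneg[OF b] by (auto simp: c_def)
  \<comment> \<open>The solution of \<open>(t * c) powr p = t * \<eta>\<close>.\<close>
  define t where "t = (\<eta> / c powr p) powr (1 / (p - 1))"
  have t: "t > 0" using c eta by (simp add: t_def)
  have "t powr p = t powr (p - 1) * t"
    using t by (simp add: powr_mult_base[symmetric] powr_diff)
  also have "t powr (p - 1) = \<eta> / c powr p"
    using p eta c by (simp add: t_def powr_powr)
  finally have tc: "(t * c) powr p = t * \<eta>"
    using t c by (simp add: powr_mult)
  have "nrm X (e x + of_real t *\<^sub>C b x) \<le> (1 + t * \<eta>) * nrm X x" if x: "x \<in> vectors X" for x
  proof -
    define y where "y = e x + of_real t *\<^sub>C b x"
    have ex: "e x \<in> vectors X" and bx: "b x \<in> vectors X" using op_maps eD(1) b x by blast+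
    have y: "y \<in> vectors X" unfolding y_def using ex bx by (intro X.add_mem X.scale_mem)
    have ey: "e y = e x"
      using op_add[OF eD(1) ex X.scale_mem[OF bx], of "of_real t"] op_scale[OF eD(1) bx] eb[OF x] eD(3)[OF x]
      by (simp add: y_def)
    have "nrm X (b x) \<le> c * nrm X (e x)"
      using op_bound[OF sX sX b ex] mult_right_mono[OF c(2) X.nrm_nonneg[OF ex]] by (simp add: be[OF x])
    then have "t * nrm X (b x) \<le> t * c * nrm X (e x)"
      using t by (simp add: mult.assoc mult_left_mono)
    then have "(t * nrm X (b x)) powr p \<le> (t * c * nrm X (e x)) powr p"
      using t p X.nrm_nonneg[OF bx] by (intro powr_mono2) auto
    moreover have "nrm X y powr p = nrm X (e x) powr p + (t * nrm X (b x)) powr p"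
      using eD(5)[OF y] t unfolding ey by (simp add: y_def X.nrm_scaleC[OF bx])
    moreover have "(t * c * nrm X (e x)) powr p = t * \<eta> * nrm X (e x) powr p"
      using t c X.nrm_nonneg[OF ex] by (simp only: powr_mult[of "t * c"] tc)
    ultimately have "nrm X y powr p \<le> (1 + t * \<eta>) * nrm X (e x) powr p"
      by (simp add: distrib_right)
    also have "\<dots> \<le> (1 + t * \<eta>) * nrm X x powr p"
      using eD(5)[OF x] t eta by (intro mult_left_mono) auto
    also have "\<dots> \<le> (1 + t * \<eta>) powr p * nrm X x powr p"
      using t eta p powr_mono[of 1 p "1 + t * \<eta>"] by (intro mult_right_mono) auto
    also have "\<dots> = ((1 + t * \<eta>) * nrm X x) powr p"
      using t eta X.nrm_nonneg[OF x] by (simp add: powr_mult)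
    finally show ?thesis
      using X.nrm_nonneg[OF x] X.nrm_nonneg[OF y] t eta p
      unfolding y_def[symmetric] by (smt (verit) mult_nonneg_nonneg powr_less_mono2)
  qed
  then show ?thesis using t by blast
qed

section \<open>Stability of an L-summand under left and right multiplications\<close>

context
  fixes p :: real and W V :: "(('a \<Rightarrow> 'a) \<Rightarrow> complex) set"
  assumes p: "1 < p" and L: "L_decomp W V (dual (operators X))"
begin

text \<open>The sum of the two multiplications maps \<open>T\<close> to
  \<open>(e + t a) \<circ> T\<close>, so the estimate needed is \<open>row_small\<close> at the
  vectors \<open>T x\<close>.\<close>

lemma left_corner:
  assumes e: "band_projection X p e" and a: "a \<in> vectors (operators X)"
    and ae: "\<And>x. x \<in> vectors X \<Longrightarrow> a (e x) = 0" and ea: "\<And>x. x \<in> vectors X \<Longrightarrow> e (a x) = a x"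
    and psi: "\<psi> \<in> W"
  shows "\<psi> \<circ> left_mult X a \<in> W"
proof (rule L_decomp_corner[OF Y.seminormed_axioms L _ left_mult_mem[OF a] _ _ _ psi])
  note eD = band_projectionD[OF e]
  show "hermitian_projection (operators X) (left_mult X e)"
    by (rule hermitian_projection_left_mult[OF eD(2)])
  fix T assume T: "T \<in> vectors (operators X)"
  show "left_mult X a (left_mult X e T) = 0"
    using ae[OF op_maps[OF T]] op_outside[OF T] op_zero[OF sX sX a] op_zero[OF sX sX eD(1)]
    by (auto simp: left_mult_def T op_comp_mem[OF sX sX sX T eD(1)] fun_eq_iff) metis
  show "left_mult X e (left_mult X a T) = left_mult X a T"
    using ea[OF op_maps[OF T]] op_outside[OF T] op_zero[OF sX sX a] op_zero[OF sX sX eD(1)]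
    by (auto simp: left_mult_def T op_comp_mem[OF sX sX sX T a] fun_eq_iff) metis
next
  note eD = band_projectionD[OF e]
  fix \<eta> :: real assume "0 < \<eta>"
  then obtain t where t: "t > 0" "\<And>x. x \<in> vectors X \<Longrightarrow> nrm X (e x + of_real t *\<^sub>C a x) \<le> (1 + t * \<eta>) * nrm X x"
    using row_small[OF p e a ae] by blast
  have "nrm (operators X) (left_mult X e T + of_real t *\<^sub>C left_mult X a T) \<le> (1 + t * \<eta>) * nrm (operators X) T"
    if T: "T \<in> vectors (operators X)" for T
  proof (rule op_nrm_le[OF sX sX])
    show "0 \<le> (1 + t * \<eta>) * nrm (operators X) T"
      using t \<open>0 < \<eta>\<close> Y.nrm_nonneg[OF T] by simp
    fix x assume x: "x \<in> vectors X"
    show "nrm X ((left_mult X e T + of_real t *\<^sub>C left_mult X a T) x) \<le> (1 + t * \<eta>) * nrm (operators X) T * nrm X x"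
      using t(2)[OF op_maps[OF T x]] mult_left_mono[OF op_bound[OF sX sX T x], of "1 + t * \<eta>"] t(1) \<open>0 < \<eta>\<close>
      by (simp add: left_mult_def T scaleC_apply mult.assoc)
  qed
  then show "\<exists>t>0. \<forall>T\<in>vectors (operators X). nrm (operators X) (left_mult X e T + of_real t *\<^sub>C left_mult X a T)
      \<le> (1 + t * \<eta>) * nrm (operators X) T"
    using t by blast
qed

text \<open>On the right the sum is \<open>T \<circ> (e + t b)\<close> with \<open>b\<close> mapping
  the band into its complement, so the estimate needed is \<open>column_small\<close>.\<close>

lemma right_corner:
  assumes e: "band_projection X p e" and b: "b \<in> vectors (operators X)"
    and eb: "\<And>x. x \<in> vectors X \<Longrightarrow> e (b x) = 0" and be: "\<And>x. x \<in> vectors X \<Longrightarrow> b (e x) = b x"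
    and psi: "\<psi> \<in> W"
  shows "\<psi> \<circ> right_mult X b \<in> W"
proof (rule L_decomp_corner[OF Y.seminormed_axioms L _ right_mult_mem[OF b] _ _ _ psi])
  note eD = band_projectionD[OF e]
  show "hermitian_projection (operators X) (right_mult X e)"
    by (rule hermitian_projection_right_mult[OF eD(2)])
  fix T assume T: "T \<in> vectors (operators X)"
  show "right_mult X b (right_mult X e T) = 0"
  proof
    fix x show "right_mult X b (right_mult X e T) x = 0 x"
      using eb[of x] op_outside[OF b, of x] op_zero[OF sX sX eD(1)] op_zero[OF sX sX T]
      by (cases "x \<in> vectors X") (auto simp: right_mult_def T op_comp_mem[OF sX sX sX eD(1) T])
  qed
  show "right_mult X e (right_mult X b T) = right_mult X b T"
  proof
    fix x show "right_mult X e (right_mult X b T) x = right_mult X b T x"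
      using be[of x] op_outside[OF b, of x] op_outside[OF eD(1), of x] op_zero[OF sX sX b] op_zero[OF sX sX T]
      by (cases "x \<in> vectors X") (auto simp: right_mult_def T op_comp_mem[OF sX sX sX b T])
  qed
next
  note eD = band_projectionD[OF e]
  fix \<eta> :: real assume "0 < \<eta>"
  then obtain t where t: "t > 0" "\<And>x. x \<in> vectors X \<Longrightarrow> nrm X (e x + of_real t *\<^sub>C b x) \<le> (1 + t * \<eta>) * nrm X x"
    using column_small[OF p e b eb be] by blast
  have "nrm (operators X) (right_mult X e T + of_real t *\<^sub>C right_mult X b T) \<le> (1 + t * \<eta>) * nrm (operators X) T"
    if T: "T \<in> vectors (operators X)" for T
  proof (rule op_nrm_le[OF sX sX])
    show "0 \<le> (1 + t * \<eta>) * nrm (operators X) T"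
      using t \<open>0 < \<eta>\<close> Y.nrm_nonneg[OF T] by simp
    fix x assume x: "x \<in> vectors X"
    have ex: "e x \<in> vectors X" and bx: "b x \<in> vectors X" using op_maps eD(1) b x by blast+
    have "(right_mult X e T + of_real t *\<^sub>C right_mult X b T) x = T (e x + of_real t *\<^sub>C b x)"
      by (simp add: right_mult_def T scaleC_apply op_add[OF T ex X.scale_mem[OF bx]] op_scale[OF T bx])
    then show "nrm X ((right_mult X e T + of_real t *\<^sub>C right_mult X b T) x) \<le> (1 + t * \<eta>) * nrm (operators X) T * nrm X x"
      using op_bound[OF sX sX T X.add_mem[OF ex X.scale_mem[OF bx]], of "of_real t"]
        mult_left_mono[OF t(2)[OF x] Y.nrm_nonneg[OF T]] by (simp add: mult.assoc mult.left_commute)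
  qed
  then show "\<exists>t>0. \<forall>T\<in>vectors (operators X). nrm (operators X) (right_mult X e T + of_real t *\<^sub>C right_mult X b T)
      \<le> (1 + t * \<eta>) * nrm (operators X) T"
    using t by blast
qed

text \<open>Off-diagonal corners suffice: with an isomorphism \<open>S\<close> exchanging the two bands,
  a diagonal corner is a product of two off-diagonal ones.\<close>

lemma left_block:
  assumes e: "band_projection X p e" and S: "S \<in> vectors (operators X)"
    and SS: "\<And>x. x \<in> vectors X \<Longrightarrow> S (S x) = x" and Se: "\<And>x. x \<in> vectors X \<Longrightarrow> S (e x) = S x - e (S x)"
    and a: "a \<in> vectors (operators X)" and psi: "\<psi> \<in> W"
  shows "\<psi> \<circ> left_mult X (e \<circ> a \<circ> compl_op X e) \<in> W" "\<psi> \<circ> left_mult X (e \<circ> a \<circ> e) \<in> W"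
proof -
  note eD = band_projectionD[OF e]
  note e' = band_projection_compl[OF e]
  note e'D = band_projectionD[OF e']
  have mem: "e x \<in> vectors X" "S x \<in> vectors X" if "x \<in> vectors X" for x
    using op_maps eD(1) S that by blast+
  have ee': "compl_op X e (e x) = 0" "e (compl_op X e x) = 0" if "x \<in> vectors X" for x
    using that mem eD(3) by (auto simp: compl_op_def op_diff[OF sX sX eD(1)])
  have off: "\<psi> \<circ> left_mult X (e \<circ> a \<circ> compl_op X e) \<in> W" if "a \<in> vectors (operators X)" "\<psi> \<in> W" for a \<psi>
    by (rule left_corner[OF e _ _ _ that(2)])
      (auto intro!: op_comp_mem[OF sX sX sX] that e'D(1) eD(1)
        simp: ee' eD(3) op_maps[OF that(1)] op_maps[OF e'D(1)] op_zero[OF sX sX that(1)] op_zero[OF sX sX eD(1)])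
  show "\<psi> \<circ> left_mult X (e \<circ> a \<circ> compl_op X e) \<in> W"
    by (rule off[OF a psi])
  have c: "e \<circ> (a \<circ> S) \<circ> compl_op X e \<in> vectors (operators X)"
    and d: "compl_op X e \<circ> S \<circ> e \<in> vectors (operators X)"
    by (auto intro!: op_comp_mem[OF sX sX sX] a S eD(1) e'D(1))
  have "\<psi> \<circ> left_mult X (e \<circ> (a \<circ> S) \<circ> compl_op X e) \<in> W"
    by (rule off[OF op_comp_mem[OF sX sX sX S a] psi])
  then have "(\<psi> \<circ> left_mult X (e \<circ> (a \<circ> S) \<circ> compl_op X e)) \<circ> left_mult X (compl_op X e \<circ> S \<circ> e) \<in> W"
    by (rule left_corner[OF e' d, rotated 2])
      (auto simp: ee' e'D(3) mem op_zero[OF sX sX S] op_zero[OF sX sX e'D(1)])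
  moreover have "(e \<circ> (a \<circ> S) \<circ> compl_op X e) \<circ> (compl_op X e \<circ> S \<circ> e) = e \<circ> a \<circ> e"
  proof (rule op_eqI[OF op_comp_mem[OF sX sX sX d c]])
    show "e \<circ> a \<circ> e \<in> vectors (operators X)"
      by (auto intro!: op_comp_mem[OF sX sX sX] a eD(1))
    fix x assume x: "x \<in> vectors X"
    have "compl_op X e (S (e x)) = S (e x)"
      using Se[OF mem(1)[OF x]] eD(3)[OF x] mem[OF x] mem(2)[OF mem(1)[OF x]] by (simp add: compl_op_def)
    then show "((e \<circ> (a \<circ> S) \<circ> compl_op X e) \<circ> (compl_op X e \<circ> S \<circ> e)) x = (e \<circ> a \<circ> e) x"
      using SS[OF mem(1)[OF x]] by simp
  qed
  ultimately show "\<psi> \<circ> left_mult X (e \<circ> a \<circ> e) \<in> W"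
    using left_mult_comp[OF c d] by (simp add: comp_assoc)
qed

lemma right_block:
  assumes e: "band_projection X p e" and S: "S \<in> vectors (operators X)"
    and SS: "\<And>x. x \<in> vectors X \<Longrightarrow> S (S x) = x" and Se: "\<And>x. x \<in> vectors X \<Longrightarrow> S (e x) = S x - e (S x)"
    and a: "a \<in> vectors (operators X)" and psi: "\<psi> \<in> W"
  shows "\<psi> \<circ> right_mult X (compl_op X e \<circ> a \<circ> e) \<in> W" "\<psi> \<circ> right_mult X (e \<circ> a \<circ> e) \<in> W"
proof -
  note eD = band_projectionD[OF e]
  note e' = band_projection_compl[OF e]
  note e'D = band_projectionD[OF e']
  have mem: "e x \<in> vectors X" "S x \<in> vectors X" "a x \<in> vectors X" if "x \<in> vectors X" for x
    using op_maps eD(1) S a that by blast+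
  have ee': "compl_op X e (e x) = 0" "e (compl_op X e x) = 0" if "x \<in> vectors X" for x
    using that mem eD(3) by (auto simp: compl_op_def op_diff[OF sX sX eD(1)])
  have off: "\<psi> \<circ> right_mult X (compl_op X e \<circ> a \<circ> e) \<in> W" if "a \<in> vectors (operators X)" "\<psi> \<in> W" for a \<psi>
    by (rule right_corner[OF e _ _ _ that(2)])
      (auto intro!: op_comp_mem[OF sX sX sX] that e'D(1) eD(1)
        simp: ee' eD(3) op_maps[OF that(1)] op_maps[OF eD(1)])
  show "\<psi> \<circ> right_mult X (compl_op X e \<circ> a \<circ> e) \<in> W"
    by (rule off[OF a psi])
  have c: "e \<circ> (a \<circ> S) \<circ> compl_op X e \<in> vectors (operators X)"
    and d: "compl_op X e \<circ> S \<circ> e \<in> vectors (operators X)"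
    by (auto intro!: op_comp_mem[OF sX sX sX] a S eD(1) e'D(1))
  have "(\<psi> \<circ> right_mult X (compl_op X e \<circ> S \<circ> e)) \<in> W"
    by (rule off[OF S psi])
  then have "(\<psi> \<circ> right_mult X (compl_op X e \<circ> S \<circ> e)) \<circ> right_mult X (e \<circ> (a \<circ> S) \<circ> compl_op X e) \<in> W"
    by (rule right_corner[OF e' c, rotated 2])
      (auto simp: ee' e'D(3) mem op_maps[OF e'D(1)])
  moreover have "(e \<circ> (a \<circ> S) \<circ> compl_op X e) \<circ> (compl_op X e \<circ> S \<circ> e) = e \<circ> a \<circ> e"
  proof (rule op_eqI[OF op_comp_mem[OF sX sX sX d c]])
    show "e \<circ> a \<circ> e \<in> vectors (operators X)"
      by (auto intro!: op_comp_mem[OF sX sX sX] a eD(1))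
    fix x assume x: "x \<in> vectors X"
    have "compl_op X e (S (e x)) = S (e x)"
      using Se[OF mem(1)[OF x]] eD(3)[OF x] mem[OF x] mem(2)[OF mem(1)[OF x]] by (simp add: compl_op_def)
    then show "((e \<circ> (a \<circ> S) \<circ> compl_op X e) \<circ> (compl_op X e \<circ> S \<circ> e)) x = (e \<circ> a \<circ> e) x"
      using SS[OF mem(1)[OF x]] by simp
  qed
  ultimately show "\<psi> \<circ> right_mult X (e \<circ> a \<circ> e) \<in> W"
    using right_mult_comp[OF c d] by (simp add: comp_assoc)
qed

text \<open>The blocks for \<open>e\<close> and for its complement are the four entries of the
  matrix of \<open>a\<close> with respect to the two bands.\<close>

lemma L_decomp_bimodule:
  assumes e: "band_projection X p e" and S: "S \<in> vectors (operators X)"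
    and SS: "\<And>x. x \<in> vectors X \<Longrightarrow> S (S x) = x" and Se: "\<And>x. x \<in> vectors X \<Longrightarrow> S (e x) = S x - e (S x)"
    and a: "a \<in> vectors (operators X)" and psi: "\<psi> \<in> W"
  shows "\<psi> \<circ> left_mult X a \<in> W" "\<psi> \<circ> right_mult X a \<in> W"
proof -
  define e' where "e' = compl_op X e"
  note eD = band_projectionD[OF e]
  have e': "band_projection X p e'" unfolding e'_def by (rule band_projection_compl[OF e])
  note e'D = band_projectionD[OF e']
  have ce': "compl_op X e' = e" unfolding e'_def by (rule compl_op_compl_op[OF eD(1)])
  have Se': "S (e' x) = S x - e' (S x)" if x: "x \<in> vectors X" for x
    using x op_maps[OF S x] op_maps[OF eD(1) x] Se[OF x]
    by (simp add: e'_def compl_op_def op_diff[OF sX sX S])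
  have psiZ: "\<psi> \<in> vectors (dual (operators X))" and Ws: "csubspace W"
    using psi L by (auto simp: L_decomp_def)
  have m: "e \<circ> a \<circ> e' \<in> vectors (operators X)" "e \<circ> a \<circ> e \<in> vectors (operators X)"
    "e' \<circ> a \<circ> e \<in> vectors (operators X)" "e' \<circ> a \<circ> e' \<in> vectors (operators X)"
    by (auto intro!: op_comp_mem[OF sX sX sX] a eD(1) e'D(1))
  have split: "a x = (e \<circ> a \<circ> e') x + (e \<circ> a \<circ> e) x + (e' \<circ> a \<circ> e) x + (e' \<circ> a \<circ> e') x" if x: "x \<in> vectors X" for x
  proof -
    have ex: "e x \<in> vectors X" "a x \<in> vectors X" "a (e x) \<in> vectors X"
      using x op_maps eD(1) a by blast+
    show ?thesis
      using x ex by (simp add: e'_def compl_op_def op_diff[OF sX sX a] op_diff[OF sX sX eD(1)] X.diff_mem)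
  qed
  have "(\<psi> \<circ> left_mult X (e \<circ> a \<circ> e')) + (\<psi> \<circ> left_mult X (e \<circ> a \<circ> e)) + (\<psi> \<circ> left_mult X (e' \<circ> a \<circ> e))
      + (\<psi> \<circ> left_mult X (e' \<circ> a \<circ> e')) \<in> W" (is "?s \<in> W")
    using left_block[OF e S SS Se a psi] left_block[OF e' S SS Se' a psi]
    unfolding ce' e'_def[symmetric] by (intro complex_vector.subspace_add[OF Ws])
  moreover have "?s = \<psi> \<circ> left_mult X a"
  proof
    fix T show "?s T = (\<psi> \<circ> left_mult X a) T"
    proof (cases "T \<in> vectors (operators X)")
      case True
      have "left_mult X a T = ((e \<circ> a \<circ> e') \<circ> T) + ((e \<circ> a \<circ> e) \<circ> T) + ((e' \<circ> a \<circ> e) \<circ> T) + ((e' \<circ> a \<circ> e') \<circ> T)"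
      proof
        fix x show "left_mult X a T x = (((e \<circ> a \<circ> e') \<circ> T) + ((e \<circ> a \<circ> e) \<circ> T) + ((e' \<circ> a \<circ> e) \<circ> T) + ((e' \<circ> a \<circ> e') \<circ> T)) x"
          using split[of "T x"] split[of 0] op_maps[OF True, of x] op_outside[OF True, of x] X.zero_mem
          by (cases "x \<in> vectors X") (simp_all add: left_mult_def True)
      qed
      then show ?thesis
        by (simp add: left_mult_def True op_add[OF psiZ] Y.add_mem op_comp_mem[OF sX sX sX True] m)
    next
      case False
      then show ?thesis
        using op_zero[OF Y.seminormed_axioms seminormed_scalar_field psiZ] by (simp add: left_mult_def)
    qed
  qed
  ultimately show "\<psi> \<circ> left_mult X a \<in> W" by simp
  have "(\<psi> \<circ> right_mult X (e \<circ> a \<circ> e')) + (\<psi> \<circ> right_mult X (e \<circ> a \<circ> e)) + (\<psi> \<circ> right_mult X (e' \<circ> a \<circ> e))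
      + (\<psi> \<circ> right_mult X (e' \<circ> a \<circ> e')) \<in> W" (is "?s \<in> W")
    using right_block[OF e S SS Se a psi] right_block[OF e' S SS Se' a psi]
    unfolding ce' e'_def[symmetric] by (intro complex_vector.subspace_add[OF Ws])
  moreover have "?s = \<psi> \<circ> right_mult X a"
  proof
    fix T show "?s T = (\<psi> \<circ> right_mult X a) T"
    proof (cases "T \<in> vectors (operators X)")
      case True
      have "right_mult X a T = (T \<circ> (e \<circ> a \<circ> e')) + (T \<circ> (e \<circ> a \<circ> e)) + (T \<circ> (e' \<circ> a \<circ> e)) + (T \<circ> (e' \<circ> a \<circ> e'))"
      proof
        fix x
        have "T (a x) = T ((e \<circ> a \<circ> e') x) + T ((e \<circ> a \<circ> e) x) + T ((e' \<circ> a \<circ> e) x) + T ((e' \<circ> a \<circ> e') x)"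
          if x: "x \<in> vectors X"
          unfolding split[OF x] using op_maps[OF m(1) x] op_maps[OF m(2) x] op_maps[OF m(3) x] op_maps[OF m(4) x]
          by (simp add: op_add[OF True] X.add_mem del: o_apply)
        then show "right_mult X a T x = ((T \<circ> (e \<circ> a \<circ> e')) + (T \<circ> (e \<circ> a \<circ> e)) + (T \<circ> (e' \<circ> a \<circ> e)) + (T \<circ> (e' \<circ> a \<circ> e'))) x"
          using op_outside[OF a, of x] op_outside[OF eD(1), of x] op_outside[OF e'D(1), of x] op_zero[OF sX sX True]
            op_zero[OF sX sX a] op_zero[OF sX sX eD(1)] op_zero[OF sX sX e'D(1)]
          by (cases "x \<in> vectors X") (simp_all add: right_mult_def True)
      qed
      then show ?thesis
        by (simp add: right_mult_def True op_add[OF psiZ] Y.add_mem op_comp_mem[OF sX sX sX _ True] m)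
    next
      case False
      then show ?thesis
        using op_zero[OF Y.seminormed_axioms seminormed_scalar_field psiZ] by (simp add: right_mult_def)
    qed
  qed
  ultimately show "\<psi> \<circ> right_mult X a \<in> W" by simp
qed

end

end

section \<open>The spaces \<open>L\<^sub>p\<close>\<close>

lemma vectors_Lp: "u \<in> vectors (Lp p) \<longleftrightarrow> p_integrable p u"
  and nrm_Lp: "nrm (Lp p) u = p_norm p u"
  by (simp_all add: Lp_def)

text \<open>With an endpoint at 0 the claim is \<open>s powr p \<le> s\<close> on the unit interval;
  two positive endpoints fall under the convexity of the power.\<close>

lemma powr_convex_nonneg:
  fixes a b t p :: real
  assumes "1 \<le> p" "0 \<le> a" "0 \<le> b" "0 \<le> t" "t \<le> 1"
  shows "(t * a + (1 - t) * b) powr p \<le> t * a powr p + (1 - t) * b powr p"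
proof -
  have scale: "(s * c) powr p \<le> s * c powr p" if "0 \<le> s" "s \<le> 1" "0 \<le> c" for s c :: real
  proof -
    have "s powr p \<le> s"
      using that assms(1) by (cases "s = 0") (auto intro: order_trans[OF powr_mono'[of 1 p s]])
    then show ?thesis
      using that by (simp add: powr_mult mult_right_mono)
  qed
  show ?thesis
  proof (cases "a = 0 \<or> b = 0")
    case True
    then show ?thesis
      using scale[of t a] scale[of "1 - t" b] assms by auto
  next
    case False
    then show ?thesis
      using convex_onD[OF powr_convex[OF assms(1)], of t b a] assms by (simp add: algebra_simps)
  qed
qed

lemma integrable_powr_add:
  fixes f g :: "'a \<Rightarrow> complex"
  assumes p: "1 \<le> p" and [measurable]: "f \<in> borel_measurable M" "g \<in> borel_measurable M"
    and f: "integrable M (\<lambda>x. cmod (f x) powr p)" and g: "integrable M (\<lambda>x. cmod (g x) powr p)"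
  shows "integrable M (\<lambda>x. cmod (f x + g x) powr p)"
proof (rule Bochner_Integration.integrable_bound)
  show "integrable M (\<lambda>x. 2 powr p * (cmod (f x) powr p + cmod (g x) powr p))"
    using f g by simp
  have "cmod (a + b) powr p \<le> 2 powr p * (cmod a powr p + cmod b powr p)" for a b :: complex
  proof -
    have "cmod (a + b) powr p \<le> (2 * max (cmod a) (cmod b)) powr p"
      using norm_triangle_ineq[of a b] p by (intro powr_mono2) auto
    also have "\<dots> \<le> 2 powr p * (cmod a powr p + cmod b powr p)"
      by (auto simp: powr_mult max_def)
    finally show ?thesis .
  qed
  then show "AE x in M. norm (cmod (f x + g x) powr p) \<le> norm (2 powr p * (cmod (f x) powr p + cmod (g x) powr p))"
    by (simp add: order_trans[OF _ abs_ge_self])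
qed simp

text \<open>The sum of the moduli is \<open>a + b\<close> times a convex combination of the moduli
  divided by \<open>a\<close> and \<open>b\<close>, and convexity of the power applies. Taking
  \<open>a\<close> and \<open>b\<close> strictly above the norms avoids division by a vanishing
  norm.\<close>

lemma Minkowski:
  fixes f g :: "'a \<Rightarrow> complex"
  assumes p: "1 \<le> p" and [measurable]: "f \<in> borel_measurable M" "g \<in> borel_measurable M"
    and f: "integrable M (\<lambda>x. cmod (f x) powr p)" and g: "integrable M (\<lambda>x. cmod (g x) powr p)"
  shows "(\<integral>x. cmod (f x + g x) powr p \<partial>M) powr (1 / p)
    \<le> (\<integral>x. cmod (f x) powr p \<partial>M) powr (1 / p) + (\<integral>x. cmod (g x) powr p \<partial>M) powr (1 / p)"
proof -
  define F where "F = (\<integral>x. cmod (f x) powr p \<partial>M)"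
  define G where "G = (\<integral>x. cmod (g x) powr p \<partial>M)"
  have FG: "0 \<le> F" "0 \<le> G" by (auto simp: F_def G_def)
  have main: "(\<integral>x. cmod (f x + g x) powr p \<partial>M) powr (1 / p) \<le> a + b"
    if a: "F powr (1 / p) < a" and b: "G powr (1 / p) < b" for a b
  proof -
    have pos: "0 < a" "0 < b"
      using a b powr_ge_zero[of F "1 / p"] powr_ge_zero[of G "1 / p"] by linarith+
    define t where "t = a / (a + b)"
    have t: "0 \<le> t" "t \<le> 1" "1 - t = b / (a + b)"
      using pos by (auto simp: t_def field_simps)
    have pw: "cmod (f x + g x) powr p \<le> (a + b) powr p * (t * cmod (f x) powr p / a powr p + (1 - t) * cmod (g x) powr p / b powr p)" for x
    proof -
      have "cmod (f x + g x) powr p \<le> (cmod (f x) + cmod (g x)) powr p"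
        using p by (intro powr_mono2 norm_triangle_ineq) auto
      also have "cmod (f x) + cmod (g x) = (a + b) * (t * (cmod (f x) / a) + (1 - t) * (cmod (g x) / b))"
      proof -
        have "t * (cmod (f x) / a) = cmod (f x) / (a + b)" "(1 - t) * (cmod (g x) / b) = cmod (g x) / (a + b)"
          unfolding t(3) using pos by (simp_all add: t_def)
        then show ?thesis using pos by (simp add: add_divide_distrib[symmetric])
      qed
      also have "\<dots> powr p = (a + b) powr p * (t * (cmod (f x) / a) + (1 - t) * (cmod (g x) / b)) powr p"
        by (rule powr_mult)
      also have "\<dots> \<le> (a + b) powr p * (t * (cmod (f x) / a) powr p + (1 - t) * (cmod (g x) / b) powr p)"
        using pos t p by (intro mult_left_mono powr_convex_nonneg) auto
      finally show ?thesis
        using pos by (simp add: powr_divide)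
    qed
    have "(\<integral>x. cmod (f x + g x) powr p \<partial>M)
        \<le> (\<integral>x. (a + b) powr p * (t * cmod (f x) powr p / a powr p + (1 - t) * cmod (g x) powr p / b powr p) \<partial>M)"
      by (rule integral_mono[OF integrable_powr_add[OF p _ _ f g] _ pw]) (use f g in simp_all)
    also have "\<dots> = (a + b) powr p * (t * F / a powr p + (1 - t) * G / b powr p)"
      using f g by (simp add: F_def G_def)
    also have "\<dots> \<le> (a + b) powr p * (t * 1 + (1 - t) * 1)"
    proof (intro mult_left_mono add_mono)
      have "F \<le> a powr p"
        using powr_mono2[of p "F powr (1 / p)" a] a p FG by (simp add: powr_powr)
      then show "t * F / a powr p \<le> t * 1"
        using t pos mult_left_mono[of "F / a powr p" 1 t] by simp
      have "G \<le> b powr p"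
        using powr_mono2[of p "G powr (1 / p)" b] b p FG by (simp add: powr_powr)
      then show "(1 - t) * G / b powr p \<le> (1 - t) * 1"
        using t pos mult_left_mono[of "G / b powr p" 1 "1 - t"] by simp
    qed simp
    finally have "(\<integral>x. cmod (f x + g x) powr p \<partial>M) powr (1 / p) \<le> ((a + b) powr p) powr (1 / p)"
      using p by (intro powr_mono2) auto
    then show ?thesis
      using p pos by (simp add: powr_powr)
  qed
  show ?thesis
    unfolding F_def[symmetric] G_def[symmetric]
  proof (rule field_le_epsilon)
    fix e :: real assume "0 < e"
    then show "(\<integral>x. cmod (f x + g x) powr p \<partial>M) powr (1 / p) \<le> F powr (1 / p) + G powr (1 / p) + e"
      using main[of "F powr (1 / p) + e / 2" "G powr (1 / p) + e / 2"] by simp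
  qed
qed

lemma seminormed_Lp:
  assumes p: "1 \<le> p"
  shows "seminormed (Lp p)"
proof
  have add: "p_integrable p (u + v)" if "p_integrable p u" "p_integrable p v" for u v
    using that by (transfer fixing: p) (rule integrable_powr_add[OF p], simp_all add: ae_eq_def)
  have scale: "p_integrable p (c *\<^sub>C u)" if "p_integrable p u" for c u
    using that by transfer (simp add: norm_mult powr_mult)
  have zero: "p_integrable p 0"
    by transfer simp
  show "csubspace (vectors (Lp p))"
    using add scale zero by (auto simp: complex_vector.subspace_def vectors_Lp)
  show "0 \<le> nrm (Lp p) x" for x
    unfolding nrm_Lp by transfer simp
  show "nrm (Lp p) (c *\<^sub>C x) = cmod c * nrm (Lp p) x" for c x
    unfolding nrm_Lp using p by (transfer fixing: p) (simp add: norm_mult powr_mult powr_powr)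
  show "nrm (Lp p) (x + y) \<le> nrm (Lp p) x + nrm (Lp p) y" if "x \<in> vectors (Lp p)" "y \<in> vectors (Lp p)" for x y
    using that unfolding nrm_Lp vectors_Lp by (transfer fixing: p) (rule Minkowski[OF p], simp_all add: ae_eq_def)
qed

lemma Lp_definite:
  assumes p: "1 \<le> p" and "u \<in> vectors (Lp p)" "p_norm p u = 0"
  shows "u = 0"
  using assms(2,3) unfolding vectors_Lp
proof (transfer fixing: p)
  fix f assume "ae_eq f f" and int: "integrable unit_measure (\<lambda>x. cmod (f x) powr p)"
    and z: "(LINT x|unit_measure. cmod (f x) powr p) powr (1 / p) = 0"
  have "AE x in unit_measure. cmod (f x) powr p = 0"
    using integral_nonneg_eq_0_iff_AE[OF int] z by simp
  then have "AE x in unit_measure. f x = 0"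
    by (elim AE_mp) simp
  then show "ae_eq f (\<lambda>_. 0)"
    using \<open>ae_eq f f\<close> by (simp add: ae_eq_def)
qed

text \<open>Sets that are not measurable are treated as empty, so that \<open>restr\<close> and \<open>ind\<close> below are total.\<close>

definition measurable_part :: "real set \<Rightarrow> real set"
  where "measurable_part E = (if E \<in> sets unit_measure then E else {})"

lemma measurable_part_sets [measurable, simp]: "measurable_part E \<in> sets unit_measure"
  by (simp add: measurable_part_def)

lemma measurable_part_eq [simp]: "E \<in> sets unit_measure \<Longrightarrow> measurable_part E = E"
  by (simp add: measurable_part_def)

lift_definition restr :: "real set \<Rightarrow> fclass \<Rightarrow> fclass"
  is "\<lambda>E f x. indicator (measurable_part E) x * f x"
  by (auto simp: ae_eq_def)

lift_definition ind :: "real set \<Rightarrow> fclass"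
  is "\<lambda>E x. indicator (measurable_part E) x"
  by (auto simp: ae_eq_def)

lift_definition integ :: "fclass \<Rightarrow> complex"
  is "\<lambda>f. \<integral>x. f x \<partial>unit_measure"
  by (rule integral_cong_AE) (auto simp: ae_eq_def)

text \<open>Pairing with the indicator of \<open>E\<close>. Such pairings stand in for the
  functionals on L_p.\<close>

definition pr :: "real set \<Rightarrow> fclass \<Rightarrow> complex"
  where "pr E u = integ (restr E u)"

abbreviation mu :: "real set \<Rightarrow> real"
  where "mu \<equiv> measure unit_measure"

section \<open>Restrictions, indicators and integrals of classes\<close>

lemma restr_add: "restr E (u + v) = restr E u + restr E v"
  by transfer (auto simp: ae_eq_def distrib_left)

lemma restr_scale: "restr E (c *\<^sub>C u) = c *\<^sub>C restr E u"
  by transfer (auto simp: ae_eq_def)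

lemma restr_zero [simp]: "restr E 0 = 0"
  by transfer (auto simp: ae_eq_def)

lemma restr_diff: "restr E (u - v) = restr E u - restr E v"
  by transfer (auto simp: ae_eq_def right_diff_distrib)

lemma restr_restr: "E \<in> sets unit_measure \<Longrightarrow> F \<in> sets unit_measure \<Longrightarrow> restr E (restr F u) = restr (E \<inter> F) u"
  by transfer (auto simp: ae_eq_def indicator_inter_arith)

lemma restr_ind: "E \<in> sets unit_measure \<Longrightarrow> F \<in> sets unit_measure \<Longrightarrow> restr E (ind F) = ind (E \<inter> F)"
  by transfer (auto simp: ae_eq_def indicator_inter_arith)

lemma restr_Un: "E \<in> sets unit_measure \<Longrightarrow> F \<in> sets unit_measure \<Longrightarrow> E \<inter> F = {} \<Longrightarrow>
    restr (E \<union> F) u = restr E u + restr F u"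
  by transfer (auto simp: ae_eq_def indicator_def)

lemma ind_Un: "E \<in> sets unit_measure \<Longrightarrow> F \<in> sets unit_measure \<Longrightarrow> E \<inter> F = {} \<Longrightarrow>
    ind (E \<union> F) = ind E + ind F"
  by transfer (auto simp: ae_eq_def indicator_def)

lemma restr_empty [simp]: "restr {} u = 0"
  by transfer (auto simp: ae_eq_def)

lemma ind_empty [simp]: "ind {} = 0"
  by transfer (auto simp: ae_eq_def)

lemma restr_conull: "E \<in> sets unit_measure \<Longrightarrow> AE x in unit_measure. x \<in> E \<Longrightarrow> restr E u = u"
proof transfer
  fix E f assume "E \<in> sets unit_measure" "AE x in unit_measure. x \<in> E" "ae_eq f f"
  then show "ae_eq (\<lambda>x. indicator (measurable_part E) x * f x) f"
    by (auto simp: ae_eq_def elim: AE_mp)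
qed

lemma restr_mem:
  assumes "u \<in> vectors (Lp p)"
  shows "restr E u \<in> vectors (Lp p)"
  using assms unfolding vectors_Lp
proof (transfer fixing: p)
  fix E f assume "ae_eq f f" "integrable unit_measure (\<lambda>x. cmod (f x) powr p)"
  then show "integrable unit_measure (\<lambda>x. cmod (indicator (measurable_part E) x * f x) powr p)"
    by (intro Bochner_Integration.integrable_bound[OF \<open>integrable _ _\<close>])
      (auto simp: ae_eq_def indicator_def)
qed

lemma p_norm_restr_compl:
  assumes p: "1 \<le> p" and "u \<in> vectors (Lp p)" "E \<in> sets unit_measure"
  shows "p_norm p u powr p = p_norm p (restr E u) powr p + p_norm p (u - restr E u) powr p"
  using assms(2,3) unfolding vectors_Lp
proof (transfer fixing: p)
  fix f E assume f: "ae_eq f f" and int: "integrable unit_measure (\<lambda>x. cmod (f x) powr p)"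
    and E: "E \<in> sets unit_measure"
  have [measurable]: "f \<in> borel_measurable unit_measure" "E \<in> sets unit_measure"
    using f E by (auto simp: ae_eq_def)
  have [simp]: "integrable unit_measure (\<lambda>x. indicator E x * cmod (f x) powr p)"
    "integrable unit_measure (\<lambda>x. indicator (- E) x * cmod (f x) powr p)"
    by (rule Bochner_Integration.integrable_bound[OF int]; auto simp: indicator_def)+
  have "(LINT x|unit_measure. cmod (f x) powr p)
    = (LINT x|unit_measure. indicator E x * cmod (f x) powr p + indicator (- E) x * cmod (f x) powr p)"
    by (rule Bochner_Integration.integral_cong) (auto simp: indicator_def)
  also have "\<dots> = (LINT x|unit_measure. indicator E x * cmod (f x) powr p) + (LINT x|unit_measure. indicator (- E) x * cmod (f x) powr p)"
    by simp
  also have "(LINT x|unit_measure. indicator E x * cmod (f x) powr p) = (LINT x|unit_measure. cmod (indicator E x * f x) powr p)"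
    by (rule Bochner_Integration.integral_cong) (auto simp: indicator_def)
  also have "(LINT x|unit_measure. indicator (- E) x * cmod (f x) powr p) = (LINT x|unit_measure. cmod (f x - indicator E x * f x) powr p)"
    by (rule Bochner_Integration.integral_cong) (auto simp: indicator_def)
  finally show "((LINT x|unit_measure. cmod (f x) powr p) powr (1 / p)) powr p =
       ((LINT x|unit_measure. cmod (indicator (measurable_part E) x * f x) powr p) powr (1 / p)) powr p +
       ((LINT x|unit_measure. cmod (f x - (indicator (measurable_part E) x * f x)) powr p) powr (1 / p)) powr p"
    using p E by (simp add: powr_powr)
qed

lemma p_norm_unimodular_restr:
  assumes "cmod c = 1" "E \<in> sets unit_measure"
  shows "p_norm p (u + (c - 1) *\<^sub>C restr E u) = p_norm p u"
  using assms
proof (transfer fixing: p)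
  fix c E f assume c: "cmod c = 1" and E: "E \<in> sets unit_measure"
  have "(LINT x|unit_measure. cmod (f x + (c - 1) * (indicator (measurable_part E) x * f x)) powr p)
      = (LINT x|unit_measure. cmod (f x) powr p)"
  proof (rule Bochner_Integration.integral_cong)
    fix x
    have "f x + (c - 1) * f x = c * f x" by (simp add: algebra_simps)
    then show "cmod (f x + (c - 1) * (indicator (measurable_part E) x * f x)) powr p = cmod (f x) powr p"
      using c E by (simp add: indicator_def norm_mult)
  qed simp
  then show "(LINT x|unit_measure. cmod (f x + (c - 1) * (indicator (measurable_part E) x * f x)) powr p) powr (1 / p)
      = (LINT x|unit_measure. cmod (f x) powr p) powr (1 / p)" by simp
qed

lemma finite_measure_unit: "finite_measure unit_measure"
  by (rule finite_measure_lebesgue_on) simp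

lemma ind_mem: "ind E \<in> vectors (Lp p)"
  unfolding vectors_Lp
proof (transfer fixing: p)
  fix E :: "real set"
  interpret finite_measure unit_measure by (rule finite_measure_unit)
  show "integrable unit_measure (\<lambda>x. cmod (indicator (measurable_part E) x) powr p)"
    by (rule integrable_const_bound[where B = 1]) (auto simp: indicator_def)
qed

lemma p_norm_ind:
  assumes "1 \<le> p" "E \<in> sets unit_measure"
  shows "p_norm p (ind E) = mu E powr (1 / p)"
  using assms(2)
proof (transfer fixing: p)
  fix E assume E: "E \<in> sets unit_measure"
  have "(LINT x|unit_measure. cmod (indicator (measurable_part E) x) powr p)
      = (LINT x|unit_measure. indicator E x)"
    using E assms(1) by (intro Bochner_Integration.integral_cong) (auto simp: indicator_def)
  also have "\<dots> = mu E"
    using sets.sets_into_space[OF E] by (simp add: Int_absorb2)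
  finally show "(LINT x|unit_measure. cmod (indicator (measurable_part E) x) powr p) powr (1 / p) = mu E powr (1 / p)"
    by simp
qed

lemma Lp_integrable:
  assumes p: "1 \<le> p" and "f \<in> borel_measurable unit_measure" "integrable unit_measure (\<lambda>x. cmod (f x) powr p)"
  shows "integrable unit_measure f"
proof -
  interpret finite_measure unit_measure by (rule finite_measure_unit)
  have "cmod z \<le> 1 + cmod z powr p" for z
  proof (cases "cmod z \<le> 1")
    case False
    then show ?thesis using powr_mono[of 1 p "cmod z"] p by simp
  qed (simp add: add_increasing2)
  then show ?thesis
    using assms by (intro Bochner_Integration.integrable_bound[of _ "\<lambda>x. 1 + cmod (f x) powr p" f]) auto
qed

lemma Lp_subset_L1:
  assumes "1 \<le> p" "u \<in> vectors (Lp p)"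
  shows "u \<in> vectors (Lp 1)"
  using assms(2) unfolding vectors_Lp
  by (transfer fixing: p) (auto simp: ae_eq_def intro!: integrable_norm dest: Lp_integrable[OF assms(1)])

lemma integ_add:
  assumes "1 \<le> p" "u \<in> vectors (Lp p)" "v \<in> vectors (Lp p)"
  shows "integ (u + v) = integ u + integ v"
  using assms(2,3) unfolding vectors_Lp
  by (transfer fixing: p)
    (auto simp: ae_eq_def intro!: Bochner_Integration.integral_add Lp_integrable[OF assms(1)])

lemma integ_scale: "integ (c *\<^sub>C u) = c * integ u"
  by transfer simp

lemma integ_bound: "cmod (integ u) \<le> p_norm 1 u"
  by transfer (simp add: order_trans[OF integral_norm_bound])

lemma pr_add: "1 \<le> p \<Longrightarrow> u \<in> vectors (Lp p) \<Longrightarrow> v \<in> vectors (Lp p) \<Longrightarrow> pr E (u + v) = pr E u + pr E v"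
  unfolding pr_def restr_add by (rule integ_add) (auto intro: restr_mem)

lemma pr_scale: "pr E (c *\<^sub>C u) = c * pr E u"
  by (simp add: pr_def restr_scale integ_scale)

lemma pr_zero [simp]: "pr E 0 = 0"
  using pr_scale[of E 0 0] by simp

lemma pr_bound_L1: "cmod (pr E u) \<le> p_norm 1 (restr E u)"
  unfolding pr_def by (rule integ_bound)

lemma pr_restr: "E \<in> sets unit_measure \<Longrightarrow> F \<in> sets unit_measure \<Longrightarrow> pr E (restr F u) = pr (E \<inter> F) u"
  by (simp add: pr_def restr_restr)

lemma pr_Un:
  assumes "1 \<le> p" "u \<in> vectors (Lp p)" "E \<in> sets unit_measure" "F \<in> sets unit_measure" "E \<inter> F = {}"
  shows "pr (E \<union> F) u = pr E u + pr F u"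
  unfolding pr_def restr_Un[OF assms(3-5)] using assms by (intro integ_add[OF assms(1)] restr_mem)

lemma pr_ind:
  assumes "E \<in> sets unit_measure" "F \<in> sets unit_measure"
  shows "pr E (ind F) = of_real (mu (E \<inter> F))"
  unfolding pr_def restr_ind[OF assms]
proof -
  have EF: "E \<inter> F \<in> sets unit_measure" using assms by simp
  have "integ (ind E) = of_real (mu E)" if "E \<in> sets unit_measure" for E
    using that
  proof transfer
    fix E assume E: "E \<in> sets unit_measure"
    have "(LINT x|unit_measure. indicator (measurable_part E) x) = (LINT x|unit_measure. complex_of_real (indicator E x))"
      using E by (intro Bochner_Integration.integral_cong) (auto simp: indicator_def)
    also have "\<dots> = of_real (mu E)"
      using sets.sets_into_space[OF E] by (subst integral_complex_of_real) (simp add: Int_absorb2)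
    finally show "(LINT x|unit_measure. indicator (measurable_part E) x) = complex_of_real (mu E)" .
  qed
  then show "integ (ind (E \<inter> F)) = of_real (mu (E \<inter> F))"
    using EF by blast
qed

lemma pr_separates:
  assumes p: "1 \<le> p" and "u \<in> vectors (Lp p)" and "\<And>E. E \<in> sets unit_measure \<Longrightarrow> pr E u = 0"
  shows "u = 0"
  using assms(2,3) unfolding vectors_Lp pr_def
proof (transfer fixing: p)
  fix f assume f: "ae_eq f f" and int: "integrable unit_measure (\<lambda>x. cmod (f x) powr p)"
    and z: "\<And>E. E \<in> sets unit_measure \<Longrightarrow> (LINT x|unit_measure. indicator (measurable_part E) x * f x) = 0"
  interpret finite_measure unit_measure by (rule finite_measure_unit)
  have fm: "f \<in> borel_measurable unit_measure" using f by (simp add: ae_eq_def)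
  have fi: "integrable unit_measure f" by (rule Lp_integrable[OF p fm int])
  have "AE x in unit_measure. f x = 0"
  proof (rule density_zero)
    fix A assume A: "A \<in> sets unit_measure"
    have "(LINT x:A|unit_measure. f x) = (LINT x|unit_measure. indicator (measurable_part A) x * f x)"
      unfolding set_lebesgue_integral_def using A
      by (intro Bochner_Integration.integral_cong) (auto simp: indicator_def)
    then show "(LINT x:A|unit_measure. f x) = 0" using z[OF A] by simp
  qed (rule fi)
  then show "ae_eq f (\<lambda>_. 0)"
    using fm by (simp add: ae_eq_def)
qed

section \<open>Hoelder's inequality and completeness\<close>

lemma powr_Bernoulli:
  fixes t p :: real
  assumes "1 < p" "0 \<le> t"
  shows "t \<le> t powr p / p + (1 - 1 / p)"
proof -
  have "t * 1 \<le> t powr p / p + 1 powr (p / (p - 1)) / (p / (p - 1))"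
    by (rule Youngs_inequality) (use assms in \<open>auto simp: field_simps\<close>)
  also have "1 powr (p / (p - 1)) / (p / (p - 1)) = 1 - 1 / p"
    using assms by (simp add: field_simps)
  finally show ?thesis by simp
qed

text \<open>Integrating the Bernoulli inequality for \<open>cmod (f x) / s\<close> over
  \<open>E\<close> gives a bound for each scale \<open>s > 0\<close>. The best scale makes
  \<open>s powr p\<close> the mean of \<open>cmod (f x) powr p\<close> over
  \<open>E\<close>.\<close>

lemma Hoelder_indicator:
  assumes p: "1 < p" and "u \<in> vectors (Lp p)" "E \<in> sets unit_measure"
  shows "p_norm 1 (restr E u) \<le> mu E powr (1 - 1 / p) * p_norm p (restr E u)"
  using assms(2,3) unfolding vectors_Lp
proof (transfer fixing: p)
  fix f E assume f: "ae_eq f f" and int: "integrable unit_measure (\<lambda>x. cmod (f x) powr p)"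
    and E [measurable]: "E \<in> sets unit_measure"
  interpret finite_measure unit_measure by (rule finite_measure_unit)
  have [measurable]: "f \<in> borel_measurable unit_measure" using f by (simp add: ae_eq_def)
  have fi: "integrable unit_measure f" using p int by (intro Lp_integrable) auto
  define m where "m = mu E"
  define N where "N = (LINT x|unit_measure. indicator E x * cmod (f x) powr p)"
  define L where "L = (LINT x|unit_measure. indicator E x * cmod (f x))"
  have int': "integrable unit_measure (\<lambda>x. indicator E x * cmod (f x) powr p)"
    "integrable unit_measure (\<lambda>x. indicator E x * cmod (f x))"
    by (rule Bochner_Integration.integrable_bound[OF int], auto simp: indicator_def)
      (rule Bochner_Integration.integrable_bound[OF fi], auto simp: indicator_def)
  have inte: "integrable unit_measure (\<lambda>x. indicator E x :: real)"
    by (rule integrable_const_bound[where B = 1]) auto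
  have mE: "(LINT x|unit_measure. indicator E x) = m"
    using sets.sets_into_space[OF E] by (simp add: Int_absorb2 m_def)
  have pos: "0 \<le> m" "0 \<le> N" by (auto simp: m_def N_def)
  have key: "L \<le> s * (N / s powr p / p + (1 - 1 / p) * m)" if s: "s > 0" for s
  proof -
    have "L \<le> (LINT x|unit_measure. s / (s powr p * p) * (indicator E x * cmod (f x) powr p) + s * (1 - 1 / p) * indicator E x)"
      unfolding L_def
    proof (rule integral_mono[OF int'(2)])
      show "integrable unit_measure (\<lambda>x. s / (s powr p * p) * (indicator E x * cmod (f x) powr p) + s * (1 - 1 / p) * indicator E x)"
        using int'(1) inte by simp
      fix x
      have "cmod (f x) = s * (cmod (f x) / s)" using s by simp
      also have "\<dots> \<le> s * ((cmod (f x) / s) powr p / p + (1 - 1 / p))"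
        using s p by (intro mult_left_mono powr_Bernoulli) auto
      also have "\<dots> = s / (s powr p * p) * cmod (f x) powr p + s * (1 - 1 / p)"
        using s by (simp add: powr_divide distrib_left)
      finally show "indicator E x * cmod (f x) \<le> s / (s powr p * p) * (indicator E x * cmod (f x) powr p) + s * (1 - 1 / p) * indicator E x"
        by (simp add: indicator_def)
    qed
    also have "\<dots> = s / (s powr p * p) * N + s * (1 - 1 / p) * m"
      using int'(1) inte sets.sets_into_space[OF E] by (simp add: N_def m_def Int_absorb2)
    also have "\<dots> = s * (N / s powr p / p + (1 - 1 / p) * m)"
      by (simp add: distrib_left)
    finally show ?thesis .
  qed
  have "L \<le> m powr (1 - 1 / p) * N powr (1 / p)"
  proof (cases "m = 0")
    case True
    then have "AE x in unit_measure. x \<notin> E"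
      by (intro AE_not_in) (auto simp: m_def emeasure_eq_measure null_sets_def)
    then have "L = (LINT x|unit_measure. 0)"
      unfolding L_def by (intro integral_cong_AE) (auto elim: AE_mp)
    then show ?thesis by simp
  next
    case m: False
    show ?thesis
    proof (cases "N = 0")
      case True
      \<comment> \<open>For \<open>N = 0\<close> no best scale exists; the bound is
        \<open>s * (1 - 1 / p) * m\<close> with \<open>s\<close> arbitrarily small.\<close>
      have "L \<le> 0 + e" if "e > 0" for e
        using key[of "e / ((1 - 1 / p) * m)"] m p pos that True by simp
      then have "L \<le> 0" by (rule field_le_epsilon)
      then show ?thesis by (simp add: order_trans)
    next
      case N: False
      define s where "s = (N / m) powr (1 / p)"
      have s: "s > 0" "s powr p = N / m" using m N pos p by (auto simp: s_def powr_powr)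
      have "L \<le> s * (m / p + (1 - 1 / p) * m)"
        using key[OF s(1)] m N unfolding s(2) by simp
      also have "\<dots> = s * m" by (simp add: algebra_simps)
      also have "\<dots> = m powr (1 - 1 / p) * N powr (1 / p)"
        using m pos by (simp add: s_def powr_divide powr_diff)
      finally show ?thesis .
    qed
  qed
  moreover have c: "cmod (indicator (measurable_part E) x * f x) = indicator E x * cmod (f x)" for x
    using E by (simp add: indicator_def)
  moreover have "0 \<le> L" by (simp add: L_def)
  then have "L = (LINT x|unit_measure. cmod (indicator (measurable_part E) x * f x) powr 1) powr (1 / 1)"
    unfolding c by (simp add: L_def)
  moreover have "N = (LINT x|unit_measure. cmod (indicator (measurable_part E) x * f x) powr p)"
    unfolding c N_def using p by (intro Bochner_Integration.integral_cong) (auto simp: indicator_def)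
  ultimately show "(LINT x|unit_measure. cmod (indicator (measurable_part E) x * f x) powr 1) powr (1 / 1)
    \<le> mu E powr (1 - 1 / p) * (LINT x|unit_measure. cmod (indicator (measurable_part E) x * f x) powr p) powr (1 / p)"
    by (simp add: m_def)
qed

lemma mu_le_1: "mu E \<le> 1"
proof -
  interpret finite_measure unit_measure by (rule finite_measure_unit)
  have "mu E \<le> mu (space unit_measure)" by (rule bounded_measure)
  also have "\<dots> = 1" by (simp add: measure_restrict_space)
  finally show ?thesis .
qed

lemma p_norm_restr_le:
  assumes "1 \<le> p" "u \<in> vectors (Lp p)" "E \<in> sets unit_measure"
  shows "p_norm p (restr E u) \<le> p_norm p u"
proof -
  have nn: "0 \<le> p_norm p v" for v by transfer simp
  have "p_norm p (restr E u) powr p \<le> p_norm p u powr p"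
    using p_norm_restr_compl[OF assms] by simp
  then show ?thesis
    using nn assms(1) by (meson linorder_not_le powr_less_mono2 zero_less_one order_less_le_trans)
qed

lemma p_norm_1_le:
  assumes p: "1 < p" and u: "u \<in> vectors (Lp p)"
  shows "p_norm 1 u \<le> p_norm p u"
proof -
  have sp: "{0..1} \<in> sets unit_measure"
    using sets.top[of unit_measure] by simp
  have r: "restr {0..1} u = u"
    by (rule restr_conull[OF sp], rule AE_I2) simp
  have nn: "0 \<le> p_norm p u" by transfer simp
  have "p_norm 1 u \<le> mu {0..1} powr (1 - 1 / p) * p_norm p u"
    using Hoelder_indicator[OF p u sp] by (simp add: r)
  also have "\<dots> \<le> 1 * p_norm p u"
    using nn p by (intro mult_right_mono powr_le1) (auto simp: mu_le_1)
  finally show ?thesis by simp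
qed

lemma pr_bound:
  assumes p: "1 < p" and u: "u \<in> vectors (Lp p)" and E: "E \<in> sets unit_measure"
  shows "cmod (pr E u) \<le> mu E powr (1 - 1 / p) * p_norm p (restr E u)"
  using order_trans[OF pr_bound_L1 Hoelder_indicator[OF assms]] .

lemma fclass_rep:
  obtains f where "f \<in> borel_measurable unit_measure" "u = abs_fclass f"
proof -
  have "\<exists>f. ae_eq f f \<and> u = abs_fclass f"
    by (metis Quotient3_abs_rep Quotient3_rep_reflp Quotient3_fclass)
  then show ?thesis using that by (auto simp: ae_eq_def)
qed

text \<open>Riesz-Fischer: the sequence is also Cauchy in L_1, so a subsequence converges almost
  everywhere, and Fatou's lemma bounds the distance of late members to the pointwise limit.\<close>

lemma Lp_complete:
  assumes p: "1 < p" and u: "\<And>n. u n \<in> vectors (Lp p)"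
    and cauchy: "\<And>e. e > 0 \<Longrightarrow> \<exists>N. \<forall>m\<ge>N. \<forall>n\<ge>N. p_norm p (u m - u n) < e"
  shows "\<exists>v\<in>vectors (Lp p). (\<lambda>n. p_norm p (u n - v)) \<longlonglongrightarrow> 0"
proof -
  have p1: "1 \<le> p" using p by simp
  interpret Lp: seminormed "Lp p" by (rule seminormed_Lp[OF p1])
  have "\<exists>f. \<forall>n. f n \<in> borel_measurable unit_measure \<and> u n = abs_fclass (f n)"
    by (rule choice, rule allI) (metis fclass_rep)
  then obtain f where f [measurable]: "\<And>n. f n \<in> borel_measurable unit_measure" and uf: "\<And>n. u n = abs_fclass (f n)"
    by auto
  have ae: "ae_eq g g" if "g \<in> borel_measurable unit_measure" for g using that by (simp add: ae_eq_def)
  have fint: "integrable unit_measure (\<lambda>x. cmod (f n x) powr p)" for n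
    using u[of n] unfolding uf vectors_Lp p_integrable.abs_eq[OF ae[OF f]] .
  have diff: "abs_fclass g - abs_fclass h = abs_fclass (\<lambda>x. g x - h x)"
    if "g \<in> borel_measurable unit_measure" "h \<in> borel_measurable unit_measure" for g h
    using that by (simp add: minus_fclass.abs_eq ae)
  have norm: "p_norm q (abs_fclass g) = (LINT x|unit_measure. cmod (g x) powr q) powr (1 / q)"
    if "g \<in> borel_measurable unit_measure" for g q
    using that by (simp add: p_norm.abs_eq ae)
  have "\<exists>N. \<forall>i\<ge>N. \<forall>j\<ge>N. LINT x|unit_measure. norm (f i x - f j x) < e" if "e > 0" for e
  proof -
    obtain N where N: "\<forall>m\<ge>N. \<forall>n\<ge>N. p_norm p (u m - u n) < e" using cauchy[OF \<open>e > 0\<close>] by auto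
    have "LINT x|unit_measure. norm (f i x - f j x) = p_norm 1 (u i - u j)" for i j
      by (simp add: uf diff norm)
    then show ?thesis
      using N p_norm_1_le[OF p Lp.diff_mem[OF u u]] by (metis order_le_less_trans)
  qed
  then obtain r where r: "strict_mono r" and rc: "AE x in unit_measure. Cauchy (\<lambda>i. f (r i) x)"
    using cauchy_L1_AE_cauchy_subseq[of unit_measure f, OF Lp_integrable[OF p1 f fint]] by blast
  \<comment> \<open>A total measurable function whose values off the set of convergence are
    irrelevant.\<close>
  define g where "g = (\<lambda>x. lim (\<lambda>i. f (r i) x))"
  have [measurable]: "g \<in> borel_measurable unit_measure"
    unfolding g_def by (rule borel_measurable_lim_metric) simp
  have conv: "AE x in unit_measure. (\<lambda>i. f (r i) x) \<longlonglongrightarrow> g x"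
    using rc by (elim AE_mp) (auto simp: g_def Cauchy_convergent_iff convergent_LIMSEQ_iff)
  have est: "integrable unit_measure (\<lambda>x. cmod (f n x - g x) powr p) \<and> (LINT x|unit_measure. cmod (f n x - g x) powr p) \<le> e powr p"
    if e: "e > 0" and N: "\<forall>m\<ge>N. \<forall>n\<ge>N. p_norm p (u m - u n) < e" and n: "n \<ge> N" for e N n
  proof -
    have "(\<integral>\<^sup>+x. ennreal (cmod (f n x - g x) powr p) \<partial>unit_measure)
        \<le> (\<integral>\<^sup>+x. liminf (\<lambda>i. ennreal (cmod (f n x - f (r i) x) powr p)) \<partial>unit_measure)"
    proof (rule nn_integral_mono_AE, use conv in \<open>elim AE_mp\<close>, rule AE_I2, rule impI)
      fix x assume "(\<lambda>i. f (r i) x) \<longlonglongrightarrow> g x"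
      then have "(\<lambda>i. cmod (f n x - f (r i) x) powr p) \<longlonglongrightarrow> cmod (f n x - g x) powr p"
        using p by (intro tendsto_powr2 tendsto_intros) auto
      then have "(\<lambda>i. ennreal (cmod (f n x - f (r i) x) powr p)) \<longlonglongrightarrow> ennreal (cmod (f n x - g x) powr p)"
        by (rule tendsto_ennrealI)
      then show "ennreal (cmod (f n x - g x) powr p) \<le> liminf (\<lambda>i. ennreal (cmod (f n x - f (r i) x) powr p))"
        using lim_imp_Liminf[OF trivial_limit_sequentially] by (metis order_refl)
    qed
    also have "\<dots> \<le> liminf (\<lambda>i. \<integral>\<^sup>+x. ennreal (cmod (f n x - f (r i) x) powr p) \<partial>unit_measure)"
      by (rule nn_integral_liminf) simp
    also have "\<dots> \<le> ennreal (e powr p)"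
    proof (rule order_trans[OF Liminf_le_Limsup[OF trivial_limit_sequentially] Limsup_bounded],
        rule eventually_sequentiallyI[of N])
      fix i assume i: "N \<le> i"
      have ri: "N \<le> r i" using i seq_suble[OF r, of i] by simp
      have int: "integrable unit_measure (\<lambda>x. cmod (f n x - f (r i) x) powr p)"
        using Lp.diff_mem[OF u[of n] u[of "r i"]]
        by (simp add: uf diff vectors_Lp p_integrable.abs_eq ae)
      have lt: "(LINT x|unit_measure. cmod (f n x - f (r i) x) powr p) powr (1 / p) < e"
        using N n ri by (simp add: uf diff norm)
      have "(LINT x|unit_measure. cmod (f n x - f (r i) x) powr p) \<le> e powr p"
        using powr_mono2[OF _ _ less_imp_le[OF lt], of p] p by (simp add: powr_powr)
      then show "(\<integral>\<^sup>+x. ennreal (cmod (f n x - f (r i) x) powr p) \<partial>unit_measure) \<le> ennreal (e powr p)"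
        by (subst nn_integral_eq_integral[OF int]) (auto intro: ennreal_leI)
    qed
    finally have le: "(\<integral>\<^sup>+x. ennreal (cmod (f n x - g x) powr p) \<partial>unit_measure) \<le> ennreal (e powr p)" .
    have int: "integrable unit_measure (\<lambda>x. cmod (f n x - g x) powr p)"
      by (rule integrableI_bounded) (use le in \<open>auto simp: ennreal_less_top intro: le_less_trans\<close>)
    then show ?thesis
      using le by (simp add: nn_integral_eq_integral ennreal_le_iff)
  qed
  define v where "v = abs_fclass g"
  have uv: "u n - v = abs_fclass (\<lambda>x. f n x - g x)" for n
    by (simp add: uf v_def diff)
  have mem: "\<exists>N. \<forall>n\<ge>N. u n - v \<in> vectors (Lp p) \<and> p_norm p (u n - v) \<le> e" if e: "e > 0" for e
  proof -
    obtain N where N: "\<forall>m\<ge>N. \<forall>n\<ge>N. p_norm p (u m - u n) < e" using cauchy[OF e] by auto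
    have "u n - v \<in> vectors (Lp p) \<and> p_norm p (u n - v) \<le> e" if n: "n \<ge> N" for n
    proof
      show "u n - v \<in> vectors (Lp p)"
        using est[OF e N n] by (simp add: uv vectors_Lp p_integrable.abs_eq ae)
      have "(LINT x|unit_measure. cmod (f n x - g x) powr p) powr (1 / p) \<le> (e powr p) powr (1 / p)"
        using est[OF e N n] p by (intro powr_mono2) auto
      then show "p_norm p (u n - v) \<le> e"
        using e p by (simp add: uv norm powr_powr)
    qed
    then show ?thesis by blast
  qed
  have "v \<in> vectors (Lp p)"
  proof -
    obtain n where "u n - v \<in> vectors (Lp p)" using mem[of 1] by auto
    from Lp.diff_mem[OF u[of n] this] show ?thesis
      by (simp add: diff_diff_eq2)
  qed
  moreover have "(\<lambda>n. p_norm p (u n - v)) \<longlonglongrightarrow> 0"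
  proof (rule LIMSEQ_I)
    fix e :: real assume e: "0 < e"
    have nn: "0 \<le> p_norm p w" for w by transfer simp
    obtain N where "\<forall>n\<ge>N. p_norm p (u n - v) \<le> e / 2" using mem[of "e / 2"] e by auto
    then show "\<exists>N. \<forall>n\<ge>N. norm (p_norm p (u n - v) - 0) < e"
      using e nn by (intro exI[of _ N]) (auto simp: le_less_trans[of _ "e / 2"])
  qed
  ultimately show ?thesis by blast
qed

section \<open>Dyadic intervals and trees of sets\<close>

text \<open>Heap indexing: node \<open>1\<close> is \<open>[0,1)\<close>, and the halves of node \<open>j\<close> are the nodes \<open>2j\<close> and \<open>2j + 1\<close>.\<close>

definition dyadic :: "nat \<Rightarrow> real set"
  where "dyadic j = {real j / 2 ^ floor_log j - 1 ..< (real j + 1) / 2 ^ floor_log j - 1}"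

abbreviation level :: "nat \<Rightarrow> nat set"
  where "level N \<equiv> {2 ^ N ..< 2 * 2 ^ N}"

lemma level_iff: "j \<in> level N \<longleftrightarrow> 1 \<le> j \<and> floor_log j = N"
  using floor_log_exp2_le[of j] floor_log_exp2_gt[of j]
  by (auto intro!: floor_log_eqI simp: Suc_le_eq)

lemma floor_log_double: "1 \<le> j \<Longrightarrow> floor_log (2 * j) = Suc (floor_log j)" "1 \<le> j \<Longrightarrow> floor_log (Suc (2 * j)) = Suc (floor_log j)"
  by (subst floor_log_rec; simp)+

lemma dyadic_bounds:
  assumes "1 \<le> j"
  shows "dyadic j \<subseteq> {0..<1}"
proof -
  have "real (2 ^ floor_log j) \<le> real j" "real (j + 1) \<le> real (2 * 2 ^ floor_log j)"
    using floor_log_exp2_le[of j] floor_log_exp2_gt[of j] assms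
    by (simp_all only: of_nat_le_iff Suc_le_eq Suc_eq_plus1[symmetric])
  then have "(2 ^ floor_log j :: real) \<le> real j" "real j + 1 \<le> 2 * 2 ^ floor_log j"
    by simp_all
  then have "1 \<le> real j / 2 ^ floor_log j" "(real j + 1) / 2 ^ floor_log j \<le> 2"
    by (simp_all add: field_simps)
  moreover have "{a - 1..<b - 1} \<subseteq> {0..<1}" if "1 \<le> a" "b \<le> 2" for a b :: real
    using that by auto
  ultimately show ?thesis
    unfolding dyadic_def by blast
qed

lemma interval_in_sets:
  assumes "E \<in> sets borel" "E \<subseteq> {0..1}"
  shows "E \<in> sets unit_measure"
  using assms by (auto simp: sets_restrict_space_iff)

lemma dyadic_sets [measurable, simp]: "1 \<le> j \<Longrightarrow> dyadic j \<in> sets unit_measure"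
proof (rule interval_in_sets)
  assume "1 \<le> j"
  then show "dyadic j \<subseteq> {0..1}"
    using dyadic_bounds[of j] by force
qed (simp add: dyadic_def)

lemma unit_sets [measurable, simp]: "{0..<1} \<in> sets unit_measure"
  by (rule interval_in_sets) auto

lemma mu_eq: "E \<subseteq> {0..1} \<Longrightarrow> mu E = measure lebesgue E"
  by (simp add: measure_restrict_space)

lemma mu_dyadic:
  assumes "1 \<le> j"
  shows "mu (dyadic j) = 1 / 2 ^ floor_log j"
proof -
  have "dyadic j \<subseteq> {0..1}"
    using dyadic_bounds[of j] assms by force
  then have "mu (dyadic j) = measure lborel (dyadic j)"
    by (subst mu_eq) (auto simp: dyadic_def)
  also have "\<dots> = (real j + 1) / 2 ^ floor_log j - 1 - (real j / 2 ^ floor_log j - 1)"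
    unfolding dyadic_def by (rule measure_lborel_Ico) (simp add: divide_right_mono)
  finally show ?thesis
    by (simp add: add_divide_distrib)
qed

lemma mu_dyadic_pos: "1 \<le> j \<Longrightarrow> 0 < mu (dyadic j)"
  by (simp add: mu_dyadic)

lemma dyadic_1: "dyadic 1 = {0..<1}"
  by (simp add: dyadic_def)

lemma dyadic_split:
  assumes "1 \<le> j"
  shows "dyadic (2 * j) \<union> dyadic (2 * j + 1) = dyadic j" "dyadic (2 * j) \<inter> dyadic (2 * j + 1) = {}"
  unfolding dyadic_def using floor_log_double[OF assms]
  by (auto simp: field_simps)

lemma dyadic_parent: "2 \<le> j \<Longrightarrow> dyadic j \<subseteq> dyadic (j div 2)"
  using dyadic_split(1)[of "j div 2"] by (cases "even j") (auto elim!: evenE oddE)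

lemma level_disjoint: "disjoint_family_on dyadic (level N)"
  unfolding disjoint_family_on_def
proof (intro ballI impI)
  fix i j assume ij: "i \<in> level N" "j \<in> level N" "i \<noteq> j"
  have aux: "dyadic i \<inter> dyadic j = {}" if "i \<in> level N" "j \<in> level N" "i < j" for i j
  proof -
    have "floor_log i = N" "floor_log j = N" using that(1,2) by (simp_all only: level_iff)
    moreover have "(real i + 1) / 2 ^ N \<le> real j / 2 ^ N"
      using that by (intro divide_right_mono) auto
    ultimately show ?thesis by (auto simp: dyadic_def)
  qed
  show "dyadic i \<inter> dyadic j = {}"
    using aux[of i j] aux[of j i] ij by (cases "i < j") auto
qed

lemma level_Union: "(\<Union>j\<in>level N. dyadic j) = {0..<1}"
proof
  show "(\<Union>j\<in>level N. dyadic j) \<subseteq> {0..<1}"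
  proof (rule UN_least)
    fix j assume "j \<in> level N"
    then show "dyadic j \<subseteq> {0..<1}"
      by (intro dyadic_bounds) (simp only: level_iff)
  qed
  show "{0..<1} \<subseteq> (\<Union>j\<in>level N. dyadic j)"
  proof
    fix x :: real assume x: "x \<in> {0..<1}"
    define i where "i = nat \<lfloor>x * 2 ^ N\<rfloor>"
    have i: "real i \<le> x * 2 ^ N" "x * 2 ^ N < real i + 1"
      using x by (auto simp: i_def)
    have "x * 2 ^ N < 1 * 2 ^ N" using x by (intro mult_strict_right_mono) auto
    with i(1) have "real i < 1 * 2 ^ N" by (rule order_le_less_trans)
    then have "real i < real (2 ^ N)" by (simp only: mult_1 of_nat_power of_nat_numeral)
    then have "i < 2 ^ N" by (simp only: of_nat_less_iff)
    then have l: "2 ^ N + i \<in> level N" by simp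
    then have "floor_log (2 ^ N + i) = N" by (simp only: level_iff)
    then have "x \<in> dyadic (2 ^ N + i)"
      using i by (simp add: dyadic_def field_simps)
    then show "x \<in> (\<Union>j\<in>level N. dyadic j)" using l by blast
  qed
qed

lemma dyadic_nested:
  assumes "1 \<le> i" "j \<in> level N" "floor_log i \<le> N"
  shows "dyadic j \<subseteq> dyadic i \<or> dyadic j \<inter> dyadic i = {}"
  using assms(2,3)
proof (induction N arbitrary: j)
  case 0
  then have "floor_log i = 0" by simp
  then have "i \<in> level 0" using assms(1) by (simp only: level_iff)
  then have "i = 1" by simp
  moreover have "j = 1" using 0 by simp
  ultimately show ?case by simp
next
  case (Suc N)
  show ?case
  proof (cases "floor_log i = Suc N")
    case True
    then have "i \<in> level (Suc N)" using assms(1) by (simp only: level_iff)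
    then show ?thesis
      using level_disjoint[of "Suc N"] Suc.prems(1) by (cases "i = j") (auto simp: disjoint_family_on_def)
  next
    case False
    have "2 * 1 \<le> 2 * (2::nat) ^ N" by (intro mult_left_mono) simp_all
    also have "\<dots> \<le> j" using Suc.prems(1) by simp
    finally have j: "2 \<le> j" by simp
    moreover have "j div 2 \<in> level N" using Suc.prems(1) by auto
    ultimately have j: "2 \<le> j" "j div 2 \<in> level N" by auto
    show ?thesis
      using Suc.IH[OF j(2)] dyadic_parent[OF j(1)] False Suc.prems(2) by auto
  qed
qed

text \<open>Levels grow with the heap index, so the interval with the larger index is never the
  coarser one.\<close>

lemma dyadic_nested_less:
  assumes "1 \<le> i" "i \<le> j"
  shows "dyadic j \<subseteq> dyadic i \<or> dyadic j \<inter> dyadic i = {}"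
  using assms by (intro dyadic_nested[of i j "floor_log j"]) (auto simp: level_iff floor_log_le_iff simp del: atLeastLessThan_iff)

lemma restr_unit [simp]: "restr {0..<1} u = u"
proof (rule restr_conull)
  show "{0..<1} \<in> sets unit_measure" by simp
  have "AE x in lebesgue. x \<noteq> (1::real)" by (rule AE_not_in[of "{1}", simplified]) simp
  then show "AE x in unit_measure. x \<in> {0..<1}"
    by (subst AE_restrict_space_iff) (auto elim: AE_mp)
qed

lemma ind_unit: "E \<in> sets unit_measure \<Longrightarrow> ind (E \<inter> {0..<1}) = ind E"
  using restr_ind[of "{0..<1}" E] by (simp add: Int_commute)

lemma ind_Union:
  assumes "finite I" "\<And>i. i \<in> I \<Longrightarrow> E i \<in> sets unit_measure" "disjoint_family_on E I"
  shows "ind (\<Union>i\<in>I. E i) = (\<Sum>i\<in>I. ind (E i))"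
  using assms
proof (induction I)
  case (insert i I)
  have "ind (E i \<union> (\<Union>i\<in>I. E i)) = ind (E i) + ind (\<Union>i\<in>I. E i)"
    using insert by (intro ind_Un sets.finite_UN) (auto simp: disjoint_family_on_def)
  then show ?case
    using insert by (simp add: disjoint_family_on_def)
qed simp

lemma pr_Union:
  assumes "1 \<le> p" "u \<in> vectors (Lp p)" "finite I" "\<And>i. i \<in> I \<Longrightarrow> E i \<in> sets unit_measure" "disjoint_family_on E I"
  shows "pr (\<Union>i\<in>I. E i) u = (\<Sum>i\<in>I. pr (E i) u)"
  using assms(3-)
proof (induction I)
  case (insert i I)
  have "pr (E i \<union> (\<Union>i\<in>I. E i)) u = pr (E i) u + pr (\<Union>i\<in>I. E i) u"
    using insert by (intro pr_Un[OF assms(1,2)] sets.finite_UN) (auto simp: disjoint_family_on_def)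
  then show ?case
    using insert by (simp add: disjoint_family_on_def)
qed (simp add: pr_def integ_scale[of 0 0, simplified])

lemma ind_diff:
  assumes "E \<in> sets unit_measure" "F \<in> sets unit_measure" "F \<subseteq> E"
  shows "ind E - ind F = ind (E - F)"
  using ind_Un[of F "E - F"] assms by (simp add: Un_absorb1)

lemma simple_function_fclass:
  assumes g: "simple_function unit_measure g"
  shows "abs_fclass g = (\<Sum>y\<in>g ` space unit_measure. y *\<^sub>C ind (g -` {y} \<inter> space unit_measure))"
proof -
  have ae: "ae_eq h h" if "h \<in> borel_measurable unit_measure" for h using that by (simp add: ae_eq_def)
  define A where "A = (\<lambda>y. g -` {y} \<inter> space unit_measure)"
  have A [measurable]: "A y \<in> sets unit_measure" for y
    unfolding A_def by (rule simple_functionD(2)[OF g])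
  have sum: "abs_fclass (\<lambda>x. \<Sum>y\<in>Y. y * indicator (A y) x) = (\<Sum>y\<in>Y. y *\<^sub>C ind (A y))" if "finite Y" for Y
    using that
  proof (induction Y)
    case empty
    show ?case by (simp add: zero_fclass_def)
  next
    case (insert y Y)
    have "ind (A y) = abs_fclass (indicator (A y))"
      by (simp add: ind.abs_eq ind_def)
    then have "y *\<^sub>C ind (A y) = abs_fclass (\<lambda>x. y * indicator (A y) x)"
      by (simp add: scaleC_fclass.abs_eq ae)
    moreover have "(\<lambda>x. \<Sum>y\<in>insert y Y. y * indicator (A y) x) = (\<lambda>x. y * indicator (A y) x + (\<Sum>y\<in>Y. y * indicator (A y) x))"
      by (rule ext) (rule sum.insert[OF insert.hyps])
    moreover have "ae_eq (\<lambda>x. y * indicator (A y) x) (\<lambda>x. y * indicator (A y) x)"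
      "ae_eq (\<lambda>x. \<Sum>y\<in>Y. y * indicator (A y) x) (\<lambda>x. \<Sum>y\<in>Y. y * indicator (A y) x)"
      by (rule ae, measurable)+
    ultimately show ?case
      unfolding sum.insert[OF insert.hyps] insert.IH[symmetric] by (simp only: plus_fclass.abs_eq)
  qed
  have eq: "g x = (\<Sum>y\<in>g ` space unit_measure. y * indicator (A y) x)" if "x \<in> space unit_measure" for x
  proof -
    have "(\<Sum>y\<in>g ` space unit_measure. y * indicator (A y) x) = (\<Sum>y\<in>g ` space unit_measure. if y = g x then y else 0)"
      using that by (intro sum.cong) (auto simp: A_def indicator_def)
    also have "\<dots> = g x"
      using that simple_functionD(1)[OF g] by simp
    finally show ?thesis by simp
  qed
  have "ae_eq g (\<lambda>x. \<Sum>y\<in>g ` space unit_measure. y * indicator (A y) x)"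
    unfolding ae_eq_def
  proof (intro conjI)
    show "g \<in> borel_measurable unit_measure" by (rule borel_measurable_simple_function[OF g])
    show "(\<lambda>x. \<Sum>y\<in>g ` space unit_measure. y * indicator (A y) x) \<in> borel_measurable unit_measure"
      by measurable
    show "AE x in unit_measure. g x = (\<Sum>y\<in>g ` space unit_measure. y * indicator (A y) x)"
      by (rule AE_I2) (rule eq)
  qed
  then have "abs_fclass g = abs_fclass (\<lambda>x. \<Sum>y\<in>g ` space unit_measure. y * indicator (A y) x)"
    by (rule Quotient3_rel_abs[OF Quotient3_fclass])
  also have "\<dots> = (\<Sum>y\<in>g ` space unit_measure. y *\<^sub>C ind (A y))"
    by (rule sum[OF simple_functionD(1)[OF g]])
  finally show ?thesis by (simp add: A_def)
qed

text \<open>Density of dyadic step functions in the form of an induction principle. Open sets are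
  exhausted from inside by dyadic intervals, measurable sets are approximated from outside by open
  sets, and general elements by simple functions.\<close>

lemma Lp_dyadic_induct:
  assumes p: "1 \<le> p" and S: "csubspace S" and dy: "\<And>j. 1 \<le> j \<Longrightarrow> ind (dyadic j) \<in> S"
    and closed: "\<And>u. u \<in> vectors (Lp p) \<Longrightarrow> (\<And>e. 0 < e \<Longrightarrow> \<exists>s\<in>S. s \<in> vectors (Lp p) \<and> p_norm p (u - s) < e) \<Longrightarrow> u \<in> S"
    and u: "u \<in> vectors (Lp p)"
  shows "u \<in> S"
proof -
  interpret finite_measure unit_measure by (rule finite_measure_unit)
  interpret Lp: seminormed "Lp p" by (rule seminormed_Lp[OF p])
  have small: "\<exists>d>0. \<forall>m. 0 \<le> m \<longrightarrow> m < d \<longrightarrow> m powr (1 / p) < e" if e: "e > 0" for e :: real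
  proof (intro exI[of _ "e powr p"] conjI allI impI)
    fix m :: real assume m: "0 \<le> m" "m < e powr p"
    then have "m powr (1 / p) < (e powr p) powr (1 / p)"
      using p by (intro powr_less_mono2) auto
    then show "m powr (1 / p) < e" using e p by (simp add: powr_powr)
  qed (use e in auto)
  \<comment> \<open>Approximation from inside or from outside makes the difference of the
    indicators, up to sign, the indicator of a set of small measure.\<close>
  have approx: "ind E \<in> S"
    if E: "E \<in> sets unit_measure" and F: "\<And>d. 0 < d \<Longrightarrow> \<exists>F. F \<in> sets unit_measure \<and> ind F \<in> S \<and> (F \<subseteq> E \<and> mu (E - F) < d \<or> E \<subseteq> F \<and> mu (F - E) < d)" for E
  proof (rule closed[OF ind_mem])
    fix e :: real assume "0 < e"
    then obtain d where d: "d > 0" "\<And>m. 0 \<le> m \<Longrightarrow> m < d \<Longrightarrow> m powr (1 / p) < e" using small by blast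
    obtain F where F: "F \<in> sets unit_measure" "ind F \<in> S" "F \<subseteq> E \<and> mu (E - F) < d \<or> E \<subseteq> F \<and> mu (F - E) < d"
      using F[OF d(1)] by auto
    have "p_norm p (ind E - ind F) < e"
      using F(3)
    proof
      assume h: "F \<subseteq> E \<and> mu (E - F) < d"
      then show ?thesis
        using ind_diff[OF E F(1)] p_norm_ind[OF p, of "E - F"] d(2)[of "mu (E - F)"] E F(1) by simp
    next
      assume h: "E \<subseteq> F \<and> mu (F - E) < d"
      have "p_norm p (ind E - ind F) = p_norm p (ind F - ind E)"
        using Lp.nrm_diff_commute[OF ind_mem ind_mem] by (simp add: nrm_Lp)
      then show ?thesis
        using h ind_diff[OF F(1) E] p_norm_ind[OF p, of "F - E"] d(2)[of "mu (F - E)"] E F(1) by simp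
    qed
    then show "\<exists>s\<in>S. s \<in> vectors (Lp p) \<and> p_norm p (ind E - s) < e"
      using F(2) ind_mem by blast
  qed
  have open_S: "ind (U \<inter> {0..<1}) \<in> S" if U: "open U" for U
  proof (rule approx)
    have Us: "U \<inter> {0..<1} \<in> sets unit_measure"
      using U by (intro interval_in_sets) auto
    show "U \<inter> {0..<1} \<in> sets unit_measure" by fact
    define L where "L = (\<lambda>N. {j \<in> level N. dyadic j \<subseteq> U})"
    define F where "F = (\<lambda>N. \<Union>j\<in>L N. dyadic j)"
    have Lfin: "finite (L N)" and Ls: "\<And>j. j \<in> L N \<Longrightarrow> 1 \<le> j" for N
      by (auto simp: L_def intro: order_trans[of 1 "2 ^ N"])
    have Fs: "F N \<in> sets unit_measure" for N
      unfolding F_def using Lfin Ls by (intro sets.finite_UN) auto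
    have "ind (F N) = (\<Sum>j\<in>L N. ind (dyadic j))" for N
      unfolding F_def using Lfin Ls level_disjoint[of N]
      by (intro ind_Union) (auto simp: L_def disjoint_family_on_def)
    then have FS: "ind (F N) \<in> S" for N
      using dy Ls by (auto intro!: complex_vector.subspace_sum[OF S])
    have "F N \<subseteq> F (Suc N)" for N
    proof
      fix x assume "x \<in> F N"
      then obtain j where j: "j \<in> level N" "dyadic j \<subseteq> U" "x \<in> dyadic j" by (auto simp: F_def L_def)
      have j1: "1 \<le> j" using j(1) by (auto intro: order_trans[of 1 "2 ^ N"])
      have "2 * j \<in> level (Suc N)" "2 * j + 1 \<in> level (Suc N)" using j(1) by auto
      moreover have "dyadic (2 * j) \<subseteq> U" "dyadic (2 * j + 1) \<subseteq> U" "x \<in> dyadic (2 * j) \<or> x \<in> dyadic (2 * j + 1)"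
        using dyadic_split(1)[OF j1] j(2,3) by auto
      ultimately have "\<exists>k. k \<in> L (Suc N) \<and> x \<in> dyadic k"
        by (simp only: L_def mem_Collect_eq) metis
      then show "x \<in> F (Suc N)"
        by (auto simp: F_def)
    qed
    then have inc: "incseq F" by (rule incseq_SucI)
    have Un: "(\<Union>N. F N) = U \<inter> {0..<1}"
    proof
      show "(\<Union>N. F N) \<subseteq> U \<inter> {0..<1}"
      proof
        fix x assume "x \<in> (\<Union>N. F N)"
        then obtain N j where j: "j \<in> L N" "x \<in> dyadic j" by (auto simp: F_def)
        then have "x \<in> U" by (auto simp: L_def)
        then show "x \<in> U \<inter> {0..<1}"
          using dyadic_bounds[OF Ls[OF j(1)]] j(2) by auto
      qed
      show "U \<inter> {0..<1} \<subseteq> (\<Union>N. F N)"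
      proof
        fix x assume x: "x \<in> U \<inter> {0..<1}"
        then obtain r where r: "r > 0" "ball x r \<subseteq> U" using U by (auto simp: open_contains_ball)
        obtain N where N: "(1 / 2) ^ N < r" using real_arch_pow_inv[OF r(1), of "1 / 2"] by auto
        obtain j where j: "j \<in> level N" "x \<in> dyadic j" using level_Union[of N] x by blast
        have "floor_log j = N" using j(1) by (simp only: level_iff)
        then have "dyadic j \<subseteq> ball x r"
          using j(2) N unfolding dyadic_def by (auto simp: dist_real_def power_one_over add_divide_distrib)
        then have "j \<in> L N" using j(1) r(2) by (simp only: L_def mem_Collect_eq) simp
        then show "x \<in> (\<Union>N. F N)" using j(2) by (auto simp: F_def)
      qed
    qed
    fix d :: real assume d: "0 < d"
    have "(\<lambda>N. mu (F N)) \<longlonglongrightarrow> mu (U \<inter> {0..<1})"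
      using finite_Lim_measure_incseq[OF _ inc] Fs Un by auto
    then obtain N where "\<bar>mu (F N) - mu (U \<inter> {0..<1})\<bar> < d"
      using d by (auto simp: LIMSEQ_iff)
    moreover have sub: "F N \<subseteq> U \<inter> {0..<1}" using Un by blast
    ultimately have "mu (U \<inter> {0..<1} - F N) < d"
      using finite_measure_Diff[OF Us Fs sub] by simp
    then show "\<exists>F. F \<in> sets unit_measure \<and> ind F \<in> S \<and> (F \<subseteq> U \<inter> {0..<1} \<and> mu (U \<inter> {0..<1} - F) < d \<or> U \<inter> {0..<1} \<subseteq> F \<and> mu (F - U \<inter> {0..<1}) < d)"
      using Fs FS sub by blast
  qed
  have ind_S: "ind E \<in> S" if E: "E \<in> sets unit_measure" for E
  proof -
    have El: "E \<in> sets lebesgue" using E by (auto simp: sets_restrict_space_iff)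
    have Es: "E \<inter> {0..<1} \<in> sets unit_measure"
      using E by (intro sets.Int) simp_all
    have "ind (E \<inter> {0..<1}) \<in> S"
    proof (rule approx[OF Es])
      fix d :: real assume d: "0 < d"
      obtain T where T: "open T" "E \<subseteq> T" "T - E \<in> lmeasurable" "emeasure lebesgue (T - E) < ennreal d"
        using sets_lebesgue_outer_open[OF El d] .
      have Ts: "T \<inter> {0..<1} \<in> sets unit_measure"
        using T by (intro interval_in_sets) auto
      have "mu (T \<inter> {0..<1} - E \<inter> {0..<1}) = measure lebesgue (T \<inter> {0..<1} - E \<inter> {0..<1})"
        by (rule mu_eq) auto
      also have "\<dots> \<le> measure lebesgue (T - E)"
      proof (rule measure_mono_fmeasurable[OF _ _ T(3)])
        show "T \<inter> {0..<1} - E \<inter> {0..<1} \<in> sets lebesgue"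
          using T(1) El by (intro sets.Diff sets.Int) (auto intro: borel_open sets_completionI_sets)
      qed auto
      also have "\<dots> < d"
        using T(3,4) d by (simp add: emeasure_eq_measure2 ennreal_less_iff)
      finally show "\<exists>F. F \<in> sets unit_measure \<and> ind F \<in> S \<and> (F \<subseteq> E \<inter> {0..<1} \<and> mu (E \<inter> {0..<1} - F) < d \<or> E \<inter> {0..<1} \<subseteq> F \<and> mu (F - E \<inter> {0..<1}) < d)"
        using Ts open_S[OF T(1)] T(2) by (intro exI[of _ "T \<inter> {0..<1}"]) auto
    qed
    then show ?thesis by (simp add: ind_unit[OF E])
  qed
  have ae: "ae_eq h h" if "h \<in> borel_measurable unit_measure" for h using that by (simp add: ae_eq_def)
  obtain f where f [measurable]: "f \<in> borel_measurable unit_measure" and uf: "u = abs_fclass f"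
    by (rule fclass_rep)
  have fint: "integrable unit_measure (\<lambda>x. cmod (f x) powr p)"
    using u unfolding uf vectors_Lp p_integrable.abs_eq[OF ae[OF f]] .
  obtain s where s: "\<And>i. simple_function unit_measure (s i)"
    "\<And>x. x \<in> space unit_measure \<Longrightarrow> (\<lambda>i. s i x) \<longlonglongrightarrow> f x"
    "\<And>i x. x \<in> space unit_measure \<Longrightarrow> dist (s i x) 0 \<le> 2 * dist (f x) 0"
    using borel_measurable_implies_sequence_metric[OF f, of 0] by blast
  have [measurable]: "s i \<in> borel_measurable unit_measure" for i
    by (rule borel_measurable_simple_function[OF s(1)])
  have sS: "abs_fclass (s i) \<in> S" for i
    unfolding simple_function_fclass[OF s(1)]
    by (intro complex_vector.subspace_sum[OF S] complex_vector.subspace_scale[OF S] ind_S simple_functionD(2)[OF s(1)])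
  have sLp: "abs_fclass (s i) \<in> vectors (Lp p)" for i
    unfolding simple_function_fclass[OF s(1)]
    by (intro Lp.sum_mem Lp.scale_mem ind_mem)
  have "(\<lambda>i. LINT x|unit_measure. cmod (f x - s i x) powr p) \<longlonglongrightarrow> (LINT x|unit_measure. 0)"
  proof (rule integral_dominated_convergence)
    \<comment> \<open>The simple functions are bounded by twice the modulus of \<open>f\<close>,
      hence the differences by three times that modulus.\<close>
    show "integrable unit_measure (\<lambda>x. 3 powr p * cmod (f x) powr p)"
      using fint by simp
    show "AE x in unit_measure. (\<lambda>i. cmod (f x - s i x) powr p) \<longlonglongrightarrow> 0"
    proof (rule AE_I2)
      fix x assume x: "x \<in> space unit_measure"
      have "(\<lambda>i. cmod (f x - s i x) powr p) \<longlonglongrightarrow> cmod (f x - f x) powr p"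
        using s(2)[OF x] p by (intro tendsto_powr2 tendsto_intros) auto
      then show "(\<lambda>i. cmod (f x - s i x) powr p) \<longlonglongrightarrow> 0" by simp
    qed
    show "AE x in unit_measure. norm (cmod (f x - s i x) powr p) \<le> 3 powr p * cmod (f x) powr p" for i
    proof (rule AE_I2)
      fix x assume x: "x \<in> space unit_measure"
      have "cmod (f x - s i x) \<le> 3 * cmod (f x)"
        using norm_triangle_ineq4[of "f x" "s i x"] s(3)[OF x, of i] by simp
      then have "cmod (f x - s i x) powr p \<le> (3 * cmod (f x)) powr p"
        using p by (intro powr_mono2) auto
      then show "norm (cmod (f x - s i x) powr p) \<le> 3 powr p * cmod (f x) powr p"
        by (simp add: powr_mult)
    qed
  qed simp_all
  then have lim: "(\<lambda>i. LINT x|unit_measure. cmod (f x - s i x) powr p) \<longlonglongrightarrow> 0" by simp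
  show ?thesis
  proof (rule closed[OF u])
    fix e :: real assume "0 < e"
    then obtain d where d: "d > 0" "\<And>m. 0 \<le> m \<Longrightarrow> m < d \<Longrightarrow> m powr (1 / p) < e" using small by blast
    have "\<forall>\<^sub>F i in sequentially. (LINT x|unit_measure. cmod (f x - s i x) powr p) < d"
      by (rule order_tendstoD(2)[OF lim d(1)])
    then obtain i where "(LINT x|unit_measure. cmod (f x - s i x) powr p) < d"
      by (auto simp: eventually_sequentially)
    then have "(LINT x|unit_measure. cmod (f x - s i x) powr p) powr (1 / p) < e"
      by (intro d(2)) auto
    then have "p_norm p (u - abs_fclass (s i)) < e"
      by (simp add: uf minus_fclass.abs_eq p_norm.abs_eq ae)
    then show "\<exists>s\<in>S. s \<in> vectors (Lp p) \<and> p_norm p (u - s) < e"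
      using sS sLp by blast
  qed
qed

section \<open>Convergence in a seminormed space\<close>

definition converges_in :: "'a::complex_vector cnspace \<Rightarrow> (nat \<Rightarrow> 'a) \<Rightarrow> 'a \<Rightarrow> bool"
  where "converges_in X x v \<longleftrightarrow> (\<lambda>k. nrm X (x k - v)) \<longlonglongrightarrow> 0"

context seminormed
begin

lemma converges_in_const: "eventually (\<lambda>k. x k = v) sequentially \<Longrightarrow> converges_in X x v"
  unfolding converges_in_def by (rule tendsto_eventually) (auto elim!: eventually_mono simp: nrm_zero)

lemma converges_in_add:
  assumes "converges_in X x v" "converges_in X y w" "\<And>k. x k \<in> vectors X" "\<And>k. y k \<in> vectors X"
    "v \<in> vectors X" "w \<in> vectors X"
  shows "converges_in X (\<lambda>k. x k + y k) (v + w)"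
  unfolding converges_in_def
proof (rule tendsto_sandwich[OF _ _ tendsto_const])
  show "(\<lambda>k. nrm X (x k - v) + nrm X (y k - w)) \<longlonglongrightarrow> 0"
    using tendsto_add[OF assms(1,2)[unfolded converges_in_def]] by simp
  show "\<forall>\<^sub>F k in sequentially. 0 \<le> nrm X (x k + y k - (v + w))"
    by (intro always_eventually allI nrm_nonneg diff_mem add_mem assms)
  have eq: "x k + y k - (v + w) = (x k - v) + (y k - w)" for k by simp
  show "\<forall>\<^sub>F k in sequentially. nrm X (x k + y k - (v + w)) \<le> nrm X (x k - v) + nrm X (y k - w)"
    unfolding eq by (intro always_eventually allI nrm_add diff_mem assms)
qed

lemma converges_in_scale:
  assumes "converges_in X x v" "\<And>k. x k \<in> vectors X" "v \<in> vectors X"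
  shows "converges_in X (\<lambda>k. c *\<^sub>C x k) (c *\<^sub>C v)"
proof -
  have "nrm X (c *\<^sub>C x k - c *\<^sub>C v) = cmod c * nrm X (x k - v)" for k
    using nrm_scaleC[OF diff_mem[OF assms(2,3)]] by (simp add: complex_vector.scale_right_diff_distrib)
  then show ?thesis
    using tendsto_mult_left[OF assms(1)[unfolded converges_in_def], of "cmod c"] by (simp add: converges_in_def)
qed

lemma nrm_limit_le:
  assumes "converges_in X x v" "\<And>k. x k \<in> vectors X" "v \<in> vectors X" "eventually (\<lambda>k. nrm X (x k) \<le> C) sequentially"
  shows "nrm X v \<le> C"
proof (rule tendsto_lowerbound)
  show "(\<lambda>k. nrm X (x k - v) + C) \<longlonglongrightarrow> C"
    using tendsto_add[OF assms(1)[unfolded converges_in_def] tendsto_const[of C]] by simp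
  show "\<forall>\<^sub>F k in sequentially. nrm X v \<le> nrm X (x k - v) + C"
    using assms(4)
  proof eventually_elim
    case (elim k)
    then show ?case
      using nrm_diff[OF assms(2)[of k] diff_mem[OF assms(2)[of k] assms(3)]] by simp
  qed
qed simp

lemma converges_in_unique:
  assumes "converges_in X x v" "converges_in X x w" "\<And>k. x k \<in> vectors X" "v \<in> vectors X" "w \<in> vectors X"
  shows "nrm X (v - w) = 0"
proof -
  have "converges_in X (\<lambda>k. x k + (- 1) *\<^sub>C x k) (v + (- 1) *\<^sub>C w)"
    by (intro converges_in_add converges_in_scale assms scale_mem)
  then have c: "converges_in X (\<lambda>k. 0) (v - w)" by simp
  have "nrm X (v - w) \<le> 0"
    by (rule nrm_limit_le[OF c zero_mem diff_mem[OF assms(4,5)]]) (simp add: nrm_zero)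
  then show ?thesis
    using nrm_nonneg[OF diff_mem[OF assms(4,5)]] by simp
qed

end

lemma converges_in_op:
  assumes "seminormed X" "seminormed Y" "T \<in> vectors (bounded_ops X Y)"
    and "converges_in X x v" "\<And>k. x k \<in> vectors X" "v \<in> vectors X"
  shows "converges_in Y (\<lambda>k. T (x k)) (T v)"
proof -
  interpret X: seminormed X by fact
  interpret Y: seminormed Y by fact
  show ?thesis
    unfolding converges_in_def
  proof (rule tendsto_sandwich[OF _ _ tendsto_const])
    show "(\<lambda>k. nrm (bounded_ops X Y) T * nrm X (x k - v)) \<longlonglongrightarrow> 0"
      using tendsto_mult_left[OF assms(4)[unfolded converges_in_def], of "nrm (bounded_ops X Y) T"] by simp
    show "\<forall>\<^sub>F k in sequentially. 0 \<le> nrm Y (T (x k) - T v)"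
      by (intro always_eventually allI Y.nrm_nonneg Y.diff_mem op_maps[OF assms(3)] assms)
    show "\<forall>\<^sub>F k in sequentially. nrm Y (T (x k) - T v) \<le> nrm (bounded_ops X Y) T * nrm X (x k - v)"
      using op_bound[OF assms(1-3) X.diff_mem[OF assms(5,6)]] op_diff[OF assms(1-3) assms(5,6)] by simp
  qed
qed

definition restr_op :: "real \<Rightarrow> real set \<Rightarrow> fclass \<Rightarrow> fclass"
  where "restr_op p E u = (if u \<in> vectors (Lp p) then restr E u else 0)"

definition rank_one :: "real \<Rightarrow> real set \<Rightarrow> fclass \<Rightarrow> fclass \<Rightarrow> fclass"
  where "rank_one p E y u = (if u \<in> vectors (Lp p) then pr E u *\<^sub>C y else 0)"

text \<open>Takes the mean of \<open>u\<close> over each \<open>E i\<close> and transplants it to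
  \<open>F i\<close> with weight \<open>c i\<close>. For a partition with \<open>E = F\<close> and
  weights 1 it is a conditional expectation.\<close>

definition averaging :: "real \<Rightarrow> nat set \<Rightarrow> (nat \<Rightarrow> complex) \<Rightarrow> (nat \<Rightarrow> real set) \<Rightarrow> (nat \<Rightarrow> real set) \<Rightarrow> fclass \<Rightarrow> fclass"
  where "averaging p I c E F u = (if u \<in> vectors (Lp p) then \<Sum>i\<in>I. (c i * pr (E i) u / of_real (mu (E i))) *\<^sub>C ind (F i) else 0)"

definition halving_tree :: "(nat \<Rightarrow> real set) \<Rightarrow> bool"
  where "halving_tree A \<longleftrightarrow> A 1 = dyadic 1 \<and> (\<forall>j\<ge>1. A j \<in> sets unit_measure \<and> mu (A j) = mu (dyadic j) \<and>
    A (2 * j) \<union> A (2 * j + 1) = A j \<and> A (2 * j) \<inter> A (2 * j + 1) = {})"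

text \<open>The second clause says that from split \<open>m\<close> on, each split halves the trace
  of its node on \<open>dyadic m\<close>. Averages of the indicator of \<open>dyadic m\<close> over
  the leaves then stop changing, which is what lets the averaging operators converge.\<close>

definition balanced_tree :: "(nat \<Rightarrow> real set) \<Rightarrow> bool"
  where "balanced_tree A \<longleftrightarrow> halving_tree A \<and>
    (\<forall>m\<ge>1. \<forall>k\<ge>m. mu (A (2 * k) \<inter> dyadic m) = mu (A (2 * k + 1) \<inter> dyadic m))"

lemma halving_treeD:
  assumes "halving_tree A"
  shows "A 1 = {0..<1}" "1 \<le> j \<Longrightarrow> A j \<in> sets unit_measure" "1 \<le> j \<Longrightarrow> mu (A j) = mu (dyadic j)"
    "1 \<le> j \<Longrightarrow> A (2 * j) \<union> A (2 * j + 1) = A j" "1 \<le> j \<Longrightarrow> A (2 * j) \<inter> A (2 * j + 1) = {}"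
  using assms by (auto simp: halving_tree_def dyadic_1[simplified])

text \<open>After the nodes \<open>1, \<dots>, k - 1\<close> have been split, the leaves are \<open>k, \<dots>, 2k - 1\<close>.\<close>

lemma sum_leaves_step:
  fixes f :: "nat \<Rightarrow> 'a::ab_group_add"
  assumes "1 \<le> k"
  shows "sum f {Suc k..<2 * Suc k} = sum f {k..<2 * k} + (f (2 * k) + f (2 * k + 1) - f k)"
proof -
  have "sum f {k..<2 * Suc k} = sum f {k..<2 * k} + f (2 * k) + f (2 * k + 1)"
    by simp
  moreover have "sum f {k..<2 * Suc k} = f k + sum f {Suc k..<2 * Suc k}"
    by (rule sum.atLeast_Suc_lessThan) simp
  ultimately show ?thesis by (simp add: algebra_simps)
qed

lemma halving_tree_leaves:
  assumes A: "halving_tree A" and "1 \<le> k"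
  shows "disjoint_family_on A {k..<2 * k}" "(\<Union>j\<in>{k..<2 * k}. A j) = {0..<1}"
proof -
  note D = halving_treeD[OF A]
  have "disjoint_family_on A {k..<2 * k} \<and> (\<Union>j\<in>{k..<2 * k}. A j) = {0..<1}"
    using assms(2)
  proof (induction k rule: dec_induct)
    case base
    have "{1..<2 * 1::nat} = {1}" by auto
    then show ?case using D(1) by (simp add: disjoint_family_on_def)
  next
    case (step k)
    have split: "A (2 * k) \<union> A (2 * k + 1) = A k" "A (2 * k) \<inter> A (2 * k + 1) = {}"
      using D(4,5) step by auto
    define R where "R = {Suc k..<2 * k}"
    have R: "{k..<2 * k} = insert k R" "k \<notin> R" "{Suc k..<2 * Suc k} = insert (2 * k) (insert (2 * k + 1) R)"
      "2 * k \<notin> R" "2 * k + 1 \<notin> R"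
      using step by (auto simp: R_def)
    have dR: "disjoint_family_on A R" and dk: "A k \<inter> (\<Union>j\<in>R. A j) = {}"
      using step.IH R(1,2) by (auto simp: disjoint_family_on_def)
    have Un: "(\<Union>j\<in>{Suc k..<2 * Suc k}. A j) = (\<Union>j\<in>{k..<2 * k}. A j)"
      unfolding R using split(1) by auto
    have "A (2 * k) \<inter> (\<Union>j\<in>R. A j) = {}" "A (2 * k + 1) \<inter> (\<Union>j\<in>R. A j) = {}"
      using dk split(1) by auto
    then have "disjoint_family_on A {Suc k..<2 * Suc k}"
      unfolding R(3) using dR split(2) R(4,5) by (auto simp: disjoint_family_on_insert)
    then show ?case using Un step.IH by simp
  qed
  then show "disjoint_family_on A {k..<2 * k}" "(\<Union>j\<in>{k..<2 * k}. A j) = {0..<1}" by auto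
qed

lemma halving_tree_dyadic: "halving_tree dyadic"
  using dyadic_split by (auto simp: halving_tree_def simp del: One_nat_def)

lemma balanced_tree_dyadic: "balanced_tree dyadic"
  unfolding balanced_tree_def
proof (intro conjI halving_tree_dyadic allI impI)
  fix m k :: nat assume m: "1 \<le> m" and k: "m \<le> k"
  have sub: "dyadic (2 * k) \<subseteq> dyadic k" "dyadic (2 * k + 1) \<subseteq> dyadic k"
    using dyadic_split(1)[of k] m k by auto
  have eq: "mu (dyadic (2 * k)) = mu (dyadic (2 * k + 1))"
    using m k floor_log_double[of k] by (simp add: mu_dyadic)
  show "mu (dyadic (2 * k) \<inter> dyadic m) = mu (dyadic (2 * k + 1) \<inter> dyadic m)"
    using dyadic_nested_less[OF m k]
  proof
    assume "dyadic k \<subseteq> dyadic m"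
    then show ?thesis using sub eq by (simp add: Int_absorb2 order_trans[of _ "dyadic k"])
  next
    assume "dyadic k \<inter> dyadic m = {}"
    then have "dyadic (2 * k) \<inter> dyadic m = {}" "dyadic (2 * k + 1) \<inter> dyadic m = {}"
      using sub by blast+
    then show ?thesis by simp
  qed
qed

lemma p_norm_nonneg: "0 \<le> p_norm p u"
  by transfer simp

section \<open>Operators on L_p defined by trees of sets\<close>

context
  fixes p :: real
  assumes p: "1 < p"
begin

lemma p1: "1 \<le> p" using p by simp

interpretation Lp: seminormed "Lp p" by (rule seminormed_Lp[OF p1])

lemma sLp: "seminormed (Lp p)" by (rule seminormed_Lp[OF p1])

interpretation Y: seminormed "operators (Lp p)" by (rule seminormed_bounded_ops[OF sLp sLp])

lemma Lp_eqI:
  assumes "u \<in> vectors (Lp p)" "v \<in> vectors (Lp p)" "nrm (Lp p) (u - v) = 0"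
  shows "u = v"
  using Lp_definite[OF p1 Lp.diff_mem[OF assms(1,2)]] assms(3) by (simp add: nrm_Lp)

text \<open>The vectors on which two operators agree form a closed subspace, so density of dyadic
  step functions applies.\<close>

lemma Lp_op_eqI:
  assumes T: "T \<in> vectors (operators (Lp p))" and S: "S \<in> vectors (operators (Lp p))"
    and eq: "\<And>j. 1 \<le> j \<Longrightarrow> T (ind (dyadic j)) = S (ind (dyadic j))"
  shows "T = S"
proof (rule op_eqI[OF T S])
  define D where "D = {u \<in> vectors (Lp p). T u = S u}"
  have "csubspace D"
    unfolding complex_vector.subspace_def D_def
    by (auto simp: Lp.zero_mem Lp.add_mem Lp.scale_mem op_zero[OF sLp sLp T] op_zero[OF sLp sLp S]
        op_add[OF T] op_add[OF S] op_scale[OF T] op_scale[OF S])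
  moreover have "u \<in> D"
    if u: "u \<in> vectors (Lp p)" and ap: "\<And>e. 0 < e \<Longrightarrow> \<exists>s\<in>D. s \<in> vectors (Lp p) \<and> p_norm p (u - s) < e" for u
  proof -
    define b where "b = nrm (operators (Lp p)) (T - S)"
    have TS: "T - S \<in> vectors (operators (Lp p))" by (rule Y.diff_mem[OF T S])
    have b: "0 \<le> b" unfolding b_def by (rule Y.nrm_nonneg[OF TS])
    have "nrm (Lp p) (T u - S u) \<le> 0 + e" if e: "e > 0" for e
    proof -
      obtain s where s: "s \<in> D" "s \<in> vectors (Lp p)" "p_norm p (u - s) < e / (b + 1)"
        using ap[of "e / (b + 1)"] e b by auto
      have "T u - S u = (T - S) (u - s)"
        using s(1) u s(2) by (simp add: D_def op_diff[OF sLp sLp T] op_diff[OF sLp sLp S])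
      then have "nrm (Lp p) (T u - S u) \<le> b * p_norm p (u - s)"
        using op_bound[OF sLp sLp TS Lp.diff_mem[OF u s(2)]] by (simp add: b_def nrm_Lp)
      also have "\<dots> \<le> b * (e / (b + 1))"
        using s(3) b by (intro mult_left_mono) auto
      also have "\<dots> \<le> e" using b e by (simp add: field_simps)
      finally show ?thesis by simp
    qed
    then have "nrm (Lp p) (T u - S u) \<le> 0" by (rule field_le_epsilon)
    then have "nrm (Lp p) (T u - S u) = 0"
      using Lp.nrm_nonneg[OF Lp.diff_mem[OF op_maps[OF T u] op_maps[OF S u]]] by simp
    then show "u \<in> D"
      using Lp_eqI[OF op_maps[OF T u] op_maps[OF S u]] u by (simp add: D_def)
  qed
  ultimately show "T u = S u" if "u \<in> vectors (Lp p)" for u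
    using Lp_dyadic_induct[OF p1, of D u] that eq ind_mem by (auto simp: D_def)
qed

text \<open>The uniform bound makes the vectors with Cauchy images a closed subspace, stability puts
  the dyadic indicators into it, and completeness supplies the limits.\<close>

lemma operator_limit:
  assumes T: "\<And>k. T k \<in> vectors (operators (Lp p))"
    and C: "\<And>k u. u \<in> vectors (Lp p) \<Longrightarrow> p_norm p (T k u) \<le> C * p_norm p u"
    and st: "\<And>j. 1 \<le> j \<Longrightarrow> \<exists>K. \<forall>k\<ge>K. T k (ind (dyadic j)) = T K (ind (dyadic j))"
  shows "\<exists>L\<in>vectors (operators (Lp p)). \<forall>u\<in>vectors (Lp p). converges_in (Lp p) (\<lambda>k. T k u) (L u)"
proof -
  define D where "D = {u \<in> vectors (Lp p). \<forall>e>0. \<exists>N. \<forall>m\<ge>N. \<forall>n\<ge>N. p_norm p (T m u - T n u) < e}"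
  have tri: "p_norm p (x + y) \<le> p_norm p x + p_norm p y" if "x \<in> vectors (Lp p)" "y \<in> vectors (Lp p)" for x y
    using Lp.nrm_add[OF that] by (simp add: nrm_Lp)
  have mem: "T m u - T n u \<in> vectors (Lp p)" if "u \<in> vectors (Lp p)" for m n u
    by (intro Lp.diff_mem op_maps[OF T] that)
  have "csubspace D"
    unfolding complex_vector.subspace_def
  proof (intro conjI ballI allI)
    show "0 \<in> D"
      using Lp.nrm_zero by (simp add: D_def Lp.zero_mem op_zero[OF sLp sLp T] nrm_Lp)
    fix u v assume u: "u \<in> D" and v: "v \<in> D"
    have uv: "u \<in> vectors (Lp p)" "v \<in> vectors (Lp p)" using u v by (auto simp: D_def)
    have "\<exists>N. \<forall>m\<ge>N. \<forall>n\<ge>N. p_norm p (T m (u + v) - T n (u + v)) < e" if e: "e > 0" for e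
    proof -
      obtain N where N: "\<And>m n. m \<ge> N \<Longrightarrow> n \<ge> N \<Longrightarrow> p_norm p (T m u - T n u) < e / 2"
        using u half_gt_zero[OF e] unfolding D_def by blast
      obtain N' where N': "\<And>m n. m \<ge> N' \<Longrightarrow> n \<ge> N' \<Longrightarrow> p_norm p (T m v - T n v) < e / 2"
        using v half_gt_zero[OF e] unfolding D_def by blast
      have "p_norm p (T m (u + v) - T n (u + v)) < e" if mn: "m \<ge> max N N'" "n \<ge> max N N'" for m n
      proof -
        have "T m (u + v) - T n (u + v) = (T m u - T n u) + (T m v - T n v)"
          by (simp add: op_add[OF T uv])
        then show ?thesis
          using tri[OF mem[OF uv(1), of m n] mem[OF uv(2), of m n]] N[of m n] N'[of m n] mn by simp
      qed
      then show ?thesis by blast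
    qed
    then show "u + v \<in> D" using uv by (simp add: D_def Lp.add_mem)
  next
    fix c u assume u: "u \<in> D"
    then have uv: "u \<in> vectors (Lp p)" by (simp add: D_def)
    have "\<exists>N. \<forall>m\<ge>N. \<forall>n\<ge>N. p_norm p (T m (c *\<^sub>C u) - T n (c *\<^sub>C u)) < e" if e: "e > 0" for e
    proof -
      have "e / (cmod c + 1) > 0" using e by (simp add: add_nonneg_pos)
      then obtain N where N: "\<And>m n. m \<ge> N \<Longrightarrow> n \<ge> N \<Longrightarrow> p_norm p (T m u - T n u) < e / (cmod c + 1)"
        using u unfolding D_def by blast
      have "p_norm p (T m (c *\<^sub>C u) - T n (c *\<^sub>C u)) < e" if mn: "m \<ge> N" "n \<ge> N" for m n
      proof -
        have "T m (c *\<^sub>C u) - T n (c *\<^sub>C u) = c *\<^sub>C (T m u - T n u)"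
          by (simp add: op_scale[OF T uv] complex_vector.scale_right_diff_distrib)
        then have "p_norm p (T m (c *\<^sub>C u) - T n (c *\<^sub>C u)) = cmod c * p_norm p (T m u - T n u)"
          using Lp.nrm_scaleC[OF mem[OF uv], of c m n] by (simp add: nrm_Lp)
        also have "\<dots> \<le> cmod c * (e / (cmod c + 1))"
          using N[OF mn] by (intro mult_left_mono) auto
        also have "\<dots> < e"
          using e by (simp add: field_simps add_pos_nonneg)
        finally show ?thesis .
      qed
      then show ?thesis by blast
    qed
    then show "c *\<^sub>C u \<in> D" using uv by (simp add: D_def Lp.scale_mem)
  qed
  moreover have "ind (dyadic j) \<in> D" if j: "1 \<le> j" for j
  proof -
    obtain K where K: "\<forall>k\<ge>K. T k (ind (dyadic j)) = T K (ind (dyadic j))" using st[OF j] by auto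
    have z: "p_norm p (T m (ind (dyadic j)) - T n (ind (dyadic j))) = 0" if "m \<ge> K" "n \<ge> K" for m n
    proof -
      have "T m (ind (dyadic j)) = T K (ind (dyadic j))" "T n (ind (dyadic j)) = T K (ind (dyadic j))"
        using K that by blast+
      then show ?thesis using Lp.nrm_zero by (simp only: diff_self nrm_Lp)
    qed
    have "\<exists>N. \<forall>m\<ge>N. \<forall>n\<ge>N. p_norm p (T m (ind (dyadic j)) - T n (ind (dyadic j))) < e" if "e > 0" for e
      by (intro exI[of _ K] allI impI) (use z that in \<open>simp only:\<close>)
    then show ?thesis
      unfolding D_def by (simp only: mem_Collect_eq ind_mem simp_thms) blast
  qed
  moreover have "u \<in> D"
    if u: "u \<in> vectors (Lp p)" and ap: "\<And>e. 0 < e \<Longrightarrow> \<exists>s\<in>D. s \<in> vectors (Lp p) \<and> p_norm p (u - s) < e" for u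
  proof -
    have "\<exists>N. \<forall>m\<ge>N. \<forall>n\<ge>N. p_norm p (T m u - T n u) < e" if e: "e > 0" for e
    proof -
      define d where "d = e / (3 * (\<bar>C\<bar> + 1))"
      have d: "d > 0" "\<bar>C\<bar> * d < e / 3" using e by (auto simp: d_def field_simps add_pos_nonneg)
      obtain s where s: "s \<in> D" "s \<in> vectors (Lp p)" "p_norm p (u - s) < d" using ap[OF d(1)] by auto
      have us: "u - s \<in> vectors (Lp p)" by (rule Lp.diff_mem[OF u s(2)])
      have small: "p_norm p (T m (u - s)) < e / 3" for m
      proof -
        have "p_norm p (T m (u - s)) \<le> C * p_norm p (u - s)" by (rule C[OF us])
        also have "\<dots> \<le> \<bar>C\<bar> * d"
          using s(3) p_norm_nonneg[of p "u - s"] by (intro mult_mono) auto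
        finally show ?thesis using d(2) by simp
      qed
      have e3: "e / 3 > 0" using e by simp
      obtain N where N: "\<And>m n. m \<ge> N \<Longrightarrow> n \<ge> N \<Longrightarrow> p_norm p (T m s - T n s) < e / 3"
        using s(1) e3 unfolding D_def by blast
      have "p_norm p (T m u - T n u) < e" if mn: "m \<ge> N" "n \<ge> N" for m n
      proof -
        have Tm: "T m (u - s) \<in> vectors (Lp p)" for m by (rule op_maps[OF T us])
        have "T m u - T n u = (T m (u - s) + (T m s - T n s)) - T n (u - s)"
          by (simp add: op_diff[OF sLp sLp T u s(2)])
        then have "p_norm p (T m u - T n u) \<le> (p_norm p (T m (u - s)) + p_norm p (T m s - T n s)) + p_norm p (T n (u - s))"
          using Lp.nrm_diff[OF Lp.add_mem[OF Tm mem[OF s(2)]] Tm, of m m n n] tri[OF Tm[of m] mem[OF s(2), of m n]]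
          by (simp add: nrm_Lp)
        then show ?thesis using small[of m] small[of n] N[OF mn] by simp
      qed
      then show ?thesis by blast
    qed
    then show ?thesis using u by (simp add: D_def)
  qed
  ultimately have D: "u \<in> D" if "u \<in> vectors (Lp p)" for u
    using Lp_dyadic_induct[OF p1, of D u] that by blast
  have "\<exists>v\<in>vectors (Lp p). converges_in (Lp p) (\<lambda>k. T k u) v" if u: "u \<in> vectors (Lp p)" for u
    unfolding converges_in_def nrm_Lp using D[OF u] by (intro Lp_complete[OF p] op_maps[OF T u]) (simp add: D_def)
  then obtain L0 where L0: "\<And>u. u \<in> vectors (Lp p) \<Longrightarrow> L0 u \<in> vectors (Lp p)"
    "\<And>u. u \<in> vectors (Lp p) \<Longrightarrow> converges_in (Lp p) (\<lambda>k. T k u) (L0 u)"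
    by metis
  define L where "L = (\<lambda>u. if u \<in> vectors (Lp p) then L0 u else 0)"
  have "L \<in> vectors (operators (Lp p))"
  proof (rule opI[OF sLp sLp])
    show "L u \<in> vectors (Lp p)" if "u \<in> vectors (Lp p)" for u using that L0(1) by (simp add: L_def)
    show "L u = 0" if "u \<notin> vectors (Lp p)" for u using that by (simp add: L_def)
    fix u v assume u: "u \<in> vectors (Lp p)" and v: "v \<in> vectors (Lp p)"
    have "converges_in (Lp p) (\<lambda>k. T k (u + v)) (L0 u + L0 v)"
      unfolding op_add[OF T u v] by (intro Lp.converges_in_add L0 u v op_maps[OF T])
    then have "nrm (Lp p) (L0 (u + v) - (L0 u + L0 v)) = 0"
      using u v by (intro Lp.converges_in_unique[OF L0(2)] op_maps[OF T] Lp.add_mem L0(1))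
    then show "L (u + v) = L u + L v"
      using u v Lp_eqI[of "L0 (u + v)" "L0 u + L0 v"] by (simp add: L_def Lp.add_mem L0(1))
  next
    fix c u assume u: "u \<in> vectors (Lp p)"
    have "converges_in (Lp p) (\<lambda>k. T k (c *\<^sub>C u)) (c *\<^sub>C L0 u)"
      unfolding op_scale[OF T u] by (intro Lp.converges_in_scale L0 u op_maps[OF T])
    then have "nrm (Lp p) (L0 (c *\<^sub>C u) - c *\<^sub>C L0 u) = 0"
      using u by (intro Lp.converges_in_unique[OF L0(2)] op_maps[OF T] Lp.scale_mem L0(1))
    then show "L (c *\<^sub>C u) = c *\<^sub>C L u"
      using u Lp_eqI[of "L0 (c *\<^sub>C u)" "c *\<^sub>C L0 u"] by (simp add: L_def Lp.scale_mem L0(1))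
  next
    fix u assume u: "u \<in> vectors (Lp p)"
    show "nrm (Lp p) (L u) \<le> C * nrm (Lp p) u"
      using u C[OF u] by (simp add: L_def nrm_Lp) (intro Lp.nrm_limit_le[OF L0(2)[OF u] op_maps[OF T u] L0(1)[OF u], unfolded nrm_Lp] always_eventually allI)
  qed
  then show ?thesis
    using L0(2) by (intro bexI[of _ L]) (simp_all add: L_def)
qed

lemma restr_op_mem: "E \<in> sets unit_measure \<Longrightarrow> restr_op p E \<in> vectors (operators (Lp p))"
  by (rule opI[OF sLp sLp, where B = 1])
    (auto simp: restr_op_def restr_mem Lp.add_mem Lp.scale_mem restr_add restr_scale nrm_Lp p_norm_restr_le[OF p1])

lemma band_projection_restr_op:
  assumes E: "E \<in> sets unit_measure"
  shows "band_projection (Lp p) p (restr_op p E)"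
  unfolding band_projection_def hermitian_projection_def
proof (intro conjI ballI allI impI restr_op_mem[OF E])
  fix u assume u: "u \<in> vectors (Lp p)"
  show "restr_op p E (restr_op p E u) = restr_op p E u"
    using u by (simp add: restr_op_def restr_mem restr_restr E)
  show "nrm (Lp p) u powr p = nrm (Lp p) (restr_op p E u) powr p + nrm (Lp p) (u - restr_op p E u) powr p"
    using p_norm_restr_compl[OF p1 u E] u by (simp add: restr_op_def nrm_Lp)
  fix c :: complex assume "cmod c = 1"
  then show "nrm (Lp p) (u + (c - 1) *\<^sub>C restr_op p E u) \<le> nrm (Lp p) u"
    using u E by (simp add: restr_op_def nrm_Lp p_norm_unimodular_restr)
qed

lemma rank_one_nrm:
  assumes E: "E \<in> sets unit_measure" and y: "y \<in> vectors (Lp p)" and u: "u \<in> vectors (Lp p)"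
  shows "p_norm p (rank_one p E y u) \<le> mu E powr (1 - 1 / p) * p_norm p y * p_norm p u"
proof -
  have "cmod (pr E u) \<le> mu E powr (1 - 1 / p) * p_norm p u"
    using pr_bound[OF p u E] mult_left_mono[OF p_norm_restr_le[OF p1 u E], of "mu E powr (1 - 1 / p)"] by simp
  then have "cmod (pr E u) * p_norm p y \<le> mu E powr (1 - 1 / p) * p_norm p u * p_norm p y"
    by (intro mult_right_mono p_norm_nonneg)
  then show ?thesis
    using Lp.nrm_scaleC[OF y] u by (simp add: rank_one_def nrm_Lp mult_ac)
qed

lemma rank_one_mem:
  assumes E: "E \<in> sets unit_measure" and y: "y \<in> vectors (Lp p)"
  shows "rank_one p E y \<in> vectors (operators (Lp p))"
proof (rule opI[OF sLp sLp])
  show "nrm (Lp p) (rank_one p E y u) \<le> (mu E powr (1 - 1 / p) * p_norm p y) * nrm (Lp p) u" if "u \<in> vectors (Lp p)" for u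
    using rank_one_nrm[OF E y that] by (simp add: nrm_Lp)
qed (auto simp: rank_one_def Lp.scale_mem y Lp.add_mem pr_add[OF p1] pr_scale scaleC_add_left scaleC_scaleC)

lemma p_norm_sum_disjoint:
  assumes "finite I" "\<And>i. i \<in> I \<Longrightarrow> E i \<in> sets unit_measure" "disjoint_family_on E I"
    "\<And>i. i \<in> I \<Longrightarrow> u i \<in> vectors (Lp p)" "\<And>i. i \<in> I \<Longrightarrow> restr (E i) (u i) = u i"
  shows "p_norm p (sum u I) powr p = (\<Sum>i\<in>I. p_norm p (u i) powr p)"
  using assms
proof (induction I)
  case empty
  then show ?case using Lp.nrm_zero p by (simp add: nrm_Lp)
next
  case (insert i I)
  have "restr (E i) (u j) = 0" if "j \<in> I" for j
  proof -
    have "E i \<inter> E j = {}" using insert that by (auto simp: disjoint_family_on_def)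
    moreover have "restr (E i) (u j) = restr (E i) (restr (E j) (u j))"
      using insert that by simp
    ultimately show ?thesis using insert.prems(1) that by (simp add: restr_restr)
  qed
  moreover have "restr (E i) (sum u J) = (\<Sum>j\<in>J. restr (E i) (u j))" if "finite J" for J
    using that by (induction J) (simp_all add: restr_add)
  ultimately have z: "restr (E i) (sum u I) = 0" using insert.hyps by simp
  have mem: "sum u (insert i I) \<in> vectors (Lp p)" using insert by (intro Lp.sum_mem) auto
  have r: "restr (E i) (sum u (insert i I)) = u i"
    using insert z by (simp add: restr_add)
  have "p_norm p (sum u (insert i I)) powr p = p_norm p (u i) powr p + p_norm p (sum u (insert i I) - u i) powr p"
    using p_norm_restr_compl[OF p1 mem, of "E i"] insert r by simp
  also have "sum u (insert i I) - u i = sum u I" using insert by simp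
  finally show ?case using insert by (simp add: disjoint_family_on_def)
qed

text \<open>The exponent \<open>q\<close> is independent of \<open>p\<close> because the estimate
  serves both at \<open>p\<close> and at 1.\<close>

lemma sum_p_norm_restr_le:
  assumes "finite I" "\<And>i. i \<in> I \<Longrightarrow> E i \<in> sets unit_measure" "disjoint_family_on E I" and q: "1 \<le> q"
  shows "u \<in> vectors (Lp q) \<Longrightarrow> (\<Sum>i\<in>I. p_norm q (restr (E i) u) powr q) \<le> p_norm q u powr q"
  using assms(1-3)
proof (induction I arbitrary: u)
  case (insert i I)
  interpret Lq: seminormed "Lp q" by (rule seminormed_Lp[OF q])
  define v where "v = u - restr (E i) u"
  have v: "v \<in> vectors (Lp q)" unfolding v_def by (intro Lq.diff_mem restr_mem insert)
  have eq: "restr (E j) v = restr (E j) u" if "j \<in> I" for j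
  proof -
    have "E j \<inter> E i = {}" using insert that by (auto simp: disjoint_family_on_def)
    then show ?thesis using insert that by (simp add: v_def restr_diff restr_restr)
  qed
  have "(\<Sum>j\<in>I. p_norm q (restr (E j) u) powr q) \<le> p_norm q v powr q"
    using insert.IH[OF v] insert.prems eq by (simp add: disjoint_family_on_def)
  moreover have "p_norm q u powr q = p_norm q (restr (E i) u) powr q + p_norm q v powr q"
    unfolding v_def using insert by (intro p_norm_restr_compl[OF q]) auto
  ultimately show ?case using insert by simp
qed simp

text \<open>On each set Hoelder's inequality produces the factors \<open>m powr (1 - 1 / p)\<close>,
  \<open>1 / m\<close> and \<open>m powr (1 / p)\<close>, which cancel because \<open>F i\<close>
  has the measure of \<open>E i\<close>. Disjointness of both families adds up the p-th
  powers.\<close>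

lemma averaging_nrm:
  assumes I: "finite I" and E: "\<And>i. i \<in> I \<Longrightarrow> E i \<in> sets unit_measure" and F: "\<And>i. i \<in> I \<Longrightarrow> F i \<in> sets unit_measure"
    and dE: "disjoint_family_on E I" and dF: "disjoint_family_on F I"
    and eq: "\<And>i. i \<in> I \<Longrightarrow> mu (F i) = mu (E i)" and pos: "\<And>i. i \<in> I \<Longrightarrow> 0 < mu (E i)"
    and c: "\<And>i. i \<in> I \<Longrightarrow> cmod (c i) \<le> C" and C: "0 \<le> C" and u: "u \<in> vectors (Lp p)"
  shows "p_norm p (averaging p I c E F u) \<le> C * p_norm p u"
proof -
  define v where "v = (\<lambda>i. (c i * pr (E i) u / of_real (mu (E i))) *\<^sub>C ind (F i))"
  have vi: "v i \<in> vectors (Lp p)" for i unfolding v_def by (intro Lp.scale_mem ind_mem)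
  have "p_norm p (averaging p I c E F u) powr p = (\<Sum>i\<in>I. p_norm p (v i) powr p)"
    using u p_norm_sum_disjoint[OF I F dF vi] F
    by (simp add: averaging_def v_def restr_scale restr_ind)
  also have "\<dots> \<le> (\<Sum>i\<in>I. C powr p * p_norm p (restr (E i) u) powr p)"
  proof (rule sum_mono)
    fix i assume i: "i \<in> I"
    define m where "m = mu (E i)"
    define r where "r = p_norm p (restr (E i) u)"
    have m: "m > 0" using pos[OF i] by (simp add: m_def)
    have "p_norm p (v i) = cmod (c i) * cmod (pr (E i) u) / m * m powr (1 / p)"
      using Lp.nrm_scaleC[OF ind_mem[of "F i" p], of "c i * pr (E i) u / of_real m"] p_norm_ind[OF p1 F[OF i]] m
      by (simp add: v_def nrm_Lp norm_mult norm_divide eq[OF i] m_def)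
    also have "\<dots> \<le> C * (m powr (1 - 1 / p) * r) / m * m powr (1 / p)"
      using m c[OF i] C pr_bound[OF p u E[OF i]] by (intro mult_right_mono divide_right_mono mult_mono) (auto simp: m_def r_def)
    also have "\<dots> = C * r"
      using m by (simp add: powr_diff)
    finally have "p_norm p (v i) powr p \<le> (C * r) powr p"
      using p by (intro powr_mono2 p_norm_nonneg) auto
    then show "p_norm p (v i) powr p \<le> C powr p * p_norm p (restr (E i) u) powr p"
      using C p_norm_nonneg[of p "restr (E i) u"] by (simp add: powr_mult r_def)
  qed
  also have "\<dots> = C powr p * (\<Sum>i\<in>I. p_norm p (restr (E i) u) powr p)" by (simp add: sum_distrib_left)
  also have "\<dots> \<le> C powr p * p_norm p u powr p"
    by (intro mult_left_mono sum_p_norm_restr_le[OF I E dE p1 u]) auto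
  also have "\<dots> = (C * p_norm p u) powr p"
    using C p_norm_nonneg[of p u] by (simp add: powr_mult)
  finally show ?thesis
    using p C p_norm_nonneg by (smt (verit) mult_nonneg_nonneg powr_less_mono2)
qed

lemma averaging_mem:
  assumes I: "finite I" and E: "\<And>i. i \<in> I \<Longrightarrow> E i \<in> sets unit_measure"
  shows "averaging p I c E F \<in> vectors (operators (Lp p))"
proof -
  have "averaging p I c E F = (\<Sum>i\<in>I. rank_one p (E i) ((c i / of_real (mu (E i))) *\<^sub>C ind (F i)))"
  proof
    fix u
    have "(\<Sum>i\<in>J. rank_one p (E i) ((c i / of_real (mu (E i))) *\<^sub>C ind (F i))) u
        = (\<Sum>i\<in>J. rank_one p (E i) ((c i / of_real (mu (E i))) *\<^sub>C ind (F i)) u)" if "finite J" for J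
      using that by (induction J) auto
    then show "averaging p I c E F u = (\<Sum>i\<in>I. rank_one p (E i) ((c i / of_real (mu (E i))) *\<^sub>C ind (F i))) u"
      using I by (simp add: averaging_def rank_one_def scaleC_scaleC mult_ac)
  qed
  then show ?thesis
    by (simp only:) (intro Y.sum_mem rank_one_mem E Lp.scale_mem ind_mem)
qed

text \<open>Replacing the leaf \<open>k\<close> by its children refines the mean by a single Haar
  term, as for a martingale difference.\<close>

lemma averaging_step:
  assumes E: "halving_tree E" and F: "halving_tree F" and k: "1 \<le> k" and u: "u \<in> vectors (Lp p)"
  shows "averaging p {Suc k..<2 * Suc k} (\<lambda>_. 1) E F u = averaging p {k..<2 * k} (\<lambda>_. 1) E F u +
    ((pr (E (2 * k)) u - pr (E (2 * k + 1)) u) / of_real (mu (dyadic k))) *\<^sub>C (ind (F (2 * k)) - ind (F (2 * k + 1)))"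
proof -
  note ED = halving_treeD[OF E] and FD = halving_treeD[OF F]
  define a b m where "a = pr (E (2 * k)) u" and "b = pr (E (2 * k + 1)) u" and "m = complex_of_real (mu (dyadic k))"
  have s: "1 \<le> 2 * k" "1 \<le> 2 * k + 1" using k by auto
  have m: "m \<noteq> 0" using mu_dyadic_pos[OF k] by (simp add: m_def)
  have half: "complex_of_real (mu (E (2 * k))) = m / 2" "complex_of_real (mu (E (2 * k + 1))) = m / 2"
    "complex_of_real (mu (E k)) = m"
    using k s floor_log_double[OF k] by (simp_all add: ED(3) m_def mu_dyadic)
  have ab: "pr (E k) u = a + b"
    unfolding a_def b_def ED(4)[OF k, symmetric] by (rule pr_Un[OF p1 u ED(2)[OF s(1)] ED(2)[OF s(2)] ED(5)[OF k]])
  have "ind (F k) = ind (F (2 * k)) + ind (F (2 * k + 1))"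
    unfolding FD(4)[OF k, symmetric] by (rule ind_Un[OF FD(2)[OF s(1)] FD(2)[OF s(2)] FD(5)[OF k]])
  moreover have "(a / (m / 2)) *\<^sub>C x + (b / (m / 2)) *\<^sub>C y - ((a + b) / m) *\<^sub>C (x + y) = ((a - b) / m) *\<^sub>C (x - y)"
    for x y :: fclass
  proof -
    have e: "a / (m / 2) = a / m + a / m" "b / (m / 2) = b / m + b / m" "(a + b) / m = a / m + b / m" "(a - b) / m = a / m - b / m"
      using m by (simp_all add: field_simps)
    show ?thesis
      unfolding e scaleC_add_left scaleC_add_right complex_vector.scale_left_diff_distrib
          complex_vector.scale_right_diff_distrib by simp
  qed
  ultimately show ?thesis
    by (simp only: averaging_def if_P[OF u] sum_leaves_step[OF k] mult_1 half ab flip: a_def b_def m_def)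
qed

text \<open>Balance makes the Haar coefficient of the indicator of \<open>dyadic m\<close> vanish at
  every split from \<open>m\<close> on, so no further increments occur.\<close>

lemma averaging_stable:
  assumes E: "balanced_tree E" and F: "halving_tree F" and m: "1 \<le> m" and k: "m \<le> k"
  shows "averaging p {k..<2 * k} (\<lambda>_. 1) E F (ind (dyadic m)) = averaging p {m..<2 * m} (\<lambda>_. 1) E F (ind (dyadic m))"
  using k
proof (induction k rule: dec_induct)
  case (step k)
  have E': "halving_tree E" and bal: "mu (E (2 * k) \<inter> dyadic m) = mu (E (2 * k + 1) \<inter> dyadic m)"
    using E m step by (auto simp: balanced_tree_def)
  have s: "1 \<le> k" "1 \<le> 2 * k" "1 \<le> 2 * k + 1" using m step by auto
  have "pr (E (2 * k)) (ind (dyadic m)) = pr (E (2 * k + 1)) (ind (dyadic m))"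
    by (simp only: bal pr_ind[OF halving_treeD(2)[OF E' s(2)] dyadic_sets[OF m]]
        pr_ind[OF halving_treeD(2)[OF E' s(3)] dyadic_sets[OF m]])
  then show ?case
    using averaging_step[OF E' F s(1) ind_mem, of "dyadic m"] step.IH by simp
qed simp

lemma tree_operator:
  assumes E: "balanced_tree E" and F: "halving_tree F"
  shows "\<exists>T\<in>vectors (operators (Lp p)). \<forall>u\<in>vectors (Lp p).
    converges_in (Lp p) (\<lambda>k. averaging p {Suc k..<2 * Suc k} (\<lambda>_. 1) E F u) (T u)"
proof (rule operator_limit)
  have E': "halving_tree E" using E by (simp add: balanced_tree_def)
  \<comment> \<open>The shift by \<open>Suc\<close> excludes index 0, for which there are no
    leaves.\<close>
  show "averaging p {Suc k..<2 * Suc k} (\<lambda>_. 1) E F \<in> vectors (operators (Lp p))" for k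
    by (rule averaging_mem) (auto intro!: halving_treeD(2)[OF E'])
  show "p_norm p (averaging p {Suc k..<2 * Suc k} (\<lambda>_. 1) E F u) \<le> 1 * p_norm p u" if "u \<in> vectors (Lp p)" for k u
    by (rule averaging_nrm)
      (use that halving_tree_leaves(1)[OF E', of "Suc k"] halving_tree_leaves(1)[OF F, of "Suc k"]
        in \<open>auto simp: halving_treeD(2,3)[OF E'] halving_treeD(2,3)[OF F] mu_dyadic\<close>)
  fix j :: nat assume j: "1 \<le> j"
  show "\<exists>K. \<forall>k\<ge>K. averaging p {Suc k..<2 * Suc k} (\<lambda>_. 1) E F (ind (dyadic j)) =
      averaging p {Suc K..<2 * Suc K} (\<lambda>_. 1) E F (ind (dyadic j))"
    using averaging_stable[OF E F j] by (intro exI[of _ j] allI impI) (metis le_SucI le_refl)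
qed

lemma averaging_dyadic:
  assumes F: "halving_tree F" and m: "1 \<le> m" and k: "m \<le> k"
  shows "averaging p {k..<2 * k} (\<lambda>_. 1) dyadic F (ind (dyadic m)) = ind (F m)"
proof -
  have z: "dyadic j \<inter> dyadic m = {}" if "j \<in> {m..<2 * m}" "j \<noteq> m" for j
    using halving_tree_leaves(1)[OF halving_tree_dyadic m] that m by (auto simp: disjoint_family_on_def)
  have "averaging p {m..<2 * m} (\<lambda>_. 1) dyadic F (ind (dyadic m))
      = (\<Sum>j\<in>{m..<2 * m}. if j = m then ind (F m) else 0)"
    unfolding averaging_def if_P[OF ind_mem] using m mu_dyadic_pos[OF m]
    by (intro sum.cong refl) (auto simp: pr_ind z scaleC_one)
  also have "\<dots> = ind (F m)" using m by simp
  finally show ?thesis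
    using averaging_stable[OF balanced_tree_dyadic F m k] by simp
qed

text \<open>Corresponding nodes have equal measure, so the correspondence between the dyadic tree
  and \<open>F\<close> extends from indicators to an operator. The convergence is recorded because
  the operator is later evaluated through its approximants.\<close>

lemma tree_embedding:
  assumes F: "halving_tree F"
  shows "\<exists>T\<in>vectors (operators (Lp p)). (\<forall>j\<ge>1. T (ind (dyadic j)) = ind (F j)) \<and>
    (\<forall>u\<in>vectors (Lp p). converges_in (Lp p) (\<lambda>k. averaging p {Suc k..<2 * Suc k} (\<lambda>_. 1) dyadic F u) (T u))"
proof -
  obtain T where T: "T \<in> vectors (operators (Lp p))"
    "\<And>u. u \<in> vectors (Lp p) \<Longrightarrow> converges_in (Lp p) (\<lambda>k. averaging p {Suc k..<2 * Suc k} (\<lambda>_. 1) dyadic F u) (T u)"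
    using tree_operator[OF balanced_tree_dyadic F] by auto
  have "T (ind (dyadic j)) = ind (F j)" if j: "1 \<le> j" for j
  proof -
    have c: "converges_in (Lp p) (\<lambda>k. averaging p {Suc k..<2 * Suc k} (\<lambda>_. 1) dyadic F (ind (dyadic j))) (ind (F j))"
      by (rule Lp.converges_in_const, rule eventually_sequentiallyI[of j], rule averaging_dyadic[OF F j]) simp
    show ?thesis
      by (rule Lp_eqI[OF op_maps[OF T(1) ind_mem] ind_mem Lp.converges_in_unique[OF T(2)[OF ind_mem] c _ op_maps[OF T(1) ind_mem] ind_mem]])
        (intro op_maps[OF averaging_mem ind_mem], auto)
  qed
  then show ?thesis using T by blast
qed

end

section \<open>Haar functions and random signs\<close>

text \<open>The action on tree nodes of the exchange of the two halves of the interval.\<close>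

fun swap_index :: "nat \<Rightarrow> nat"
  where "swap_index j = (if j \<le> 1 then j else if j = 2 then 3 else if j = 3 then 2 else 2 * swap_index (j div 2) + j mod 2)"

declare swap_index.simps [simp del]

lemma swap_index_simps:
  "swap_index 1 = 1" "swap_index 2 = 3" "swap_index 3 = 2"
  "2 \<le> k \<Longrightarrow> swap_index (2 * k) = 2 * swap_index k" "2 \<le> k \<Longrightarrow> swap_index (2 * k + 1) = 2 * swap_index k + 1"
  by (subst swap_index.simps; simp)+

text \<open>The cases 1, 2 and 3 are separate because \<open>swap_index\<close> treats the root and
  its two children specially.\<close>

lemma heap_induct [consumes 1, case_names 1 2 3 even odd]:
  assumes "1 \<le> (j::nat)" "P 1" "P 2" "P 3" "\<And>k. 2 \<le> k \<Longrightarrow> P k \<Longrightarrow> P (2 * k)" "\<And>k. 2 \<le> k \<Longrightarrow> P k \<Longrightarrow> P (2 * k + 1)"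
  shows "P j"
  using assms(1)
proof (induction j rule: less_induct)
  case (less j)
  show ?case
  proof (cases "j \<le> 3")
    case True
    then have "j = 1 \<or> j = 2 \<or> j = 3" using less.prems by linarith
    then show ?thesis using assms(2-4) by auto
  next
    case False
    define k where "k = j div 2"
    have k: "2 \<le> k" "k < j" "j = 2 * k \<or> j = 2 * k + 1" using False by (auto simp: k_def)
    then have "P k" using less.IH[of k] by simp
    then show ?thesis using assms(5,6)[OF k(1)] k(3) by auto
  qed
qed

lemma swap_index_props:
  assumes "1 \<le> j"
  shows "1 \<le> swap_index j \<and> floor_log (swap_index j) = floor_log j \<and> swap_index (swap_index j) = j \<and>
    (2 \<le> j \<longrightarrow> 2 \<le> swap_index j)"
  using assms
proof (induction j rule: heap_induct)
  case (even k)
  then show ?case by (simp add: swap_index_simps floor_log_double del: One_nat_def)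
next
  case (odd k)
  then show ?case using swap_index_simps(5)[of "swap_index k"] swap_index_simps(5)[of k] floor_log_double[of k] floor_log_double[of "swap_index k"]
    by simp
qed (simp_all add: swap_index_simps[simplified] floor_log.simps)

lemma swap_index_halves:
  assumes "2 \<le> j"
  shows "dyadic j \<subseteq> dyadic 2 \<and> dyadic (swap_index j) \<subseteq> dyadic 3 \<or> dyadic j \<subseteq> dyadic 3 \<and> dyadic (swap_index j) \<subseteq> dyadic 2"
proof -
  have "1 \<le> j" using assms by simp
  then have "2 \<le> j \<longrightarrow> dyadic j \<subseteq> dyadic 2 \<and> dyadic (swap_index j) \<subseteq> dyadic 3 \<or> dyadic j \<subseteq> dyadic 3 \<and> dyadic (swap_index j) \<subseteq> dyadic 2"
  proof (induction j rule: heap_induct)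
    case (even k)
    have "dyadic (2 * k) \<subseteq> dyadic k" "dyadic (2 * swap_index k) \<subseteq> dyadic (swap_index k)"
      using dyadic_split(1)[of k] dyadic_split(1)[of "swap_index k"] even(1) swap_index_props[of k] by auto
    then show ?case
      using even unfolding swap_index_simps(4)[OF even(1)] by (meson order_trans)
  next
    case (odd k)
    have "dyadic (2 * k + 1) \<subseteq> dyadic k" "dyadic (2 * swap_index k + 1) \<subseteq> dyadic (swap_index k)"
      using dyadic_split(1)[of k] dyadic_split(1)[of "swap_index k"] odd(1) swap_index_props[of k] by auto
    then show ?case
      using odd unfolding swap_index_simps(5)[OF odd(1)] by (meson order_trans)
  qed (simp_all add: swap_index_simps)
  then show ?thesis using assms by blast
qed

lemma halving_tree_swap: "halving_tree (\<lambda>j. dyadic (swap_index j))"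
  unfolding halving_tree_def
proof (intro conjI allI impI)
  fix j :: nat assume j: "1 \<le> j"
  note P = swap_index_props[OF j]
  show "dyadic (swap_index j) \<in> sets unit_measure" using P by simp
  show "mu (dyadic (swap_index j)) = mu (dyadic j)" using P j by (simp add: mu_dyadic)
  have "dyadic (swap_index (2 * j)) \<union> dyadic (swap_index (2 * j + 1)) = dyadic (swap_index j) \<and>
    dyadic (swap_index (2 * j)) \<inter> dyadic (swap_index (2 * j + 1)) = {}"
  proof (cases "j = 1")
    case True
    then show ?thesis using dyadic_split[of 1] swap_index_simps(1-3) by (auto simp: numeral_3_eq_3)
  next
    case False
    then have "2 \<le> j" using j by simp
    then show ?thesis using dyadic_split[of "swap_index j"] P by (simp only: swap_index_simps)
  qed
  then show "dyadic (swap_index (2 * j)) \<union> dyadic (swap_index (2 * j + 1)) = dyadic (swap_index j)"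
    "dyadic (swap_index (2 * j)) \<inter> dyadic (swap_index (2 * j + 1)) = {}" by auto
qed (simp add: swap_index_simps(1)[simplified])

text \<open>Left without normalisation, so that a sum over one level with sign coefficients takes
  only the values 1 and -1 and thereby splits a set into two.\<close>

definition haar :: "nat \<Rightarrow> fclass"
  where "haar j = ind (dyadic (2 * j)) - ind (dyadic (2 * j + 1))"

definition haar_pr :: "nat \<Rightarrow> fclass \<Rightarrow> complex"
  where "haar_pr j u = pr (dyadic (2 * j)) u - pr (dyadic (2 * j + 1)) u"

lemma sum_insert_offdiag:
  assumes "finite F" "k \<notin> F"
  shows "(\<Sum>i\<in>insert k F. \<Sum>j\<in>insert k F - {i}. x i j) = (\<Sum>i\<in>F. \<Sum>j\<in>F - {i}. x i j) + (\<Sum>j\<in>F. x k j + x j k :: 'a::comm_monoid_add)"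
proof -
  have "(\<Sum>i\<in>F. \<Sum>j\<in>insert k F - {i}. x i j) = (\<Sum>i\<in>F. x i k + (\<Sum>j\<in>F - {i}. x i j))"
  proof (rule sum.cong[OF refl])
    fix i assume "i \<in> F"
    then have "insert k F - {i} = insert k (F - {i})" using assms by auto
    then show "(\<Sum>j\<in>insert k F - {i}. x i j) = x i k + (\<Sum>j\<in>F - {i}. x i j)" using assms by simp
  qed
  moreover have "insert k F - {k} = F" using assms by auto
  ultimately show ?thesis using assms by (simp add: sum.distrib ac_simps)
qed

section \<open>Choice of signs by averaging\<close>

lemma parallelogram_complex: "(cmod (x + y))\<^sup>2 + (cmod (x - y))\<^sup>2 = 2 * (cmod x)\<^sup>2 + 2 * (cmod y)\<^sup>2"
  unfolding cmod_power2 by (simp add: power2_eq_square algebra_simps)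

text \<open>The right side dominates the mean of the left side over independent signs; the mean is
  taken one sign at a time by the parallelogram law. The list of linear forms is arbitrary so that,
  in the induction, the coefficient \<open>l\<close> of the new sign in the quadratic form can be
  added to it.\<close>

lemma random_signs_small:
  fixes b :: "'i \<Rightarrow> 'i \<Rightarrow> complex" and as :: "('i \<Rightarrow> complex) list"
  assumes "finite F"
  shows "\<exists>\<theta>. (\<forall>i. \<theta> i = 1 \<or> \<theta> i = - 1) \<and>
    (\<Sum>a\<leftarrow>as. (cmod (\<Sum>i\<in>F. \<theta> i * a i))\<^sup>2) + (cmod (\<Sum>i\<in>F. \<Sum>j\<in>F - {i}. \<theta> i * \<theta> j * b i j))\<^sup>2
    \<le> (\<Sum>a\<leftarrow>as. \<Sum>i\<in>F. (cmod (a i))\<^sup>2) + 2 * (\<Sum>i\<in>F. \<Sum>j\<in>F - {i}. (cmod (b i j))\<^sup>2)"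
  using assms
proof (induction F arbitrary: as)
  case empty
  show ?case by (intro exI[of _ "\<lambda>_. 1"]) (simp add: sum_list_0)
next
  case (insert k F)
  define l where "l = (\<lambda>j. b k j + b j k)"
  obtain \<theta> where \<theta>: "\<And>i. \<theta> i = 1 \<or> \<theta> i = - 1"
    "(\<Sum>a\<leftarrow>l # as. (cmod (\<Sum>i\<in>F. \<theta> i * a i))\<^sup>2) + (cmod (\<Sum>i\<in>F. \<Sum>j\<in>F - {i}. \<theta> i * \<theta> j * b i j))\<^sup>2
    \<le> (\<Sum>a\<leftarrow>l # as. \<Sum>i\<in>F. (cmod (a i))\<^sup>2) + 2 * (\<Sum>i\<in>F. \<Sum>j\<in>F - {i}. (cmod (b i j))\<^sup>2)"
    using insert.IH[of "l # as"] by auto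
  define Q where "Q = (\<Sum>i\<in>F. \<Sum>j\<in>F - {i}. \<theta> i * \<theta> j * b i j)"
  define L where "L = (\<Sum>i\<in>F. \<theta> i * l i)"
  define G where "G = (\<lambda>s::complex. (\<Sum>a\<leftarrow>as. (cmod ((\<Sum>i\<in>F. \<theta> i * a i) + s * a k))\<^sup>2) + (cmod (Q + s * L))\<^sup>2)"
  define R where "R = (\<Sum>a\<leftarrow>as. (cmod (a k))\<^sup>2)"
  have avg: "G 1 + G (- 1) = 2 * ((\<Sum>a\<leftarrow>as. (cmod (\<Sum>i\<in>F. \<theta> i * a i))\<^sup>2) + R) + 2 * ((cmod Q)\<^sup>2 + (cmod L)\<^sup>2)"
  proof -
    have "(\<Sum>a\<leftarrow>as. (cmod ((\<Sum>i\<in>F. \<theta> i * a i) + 1 * a k))\<^sup>2) + (\<Sum>a\<leftarrow>as. (cmod ((\<Sum>i\<in>F. \<theta> i * a i) + (- 1) * a k))\<^sup>2)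
        = 2 * ((\<Sum>a\<leftarrow>as. (cmod (\<Sum>i\<in>F. \<theta> i * a i))\<^sup>2) + R)"
      unfolding R_def
    proof (induction as)
      case (Cons a as)
      then show ?case using parallelogram_complex[of "\<Sum>i\<in>F. \<theta> i * a i" "a k"] by (simp add: algebra_simps)
    qed simp
    moreover have "(cmod (Q + 1 * L))\<^sup>2 + (cmod (Q + (- 1) * L))\<^sup>2 = 2 * ((cmod Q)\<^sup>2 + (cmod L)\<^sup>2)"
      using parallelogram_complex[of Q L] by simp
    ultimately show ?thesis unfolding G_def by linarith
  qed
  have "\<exists>s. (s = 1 \<or> s = - 1) \<and> 2 * G s \<le> G 1 + G (- 1)"
    by (cases "G 1 \<le> G (- 1)") (auto intro: exI[of _ 1] exI[of _ "- 1"])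
  then obtain s where s: "s = 1 \<or> s = - 1" "2 * G s \<le> G 1 + G (- 1)" by auto
  define \<theta>' where "\<theta>' = \<theta>(k := s)"
  have lin: "(\<Sum>i\<in>insert k F. \<theta>' i * a i) = (\<Sum>i\<in>F. \<theta> i * a i) + s * a k" for a :: "'i \<Rightarrow> complex"
  proof -
    have "(\<Sum>i\<in>F. \<theta>' i * a i) = (\<Sum>i\<in>F. \<theta> i * a i)"
      using insert.hyps by (intro sum.cong) (auto simp: \<theta>'_def)
    then show ?thesis using insert.hyps by (simp add: \<theta>'_def)
  qed
  have quad: "(\<Sum>i\<in>insert k F. \<Sum>j\<in>insert k F - {i}. \<theta>' i * \<theta>' j * b i j) = Q + s * L"
  proof -
    have "(\<Sum>i\<in>F. \<Sum>j\<in>F - {i}. \<theta>' i * \<theta>' j * b i j) = Q"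
      unfolding Q_def using insert.hyps by (intro sum.cong) (auto simp: \<theta>'_def)
    moreover have "(\<Sum>j\<in>F. \<theta>' k * \<theta>' j * b k j + \<theta>' j * \<theta>' k * b j k) = s * L"
      unfolding L_def sum_distrib_left using insert.hyps by (intro sum.cong) (auto simp: \<theta>'_def l_def algebra_simps)
    ultimately show ?thesis unfolding sum_insert_offdiag[OF insert.hyps] by simp
  qed
  \<comment> \<open>\<open>b k i\<close> and \<open>b i k\<close> carry the same product of signs,
    so only their sum matters; this is the origin of the factor 2.\<close>
  have lb: "(\<Sum>i\<in>F. (cmod (l i))\<^sup>2) \<le> 2 * (\<Sum>j\<in>F. (cmod (b k j))\<^sup>2 + (cmod (b j k))\<^sup>2)"
    unfolding sum_distrib_left
  proof (rule sum_mono)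
    fix i
    show "(cmod (l i))\<^sup>2 \<le> 2 * ((cmod (b k i))\<^sup>2 + (cmod (b i k))\<^sup>2)"
    proof -
      have "(cmod (l i))\<^sup>2 \<le> (cmod (b k i + b i k))\<^sup>2 + (cmod (b k i - b i k))\<^sup>2"
        by (simp add: l_def)
      then show ?thesis
        unfolding parallelogram_complex distrib_left .
    qed
  qed
  have "(\<Sum>a\<leftarrow>as. (cmod (\<Sum>i\<in>insert k F. \<theta>' i * a i))\<^sup>2) + (cmod (\<Sum>i\<in>insert k F. \<Sum>j\<in>insert k F - {i}. \<theta>' i * \<theta>' j * b i j))\<^sup>2 = G s"
    unfolding lin quad G_def by simp
  also have "G s \<le> (\<Sum>a\<leftarrow>as. (cmod (\<Sum>i\<in>F. \<theta> i * a i))\<^sup>2) + R + (cmod Q)\<^sup>2 + (cmod L)\<^sup>2"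
    using s(2) avg by simp
  also have "\<dots> \<le> R + (\<Sum>a\<leftarrow>as. \<Sum>i\<in>F. (cmod (a i))\<^sup>2) + (\<Sum>i\<in>F. (cmod (l i))\<^sup>2) + 2 * (\<Sum>i\<in>F. \<Sum>j\<in>F - {i}. (cmod (b i j))\<^sup>2)"
    using \<theta>(2) by (simp add: Q_def L_def)
  also have "\<dots> \<le> R + (\<Sum>a\<leftarrow>as. \<Sum>i\<in>F. (cmod (a i))\<^sup>2) + 2 * (\<Sum>i\<in>insert k F. \<Sum>j\<in>insert k F - {i}. (cmod (b i j))\<^sup>2)"
    using lb unfolding sum_insert_offdiag[OF insert.hyps] by simp
  also have "R + (\<Sum>a\<leftarrow>as. \<Sum>i\<in>F. (cmod (a i))\<^sup>2) = (\<Sum>a\<leftarrow>as. \<Sum>i\<in>insert k F. (cmod (a i))\<^sup>2)"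
    using insert.hyps by (simp add: R_def sum_list_addf)
  finally show ?case
    using \<theta>(1) s(1) by (intro exI[of _ \<theta>']) (auto simp: \<theta>'_def)
qed

text \<open>Since each sign has square 1, the left side is the modulus of the mean over all signs,
  and some choice does not fall below it. Signs are fixed one at a time, the diagonal coefficient of
  the new one being absorbed into \<open>c\<close>.\<close>

lemma random_signs_large:
  fixes b :: "'i \<Rightarrow> 'i \<Rightarrow> complex" and a :: "'i \<Rightarrow> complex"
  assumes "finite F"
  shows "\<exists>\<theta>. (\<forall>i. \<theta> i = 1 \<or> \<theta> i = - 1) \<and>
    cmod (c + (\<Sum>i\<in>F. b i i)) \<le> cmod (c + (\<Sum>i\<in>F. \<theta> i * a i) + (\<Sum>i\<in>F. \<Sum>j\<in>F. \<theta> i * \<theta> j * b i j))"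
  using assms
proof (induction F arbitrary: c)
  case empty
  show ?case by (intro exI[of _ "\<lambda>_. 1"]) simp
next
  case (insert k F)
  obtain \<theta> where \<theta>: "\<And>i. \<theta> i = 1 \<or> \<theta> i = - 1"
    "cmod (c + b k k + (\<Sum>i\<in>F. b i i)) \<le> cmod (c + b k k + (\<Sum>i\<in>F. \<theta> i * a i) + (\<Sum>i\<in>F. \<Sum>j\<in>F. \<theta> i * \<theta> j * b i j))"
    using insert.IH[of "c + b k k"] by auto
  define x where "x = c + b k k + (\<Sum>i\<in>F. \<theta> i * a i) + (\<Sum>i\<in>F. \<Sum>j\<in>F. \<theta> i * \<theta> j * b i j)"
  define y where "y = a k + (\<Sum>j\<in>F. \<theta> j * b k j + \<theta> j * b j k)"
  have "2 * cmod x \<le> cmod (x + y) + cmod (x - y)"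
    using norm_triangle_ineq[of "x + y" "x - y"] by (simp add: norm_mult flip: mult_2)
  then have "\<exists>s. (s = 1 \<or> s = - 1) \<and> cmod x \<le> cmod (x + s * y)"
    by (cases "cmod x \<le> cmod (x + y)") (auto intro: exI[of _ 1] exI[of _ "- 1"])
  then obtain s where s: "s = 1 \<or> s = - 1" "cmod x \<le> cmod (x + s * y)" by auto
  define \<theta>' where "\<theta>' = \<theta>(k := s)"
  have 1: "(\<Sum>i\<in>F. \<theta>' i * f i) = (\<Sum>i\<in>F. \<theta> i * f i)" for f :: "'i \<Rightarrow> complex"
    using insert.hyps by (intro sum.cong) (auto simp: \<theta>'_def)
  have 2: "(\<Sum>i\<in>F. \<Sum>j\<in>F. \<theta>' i * \<theta>' j * b i j) = (\<Sum>i\<in>F. \<Sum>j\<in>F. \<theta> i * \<theta> j * b i j)"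
    using insert.hyps by (intro sum.cong) (auto simp: \<theta>'_def)
  have ss: "s * s = 1" using s(1) by auto
  have tk: "\<theta>' k = s" by (simp add: \<theta>'_def)
  have "(\<Sum>i\<in>insert k F. \<Sum>j\<in>insert k F. \<theta>' i * \<theta>' j * b i j)
      = s * s * b k k + s * (\<Sum>j\<in>F. \<theta>' j * b k j) + s * (\<Sum>i\<in>F. \<theta>' i * b i k) + (\<Sum>i\<in>F. \<Sum>j\<in>F. \<theta>' i * \<theta>' j * b i j)"
    using insert.hyps by (simp add: tk sum.distrib sum_distrib_left algebra_simps)
  then have q: "(\<Sum>i\<in>insert k F. \<Sum>j\<in>insert k F. \<theta>' i * \<theta>' j * b i j)
      = b k k + s * (\<Sum>j\<in>F. \<theta> j * b k j) + s * (\<Sum>i\<in>F. \<theta> i * b i k) + (\<Sum>i\<in>F. \<Sum>j\<in>F. \<theta> i * \<theta> j * b i j)"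
    by (simp only: 1 2 ss mult_1_left)
  have "c + (\<Sum>i\<in>insert k F. \<theta>' i * a i) + (\<Sum>i\<in>insert k F. \<Sum>j\<in>insert k F. \<theta>' i * \<theta>' j * b i j) = x + s * y"
    unfolding q unfolding sum.insert[OF insert.hyps] tk 1 by (simp add: x_def y_def sum.distrib algebra_simps)
  moreover have "cmod (c + (\<Sum>i\<in>insert k F. b i i)) \<le> cmod x"
    using \<theta>(2) insert.hyps by (simp add: x_def add.assoc)
  ultimately show ?case
    using s \<theta>(1) by (intro exI[of _ \<theta>']) (auto simp: \<theta>'_def)
qed

text \<open>Weak-star compactness by Tychonoff's theorem, since all functionals lie in a product of
  discs. A filter replaces a subsequence because no subsequence need converge at all points at once;
  being below \<open>sequentially\<close>, it keeps whatever holds for all large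
  \<open>N\<close>.\<close>

lemma cluster_functional:
  fixes g :: "nat \<Rightarrow> 'a::complex_vector \<Rightarrow> complex"
  assumes sY: "seminormed Y" and g: "\<And>N. g N \<in> vectors (dual Y)"
    and B: "\<And>N y. y \<in> vectors Y \<Longrightarrow> cmod (g N y) \<le> B * nrm Y y"
  shows "\<exists>\<Psi>\<in>vectors (dual Y). \<exists>F. F \<noteq> bot \<and> F \<le> sequentially \<and> (\<forall>y. ((\<lambda>N. g N y) \<longlongrightarrow> \<Psi> y) F)"
proof -
  define K where "K = PiE UNIV (\<lambda>y. cball (0::complex) (if y \<in> vectors Y then B * nrm Y y else 0))"
  have "compactin (product_topology (\<lambda>_. euclidean) UNIV) K"
    unfolding K_def compactin_PiE by auto
  then have "compact K"
    by (simp add: euclidean_product_topology flip: compactin_euclidean_iff)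
  moreover have "\<forall>\<^sub>F f in filtermap g sequentially. f \<in> K"
    using B op_outside[OF g] by (auto simp: eventually_filtermap K_def PiE_def)
  moreover have "filtermap g sequentially \<noteq> bot"
    by (simp add: filtermap_bot_iff)
  ultimately obtain \<Psi> where \<Psi>: "inf (nhds \<Psi>) (filtermap g sequentially) \<noteq> bot"
    unfolding compact_filter by blast
  \<comment> \<open>The indices that are large and at which \<open>g\<close> is close to the cluster
    point.\<close>
  define F where "F = inf (filtercomap g (nhds \<Psi>)) sequentially"
  have F0: "F \<noteq> bot"
  proof
    assume "F = bot"
    then have "filtermap g F = bot" by (simp add: filtermap_bot)
    moreover have "inf (nhds \<Psi>) (filtermap g sequentially) \<le> filtermap g F"
      unfolding le_filter_def
    proof (intro allI impI)
      fix P assume "eventually P (filtermap g F)"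
      then obtain Q R where QR: "eventually Q (nhds \<Psi>)" "eventually R sequentially" "\<And>x. Q (g x) \<Longrightarrow> R x \<Longrightarrow> P (g x)"
        unfolding F_def eventually_filtermap eventually_inf eventually_filtercomap by blast
      have "eventually (\<lambda>f. Q f \<longrightarrow> P f) (filtermap g sequentially)"
        unfolding eventually_filtermap using QR(2) by eventually_elim (use QR(3) in blast)
      then show "eventually P (inf (nhds \<Psi>) (filtermap g sequentially))"
        using QR(1) unfolding eventually_inf by blast
    qed
    ultimately show False using \<Psi> by (simp add: bot_unique)
  qed
  have "filterlim g (nhds \<Psi>) F"
    unfolding F_def by (rule filterlim_mono[OF filterlim_filtercomap order_refl inf_le1])
  then have lim: "((\<lambda>N. g N y) \<longlongrightarrow> \<Psi> y) F" for y
    using continuous_on_tendsto_compose[OF continuous_on_product_coordinates \<open>filterlim g (nhds \<Psi>) F\<close>, of y] by simp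
  have "\<Psi> \<in> vectors (dual Y)"
  proof (rule dualI[OF sY])
    fix y assume "y \<notin> vectors Y"
    then have "(\<lambda>N. g N y) = (\<lambda>_. 0)" using op_outside[OF g] by blast
    then show "\<Psi> y = 0" using tendsto_unique[OF F0 lim[of y]] by simp
  next
    fix x y assume "x \<in> vectors Y" "y \<in> vectors Y"
    then have "(\<lambda>N. g N (x + y)) = (\<lambda>N. g N x + g N y)" using op_add[OF g] by blast
    then show "\<Psi> (x + y) = \<Psi> x + \<Psi> y"
      using tendsto_unique[OF F0 lim[of "x + y"]] tendsto_add[OF lim[of x] lim[of y]] by simp
  next
    fix c y assume "y \<in> vectors Y"
    then have "(\<lambda>N. g N (c *\<^sub>C y)) = (\<lambda>N. c * g N y)" using op_scale[OF g] by (auto simp: fun_eq_iff)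
    then show "\<Psi> (c *\<^sub>C y) = c * \<Psi> y"
      using tendsto_unique[OF F0 lim[of "c *\<^sub>C y"]] tendsto_mult_left[OF lim[of y], of c] by simp
  next
    fix y assume "y \<in> vectors Y"
    then show "cmod (\<Psi> y) \<le> B * nrm Y y"
      using B by (intro tendsto_upperbound[OF tendsto_norm[OF lim[of y]] _ F0]) auto
  qed
  moreover have "F \<le> sequentially" by (simp add: F_def)
  ultimately show ?thesis using F0 lim by blast
qed

section \<open>The annihilator as a bimodule, and estimates for Haar functions\<close>

context
  fixes p :: real
  assumes p: "1 < p"
begin

interpretation Lp: seminormed "Lp p" by (rule sLp[OF p])
interpretation Y: seminormed "operators (Lp p)" by (rule seminormed_bounded_ops[OF sLp[OF p] sLp[OF p]])

text \<open>The exchange of the two halves of the interval, obtained from the swapped tree. Its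
  identities are verified on dyadic indicators only.\<close>

lemma half_swap:
  "\<exists>S\<in>vectors (operators (Lp p)). (\<forall>u\<in>vectors (Lp p). S (S u) = u) \<and>
    (\<forall>u\<in>vectors (Lp p). S (restr_op p (dyadic 2) u) = S u - restr_op p (dyadic 2) (S u))"
proof -
  obtain S where S: "S \<in> vectors (operators (Lp p))" "\<And>j. 1 \<le> j \<Longrightarrow> S (ind (dyadic j)) = ind (dyadic (swap_index j))"
    using tree_embedding[OF p halving_tree_swap] by auto
  define e where "e = restr_op p (dyadic 2)"
  have e: "e \<in> vectors (operators (Lp p))" unfolding e_def by (rule restr_op_mem[OF p]) simp
  have SS: "S \<circ> S = restr_op p {0..<1}"
  proof (rule Lp_op_eqI[OF p op_comp_mem[OF sLp[OF p] sLp[OF p] sLp[OF p] S(1) S(1)] restr_op_mem[OF p unit_sets]])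
    fix j :: nat assume j: "1 \<le> j"
    show "(S \<circ> S) (ind (dyadic j)) = restr_op p {0..<1} (ind (dyadic j))"
      using S(2)[OF j] S(2)[of "swap_index j"] swap_index_props[OF j] by (simp add: restr_op_def ind_mem)
  qed
  have Se: "S \<circ> e = compl_op (Lp p) e \<circ> S"
  proof (rule Lp_op_eqI[OF p])
    show "S \<circ> e \<in> vectors (operators (Lp p))" by (rule op_comp_mem[OF sLp[OF p] sLp[OF p] sLp[OF p] e S(1)])
    show "compl_op (Lp p) e \<circ> S \<in> vectors (operators (Lp p))"
      by (rule op_comp_mem[OF sLp[OF p] sLp[OF p] sLp[OF p] S(1) compl_op_mem[OF sLp[OF p] e]])
    fix j :: nat assume j: "1 \<le> j"
    have sj: "1 \<le> swap_index j" using swap_index_props[OF j] by simp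
    have d23: "dyadic 2 \<union> dyadic 3 = dyadic 1" "dyadic 2 \<inter> dyadic 3 = {}"
      using dyadic_split[of 1] by (simp_all add: numeral_3_eq_3)
    have L: "(S \<circ> e) (ind (dyadic j)) = S (ind (dyadic 2 \<inter> dyadic j))"
      using j by (simp add: e_def restr_op_def ind_mem restr_ind)
    have R: "(compl_op (Lp p) e \<circ> S) (ind (dyadic j)) = ind (dyadic (swap_index j)) - ind (dyadic 2 \<inter> dyadic (swap_index j))"
      using sj by (simp add: S(2)[OF j] compl_op_def e_def restr_op_def ind_mem restr_ind)
    show "(S \<circ> e) (ind (dyadic j)) = (compl_op (Lp p) e \<circ> S) (ind (dyadic j))"
    proof (cases "j = 1")
      case True
      have "dyadic 2 \<inter> dyadic 1 = dyadic 2" "dyadic 1 - dyadic 2 = dyadic 3" using d23 by auto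
      then have "(S \<circ> e) (ind (dyadic j)) = ind (dyadic 3)"
        unfolding L using True S(2)[of 2] by (simp add: swap_index_simps del: One_nat_def)
      moreover have "ind (dyadic 1) - ind (dyadic 2) = ind (dyadic 1 - dyadic 2)"
        using d23(1) by (intro ind_diff) auto
      ultimately show ?thesis
        unfolding R using True \<open>dyadic 2 \<inter> dyadic 1 = dyadic 2\<close> \<open>dyadic 1 - dyadic 2 = dyadic 3\<close>
        by (simp only: swap_index_simps(1))
    next
      case False
      then have "2 \<le> j" using j by simp
      from swap_index_halves[OF this] show ?thesis
      proof (elim disjE)
        assume h: "dyadic j \<subseteq> dyadic 2 \<and> dyadic (swap_index j) \<subseteq> dyadic 3"
        then have "dyadic 2 \<inter> dyadic j = dyadic j" "dyadic 2 \<inter> dyadic (swap_index j) = {}" using d23 by auto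
        then show ?thesis unfolding L R using S(2)[OF j] by simp
      next
        assume h: "dyadic j \<subseteq> dyadic 3 \<and> dyadic (swap_index j) \<subseteq> dyadic 2"
        then have "dyadic 2 \<inter> dyadic j = {}" "dyadic 2 \<inter> dyadic (swap_index j) = dyadic (swap_index j)" using d23 by auto
        then show ?thesis unfolding L R using op_zero[OF sLp[OF p] sLp[OF p] S(1)] by simp
      qed
    qed
  qed
  have "S (S u) = u" if "u \<in> vectors (Lp p)" for u
    using fun_cong[OF SS, of u] that by (simp add: restr_op_def)
  moreover have "S (e u) = S u - e (S u)" if "u \<in> vectors (Lp p)" for u
    using fun_cong[OF Se, of u] op_maps[OF S(1) that] by (simp add: compl_op_def)
  ultimately show ?thesis using S(1) unfolding e_def by blast
qed

lemma Lp_bimodule: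
  assumes L: "L_decomp W V (dual (operators (Lp p)))" and a: "a \<in> vectors (operators (Lp p))" and psi: "\<psi> \<in> W"
  shows "\<psi> \<circ> left_mult (Lp p) a \<in> W" "\<psi> \<circ> right_mult (Lp p) a \<in> W"
proof -
  obtain S where S: "S \<in> vectors (operators (Lp p))" "\<And>u. u \<in> vectors (Lp p) \<Longrightarrow> S (S u) = u"
    "\<And>u. u \<in> vectors (Lp p) \<Longrightarrow> S (restr_op p (dyadic 2) u) = S u - restr_op p (dyadic 2) (S u)"
    using half_swap by blast
  have e: "band_projection (Lp p) p (restr_op p (dyadic 2))"
    by (rule band_projection_restr_op[OF p]) simp
  show "\<psi> \<circ> left_mult (Lp p) a \<in> W" "\<psi> \<circ> right_mult (Lp p) a \<in> W"
    using L_decomp_bimodule[OF sLp[OF p] p L e S a psi] by blast+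
qed

lemma rank_one_comp:
  assumes "E \<in> sets unit_measure" "E' \<in> sets unit_measure" "x \<in> vectors (Lp p)" "y \<in> vectors (Lp p)"
    "K \<in> vectors (operators (Lp p))"
  shows "rank_one p E y \<circ> (K \<circ> rank_one p E' x) = pr E (K x) *\<^sub>C rank_one p E' y"
proof
  fix u
  show "(rank_one p E y \<circ> (K \<circ> rank_one p E' x)) u = (pr E (K x) *\<^sub>C rank_one p E' y) u"
    using assms op_zero[OF sLp[OF p] sLp[OF p] assms(5)] op_maps[OF assms(5,3)]
    by (simp add: rank_one_def scaleC_apply op_scale[OF assms(5,3)] Lp.scale_mem pr_scale scaleC_scaleC mult.commute Lp.zero_mem)
qed

text \<open>Sandwiched between two rank one operators, \<open>K\<close> becomes
  \<open>pr E0 (K x)\<close> times \<open>rank_one p E y\<close>. Since \<open>\<psi>\<close>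
  composed with multiplications still annihilates \<open>J\<close>, it kills this product, and the
  scalar is not 0.\<close>

lemma annihilator_rank_one:
  assumes L: "L_decomp (annihilator (operators (Lp p)) J) V (dual (operators (Lp p)))"
    and J: "J \<subseteq> vectors (operators (Lp p))" and K: "K \<in> J" "K \<noteq> 0"
    and psi: "\<psi> \<in> annihilator (operators (Lp p)) J" and E: "E \<in> sets unit_measure" and y: "y \<in> vectors (Lp p)"
  shows "\<psi> (rank_one p E y) = 0"
proof -
  have KY: "K \<in> vectors (operators (Lp p))" using J K by blast
  obtain x where x: "K x \<noteq> 0" using K(2) by (auto simp: fun_eq_iff)
  then have xX: "x \<in> vectors (Lp p)" using op_outside[OF KY] by blast
  obtain E0 where E0: "E0 \<in> sets unit_measure" "pr E0 (K x) \<noteq> 0"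
    using pr_separates[OF p1[OF p] op_maps[OF KY xX]] x by blast
  have "(\<psi> \<circ> left_mult (Lp p) (rank_one p E0 y)) \<circ> right_mult (Lp p) (rank_one p E x) \<in> annihilator (operators (Lp p)) J"
    by (intro Lp_bimodule[OF L] rank_one_mem[OF p] psi E E0 y xX)
  then have "\<psi> (rank_one p E0 y \<circ> (K \<circ> rank_one p E x)) = 0"
    using K(1) KY op_comp_mem[OF sLp[OF p] sLp[OF p] sLp[OF p] rank_one_mem[OF p E xX] KY]
    by (auto simp: annihilator_def left_mult_def right_mult_def)
  moreover have psiZ: "\<psi> \<in> vectors (dual (operators (Lp p)))" using psi by (simp add: annihilator_def)
  ultimately have "pr E0 (K x) * \<psi> (rank_one p E y) = 0"
    unfolding rank_one_comp[OF E0(1) E xX y KY] op_scale[OF psiZ rank_one_mem[OF p E y]] by simp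
  then show ?thesis using E0(2) by simp
qed

lemma haar_pr_bound_L1:
  assumes u: "u \<in> vectors (Lp p)" and j: "1 \<le> j"
  shows "cmod (haar_pr j u) \<le> p_norm 1 (restr (dyadic j) u)"
proof -
  have s: "1 \<le> 2 * j" "1 \<le> 2 * j + 1" using j by auto
  have sub: "dyadic (2 * j) \<inter> dyadic j = dyadic (2 * j)" "dyadic (2 * j + 1) \<inter> dyadic j = dyadic (2 * j + 1)"
    using dyadic_split(1)[OF j] by auto
  have v: "restr (dyadic j) u \<in> vectors (Lp 1)"
    by (rule restr_mem[OF Lp_subset_L1[OF p1[OF p] u]])
  have "(\<Sum>i\<in>{2 * j, 2 * j + 1}. p_norm 1 (restr (dyadic i) (restr (dyadic j) u)) powr 1) \<le> p_norm 1 (restr (dyadic j) u) powr 1"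
    by (rule sum_p_norm_restr_le[OF p _ _ _ _ v])
      (use s dyadic_split(2)[OF j] in \<open>auto simp: disjoint_family_on_def\<close>)
  then have "p_norm 1 (restr (dyadic (2 * j)) u) + p_norm 1 (restr (dyadic (2 * j + 1)) u) \<le> p_norm 1 (restr (dyadic j) u)"
    using restr_restr[OF dyadic_sets[OF s(1)] dyadic_sets[OF j], of u] restr_restr[OF dyadic_sets[OF s(2)] dyadic_sets[OF j], of u]
    unfolding sub by (simp add: p_norm_nonneg)
  then show ?thesis
    using norm_triangle_ineq4[of "pr (dyadic (2 * j)) u" "pr (dyadic (2 * j + 1)) u"]
      pr_bound_L1[of "dyadic (2 * j)" u] pr_bound_L1[of "dyadic (2 * j + 1)" u]
    unfolding haar_pr_def by linarith
qed

lemma haar_pr_bound: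
  assumes u: "u \<in> vectors (Lp p)" and j: "1 \<le> j"
  shows "cmod (haar_pr j u) \<le> mu (dyadic j) powr (1 - 1 / p) * p_norm p u"
proof -
  have "cmod (haar_pr j u) \<le> mu (dyadic j) powr (1 - 1 / p) * p_norm p (restr (dyadic j) u)"
    using haar_pr_bound_L1[OF u j] Hoelder_indicator[OF p u dyadic_sets[OF j]] by simp
  also have "\<dots> \<le> mu (dyadic j) powr (1 - 1 / p) * p_norm p u"
    by (intro mult_left_mono p_norm_restr_le[OF p1[OF p] u dyadic_sets[OF j]]) simp
  finally show ?thesis .
qed

text \<open>Intervals of one level are disjoint, so the moduli sum to at most the L_1 norm, which
  the p-norm dominates.\<close>

lemma sum_haar_pr_le:
  assumes u: "u \<in> vectors (Lp p)" and F: "F \<subseteq> level N"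
  shows "(\<Sum>j\<in>F. cmod (haar_pr j u)) \<le> p_norm p u"
proof -
  have fin: "finite F" using F finite_subset by blast
  have F1: "1 \<le> j" if "j \<in> F" for j using that F by (auto simp only: level_iff)
  have "(\<Sum>j\<in>F. cmod (haar_pr j u)) \<le> (\<Sum>j\<in>F. p_norm 1 (restr (dyadic j) u) powr 1)"
    using haar_pr_bound_L1[OF u F1] by (intro sum_mono) (simp add: p_norm_nonneg)
  also have "\<dots> \<le> p_norm 1 u powr 1"
    by (rule sum_p_norm_restr_le[OF p fin _ _ _ Lp_subset_L1[OF p1[OF p] u]])
      (use F1 disjoint_family_on_mono[OF F level_disjoint] in auto)
  also have "\<dots> \<le> p_norm p u"
    using p_norm_1_le[OF p u] by (simp add: p_norm_nonneg)
  finally show ?thesis .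
qed

lemma p_norm_sum_ind_le:
  assumes I: "finite I" and E: "\<And>i. i \<in> I \<Longrightarrow> E i \<in> sets unit_measure" and d: "disjoint_family_on E I"
    and c: "\<And>i. i \<in> I \<Longrightarrow> cmod (c i) \<le> C" and C: "0 \<le> C"
  shows "p_norm p (\<Sum>i\<in>I. c i *\<^sub>C ind (E i)) \<le> C * (\<Sum>i\<in>I. mu (E i)) powr (1 / p)"
proof -
  have n: "p_norm p (c i *\<^sub>C ind (E i)) = cmod (c i) * mu (E i) powr (1 / p)" if "i \<in> I" for i
    using Lp.nrm_scaleC[OF ind_mem[of "E i" p], of "c i"] p_norm_ind[OF p1[OF p] E[OF that]] by (simp add: nrm_Lp)
  have "p_norm p (\<Sum>i\<in>I. c i *\<^sub>C ind (E i)) powr p = (\<Sum>i\<in>I. p_norm p (c i *\<^sub>C ind (E i)) powr p)"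
    by (rule p_norm_sum_disjoint[OF p I E d Lp.scale_mem[OF ind_mem]]) (auto simp: restr_scale restr_ind E)
  also have "\<dots> = (\<Sum>i\<in>I. cmod (c i) powr p * mu (E i))"
    using p by (intro sum.cong refl) (simp add: n powr_mult powr_powr)
  also have "\<dots> \<le> (\<Sum>i\<in>I. C powr p * mu (E i))"
    using c p by (intro sum_mono mult_right_mono powr_mono2) auto
  also have "\<dots> = (C * (\<Sum>i\<in>I. mu (E i)) powr (1 / p)) powr p"
    using p C by (simp add: powr_mult powr_powr sum_distrib_left sum_nonneg)
  finally show ?thesis
    using p C p_norm_nonneg by (smt (verit) mult_nonneg_nonneg powr_less_mono2 powr_ge_zero)
qed

lemma haar_mem: "haar j \<in> vectors (Lp p)"
  unfolding haar_def by (intro Lp.diff_mem ind_mem)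

lemma p_norm_haar_le:
  assumes j: "1 \<le> j"
  shows "p_norm p (haar j) \<le> mu (dyadic j) powr (1 / p)"
proof -
  have s: "1 \<le> 2 * j" "1 \<le> 2 * j + 1" using j by auto
  have "p_norm p (\<Sum>i\<in>{2 * j, 2 * j + 1}. (if i = 2 * j then 1 else - 1) *\<^sub>C ind (dyadic i))
      \<le> 1 * (\<Sum>i\<in>{2 * j, 2 * j + 1}. mu (dyadic i)) powr (1 / p)"
    by (rule p_norm_sum_ind_le) (use s dyadic_split(2)[OF j] in \<open>auto simp: disjoint_family_on_def\<close>)
  moreover have "(\<Sum>i\<in>{2 * j, 2 * j + 1}. mu (dyadic i)) = mu (dyadic j)"
    using j floor_log_double[OF j] by (simp add: mu_dyadic)
  ultimately show ?thesis
    by (simp add: haar_def scaleC_one)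
qed

lemma restr_haar:
  assumes j: "1 \<le> j"
  shows "restr (dyadic j) (haar j) = haar j"
proof -
  have s: "1 \<le> 2 * j" "1 \<le> 2 * j + 1" using j by auto
  have "dyadic j \<inter> dyadic (2 * j) = dyadic (2 * j)" "dyadic j \<inter> dyadic (2 * j + 1) = dyadic (2 * j + 1)"
    using dyadic_split(1)[OF j] by auto
  then show ?thesis
    unfolding haar_def restr_diff restr_ind[OF dyadic_sets[OF j] dyadic_sets[OF s(1)]]
      restr_ind[OF dyadic_sets[OF j] dyadic_sets[OF s(2)]] by simp
qed

lemma p_norm_haar_sum_le:
  assumes F: "F \<subseteq> level N" and t: "\<And>j. cmod (t j) \<le> 1"
  shows "p_norm p (\<Sum>j\<in>F. t j *\<^sub>C haar j) \<le> (\<Sum>j\<in>F. mu (dyadic j)) powr (1 / p)"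
proof -
  have fin: "finite F" using F finite_subset by blast
  have F1: "1 \<le> j" if "j \<in> F" for j using that F by (auto simp only: level_iff)
  have "p_norm p (\<Sum>j\<in>F. t j *\<^sub>C haar j) powr p = (\<Sum>j\<in>F. p_norm p (t j *\<^sub>C haar j) powr p)"
    by (rule p_norm_sum_disjoint[OF p fin, of dyadic])
      (use F1 disjoint_family_on_mono[OF F level_disjoint] restr_haar in \<open>auto simp: restr_scale intro!: Lp.scale_mem haar_mem\<close>)
  also have "\<dots> \<le> (\<Sum>j\<in>F. mu (dyadic j))"
  proof (rule sum_mono)
    fix j assume j: "j \<in> F"
    have "p_norm p (t j *\<^sub>C haar j) = cmod (t j) * p_norm p (haar j)"
      using Lp.nrm_scaleC[OF haar_mem, of "t j" j] by (simp add: nrm_Lp)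
    also have "\<dots> \<le> 1 * mu (dyadic j) powr (1 / p)"
      using t p_norm_haar_le[OF F1[OF j]] by (intro mult_mono p_norm_nonneg) auto
    finally have "p_norm p (t j *\<^sub>C haar j) powr p \<le> (mu (dyadic j) powr (1 / p)) powr p"
      using p by (intro powr_mono2 p_norm_nonneg) auto
    then show "p_norm p (t j *\<^sub>C haar j) powr p \<le> mu (dyadic j)"
      using p by (simp add: powr_powr)
  qed
  finally have "(p_norm p (\<Sum>j\<in>F. t j *\<^sub>C haar j) powr p) powr (1 / p) \<le> (\<Sum>j\<in>F. mu (dyadic j)) powr (1 / p)"
    using p by (intro powr_mono2) auto
  then show ?thesis
    using p p_norm_nonneg by (simp add: powr_powr)
qed

end

section \<open>Almost diagonal trees\<close>

lemma pr_sum: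
  assumes "1 \<le> p" "\<And>i. i \<in> I \<Longrightarrow> f i \<in> vectors (Lp p)"
  shows "pr E (sum f I) = (\<Sum>i\<in>I. pr E (f i))"
  using assms(2)
proof (induction I rule: infinite_finite_induct)
  case (insert i I)
  interpret seminormed "Lp p" by (rule seminormed_Lp[OF assms(1)])
  show ?case
    using insert pr_add[OF assms(1), of "f i" "sum f I" E] by (simp add: sum_mem)
qed simp_all

lemma pr_diff:
  assumes "1 \<le> p" "u \<in> vectors (Lp p)" "v \<in> vectors (Lp p)"
  shows "pr E (u - v) = pr E u - pr E v"
proof -
  interpret seminormed "Lp p" by (rule seminormed_Lp[OF assms(1)])
  have "pr E (u + (- 1) *\<^sub>C v) = pr E u + pr E ((- 1) *\<^sub>C v)"
    by (rule pr_add[OF assms(1,2) scale_mem[OF assms(3)]])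
  then show ?thesis unfolding pr_scale by simp
qed

text \<open>Equivalently, \<open>A\<close> is a union of dyadic intervals of level \<open>N\<close>,
  as \<open>resolved_eq\<close> shows.\<close>

definition resolved :: "nat \<Rightarrow> real set \<Rightarrow> bool"
  where "resolved N A \<longleftrightarrow> A \<subseteq> {0..<1} \<and> (\<forall>j\<in>level N. dyadic j \<subseteq> A \<or> dyadic j \<inter> A = {})"

definition cells :: "nat \<Rightarrow> real set \<Rightarrow> nat set"
  where "cells N A = {j \<in> level N. dyadic j \<subseteq> A}"

lemma resolved_Suc:
  assumes "resolved N A"
  shows "resolved (Suc N) A"
  unfolding resolved_def
proof (intro conjI ballI)
  show "A \<subseteq> {0..<1}" using assms by (simp add: resolved_def)
  fix j assume j: "j \<in> level (Suc N)"
  have "2 * 1 \<le> 2 * (2::nat) ^ N" by (intro mult_left_mono) simp_all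
  also have "\<dots> \<le> j" using j by simp
  finally have "dyadic j \<subseteq> dyadic (j div 2)" by (intro dyadic_parent) simp
  moreover have "j div 2 \<in> level N" using j by auto
  then have "dyadic (j div 2) \<subseteq> A \<or> dyadic (j div 2) \<inter> A = {}"
    using assms unfolding resolved_def by blast
  ultimately show "dyadic j \<subseteq> A \<or> dyadic j \<inter> A = {}" by blast
qed

lemma resolved_mono: "resolved N A \<Longrightarrow> N \<le> N' \<Longrightarrow> resolved N' A"
  by (rule lift_Suc_mono_le[of "\<lambda>N. resolved N A", THEN le_boolD, THEN mp]) (auto intro: resolved_Suc)

lemma resolved_dyadic: "1 \<le> i \<Longrightarrow> floor_log i \<le> N \<Longrightarrow> resolved N (dyadic i)"
  using dyadic_nested dyadic_bounds unfolding resolved_def by blast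

lemma cells_subset: "cells N A \<subseteq> level N"
  by (auto simp: cells_def)

lemma finite_cells: "finite (cells N A)"
  by (rule finite_subset[OF cells_subset]) simp

lemma cells_ge_1: "j \<in> cells N A \<Longrightarrow> 1 \<le> j"
  using cells_subset level_iff by blast

lemma mu_cell: "j \<in> level N \<Longrightarrow> mu (dyadic j) = (1 / 2) ^ N"
  by (simp only: level_iff mu_dyadic) (simp add: power_one_over)

lemma disjoint_cells: "disjoint_family_on dyadic (cells N A)"
  by (rule disjoint_family_on_mono[OF cells_subset level_disjoint])

lemma resolved_eq:
  assumes "resolved N A"
  shows "(\<Union>j\<in>cells N A. dyadic j) = A"
proof
  show "(\<Union>j\<in>cells N A. dyadic j) \<subseteq> A" by (auto simp: cells_def)
  show "A \<subseteq> (\<Union>j\<in>cells N A. dyadic j)"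
  proof
    fix x assume x: "x \<in> A"
    then have "x \<in> (\<Union>j\<in>level N. dyadic j)"
      using assms unfolding level_Union resolved_def by blast
    then obtain j where j: "j \<in> level N" "x \<in> dyadic j" by blast
    then have "dyadic j \<subseteq> A" using assms x unfolding resolved_def by blast
    then have "j \<in> cells N A" using j(1) unfolding cells_def by blast
    then show "x \<in> (\<Union>j\<in>cells N A. dyadic j)" using j(2) by blast
  qed
qed

lemma resolved_sets:
  assumes "resolved N A"
  shows "A \<in> sets unit_measure"
proof -
  have "(\<Union>j\<in>cells N A. dyadic j) \<in> sets unit_measure"
    by (intro sets.finite_UN[OF finite_cells] dyadic_sets cells_ge_1)
  then show ?thesis by (simp only: resolved_eq[OF assms])
qed

lemma mu_resolved:
  assumes "resolved N A"
  shows "mu A = card (cells N A) * (1 / 2) ^ N"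
proof -
  interpret finite_measure unit_measure by (rule finite_measure_unit)
  have "mu (\<Union>j\<in>cells N A. dyadic j) = (\<Sum>j\<in>cells N A. mu (dyadic j))"
    using cells_ge_1 by (intro finite_measure_finite_Union finite_cells disjoint_cells) auto
  also have "\<dots> = (\<Sum>j\<in>cells N A. (1 / 2) ^ N)"
    using mu_cell cells_subset by (intro sum.cong) blast+
  finally show ?thesis by (simp add: resolved_eq[OF assms])
qed

text \<open>For signs \<open>t\<close> this is the set where the combination of the Haar functions
  of the cells of \<open>A\<close> equals 1; \<open>negative_part\<close> is where it equals
  -1.\<close>

definition positive_part :: "nat \<Rightarrow> (nat \<Rightarrow> complex) \<Rightarrow> real set \<Rightarrow> real set"
  where "positive_part N t A = (\<Union>j\<in>cells N A. if t j = 1 then dyadic (2 * j) else dyadic (2 * j + 1))"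

definition negative_part :: "nat \<Rightarrow> (nat \<Rightarrow> complex) \<Rightarrow> real set \<Rightarrow> real set"
  where "negative_part N t A = (\<Union>j\<in>cells N A. if t j = 1 then dyadic (2 * j + 1) else dyadic (2 * j))"

lemma resolved_union_children:
  assumes B: "\<And>j. j \<in> cells N A \<Longrightarrow> B j = dyadic (2 * j) \<or> B j = dyadic (2 * j + 1)"
  shows "resolved (Suc N) (\<Union>j\<in>cells N A. B j)"
  unfolding resolved_def
proof (intro conjI ballI)
  have lev: "2 * j \<in> level (Suc N)" "2 * j + 1 \<in> level (Suc N)" if "j \<in> cells N A" for j
    using that cells_subset[of N A] by auto
  have Bl: "\<exists>i\<in>level (Suc N). B j = dyadic i" if "j \<in> cells N A" for j
    using B[OF that] lev[OF that] by blast
  show "(\<Union>j\<in>cells N A. B j) \<subseteq> {0..<1}"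
    using Bl level_Union[of "Suc N"] by blast
  fix i assume i: "i \<in> level (Suc N)"
  show "dyadic i \<subseteq> (\<Union>j\<in>cells N A. B j) \<or> dyadic i \<inter> (\<Union>j\<in>cells N A. B j) = {}"
  proof (cases "\<exists>j\<in>cells N A. B j = dyadic i")
    case False
    have "dyadic i \<inter> B j = {}" if j: "j \<in> cells N A" for j
    proof -
      obtain i' where i': "i' \<in> level (Suc N)" "B j = dyadic i'" using Bl[OF j] by auto
      then have "i \<noteq> i'" using False j by auto
      then show ?thesis
        using disjoint_family_onD[OF level_disjoint i i'(1)] i'(2) by simp
    qed
    then show ?thesis by blast
  qed blast
qed

text \<open>Every cell of \<open>A\<close> is cut into its two halves and the signs decide which
  half goes where. The balance on \<open>D\<close> holds because a set resolved at level
  \<open>N\<close> contains or misses each cell.\<close>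

lemma sign_parts:
  assumes A: "resolved N A" and t: "\<And>j. t j = 1 \<or> t j = - 1"
  defines "Ap \<equiv> positive_part N t A" and "Am \<equiv> negative_part N t A"
  shows "resolved (Suc N) Ap" "resolved (Suc N) Am" "Ap \<union> Am = A" "Ap \<inter> Am = {}"
    "ind Ap - ind Am = (\<Sum>j\<in>cells N A. t j *\<^sub>C haar j)"
    "1 \<le> p \<Longrightarrow> u \<in> vectors (Lp p) \<Longrightarrow> pr Ap u - pr Am u = (\<Sum>j\<in>cells N A. t j * haar_pr j u)"
    "resolved N D \<Longrightarrow> mu (Ap \<inter> D) = mu (Am \<inter> D)"
proof -
  define B where "B = (\<lambda>j. if t j = 1 then dyadic (2 * j) else dyadic (2 * j + 1))"
  define B' where "B' = (\<lambda>j. if t j = 1 then dyadic (2 * j + 1) else dyadic (2 * j))"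
  have eqs: "Ap = (\<Union>j\<in>cells N A. B j)" "Am = (\<Union>j\<in>cells N A. B' j)"
    by (simp_all add: Ap_def Am_def positive_part_def negative_part_def B_def B'_def)
  show r: "resolved (Suc N) Ap" "resolved (Suc N) Am"
    unfolding eqs by (rule resolved_union_children; simp add: B_def B'_def)+
  have s: "1 \<le> 2 * j" "1 \<le> 2 * j + 1" if "j \<in> cells N A" for j
    using cells_ge_1[OF that] by auto
  have BB: "B j \<union> B' j = dyadic j" "B j \<inter> B' j = {}" "B j \<in> sets unit_measure" "B' j \<in> sets unit_measure"
    if "j \<in> cells N A" for j
    using dyadic_split[OF cells_ge_1[OF that]] dyadic_sets[OF s(1)[OF that]] dyadic_sets[OF s(2)[OF that]]
    by (auto simp: B_def B'_def)
  show "Ap \<union> Am = A"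
  proof -
    have "Ap \<union> Am = (\<Union>j\<in>cells N A. B j \<union> B' j)" unfolding eqs by blast
    also have "\<dots> = (\<Union>j\<in>cells N A. dyadic j)" using BB(1) by simp
    finally show ?thesis by (simp add: resolved_eq[OF A])
  qed
  have dis: "X i \<inter> X' j = {}" if "i \<in> cells N A" "j \<in> cells N A" "i \<noteq> j" "X i \<subseteq> dyadic i" "X' j \<subseteq> dyadic j" for X X' i j
    using disjoint_family_onD[OF disjoint_cells that(1-3)] that(4,5) by blast
  have sub: "B j \<subseteq> dyadic j" "B' j \<subseteq> dyadic j" if "j \<in> cells N A" for j
    using BB(1)[OF that] by auto
  have "B i \<inter> B' j = {}" if "i \<in> cells N A" "j \<in> cells N A" for i j
    using BB(2) dis[OF that, of B B'] sub that by (cases "i = j") auto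
  then show "Ap \<inter> Am = {}" unfolding eqs by blast
  have d: "disjoint_family_on B (cells N A)" "disjoint_family_on B' (cells N A)"
    using dis sub unfolding disjoint_family_on_def by metis+
  have haarB: "t j *\<^sub>C haar j = ind (B j) - ind (B' j)" for j
    using t[of j] by (auto simp: haar_def B_def B'_def scaleC_one)
  show ht: "ind Ap - ind Am = (\<Sum>j\<in>cells N A. t j *\<^sub>C haar j)"
    unfolding eqs haarB sum_subtractf using BB(3,4) d by (simp only: ind_Union[OF finite_cells])
  show "pr Ap u - pr Am u = (\<Sum>j\<in>cells N A. t j * haar_pr j u)" if p: "1 \<le> p" and u: "u \<in> vectors (Lp p)"
  proof -
    have "t j * haar_pr j u = pr (B j) u - pr (B' j) u" for j
      using t[of j] by (auto simp: haar_pr_def B_def B'_def)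
    then show ?thesis
      unfolding eqs using BB(3,4) d by (simp only: pr_Union[OF p u finite_cells] sum_subtractf)
  qed
  show "mu (Ap \<inter> D) = mu (Am \<inter> D)" if D: "resolved N D"
  proof -
    have Ds: "D \<in> sets unit_measure" by (rule resolved_sets[OF D])
    have z: "pr D (haar j) = 0" if j: "j \<in> cells N A" for j
    proof -
      have "mu (D \<inter> dyadic (2 * j)) = mu (D \<inter> dyadic (2 * j + 1))"
      proof -
        have "j \<in> level N" using j cells_subset by blast
        then have "dyadic j \<subseteq> D \<or> dyadic j \<inter> D = {}" using D unfolding resolved_def by blast
        then show ?thesis
        proof
          assume "dyadic j \<subseteq> D"
          then have "D \<inter> dyadic (2 * j) = dyadic (2 * j)" "D \<inter> dyadic (2 * j + 1) = dyadic (2 * j + 1)"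
            using dyadic_split(1)[OF cells_ge_1[OF j]] by auto
          then show ?thesis using floor_log_double[OF cells_ge_1[OF j]] cells_ge_1[OF j] by (simp add: mu_dyadic)
        next
          assume "dyadic j \<inter> D = {}"
          then have "D \<inter> dyadic (2 * j) = {}" "D \<inter> dyadic (2 * j + 1) = {}"
            using dyadic_split(1)[OF cells_ge_1[OF j]] by auto
          then show ?thesis by simp
        qed
      qed
      then show ?thesis
        unfolding haar_def pr_diff[OF order_refl ind_mem ind_mem]
        by (simp only: pr_ind[OF Ds dyadic_sets[OF s(1)[OF j]]] pr_ind[OF Ds dyadic_sets[OF s(2)[OF j]]] diff_self)
    qed
    have "t j *\<^sub>C haar j \<in> vectors (Lp 1)" for j
      unfolding haar_def by (intro seminormed.scale_mem seminormed.diff_mem seminormed_Lp ind_mem) simp_all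
    then have "pr D (ind Ap - ind Am) = 0"
      unfolding ht by (subst pr_sum[OF order_refl]) (auto simp: pr_scale z)
    then show ?thesis
      unfolding pr_diff[OF order_refl ind_mem ind_mem]
      by (simp add: pr_ind[OF Ds resolved_sets[OF r(1)]] pr_ind[OF Ds resolved_sets[OF r(2)]] Int_commute)
  qed
qed

text \<open>The trace of the matrix of \<open>T\<close> with respect to the Haar functions of one
  level, where the identity has trace 1.\<close>

definition diagonal_sum :: "real \<Rightarrow> nat \<Rightarrow> (fclass \<Rightarrow> fclass) \<Rightarrow> complex"
  where "diagonal_sum p N T = (if T \<in> vectors (operators (Lp p)) then \<Sum>j\<in>level N. haar_pr j (T (haar j)) else 0)"

lemma elem_le_sum_list:
  fixes f :: "'a \<Rightarrow> real"
  assumes "\<And>y. y \<in> set xs \<Longrightarrow> 0 \<le> f y" "x \<in> set xs"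
  shows "f x \<le> (\<Sum>y\<leftarrow>xs. f y)"
  using assms
proof (induction xs)
  case (Cons y xs)
  have "0 \<le> (\<Sum>y\<leftarrow>xs. f y)" by (rule sum_list_nonneg) (use Cons.prems in auto)
  then show ?case using Cons by fastforce
qed simp

lemma sum_list_le_const:
  fixes f :: "'a \<Rightarrow> real" and C :: real
  assumes "\<And>y. y \<in> set xs \<Longrightarrow> f y \<le> C"
  shows "(\<Sum>y\<leftarrow>xs. f y) \<le> length xs * C"
  using assms by (induction xs) (fastforce simp: algebra_simps)+

text \<open>On fine levels the bound \<open>m\<close> for single coefficients tends to 0 while the
  sum of moduli stays bounded, so sums of squares tend to 0.\<close>

lemma sum_squares_le:
  fixes a :: "'i \<Rightarrow> complex"
  assumes "\<And>i. i \<in> I \<Longrightarrow> cmod (a i) \<le> m" "(\<Sum>i\<in>I. cmod (a i)) \<le> s" "0 \<le> m"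
  shows "(\<Sum>i\<in>I. (cmod (a i))\<^sup>2) \<le> m * s"
proof -
  have "(\<Sum>i\<in>I. (cmod (a i))\<^sup>2) \<le> (\<Sum>i\<in>I. m * cmod (a i))"
    using assms(1) by (intro sum_mono) (simp add: power2_eq_square mult_right_mono)
  also have "\<dots> \<le> m * s"
    using assms(2,3) by (simp add: sum_distrib_left[symmetric] mult_left_mono)
  finally show ?thesis .
qed

section \<open>The diagonal functional, its measure, and the tree of splittings\<close>

context
  fixes p :: real
  assumes p: "1 < p"
begin

interpretation Lp: seminormed "Lp p" by (rule sLp[OF p])
interpretation Y: seminormed "operators (Lp p)" by (rule seminormed_bounded_ops[OF sLp[OF p] sLp[OF p]])

lemma haar_pr_add: "u \<in> vectors (Lp p) \<Longrightarrow> v \<in> vectors (Lp p) \<Longrightarrow> haar_pr j (u + v) = haar_pr j u + haar_pr j v"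
  by (simp add: haar_pr_def pr_add[OF p1[OF p]])

lemma haar_pr_scale: "haar_pr j (c *\<^sub>C u) = c * haar_pr j u"
  by (simp add: haar_pr_def pr_scale algebra_simps)

lemma haar_pr_sum: "(\<And>i. i \<in> I \<Longrightarrow> f i \<in> vectors (Lp p)) \<Longrightarrow> haar_pr j (sum f I) = (\<Sum>i\<in>I. haar_pr j (f i))"
  by (simp add: haar_pr_def pr_sum[OF p1[OF p]] sum_subtractf)

lemma p_norm_op:
  assumes "T \<in> vectors (operators (Lp p))" "u \<in> vectors (Lp p)"
  shows "p_norm p (T u) \<le> nrm (operators (Lp p)) T * p_norm p u"
  using op_bound[OF sLp[OF p] sLp[OF p] assms] by (simp add: nrm_Lp)

lemma p_norm_op_haar:
  assumes T: "T \<in> vectors (operators (Lp p))" and j: "j \<in> level N"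
  shows "p_norm p (T (haar j)) \<le> nrm (operators (Lp p)) T * ((1 / 2) ^ N) powr (1 / p)"
proof -
  have "1 \<le> j" using j level_iff by blast
  then have "p_norm p (haar j) \<le> ((1 / 2) ^ N) powr (1 / p)"
    using p_norm_haar_le[OF p, of j] mu_cell[OF j] by simp
  then show ?thesis
    using p_norm_op[OF T haar_mem[OF p]] mult_left_mono[OF _ Y.nrm_nonneg[OF T]] by (meson order_trans)
qed

text \<open>The Haar pairing contributes the exponent \<open>1 - 1 / p\<close> and the norm of the
  Haar function the exponent \<open>1 / p\<close>, so for every \<open>p\<close> an entry is at most
  of the order of the measure of a cell.\<close>

lemma haar_entry_bound:
  assumes T: "T \<in> vectors (operators (Lp p))" and i: "i \<in> level N" and j: "j \<in> level N"
  shows "cmod (haar_pr i (T (haar j))) \<le> nrm (operators (Lp p)) T * (1 / 2) ^ N"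
proof -
  have "1 \<le> i" using i level_iff by blast
  then have "cmod (haar_pr i (T (haar j))) \<le> ((1 / 2) ^ N) powr (1 - 1 / p) * p_norm p (T (haar j))"
    using haar_pr_bound[OF p op_maps[OF T haar_mem[OF p]], of i j] mu_cell[OF i] by simp
  also have "\<dots> \<le> ((1 / 2) ^ N) powr (1 - 1 / p) * (nrm (operators (Lp p)) T * ((1 / 2) ^ N) powr (1 / p))"
    by (intro mult_left_mono p_norm_op_haar[OF T j]) simp
  also have "\<dots> = nrm (operators (Lp p)) T * (((1 / 2) ^ N) powr (1 - 1 / p) * ((1 / 2) ^ N) powr (1 / p))"
    by (simp only: mult_ac)
  also have "((1 / 2 :: real) ^ N) powr (1 - 1 / p) * ((1 / 2) ^ N) powr (1 / p) = (1 / 2) ^ N"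
    by (simp add: powr_add[symmetric])
  finally show ?thesis .
qed

text \<open>Level \<open>N\<close> has \<open>2 ^ N\<close> nodes, which balances the bound
  \<open>(1 / 2) ^ N\<close> for the entries.\<close>

lemma diagonal_sum_bound:
  assumes "T \<in> vectors (operators (Lp p))"
  shows "cmod (diagonal_sum p N T) \<le> 1 * nrm (operators (Lp p)) T"
proof -
  have "cmod (diagonal_sum p N T) \<le> (\<Sum>j\<in>level N. nrm (operators (Lp p)) T * (1 / 2) ^ N)"
    unfolding diagonal_sum_def using assms by (simp only: if_True) (intro sum_norm_le haar_entry_bound)
  also have "\<dots> = nrm (operators (Lp p)) T * (2 ^ N * (1 / 2) ^ N)" by simp
  also have "(2::real) ^ N * (1 / 2) ^ N = 1" by (simp add: power_mult_distrib[symmetric])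
  finally show ?thesis by simp
qed

lemma diagonal_sum_dual: "diagonal_sum p N \<in> vectors (dual (operators (Lp p)))"
proof (rule dualI[OF Y.seminormed_axioms _ _ _ diagonal_sum_bound])
  show "diagonal_sum p N T = 0" if "T \<notin> vectors (operators (Lp p))" for T
    using that by (simp add: diagonal_sum_def)
  show "diagonal_sum p N (T + S) = diagonal_sum p N T + diagonal_sum p N S"
    if "T \<in> vectors (operators (Lp p))" "S \<in> vectors (operators (Lp p))" for T S
    using that op_maps[OF that(1) haar_mem[OF p]] op_maps[OF that(2) haar_mem[OF p]]
    by (simp add: diagonal_sum_def Y.add_mem haar_pr_add sum.distrib)
  show "diagonal_sum p N (c *\<^sub>C T) = c * diagonal_sum p N T" if "T \<in> vectors (operators (Lp p))" for c T
    using that by (simp add: diagonal_sum_def Y.scale_mem scaleC_apply haar_pr_scale sum_distrib_left)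
qed

text \<open>Multiplication by the indicator of a resolved set keeps or deletes whole cells.\<close>

lemma diagonal_sum_restr:
  assumes A: "resolved N A" and K: "K \<in> vectors (operators (Lp p))"
  shows "diagonal_sum p N (restr_op p A \<circ> K) = (\<Sum>j\<in>cells N A. haar_pr j (K (haar j)))"
proof -
  have m: "restr_op p A \<circ> K \<in> vectors (operators (Lp p))"
    by (rule op_comp_mem[OF sLp[OF p] sLp[OF p] sLp[OF p] K restr_op_mem[OF p resolved_sets[OF A]]])
  have "haar_pr j ((restr_op p A \<circ> K) (haar j)) = (if dyadic j \<subseteq> A then haar_pr j (K (haar j)) else 0)" if j: "j \<in> level N" for j
  proof -
    have j1: "1 \<le> j" using j level_iff by blast
    have s: "1 \<le> 2 * j" "1 \<le> 2 * j + 1" using j1 by auto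
    have sub: "dyadic (2 * j) \<subseteq> dyadic j" "dyadic (2 * j + 1) \<subseteq> dyadic j" using dyadic_split(1)[OF j1] by auto
    have r: "(restr_op p A \<circ> K) (haar j) = restr A (K (haar j))"
      by (simp add: restr_op_def op_maps[OF K haar_mem[OF p]])
    have h: "haar_pr j (restr A v) = pr (dyadic (2 * j) \<inter> A) v - pr (dyadic (2 * j + 1) \<inter> A) v" for v
      unfolding haar_pr_def pr_restr[OF dyadic_sets[OF s(1)] resolved_sets[OF A]] pr_restr[OF dyadic_sets[OF s(2)] resolved_sets[OF A]] ..
    have "dyadic j \<subseteq> A \<or> dyadic j \<inter> A = {}" using A j unfolding resolved_def by blast
    then show ?thesis
    proof
      assume jA: "dyadic j \<subseteq> A"
      then have "dyadic (2 * j) \<inter> A = dyadic (2 * j)" "dyadic (2 * j + 1) \<inter> A = dyadic (2 * j + 1)" using sub by auto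
      then show ?thesis unfolding r h using jA by (simp add: haar_pr_def)
    next
      assume jA: "dyadic j \<inter> A = {}"
      then have e: "dyadic (2 * j) \<inter> A = {}" "dyadic (2 * j + 1) \<inter> A = {}" using sub by auto
      have "\<not> dyadic j \<subseteq> A" using jA mu_dyadic_pos[OF j1] by (auto simp: Int_absorb2)
      then show ?thesis unfolding r h e by simp
    qed
  qed
  then have "diagonal_sum p N (restr_op p A \<circ> K) = (\<Sum>j\<in>level N. if dyadic j \<subseteq> A then haar_pr j (K (haar j)) else 0)"
    unfolding diagonal_sum_def if_P[OF m] by (intro sum.cong refl)
  also have "\<dots> = (\<Sum>j\<in>cells N A. haar_pr j (K (haar j)))"
    unfolding cells_def by (rule sum.inter_filter[symmetric]) simp
  finally show ?thesis .
qed

context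
  fixes \<Psi> :: "(fclass \<Rightarrow> fclass) \<Rightarrow> complex" and F :: "nat filter" and K :: "fclass \<Rightarrow> fclass"
  assumes Psi: "\<Psi> \<in> vectors (dual (operators (Lp p)))" and F: "F \<noteq> bot" "F \<le> sequentially"
    and lim: "\<And>T. ((\<lambda>N. diagonal_sum p N T) \<longlongrightarrow> \<Psi> T) F"
    and K: "K \<in> vectors (operators (Lp p))"
begin

text \<open>A finitely additive measure that distributes \<open>\<Psi> K\<close> over the interval;
  its densities on the nodes become the diagonal entries of \<open>K\<close> along the tree.\<close>

definition diagonal_measure :: "real set \<Rightarrow> complex"
  where "diagonal_measure A = \<Psi> (restr_op p A \<circ> K)"

lemma restr_op_comp_mem: "A \<in> sets unit_measure \<Longrightarrow> restr_op p A \<circ> K \<in> vectors (operators (Lp p))"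
  by (rule op_comp_mem[OF sLp[OF p] sLp[OF p] sLp[OF p] K restr_op_mem[OF p]])

lemma diagonal_measure_Un:
  assumes "A \<in> sets unit_measure" "B \<in> sets unit_measure" "A \<inter> B = {}"
  shows "diagonal_measure (A \<union> B) = diagonal_measure A + diagonal_measure B"
proof -
  have "restr_op p (A \<union> B) \<circ> K = (restr_op p A \<circ> K) + (restr_op p B \<circ> K)"
    by (rule ext) (simp add: restr_op_def restr_Un[OF assms])
  then show ?thesis
    unfolding diagonal_measure_def using op_add[OF Psi restr_op_comp_mem[OF assms(1)] restr_op_comp_mem[OF assms(2)]] by simp
qed

lemma diagonal_measure_Union:
  assumes "finite I" "\<And>i. i \<in> I \<Longrightarrow> E i \<in> sets unit_measure" "disjoint_family_on E I"
  shows "diagonal_measure (\<Union>i\<in>I. E i) = (\<Sum>i\<in>I. diagonal_measure (E i))"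
  using assms
proof (induction I)
  case empty
  have "restr_op p {} \<circ> K = 0" by (rule ext) (simp add: restr_op_def)
  then show ?case
    using op_zero[OF Y.seminormed_axioms seminormed_scalar_field Psi] by (simp add: diagonal_measure_def)
next
  case (insert i I)
  have "diagonal_measure (E i \<union> (\<Union>i\<in>I. E i)) = diagonal_measure (E i) + diagonal_measure (\<Union>i\<in>I. E i)"
    using insert by (intro diagonal_measure_Un sets.finite_UN) (auto simp: disjoint_family_on_def)
  then show ?case
    using insert by (simp add: disjoint_family_on_def)
qed

text \<open>\<open>F\<close> lies below \<open>sequentially\<close>, so only levels beyond
  \<open>N\<close> count; there \<open>A\<close> is a union of cells, each contributing at most the
  norm of \<open>K\<close> times its measure.\<close>

lemma diagonal_measure_bound:
  assumes A: "resolved N A"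
  shows "cmod (diagonal_measure A) \<le> nrm (operators (Lp p)) K * mu A"
  unfolding diagonal_measure_def
proof (rule tendsto_upperbound[OF tendsto_norm[OF lim] _ F(1)])
  have "cmod (diagonal_sum p N' (restr_op p A \<circ> K)) \<le> nrm (operators (Lp p)) K * mu A" if N': "N' \<ge> N" for N'
  proof -
    have A': "resolved N' A" by (rule resolved_mono[OF A N'])
    have "cmod (diagonal_sum p N' (restr_op p A \<circ> K)) \<le> (\<Sum>j\<in>cells N' A. nrm (operators (Lp p)) K * (1 / 2) ^ N')"
      unfolding diagonal_sum_restr[OF A' K] by (intro sum_norm_le haar_entry_bound[OF K]) (use cells_subset in blast)+
    also have "\<dots> = nrm (operators (Lp p)) K * mu A"
      by (simp add: mu_resolved[OF A'])
    finally show ?thesis .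
  qed
  then have "\<forall>\<^sub>F N in sequentially. cmod (diagonal_sum p N (restr_op p A \<circ> K)) \<le> nrm (operators (Lp p)) K * mu A"
    by (rule eventually_sequentiallyI)
  then show "\<forall>\<^sub>F N in F. cmod (diagonal_sum p N (restr_op p A \<circ> K)) \<le> nrm (operators (Lp p)) K * mu A"
    using F(2) filter_leD by blast
qed

text \<open>
  \<open>A\<close> is split according to a sign combination of the Haar functions of a fine level inside \<open>A\<close>.  For random
  signs the mean squares of all the quantities to be made small tend to \<open>0\<close> with the level.
\<close>

lemma splitting:
  assumes A: "resolved N0 A" and Es: "\<And>E. E \<in> set Es \<Longrightarrow> E \<in> sets unit_measure" and tau: "\<tau> > 0"
  shows "\<exists>Ap Am N. resolved N Ap \<and> resolved N Am \<and> Ap \<union> Am = A \<and> Ap \<inter> Am = {} \<and> mu Ap = mu Am \<and>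
    (\<forall>m. 1 \<le> m \<and> m \<le> M \<longrightarrow> mu (Ap \<inter> dyadic m) = mu (Am \<inter> dyadic m)) \<and>
    (\<forall>E\<in>set Es. cmod (pr Ap (K (ind E)) - pr Am (K (ind E))) \<le> \<tau> \<and> cmod (pr E (K (ind Ap - ind Am))) \<le> \<tau>) \<and>
    cmod (pr Ap (K (ind Ap - ind Am)) - pr Am (K (ind Ap - ind Am)) - diagonal_measure A) \<le> \<tau> \<and>
    cmod (diagonal_measure Ap - diagonal_measure Am) \<le> \<tau>"
proof -
  define C where "C = nrm (operators (Lp p)) K"
  have C: "0 \<le> C" unfolding C_def by (rule Y.nrm_nonneg[OF K])
  define r where "r = (\<lambda>N. (1 / 2 :: real) ^ N)"
  have r: "0 < r N" "r N \<le> 1" for N by (auto simp: r_def power_le_one)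
  \<comment> \<open>A bound for the mean of all squared errors: one term each for rows and columns
    against \<open>Es\<close>, one for the diagonal measure, and the off-diagonal form with the
    factor 2 of \<open>random_signs_small\<close>.\<close>
  define bnd where "bnd = (\<lambda>N. (length Es * (r N powr (1 - 1 / p) * C * C) + (length Es * (r N powr (1 / p) * C * C) + C * r N * C))
    + 2 * (C * r N powr (1 / p) * C))"
  have r0: "r \<longlonglongrightarrow> 0" unfolding r_def by (rule LIMSEQ_power_zero) simp
  have "bnd \<longlonglongrightarrow> (length Es * (0 powr (1 - 1 / p) * C * C) + (length Es * (0 powr (1 / p) * C * C) + C * 0 * C)) + 2 * (C * 0 powr (1 / p) * C)"
    unfolding bnd_def using p r less_imp_le[OF r(1)] by (intro tendsto_intros tendsto_powr2 r0) (auto intro!: always_eventually)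
  then have "bnd \<longlonglongrightarrow> 0" by simp
  then have "\<forall>\<^sub>F N in sequentially. bnd N < (\<tau> / 2)\<^sup>2"
    by (rule order_tendstoD) (use tau in simp)
  then have ev1: "\<forall>\<^sub>F N in F. bnd N < (\<tau> / 2)\<^sup>2" using F(2) filter_leD by blast
  have ev2: "\<forall>\<^sub>F N in F. N \<ge> max N0 M"
    using F(2) filter_leD eventually_ge_at_top by blast
  \<comment> \<open>Half of \<open>\<tau>\<close> pays for replacing \<open>\<Psi>\<close> by the
    trace on level \<open>N\<close>, the other half for the off-diagonal form.\<close>
  have ev3: "\<forall>\<^sub>F N in F. dist (diagonal_sum p N (restr_op p A \<circ> K)) (\<Psi> (restr_op p A \<circ> K)) < \<tau> / 2"
    by (rule tendstoD[OF lim]) (use tau in simp)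
  obtain N where N: "bnd N < (\<tau> / 2)\<^sup>2" "N \<ge> N0" "N \<ge> M"
    "dist (diagonal_sum p N (restr_op p A \<circ> K)) (\<Psi> (restr_op p A \<circ> K)) < \<tau> / 2"
    using eventually_happens[OF eventually_conj[OF ev1 eventually_conj[OF ev2 ev3]]] F(1) by auto
  have AN: "resolved N A" by (rule resolved_mono[OF A N(2)])
  define L where "L = cells N A"
  have LF: "finite L" "L \<subseteq> level N" unfolding L_def by (rule finite_cells, rule cells_subset)
  have hm: "K (haar j) \<in> vectors (Lp p)" for j by (rule op_maps[OF K haar_mem[OF p]])
  define a1 where "a1 = (\<lambda>E j. haar_pr j (K (ind E)))"
  define a2 where "a2 = (\<lambda>E j. pr E (K (haar j)))"
  define \<alpha> where "\<alpha> = (\<lambda>j. diagonal_measure (dyadic (2 * j)) - diagonal_measure (dyadic (2 * j + 1)))"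
  define b where "b = (\<lambda>i j. haar_pr i (K (haar j)))"
  have card: "real (card L) * r N \<le> 1"
    using mu_resolved[OF AN] mu_le_1[of A] by (simp add: L_def r_def)
  have ind1: "p_norm p (ind E) \<le> 1" if "E \<in> set Es" for E
    using p_norm_ind[OF p1[OF p] Es[OF that]] mu_le_1[of E] p by (simp add: powr_le1)
  have Kind: "p_norm p (K (ind E)) \<le> C" if "E \<in> set Es" for E
    using p_norm_op[OF K ind_mem[of E]] mult_left_mono[OF ind1[OF that] C] by (simp add: C_def)
  have s1: "(\<Sum>j\<in>L. (cmod (a1 E j))\<^sup>2) \<le> r N powr (1 - 1 / p) * C * C" if E: "E \<in> set Es" for E
  proof (rule sum_squares_le)
    have KE: "K (ind E) \<in> vectors (Lp p)" by (rule op_maps[OF K ind_mem])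
    fix j assume "j \<in> L"
    then have jl: "j \<in> level N" using LF(2) by blast
    then have j1: "1 \<le> j" using level_iff by blast
    have "cmod (a1 E j) \<le> r N powr (1 - 1 / p) * p_norm p (K (ind E))"
      using haar_pr_bound[OF p KE j1] mu_cell[OF jl] by (simp add: a1_def r_def)
    also have "\<dots> \<le> r N powr (1 - 1 / p) * C" by (intro mult_left_mono Kind[OF E]) simp
    finally show "cmod (a1 E j) \<le> r N powr (1 - 1 / p) * C" .
  next
    show "(\<Sum>j\<in>L. cmod (a1 E j)) \<le> C"
      using sum_haar_pr_le[OF p op_maps[OF K ind_mem] LF(2), of E] Kind[OF E] by (simp add: a1_def)
  qed (use C in simp)
  have s2: "(\<Sum>j\<in>L. (cmod (a2 E j))\<^sup>2) \<le> r N powr (1 / p) * C * C" if E: "E \<in> set Es" for E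
  proof (rule sum_squares_le)
    have prE: "cmod (pr E v) \<le> p_norm p v" if v: "v \<in> vectors (Lp p)" for v
    proof -
      have "cmod (pr E v) \<le> p_norm 1 (restr E v)" by (rule pr_bound_L1)
      also have "\<dots> \<le> p_norm p (restr E v)" by (rule p_norm_1_le[OF p restr_mem[OF v]])
      also have "\<dots> \<le> p_norm p v" by (rule p_norm_restr_le[OF p1[OF p] v Es[OF E]])
      finally show ?thesis .
    qed
    fix j assume "j \<in> L"
    then have jl: "j \<in> level N" using LF(2) by blast
    show "cmod (a2 E j) \<le> r N powr (1 / p) * C"
      using prE[OF hm] p_norm_op_haar[OF K jl] by (simp add: a2_def r_def C_def mult.commute order_trans[of _ "p_norm p (K (haar j))"])
  next
    have prE: "cmod (pr E v) \<le> p_norm p v" if v: "v \<in> vectors (Lp p)" for v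
    proof -
      have "cmod (pr E v) \<le> p_norm 1 (restr E v)" by (rule pr_bound_L1)
      also have "\<dots> \<le> p_norm p (restr E v)" by (rule p_norm_1_le[OF p restr_mem[OF v]])
      also have "\<dots> \<le> p_norm p v" by (rule p_norm_restr_le[OF p1[OF p] v Es[OF E]])
      finally show ?thesis .
    qed
    \<comment> \<open>Coefficients that rotate every \<open>a2 E j\<close> to its modulus turn the
      sum of moduli into one pairing with the image of a Haar sum of norm at most 1.\<close>
    define u where "u = (\<lambda>j. cnj (sgn (a2 E j)))"
    have u: "cmod (u j) \<le> 1" "u j * a2 E j = of_real (cmod (a2 E j))" for j
    proof -
      show "cmod (u j) \<le> 1" by (simp add: u_def norm_sgn)
      show "u j * a2 E j = of_real (cmod (a2 E j))"
        by (simp add: u_def sgn_eq mult.commute[of "cnj _"] complex_norm_square[symmetric] power2_eq_square)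
    qed
    have um: "(\<Sum>j\<in>L. u j *\<^sub>C haar j) \<in> vectors (Lp p)"
      by (intro Lp.sum_mem Lp.scale_mem haar_mem[OF p])
    have "pr E (K (\<Sum>j\<in>L. u j *\<^sub>C haar j)) = (\<Sum>j\<in>L. u j * a2 E j)"
      by (simp add: op_sum[OF sLp[OF p] sLp[OF p] K] Lp.scale_mem haar_mem[OF p] op_scale[OF K haar_mem[OF p]]
          pr_sum[OF p1[OF p]] hm pr_scale a2_def)
    also have "\<dots> = of_real (\<Sum>j\<in>L. cmod (a2 E j))" by (simp add: u(2))
    finally have "(\<Sum>j\<in>L. cmod (a2 E j)) = cmod (pr E (K (\<Sum>j\<in>L. u j *\<^sub>C haar j)))"
      by (simp add: sum_nonneg del: of_real_sum)
    also have "\<dots> \<le> p_norm p (K (\<Sum>j\<in>L. u j *\<^sub>C haar j))" by (rule prE[OF op_maps[OF K um]])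
    also have "\<dots> \<le> C * p_norm p (\<Sum>j\<in>L. u j *\<^sub>C haar j)" unfolding C_def by (rule p_norm_op[OF K um])
    also have "\<dots> \<le> C * 1"
    proof (rule mult_left_mono[OF _ C])
      have "(\<Sum>j\<in>L. mu (dyadic j)) = real (card L) * r N"
        using mu_cell LF(2) by (subst sum.cong[of L L _ "\<lambda>_. r N"]) (auto simp: r_def simp del: atLeastLessThan_iff)
      then have "(\<Sum>j\<in>L. mu (dyadic j)) powr (1 / p) \<le> 1"
        using card p r(1)[of N] by (intro powr_le1) (auto simp: abs_mult)
      then show "p_norm p (\<Sum>j\<in>L. u j *\<^sub>C haar j) \<le> 1"
        using p_norm_haar_sum_le[OF p LF(2), of u, OF u(1)] by simp
    qed
    finally show "(\<Sum>j\<in>L. cmod (a2 E j)) \<le> C" by simp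
  qed (use C in simp)
  have s3: "(\<Sum>j\<in>L. (cmod (\<alpha> j))\<^sup>2) \<le> C * r N * C"
  proof (rule sum_squares_le)
    have al: "cmod (\<alpha> j) \<le> C * r N" if jL: "j \<in> L" for j
    proof -
      have jl: "j \<in> level N" using jL LF(2) by blast
      have j1: "1 \<le> j" "floor_log j = N" using jl level_iff by blast+
      have "cmod (diagonal_measure (dyadic (2 * j))) \<le> C * mu (dyadic (2 * j))"
        "cmod (diagonal_measure (dyadic (2 * j + 1))) \<le> C * mu (dyadic (2 * j + 1))"
        unfolding C_def using j1 by (intro diagonal_measure_bound[OF resolved_dyadic[OF _ order_refl]]; simp)+
      moreover have "mu (dyadic (2 * j)) + mu (dyadic (2 * j + 1)) = r N"
        using j1 floor_log_double[OF j1(1)] by (simp add: mu_dyadic r_def power_one_over)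
      then have "C * mu (dyadic (2 * j)) + C * mu (dyadic (2 * j + 1)) = C * r N"
        by (simp only: distrib_left[symmetric])
      ultimately show ?thesis
        using norm_triangle_ineq4[of "diagonal_measure (dyadic (2 * j))" "diagonal_measure (dyadic (2 * j + 1))"]
        unfolding \<alpha>_def by linarith
    qed
    then show "cmod (\<alpha> j) \<le> C * r N" if "j \<in> L" for j using that .
    have "(\<Sum>j\<in>L. cmod (\<alpha> j)) \<le> (\<Sum>j\<in>L. C * r N)" by (rule sum_mono[OF al])
    also have "\<dots> = C * (real (card L) * r N)" by simp
    also have "\<dots> \<le> C * 1" by (rule mult_left_mono[OF card C])
    finally show "(\<Sum>j\<in>L. cmod (\<alpha> j)) \<le> C" by simp
  qed (intro mult_nonneg_nonneg C less_imp_le[OF r(1)])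
  \<comment> \<open>\<open>sum_squares_le\<close> is applied to each column. There are at most
    \<open>1 / r N\<close> columns, which cancels one factor \<open>r N\<close>.\<close>
  have s4: "(\<Sum>i\<in>L. \<Sum>j\<in>L - {i}. (cmod (b i j))\<^sup>2) \<le> C * r N powr (1 / p) * C"
  proof -
    have "(\<Sum>i\<in>L. \<Sum>j\<in>L - {i}. (cmod (b i j))\<^sup>2) \<le> (\<Sum>i\<in>L. \<Sum>j\<in>L. (cmod (b i j))\<^sup>2)"
      using LF(1) by (intro sum_mono sum_mono2) auto
    also have "\<dots> = (\<Sum>j\<in>L. \<Sum>i\<in>L. (cmod (b i j))\<^sup>2)" by (rule sum.swap)
    also have "\<dots> \<le> (\<Sum>j\<in>L. (C * r N) * (C * r N powr (1 / p)))"
    proof (rule sum_mono)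
      fix j assume "j \<in> L"
      then have jl: "j \<in> level N" using LF(2) by blast
      show "(\<Sum>i\<in>L. (cmod (b i j))\<^sup>2) \<le> (C * r N) * (C * r N powr (1 / p))"
      proof (rule sum_squares_le)
        show "cmod (b i j) \<le> C * r N" if "i \<in> L" for i
          using haar_entry_bound[OF K _ jl, of i] that LF(2) by (auto simp: b_def C_def r_def simp del: atLeastLessThan_iff)
        show "(\<Sum>i\<in>L. cmod (b i j)) \<le> C * r N powr (1 / p)"
          using sum_haar_pr_le[OF p hm LF(2), of j] p_norm_op_haar[OF K jl] by (simp add: b_def C_def r_def)
      qed (intro mult_nonneg_nonneg C less_imp_le[OF r(1)])
    qed
    also have "\<dots> = (real (card L) * r N) * (C * (C * r N powr (1 / p)))" by simp
    also have "\<dots> \<le> 1 * (C * (C * r N powr (1 / p)))"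
      using card C by (intro mult_right_mono) auto
    finally show ?thesis by (simp add: mult_ac)
  qed
  define as where "as = map a1 Es @ map a2 Es @ [\<alpha>]"
  obtain t where t: "\<And>i. t i = 1 \<or> t i = - 1"
    "(\<Sum>a\<leftarrow>as. (cmod (\<Sum>i\<in>L. t i * a i))\<^sup>2) + (cmod (\<Sum>i\<in>L. \<Sum>j\<in>L - {i}. t i * t j * b i j))\<^sup>2
    \<le> (\<Sum>a\<leftarrow>as. \<Sum>i\<in>L. (cmod (a i))\<^sup>2) + 2 * (\<Sum>i\<in>L. \<Sum>j\<in>L - {i}. (cmod (b i j))\<^sup>2)"
    using random_signs_small[OF LF(1), of as b] by blast
  have "(\<Sum>a\<leftarrow>as. \<Sum>i\<in>L. (cmod (a i))\<^sup>2) = (\<Sum>E\<leftarrow>Es. \<Sum>i\<in>L. (cmod (a1 E i))\<^sup>2) + ((\<Sum>E\<leftarrow>Es. \<Sum>i\<in>L. (cmod (a2 E i))\<^sup>2) + (\<Sum>i\<in>L. (cmod (\<alpha> i))\<^sup>2))"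
    by (simp add: as_def o_def)
  also have "\<dots> \<le> length Es * (r N powr (1 - 1 / p) * C * C) + (length Es * (r N powr (1 / p) * C * C) + C * r N * C)"
    by (rule add_mono[OF sum_list_le_const[where f = "\<lambda>E. \<Sum>i\<in>L. (cmod (a1 E i))\<^sup>2", OF s1]
      add_mono[OF sum_list_le_const[where f = "\<lambda>E. \<Sum>i\<in>L. (cmod (a2 E i))\<^sup>2", OF s2] s3]])
  finally have "(\<Sum>a\<leftarrow>as. \<Sum>i\<in>L. (cmod (a i))\<^sup>2) + 2 * (\<Sum>i\<in>L. \<Sum>j\<in>L - {i}. (cmod (b i j))\<^sup>2) \<le> bnd N"
    unfolding bnd_def using s4 by (intro add_mono mult_left_mono) auto
  then have tot: "(\<Sum>a\<leftarrow>as. (cmod (\<Sum>i\<in>L. t i * a i))\<^sup>2) + (cmod (\<Sum>i\<in>L. \<Sum>j\<in>L - {i}. t i * t j * b i j))\<^sup>2 \<le> (\<tau> / 2)\<^sup>2"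
    using t(2) N(1) by linarith
  have nn: "0 \<le> (\<Sum>a\<leftarrow>as. (cmod (\<Sum>i\<in>L. t i * a i))\<^sup>2)" by (rule sum_list_nonneg) auto
  have small: "cmod (\<Sum>i\<in>L. t i * a i) \<le> \<tau>" if "a \<in> set as" for a
  proof -
    have "(cmod (\<Sum>i\<in>L. t i * a i))\<^sup>2 \<le> (\<Sum>a\<leftarrow>as. (cmod (\<Sum>i\<in>L. t i * a i))\<^sup>2)"
      by (rule elem_le_sum_list[OF _ that]) simp
    also have "\<dots> \<le> (\<tau> / 2)\<^sup>2"
      using tot zero_le_power2[of "cmod (\<Sum>i\<in>L. \<Sum>j\<in>L - {i}. t i * t j * b i j)"] by linarith
    finally have "cmod (\<Sum>i\<in>L. t i * a i) \<le> \<tau> / 2"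
      by (rule power2_le_imp_le) (use tau in simp)
    then show ?thesis using tau by linarith
  qed
  have off: "cmod (\<Sum>i\<in>L. \<Sum>j\<in>L - {i}. t i * t j * b i j) \<le> \<tau> / 2"
  proof (rule power2_le_imp_le)
    show "(cmod (\<Sum>i\<in>L. \<Sum>j\<in>L - {i}. t i * t j * b i j))\<^sup>2 \<le> (\<tau> / 2)\<^sup>2" using tot nn by linarith
  qed (use tau in simp)
  define Ap where "Ap = positive_part N t A"
  define Am where "Am = negative_part N t A"
  note parts = sign_parts[where N = N and A = A and t = t, OF AN t(1), folded Ap_def Am_def L_def]
  have h: "ind Ap - ind Am = (\<Sum>j\<in>L. t j *\<^sub>C haar j)" by (rule parts(5))
  have hpr: "pr Ap u - pr Am u = (\<Sum>j\<in>L. t j * haar_pr j u)" if "u \<in> vectors (Lp p)" for u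
    by (rule parts(6)[OF p1[OF p] that])
  have Kh: "K (ind Ap - ind Am) = (\<Sum>j\<in>L. t j *\<^sub>C K (haar j))"
    unfolding h by (simp add: op_sum[OF sLp[OF p] sLp[OF p] K] Lp.scale_mem haar_mem[OF p] op_scale[OF K haar_mem[OF p]])
  have Khm: "K (ind Ap - ind Am) \<in> vectors (Lp p)" by (intro op_maps[OF K] Lp.diff_mem ind_mem)
  have c1: "cmod (pr Ap (K (ind E)) - pr Am (K (ind E))) \<le> \<tau>" if "E \<in> set Es" for E
    using small[of "a1 E"] that unfolding hpr[OF op_maps[OF K ind_mem]] by (simp add: as_def a1_def)
  have c2: "cmod (pr E (K (ind Ap - ind Am))) \<le> \<tau>" if "E \<in> set Es" for E
    using small[of "a2 E"] that unfolding Kh by (simp add: as_def a2_def pr_sum[OF p1[OF p]] Lp.scale_mem hm pr_scale)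
  have "pr Ap (K (ind Ap - ind Am)) - pr Am (K (ind Ap - ind Am)) = (\<Sum>i\<in>L. \<Sum>j\<in>L. t i * t j * b i j)"
    unfolding hpr[OF Khm] unfolding Kh
    by (simp add: haar_pr_sum Lp.scale_mem hm haar_pr_scale sum_distrib_left b_def mult.assoc)
  \<comment> \<open>The diagonal terms do not depend on the signs, since each sign has square 1;
    they add up to the trace over \<open>A\<close>, which is close to the diagonal measure.\<close>
  also have "\<dots> = (\<Sum>i\<in>L. t i * t i * b i i + (\<Sum>j\<in>L - {i}. t i * t j * b i j))"
    by (intro sum.cong refl sum.remove[OF LF(1)])
  also have "\<dots> = (\<Sum>i\<in>L. b i i) + (\<Sum>i\<in>L. \<Sum>j\<in>L - {i}. t i * t j * b i j)"
  proof -
    have "t i * t i = 1" for i using t(1)[of i] by auto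
    then show ?thesis by (simp add: sum.distrib)
  qed
  also have "(\<Sum>i\<in>L. b i i) = diagonal_sum p N (restr_op p A \<circ> K)"
    by (simp add: diagonal_sum_restr[OF AN K] b_def L_def)
  finally have q: "pr Ap (K (ind Ap - ind Am)) - pr Am (K (ind Ap - ind Am)) - diagonal_measure A
      = (diagonal_sum p N (restr_op p A \<circ> K) - \<Psi> (restr_op p A \<circ> K)) + (\<Sum>i\<in>L. \<Sum>j\<in>L - {i}. t i * t j * b i j)"
    by (simp add: diagonal_measure_def)
  have c3: "cmod (pr Ap (K (ind Ap - ind Am)) - pr Am (K (ind Ap - ind Am)) - diagonal_measure A) \<le> \<tau>"
    unfolding q using norm_triangle_ineq[of "diagonal_sum p N (restr_op p A \<circ> K) - \<Psi> (restr_op p A \<circ> K)"] off N(4)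
    by (smt (verit) dist_norm field_sum_of_halves)
  have c4: "cmod (diagonal_measure Ap - diagonal_measure Am) \<le> \<tau>"
  proof -
    have j1: "1 \<le> j" if "j \<in> L" for j using that cells_ge_1 unfolding L_def by blast
    define B where "B = (\<lambda>j. if t j = 1 then dyadic (2 * j) else dyadic (2 * j + 1))"
    define B' where "B' = (\<lambda>j. if t j = 1 then dyadic (2 * j + 1) else dyadic (2 * j))"
    have BB: "B j \<subseteq> dyadic j" "B' j \<subseteq> dyadic j" "B j \<in> sets unit_measure" "B' j \<in> sets unit_measure" if "j \<in> L" for j
      using dyadic_split(1)[OF j1[OF that]] dyadic_sets[of "2 * j"] dyadic_sets[of "2 * j + 1"] j1[OF that]
      by (auto simp: B_def B'_def)
    have dL: "disjoint_family_on dyadic L" unfolding L_def by (rule disjoint_cells)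
    have d: "disjoint_family_on B L" "disjoint_family_on B' L"
      using dL BB(1,2) unfolding disjoint_family_on_def by blast+
    have "diagonal_measure Ap - diagonal_measure Am = (\<Sum>j\<in>L. diagonal_measure (B j) - diagonal_measure (B' j))"
      unfolding Ap_def Am_def positive_part_def negative_part_def L_def[symmetric] B_def[symmetric] B'_def[symmetric] sum_subtractf
      using BB(3,4) d by (simp only: diagonal_measure_Union[OF LF(1)])
    also have "\<dots> = (\<Sum>j\<in>L. t j * \<alpha> j)"
    proof (rule sum.cong[OF refl])
      fix j
      show "diagonal_measure (B j) - diagonal_measure (B' j) = t j * \<alpha> j"
        using t(1)[of j] by (auto simp: B_def B'_def \<alpha>_def)
    qed
    finally show ?thesis using small[of \<alpha>] by (simp add: as_def)
  qed
  have bal: "mu (Ap \<inter> dyadic m) = mu (Am \<inter> dyadic m)" if "1 \<le> m" "m \<le> M" for m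
  proof (rule parts(7))
    have "(2::nat) ^ floor_log m \<le> m" using that by (intro floor_log_exp2_le) simp
    then have "floor_log m \<le> m" using less_exp[of "floor_log m"] by linarith
    then show "resolved N (dyadic m)" using that N(3) by (intro resolved_dyadic) auto
  qed
  have half: "mu Ap = mu Am"
  proof -
    have u: "resolved N {0..<1}"
      using resolved_dyadic[of 1 N] dyadic_1 by simp
    have "Ap \<inter> {0..<1} = Ap" "Am \<inter> {0..<1} = Am" using parts(1,2) unfolding resolved_def by blast+
    then show ?thesis using parts(7)[OF u] by simp
  qed
  show ?thesis
    using parts(1-4) half bal c1 c2 c3 c4 by blast
qed

text \<open>The indices \<open>{k..<2 * k}\<close> are the leaves just before node \<open>k\<close>
  is split, the node \<open>k\<close> itself included.\<close>

definition good_split :: "(nat \<Rightarrow> real) \<Rightarrow> nat \<Rightarrow> (nat \<Rightarrow> real set) \<Rightarrow> bool"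
  where "good_split \<tau> k A \<longleftrightarrow> A (2 * k) \<union> A (2 * k + 1) = A k \<and> A (2 * k) \<inter> A (2 * k + 1) = {} \<and>
    mu (A (2 * k)) = mu (A (2 * k + 1)) \<and>
    (\<forall>m. 1 \<le> m \<and> m \<le> k \<longrightarrow> mu (A (2 * k) \<inter> dyadic m) = mu (A (2 * k + 1) \<inter> dyadic m)) \<and>
    (\<forall>j\<in>{k..<2 * k}. cmod (pr (A (2 * k)) (K (ind (A j))) - pr (A (2 * k + 1)) (K (ind (A j)))) \<le> \<tau> k \<and>
      cmod (pr (A j) (K (ind (A (2 * k)) - ind (A (2 * k + 1))))) \<le> \<tau> k) \<and>
    cmod (pr (A (2 * k)) (K (ind (A (2 * k)) - ind (A (2 * k + 1))))
      - pr (A (2 * k + 1)) (K (ind (A (2 * k)) - ind (A (2 * k + 1)))) - diagonal_measure (A k)) \<le> \<tau> k \<and>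
    cmod (diagonal_measure (A (2 * k)) - diagonal_measure (A (2 * k + 1))) \<le> \<tau> k"

lemma good_split_cong:
  assumes "\<And>j. j < 2 * Suc k \<Longrightarrow> A j = B j" "good_split \<tau> k A" "1 \<le> k"
  shows "good_split \<tau> k B"
proof -
  have e: "A (2 * k) = B (2 * k)" "A (2 * k + 1) = B (2 * k + 1)" "A k = B k" "\<And>j. j \<in> {k..<2 * k} \<Longrightarrow> A j = B j"
    using assms(1) by auto
  show ?thesis
    using assms(2) e(4) unfolding good_split_def e(1-3) by simp
qed

text \<open>Nodes are split in heap order by dependent choice, and each split adapts to the sets
  chosen before, since the current leaves form the list \<open>Es\<close> of
  \<open>splitting\<close>.\<close>

lemma tree_exists:
  assumes tau: "\<And>k. \<tau> k > 0"
  shows "\<exists>A. balanced_tree A \<and> (\<forall>k\<ge>1. good_split \<tau> k A)"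
proof -
  interpret finite_measure unit_measure by (rule finite_measure_unit)
  \<comment> \<open>At stage \<open>n\<close> the nodes below \<open>2 * Suc n\<close> are fixed,
    and passing to the next stage splits node \<open>Suc n\<close>. So node \<open>j\<close> is
    final from stage \<open>j\<close> on, which justifies the diagonal sequence
    \<open>g j j\<close>.\<close>
  define P where "P = (\<lambda>n (f :: nat \<Rightarrow> real set). f 1 = {0..<1} \<and> (\<forall>j. 1 \<le> j \<and> j < 2 * Suc n \<longrightarrow> (\<exists>N. resolved N (f j))))"
  define Q where "Q = (\<lambda>n (f :: nat \<Rightarrow> real set) f'. (\<forall>j<2 * Suc n. f' j = f j) \<and> good_split \<tau> (Suc n) f')"
  have "\<exists>g. \<forall>n. P n (g n) \<and> Q n (g n) (g (Suc n))"
  proof (rule dependent_nat_choice)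
    have "resolved 0 {0..<1}" using resolved_dyadic[of 1 0] dyadic_1 by simp
    then have "P 0 (\<lambda>_. {0..<1})" by (auto simp: P_def)
    then show "\<exists>f. P 0 f" by blast
  next
    fix f n assume Pf: "P n f"
    define k where "k = Suc n"
    have k: "1 \<le> k" by (simp add: k_def)
    have res: "\<exists>N. resolved N (f j)" if "1 \<le> j" "j < 2 * k" for j
      using Pf that by (auto simp: P_def k_def)
    obtain N0 where N0: "resolved N0 (f k)" using res[of k] k by auto
    define Es where "Es = map f [k..<2 * k]"
    have Es: "E \<in> sets unit_measure" if E: "E \<in> set Es" for E
    proof -
      obtain j where j: "E = f j" "k \<le> j" "j < 2 * k" using E by (auto simp: Es_def)
      then obtain N where "resolved N (f j)" using res[of j] k by auto
      then show ?thesis unfolding j(1) by (rule resolved_sets)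
    qed
    obtain Ap Am N where S: "resolved N Ap" "resolved N Am" "Ap \<union> Am = f k" "Ap \<inter> Am = {}" "mu Ap = mu Am"
      "\<forall>m. 1 \<le> m \<and> m \<le> k \<longrightarrow> mu (Ap \<inter> dyadic m) = mu (Am \<inter> dyadic m)"
      "\<forall>E\<in>set Es. cmod (pr Ap (K (ind E)) - pr Am (K (ind E))) \<le> \<tau> k \<and> cmod (pr E (K (ind Ap - ind Am))) \<le> \<tau> k"
      "cmod (pr Ap (K (ind Ap - ind Am)) - pr Am (K (ind Ap - ind Am)) - diagonal_measure (f k)) \<le> \<tau> k"
      "cmod (diagonal_measure Ap - diagonal_measure Am) \<le> \<tau> k"
      using splitting[OF N0, of Es "\<tau> k" k] Es tau[of k] by blast
    define f' where "f' = f(2 * k := Ap, 2 * k + 1 := Am)"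
    have old: "f' j = f j" if "j < 2 * k" for j using that by (simp add: f'_def)
    have new: "f' (2 * k) = Ap" "f' (2 * k + 1) = Am" "f' k = f k" using k by (simp_all add: f'_def)
    have "P (Suc n) f'"
      unfolding P_def
    proof (intro conjI allI impI)
      show "f' 1 = {0..<1}" using old[of 1] k Pf by (simp add: P_def)
      fix j assume j: "1 \<le> j \<and> j < 2 * Suc (Suc n)"
      then consider "j < 2 * k" | "j = 2 * k" | "j = 2 * k + 1" by (fastforce simp: k_def)
      then show "\<exists>N. resolved N (f' j)"
      proof cases
        case 1
        then show ?thesis using res[of j] old[of j] j by simp
      next
        case 2
        then show ?thesis using new(1) S(1) by auto
      next
        case 3
        then show ?thesis using new(2) S(2) by auto
      qed
    qed
    moreover have "good_split \<tau> k f'"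
      unfolding good_split_def new
    proof (intro conjI S)
      show "\<forall>j\<in>{k..<2 * k}. cmod (pr Ap (K (ind (f' j))) - pr Am (K (ind (f' j)))) \<le> \<tau> k \<and>
        cmod (pr (f' j) (K (ind Ap - ind Am))) \<le> \<tau> k"
      proof
        fix j assume j: "j \<in> {k..<2 * k}"
        then have "f' j \<in> set Es" using old[of j] by (auto simp: Es_def)
        then show "cmod (pr Ap (K (ind (f' j))) - pr Am (K (ind (f' j)))) \<le> \<tau> k \<and>
          cmod (pr (f' j) (K (ind Ap - ind Am))) \<le> \<tau> k" using S(7) by blast
      qed
    qed
    then have "Q n f f'" using old by (simp add: Q_def k_def)
    ultimately show "\<exists>f'. P (Suc n) f' \<and> Q n f f'" by blast
  qed
  then obtain g where g: "\<And>n. P n (g n)" "\<And>n. Q n (g n) (g (Suc n))" by auto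
  define A where "A = (\<lambda>j. g j j)"
  have stable: "g m j = g n j" if "j < 2 * Suc n" "n \<le> m" for j n m
    using that(2)
  proof (induction m rule: dec_induct)
    case (step m)
    have "g (Suc m) j = g m j" using g(2)[of m] that(1) step.hyps by (simp add: Q_def)
    then show ?case using step.IH by simp
  qed simp
  have A_eq: "A j = g n j" if "j < 2 * Suc n" for j n
    using stable[of j n j] stable[of j j n] that by (cases "n \<le> j") (simp_all add: A_def)
  have good: "good_split \<tau> k A" if k: "1 \<le> k" for k
  proof (rule good_split_cong[OF _ _ k])
    obtain n where n: "k = Suc n" using k by (cases k) auto
    show "good_split \<tau> k (g k)" using g(2)[of n] by (simp add: Q_def n)
    show "g k j = A j" if "j < 2 * Suc k" for j using A_eq[OF that] by simp
  qed
  have A1: "A 1 = {0..<1}" using g(1)[of 1] by (simp add: A_def P_def)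
  have As: "A j \<in> sets unit_measure" if "1 \<le> j" for j
  proof -
    have "\<exists>N. resolved N (g j j)" using g(1)[of j] that by (simp add: P_def)
    then show ?thesis using resolved_sets by (auto simp: A_def)
  qed
  have "mu (A j) = mu (dyadic j)" if "1 \<le> j" for j
    using that
  proof (induction j rule: less_induct)
    case (less j)
    show ?case
    proof (cases "j = 1")
      case True
      then show ?thesis using A1 dyadic_1 by simp
    next
      case False
      define k where "k = j div 2"
      have k: "1 \<le> k" "k < j" "j = 2 * k \<or> j = 2 * k + 1" using False less.prems by (auto simp: k_def)
      have "A (2 * k) \<union> A (2 * k + 1) = A k" "A (2 * k) \<inter> A (2 * k + 1) = {}" "mu (A (2 * k)) = mu (A (2 * k + 1))"
        using good[OF k(1)] by (auto simp: good_split_def)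
      then have "mu (A k) = 2 * mu (A j)"
        using k(3) finite_measure_Union[of "A (2 * k)" "A (2 * k + 1)"] As[of "2 * k"] As[of "2 * k + 1"] k(1) by auto
      moreover have "mu (dyadic k) = 2 * mu (dyadic j)"
        using k floor_log_double[OF k(1)] by (auto simp: mu_dyadic)
      ultimately show ?thesis using less.IH[OF k(2,1)] by simp
    qed
  qed
  then have "halving_tree A"
    using A1 As good unfolding halving_tree_def by (simp add: good_split_def dyadic_1[simplified])
  then have "balanced_tree A"
    using good unfolding balanced_tree_def by (auto simp: good_split_def)
  then show ?thesis using good by blast
qed

end

end

section \<open>Approximate diagonalization of an operator along a tree\<close>

context
  fixes p :: real
  assumes p: "1 < p"
begin

interpretation Lp: seminormed "Lp p" by (rule sLp[OF p])
interpretation Y: seminormed "operators (Lp p)" by (rule seminormed_bounded_ops[OF sLp[OF p] sLp[OF p]])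

lemma norm_add3_le:
  assumes "a \<in> vectors (Lp p)" "b \<in> vectors (Lp p)" "c \<in> vectors (Lp p)" "d \<in> vectors (Lp p)"
  shows "p_norm p (a + b + c - d) \<le> p_norm p a + p_norm p b + p_norm p c + p_norm p d"
  using Lp.nrm_diff[OF Lp.add_mem[OF Lp.add_mem[OF assms(1,2)] assms(3)] assms(4)]
    Lp.nrm_add[OF Lp.add_mem[OF assms(1,2)] assms(3)] Lp.nrm_add[OF assms(1,2)]
  by (simp add: nrm_Lp)

lemma p_norm_scale: "p_norm p (c *\<^sub>C u) = cmod c * p_norm p u" if "u \<in> vectors (Lp p)"
  using Lp.nrm_scaleC[OF that] by (simp add: nrm_Lp)

lemma p_norm_ind_le_1: "1 \<le> j \<Longrightarrow> p_norm p (ind (dyadic j)) \<le> 1"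
  using p by (simp add: p_norm_ind[OF p1[OF p]] powr_le1 mu_le_1)

text \<open>A heap index is at least 2 to the power of its level; thus measures in denominators cost
  factors of order \<open>k\<close>.\<close>

lemma inverse_mu_dyadic_le:
  assumes "1 \<le> j"
  shows "1 / mu (dyadic j) \<le> real j"
proof -
  have "real (2 ^ floor_log j) \<le> real j"
    unfolding of_nat_le_iff using assms by (intro floor_log_exp2_le) simp
  then show ?thesis by (simp add: mu_dyadic[OF assms] power_one_over)
qed

context
  fixes A :: "nat \<Rightarrow> real set" and K :: "fclass \<Rightarrow> fclass" and \<delta> :: "nat \<Rightarrow> complex" and k :: nat and \<tau> :: real
  assumes A: "halving_tree A" and K: "K \<in> vectors (operators (Lp p))" and k: "1 \<le> k"
    and row: "\<And>j. j \<in> {k..<2 * k} \<Longrightarrow> cmod (pr (A (2 * k)) (K (ind (A j))) - pr (A (2 * k + 1)) (K (ind (A j)))) \<le> \<tau>"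
    and col: "\<And>j. j \<in> {k..<2 * k} \<Longrightarrow> cmod (pr (A j) (K (ind (A (2 * k)) - ind (A (2 * k + 1))))) \<le> \<tau>"
    and diag: "cmod (pr (A (2 * k)) (K (ind (A (2 * k)) - ind (A (2 * k + 1))))
      - pr (A (2 * k + 1)) (K (ind (A (2 * k)) - ind (A (2 * k + 1)))) - \<delta> k * of_real (mu (dyadic k))) \<le> \<tau>"
    and mean: "\<delta> (2 * k) + \<delta> (2 * k + 1) = 2 * \<delta> k" and close: "cmod (\<delta> (2 * k) - \<delta> k) \<le> real k * \<tau>"
begin

lemma tau_nonneg: "0 \<le> \<tau>"
  using diag norm_ge_zero order_trans by blast

text \<open>Refining at node \<open>k\<close> adds one Haar term on either side of \<open>K\<close>.
  Once the diagonal part is subtracted, four errors remain: \<open>D1\<close> from pairing the image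
  of the new Haar function with the leaves, \<open>D2\<close> from pairing the images of the leaves
  with it, \<open>D3\<close> from its own diagonal entry, and \<open>D4\<close> from the drift of
  \<open>\<delta>\<close>. Together they cost \<open>4 k^3 + k^2 + 2 k\<close>.\<close>

lemma diagonalization_step:
  assumes u: "u \<in> vectors (Lp p)"
  shows "p_norm p ((averaging p {Suc k..<2 * Suc k} (\<lambda>_. 1) A dyadic (K (averaging p {Suc k..<2 * Suc k} (\<lambda>_. 1) dyadic A u))
      - averaging p {Suc k..<2 * Suc k} \<delta> dyadic dyadic u)
    - (averaging p {k..<2 * k} (\<lambda>_. 1) A dyadic (K (averaging p {k..<2 * k} (\<lambda>_. 1) dyadic A u))
      - averaging p {k..<2 * k} \<delta> dyadic dyadic u)) \<le> 8 * real k ^ 3 * \<tau> * p_norm p u"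
proof -
  note AD = halving_treeD[OF A]
  define m where "m = mu (dyadic k)"
  define h where "h = ind (A (2 * k)) - ind (A (2 * k + 1))"
  define y where "y = (\<lambda>v. pr (A (2 * k)) v - pr (A (2 * k + 1)) v)"
  define x where "x = haar_pr k u"
  define U where "U = p_norm p u"
  define v where "v = K (averaging p {k..<2 * k} (\<lambda>_. 1) dyadic A u)"
  define P where "P = (\<lambda>j. (pr (dyadic j) u / of_real (mu (dyadic j))) *\<^sub>C ind (dyadic j))"
  \<comment> \<open>By \<open>mean\<close> the density of the other child deviates by
    \<open>- \<eta>\<close>.\<close>
  define \<eta> where "\<eta> = \<delta> (2 * k) - \<delta> k"
  have m: "0 < m" "1 / m \<le> real k" using mu_dyadic_pos[OF k] inverse_mu_dyadic_le[OF k] by (auto simp: m_def)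
  have U: "0 \<le> U" by (simp add: U_def p_norm_nonneg)
  have k1: "1 \<le> real k" using k by simp
  have s: "1 \<le> 2 * k" "1 \<le> 2 * k + 1" using k by auto
  have leaf: "1 \<le> j" if "j \<in> {k..<2 * k}" for j using that k by simp
  have avm: "averaging p {k..<2 * k} c E E' \<in> vectors (operators (Lp p))" if "halving_tree E" for c E E'
    by (rule averaging_mem[OF p]) (auto intro!: halving_treeD(2)[OF that] leaf[simplified])
  have hm: "h \<in> vectors (Lp p)" "K h \<in> vectors (Lp p)"
    unfolding h_def by (intro op_maps[OF K] Lp.diff_mem ind_mem)+
  have Bm: "averaging p {k..<2 * k} (\<lambda>_. 1) dyadic A u \<in> vectors (Lp p)"
    by (rule op_maps[OF avm[OF halving_tree_dyadic] u])
  have vm: "v \<in> vectors (Lp p)" unfolding v_def by (rule op_maps[OF K Bm])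
  have Pm: "P j \<in> vectors (Lp p)" for j unfolding P_def by (intro Lp.scale_mem ind_mem)
  have ylin: "y (a + b) = y a + y b" "y (c *\<^sub>C a) = c * y a" if "a \<in> vectors (Lp p)" "b \<in> vectors (Lp p)" for a b c
    using that by (simp_all add: y_def pr_add[OF p1[OF p]] pr_scale algebra_simps)
  have B: "averaging p {Suc k..<2 * Suc k} (\<lambda>_. 1) dyadic A u = averaging p {k..<2 * k} (\<lambda>_. 1) dyadic A u + (x / of_real m) *\<^sub>C h"
    using averaging_step[OF p halving_tree_dyadic A k u] by (simp only: x_def haar_pr_def m_def h_def)
  have v': "K (averaging p {Suc k..<2 * Suc k} (\<lambda>_. 1) dyadic A u) = v + (x / of_real m) *\<^sub>C K h"
    unfolding B v_def by (simp only: op_add[OF K Bm Lp.scale_mem[OF hm(1)]] op_scale[OF K hm(1)])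
  have v'm: "v + (x / of_real m) *\<^sub>C K h \<in> vectors (Lp p)" by (intro Lp.add_mem Lp.scale_mem vm hm)
  have yv: "pr (A (2 * k)) (v + (x / of_real m) *\<^sub>C K h) - pr (A (2 * k + 1)) (v + (x / of_real m) *\<^sub>C K h) = y v + (x / of_real m) * y (K h)"
    using ylin(1)[OF vm Lp.scale_mem[OF hm(2)]] ylin(2)[OF hm(2) hm(2)] by (simp add: y_def)
  have Astep: "averaging p {Suc k..<2 * Suc k} (\<lambda>_. 1) A dyadic (v + (x / of_real m) *\<^sub>C K h)
    = averaging p {k..<2 * k} (\<lambda>_. 1) A dyadic v + (x / of_real m) *\<^sub>C averaging p {k..<2 * k} (\<lambda>_. 1) A dyadic (K h)
      + ((y v + (x / of_real m) * y (K h)) / of_real m) *\<^sub>C haar k"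
    using averaging_step[OF p A halving_tree_dyadic k v'm]
    unfolding op_add[OF avm[OF A] vm Lp.scale_mem[OF hm(2)]] op_scale[OF avm[OF A] hm(2)] haar_def[symmetric] m_def[symmetric] yv .
  \<comment> \<open>Two expressions for the change of the conditional expectation of
    \<open>u\<close> at this split.\<close>
  have PQ: "P (2 * k) + P (2 * k + 1) - P k = (x / of_real m) *\<^sub>C haar k"
  proof -
    have "averaging p {Suc k..<2 * Suc k} (\<lambda>_. 1) dyadic dyadic u = averaging p {k..<2 * k} (\<lambda>_. 1) dyadic dyadic u + (P (2 * k) + P (2 * k + 1) - P k)"
      by (simp only: averaging_def if_P[OF u] sum_leaves_step[OF k] P_def mult_1)
    moreover have "averaging p {Suc k..<2 * Suc k} (\<lambda>_. 1) dyadic dyadic u = averaging p {k..<2 * k} (\<lambda>_. 1) dyadic dyadic u + (x / of_real m) *\<^sub>C haar k"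
      using averaging_step[OF p halving_tree_dyadic halving_tree_dyadic k u] by (simp only: x_def haar_pr_def m_def haar_def)
    ultimately show ?thesis by simp
  qed
  have M: "averaging p {Suc k..<2 * Suc k} \<delta> dyadic dyadic u = averaging p {k..<2 * k} \<delta> dyadic dyadic u
      + ((\<delta> k * (x / of_real m)) *\<^sub>C haar k + \<eta> *\<^sub>C (P (2 * k) - P (2 * k + 1)))"
  proof -
    have "averaging p {Suc k..<2 * Suc k} \<delta> dyadic dyadic u = averaging p {k..<2 * k} \<delta> dyadic dyadic u
        + (\<delta> (2 * k) *\<^sub>C P (2 * k) + \<delta> (2 * k + 1) *\<^sub>C P (2 * k + 1) - \<delta> k *\<^sub>C P k)"
      by (simp only: averaging_def if_P[OF u] sum_leaves_step[OF k] P_def scaleC_scaleC times_divide_eq_right)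
    also have "\<delta> (2 * k) = \<delta> k + \<eta>" by (simp add: \<eta>_def)
    also have "\<delta> (2 * k + 1) = \<delta> k - \<eta>" using mean by (simp add: \<eta>_def algebra_simps)
    also have "(\<delta> k + \<eta>) *\<^sub>C P (2 * k) + (\<delta> k - \<eta>) *\<^sub>C P (2 * k + 1) - \<delta> k *\<^sub>C P k
        = \<delta> k *\<^sub>C (P (2 * k) + P (2 * k + 1) - P k) + \<eta> *\<^sub>C (P (2 * k) - P (2 * k + 1))"
      unfolding scaleC_add_left scaleC_add_right complex_vector.scale_left_diff_distrib
        complex_vector.scale_right_diff_distrib by simp
    finally show ?thesis unfolding PQ scaleC_scaleC .
  qed
  define D1 where "D1 = (x / of_real m) *\<^sub>C averaging p {k..<2 * k} (\<lambda>_. 1) A dyadic (K h)"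
  define D2 where "D2 = (y v / of_real m) *\<^sub>C haar k"
  define D3 where "D3 = ((x / of_real m) * ((y (K h) - \<delta> k * of_real m) / of_real m)) *\<^sub>C haar k"
  define D4 where "D4 = \<eta> *\<^sub>C (P (2 * k) - P (2 * k + 1))"
  have coef: "(y v + (x / of_real m) * y (K h)) / of_real m
      = y v / of_real m + (x / of_real m) * ((y (K h) - \<delta> k * of_real m) / of_real m) + \<delta> k * (x / of_real m)"
    using m(1) by (simp add: field_simps)
  have D: "(averaging p {Suc k..<2 * Suc k} (\<lambda>_. 1) A dyadic (K (averaging p {Suc k..<2 * Suc k} (\<lambda>_. 1) dyadic A u))
      - averaging p {Suc k..<2 * Suc k} \<delta> dyadic dyadic u)
    - (averaging p {k..<2 * k} (\<lambda>_. 1) A dyadic v - averaging p {k..<2 * k} \<delta> dyadic dyadic u) = D1 + D2 + D3 - D4"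
    unfolding v' Astep M coef scaleC_add_left D1_def D2_def D3_def D4_def by (simp add: algebra_simps)
  have Dm: "D1 \<in> vectors (Lp p)" "D2 \<in> vectors (Lp p)" "D3 \<in> vectors (Lp p)" "D4 \<in> vectors (Lp p)"
    unfolding D1_def D2_def D3_def D4_def
    by (intro Lp.scale_mem Lp.diff_mem Pm haar_mem[OF p] op_maps[OF avm[OF A]] hm)+
  have xU: "cmod x \<le> U"
  proof -
    have "k \<in> level (floor_log k)" using k by (simp only: level_iff)
    then show ?thesis
      using sum_haar_pr_le[OF p u, of "{k}" "floor_log k"] by (simp add: x_def U_def)
  qed
  have xm: "cmod (x / of_real m) \<le> U * real k"
  proof -
    have "cmod (x / of_real m) = cmod x * (1 / m)" using m by (simp add: norm_divide)
    also have "\<dots> \<le> U * real k" using xU m U by (intro mult_mono) auto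
    finally show ?thesis .
  qed
  have hk: "p_norm p (haar k) \<le> 1"
  proof -
    have "mu (dyadic k) powr (1 / p) \<le> 1" using p by (intro powr_le1) (simp_all add: mu_le_1)
    then show ?thesis using p_norm_haar_le[OF p k] by linarith
  qed
  have wt: "1 / mu (dyadic j) \<le> 2 * real k" if "j \<in> {k..<2 * k}" for j
    using inverse_mu_dyadic_le[OF leaf[OF that]] that by auto
  have n1: "p_norm p (averaging p {k..<2 * k} (\<lambda>_. 1) A dyadic (K h)) \<le> real k * (2 * real k * \<tau>)"
  proof -
    have "p_norm p (averaging p {k..<2 * k} (\<lambda>_. 1) A dyadic (K h))
        \<le> (\<Sum>j\<in>{k..<2 * k}. p_norm p ((1 * pr (A j) (K h) / of_real (mu (A j))) *\<^sub>C ind (dyadic j)))"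
      unfolding averaging_def if_P[OF hm(2)] using Lp.nrm_sum[of "{k..<2 * k}"] Lp.scale_mem[OF ind_mem] by (simp add: nrm_Lp)
    also have "\<dots> \<le> (\<Sum>j\<in>{k..<2 * k}. 2 * real k * \<tau>)"
    proof (rule sum_mono)
      fix j assume j: "j \<in> {k..<2 * k}"
      have "p_norm p ((1 * pr (A j) (K h) / of_real (mu (A j))) *\<^sub>C ind (dyadic j)) = (1 / mu (dyadic j)) * cmod (pr (A j) (K h)) * p_norm p (ind (dyadic j))"
        using leaf[OF j] by (simp add: p_norm_scale[OF ind_mem] norm_divide AD(3))
      also have "\<dots> \<le> (2 * real k) * \<tau> * 1"
        using wt[OF j] col[OF j] p_norm_ind_le_1[OF leaf[OF j]] tau_nonneg unfolding h_def[symmetric]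
        by (intro mult_mono) (auto simp: p_norm_nonneg)
      finally show "p_norm p ((1 * pr (A j) (K h) / of_real (mu (A j))) *\<^sub>C ind (dyadic j)) \<le> 2 * real k * \<tau>" by simp
    qed
    finally show ?thesis by simp
  qed
  have n2: "cmod (y v) \<le> real k * (2 * real k * U * \<tau>)"
  proof -
    have prU: "cmod (pr (dyadic j) u) \<le> U" if "1 \<le> j" for j
    proof -
      have "cmod (pr (dyadic j) u) \<le> p_norm 1 (restr (dyadic j) u)" by (rule pr_bound_L1)
      also have "\<dots> \<le> p_norm p (restr (dyadic j) u)" by (rule p_norm_1_le[OF p restr_mem[OF u]])
      also have "\<dots> \<le> U" unfolding U_def by (rule p_norm_restr_le[OF p1[OF p] u dyadic_sets[OF that]])
      finally show ?thesis .
    qed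
    have Ki: "K (ind (A j)) \<in> vectors (Lp p)" for j by (rule op_maps[OF K ind_mem])
    have "v = (\<Sum>j\<in>{k..<2 * k}. (1 * pr (dyadic j) u / of_real (mu (dyadic j))) *\<^sub>C K (ind (A j)))"
      unfolding v_def averaging_def if_P[OF u]
      by (simp add: op_sum[OF sLp[OF p] sLp[OF p] K] Lp.scale_mem[OF ind_mem] op_scale[OF K ind_mem])
    then have "y v = (\<Sum>j\<in>{k..<2 * k}. (pr (dyadic j) u / of_real (mu (dyadic j))) * y (K (ind (A j))))"
      by (simp add: y_def pr_sum[OF p1[OF p]] Lp.scale_mem[OF Ki] pr_scale sum_subtractf right_diff_distrib)
    also have "cmod \<dots> \<le> (\<Sum>j\<in>{k..<2 * k}. 2 * real k * U * \<tau>)"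
    proof (rule sum_norm_le)
      fix j assume j: "j \<in> {k..<2 * k}"
      have "cmod ((pr (dyadic j) u / of_real (mu (dyadic j))) * y (K (ind (A j)))) = (1 / mu (dyadic j)) * cmod (pr (dyadic j) u) * cmod (y (K (ind (A j))))"
        by (simp add: norm_mult norm_divide)
      also have "\<dots> \<le> (2 * real k) * U * \<tau>"
        using wt[OF j] prU[OF leaf[OF j]] row[OF j] U unfolding y_def by (intro mult_mono) auto
      finally show "cmod ((pr (dyadic j) u / of_real (mu (dyadic j))) * y (K (ind (A j)))) \<le> 2 * real k * U * \<tau>" .
    qed
    finally show ?thesis by simp
  qed
  have nP: "p_norm p (P j) \<le> U" if j: "1 \<le> j" for j
  proof -
    have "P j = averaging p {j} (\<lambda>_. 1) dyadic dyadic u" using u by (simp add: P_def averaging_def)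
    moreover have "p_norm p (averaging p {j} (\<lambda>_. 1) dyadic dyadic u) \<le> 1 * U"
      unfolding U_def by (rule averaging_nrm[OF p]) (use j u mu_dyadic_pos in \<open>auto simp: disjoint_family_on_def\<close>)
    ultimately show ?thesis by simp
  qed
  have d1: "p_norm p D1 \<le> U * real k * (real k * (2 * real k * \<tau>))"
    unfolding D1_def p_norm_scale[OF op_maps[OF avm[OF A] hm(2)]]
    using xm n1 U by (intro mult_mono) (auto simp: p_norm_nonneg)
  have d2: "p_norm p D2 \<le> real k * (2 * real k * U * \<tau>) * real k"
  proof -
    have "p_norm p D2 = cmod (y v) * (1 / m) * p_norm p (haar k)"
      unfolding D2_def p_norm_scale[OF haar_mem[OF p]] using m by (simp add: norm_divide)
    also have "\<dots> \<le> real k * (2 * real k * U * \<tau>) * real k * 1"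
      using n2 m hk U tau_nonneg by (intro mult_mono) (auto simp: p_norm_nonneg)
    finally show ?thesis by simp
  qed
  have d3: "p_norm p D3 \<le> U * real k * (\<tau> * real k)"
  proof -
    have "p_norm p D3 = cmod (x / of_real m) * (cmod (y (K h) - \<delta> k * of_real m) * (1 / m)) * p_norm p (haar k)"
      unfolding D3_def p_norm_scale[OF haar_mem[OF p]] using m by (simp add: norm_mult norm_divide)
    also have "\<dots> \<le> U * real k * (\<tau> * real k) * 1"
      using xm diag m hk U tau_nonneg unfolding y_def h_def[symmetric] m_def[symmetric]
      by (intro mult_mono) (auto simp: p_norm_nonneg)
    finally show ?thesis by simp
  qed
  have d4: "p_norm p D4 \<le> real k * \<tau> * (U + U)"
  proof -
    have "p_norm p (P (2 * k) - P (2 * k + 1)) \<le> U + U"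
      using Lp.nrm_diff[OF Pm Pm, of "2 * k" "2 * k + 1"] nP[OF s(1)] nP[OF s(2)] by (simp add: nrm_Lp)
    then show ?thesis
      unfolding D4_def p_norm_scale[OF Lp.diff_mem[OF Pm Pm]] using close tau_nonneg
      by (intro mult_mono) (auto simp: \<eta>_def p_norm_nonneg)
  qed
  have "p_norm p (D1 + D2 + D3 - D4) \<le> U * real k * (real k * (2 * real k * \<tau>)) + real k * (2 * real k * U * \<tau>) * real k
      + U * real k * (\<tau> * real k) + real k * \<tau> * (U + U)"
    using norm_add3_le[OF Dm] d1 d2 d3 d4 by linarith
  also have "\<dots> = (4 * real k ^ 3 + real k ^ 2 + 2 * real k) * (\<tau> * U)"
    by (simp add: algebra_simps power2_eq_square power3_eq_cube)
  also have "\<dots> \<le> (8 * real k ^ 3) * (\<tau> * U)"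
  proof (rule mult_right_mono)
    have "real k ^ 2 \<le> real k ^ 3" "real k ^ 1 \<le> real k ^ 3" using k1 by (intro power_increasing; simp)+
    then show "4 * real k ^ 3 + real k ^ 2 + 2 * real k \<le> 8 * real k ^ 3" using k1 unfolding power_one_right by linarith
  qed (use tau_nonneg U in simp)
  finally show ?thesis unfolding D[symmetric] v_def U_def by (simp add: mult.assoc)
qed

end

text \<open>The difference \<open>G k\<close> between the compression of \<open>K\<close> to the
  leaves and the multiplier \<open>M k\<close> changes by at most \<open>\<epsilon> (1/2)^k\<close>
  per split, so it stays within \<open>\<epsilon>\<close> of \<open>G 1\<close>. The second
  \<open>\<epsilon>\<close> is the distance of \<open>M k\<close> from \<open>\<Psi> K\<close> times
  the conditional expectation.\<close>

lemma diagonalization: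
  assumes Psi: "\<Psi> \<in> vectors (dual (operators (Lp p)))" and F: "F \<noteq> bot" "F \<le> sequentially"
    and lim: "\<And>T. ((\<lambda>N. diagonal_sum p N T) \<longlongrightarrow> \<Psi> T) F"
    and K: "K \<in> vectors (operators (Lp p))" and eps: "0 < \<epsilon>"
  shows "\<exists>a\<in>vectors (operators (Lp p)). \<exists>b\<in>vectors (operators (Lp p)). \<exists>\<gamma>. \<forall>u\<in>vectors (Lp p).
    p_norm p (a (K (b u)) - \<Psi> K *\<^sub>C u - rank_one p {0..<1} (\<gamma> *\<^sub>C ind {0..<1}) u) \<le> 2 * \<epsilon> * p_norm p u"
proof -
  define dm where "dm = diagonal_measure p \<Psi> K"
  define c where "c = \<Psi> K"
  \<comment> \<open>Chosen against the error of one step, so that \<open>8 k^3 \<tau> k\<close> is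
    at most \<open>\<epsilon> (1/2)^k\<close>; the shift by 1 keeps the denominator positive at
    0.\<close>
  define \<tau> where "\<tau> = (\<lambda>k::nat. \<epsilon> * (1 / 2) ^ k / (8 * (real k + 1) ^ 3))"
  have tau: "\<tau> k > 0" for k using eps by (simp add: \<tau>_def add_nonneg_pos)
  obtain A where A: "balanced_tree A" and good: "\<And>k. 1 \<le> k \<Longrightarrow> good_split p \<Psi> K \<tau> k A"
    using tree_exists[OF p Psi F lim K, of \<tau>] tau by blast
  have A': "halving_tree A" using A by (simp add: balanced_tree_def)
  note AD = halving_treeD[OF A']
  note gd = good[unfolded good_split_def[OF p Psi F lim K], folded dm_def]
  \<comment> \<open>The density of the diagonal measure on node \<open>j\<close>; at the root it is
    \<open>\<Psi> K\<close>.\<close>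
  define \<delta> where "\<delta> = (\<lambda>j. dm (A j) / of_real (mu (dyadic j)))"
  define EA where "EA = (\<lambda>k. averaging p {k..<2 * k} (\<lambda>_. 1) A dyadic)"
  define EB where "EB = (\<lambda>k. averaging p {k..<2 * k} (\<lambda>_. 1) dyadic A)"
  define E where "E = (\<lambda>k. averaging p {k..<2 * k} (\<lambda>_. 1) dyadic dyadic)"
  define M where "M = (\<lambda>k. averaging p {k..<2 * k} \<delta> dyadic dyadic)"
  define G where "G = (\<lambda>k u. EA k (K (EB k u)) - M k u)"
  have avm: "averaging p {k..<2 * k} c E E' \<in> vectors (operators (Lp p))" if "halving_tree E" "1 \<le> k" for k c E E'
    by (rule averaging_mem[OF p]) (use that halving_treeD(2)[OF that(1)] in auto)
  have Gm: "G k u \<in> vectors (Lp p)" if "1 \<le> k" "u \<in> vectors (Lp p)" for k u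
    unfolding G_def EA_def EB_def M_def
    by (intro Lp.diff_mem op_maps[OF avm] op_maps[OF K] A' halving_tree_dyadic that)
  have d1: "\<delta> 1 = c"
  proof -
    have "restr_op p {0..<1} \<circ> K = K"
      using op_outside[OF K] op_maps[OF K] Lp.zero_mem by (intro ext) (auto simp: restr_op_def)
    then show ?thesis
      using AD(1) by (simp add: \<delta>_def dm_def diagonal_measure_def[OF p Psi F lim K] c_def mu_dyadic)
  qed
  have dsplit: "\<delta> (2 * k) + \<delta> (2 * k + 1) = 2 * \<delta> k" "cmod (\<delta> (2 * k) - \<delta> k) \<le> real k * \<tau> k"
    "cmod (\<delta> (2 * k + 1) - \<delta> k) \<le> real k * \<tau> k" if k: "1 \<le> k" for k
  proof -
    have s: "1 \<le> 2 * k" "1 \<le> 2 * k + 1" using k by auto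
    define m where "m = mu (dyadic k)"
    have m: "m > 0" "1 / m \<le> real k" using mu_dyadic_pos[OF k] inverse_mu_dyadic_le[OF k] by (auto simp: m_def)
    have half: "mu (dyadic (2 * k)) = m / 2" "mu (dyadic (2 * k + 1)) = m / 2"
      using k floor_log_double[OF k] by (simp_all add: mu_dyadic m_def)
    have "dm (A k) = dm (A (2 * k)) + dm (A (2 * k + 1))"
      unfolding dm_def AD(4)[OF k, symmetric]
      by (rule diagonal_measure_Un[OF p Psi F lim K AD(2)[OF s(1)] AD(2)[OF s(2)] AD(5)[OF k]])
    then have e: "\<delta> k = (dm (A (2 * k)) + dm (A (2 * k + 1))) / of_real m"
      "\<delta> (2 * k) = 2 * dm (A (2 * k)) / of_real m" "\<delta> (2 * k + 1) = 2 * dm (A (2 * k + 1)) / of_real m"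
      unfolding \<delta>_def half m_def[symmetric] by simp_all
    show "\<delta> (2 * k) + \<delta> (2 * k + 1) = 2 * \<delta> k" unfolding e by (simp add: add_divide_distrib)
    have "cmod ((dm (A (2 * k)) - dm (A (2 * k + 1))) / of_real m) = cmod (dm (A (2 * k)) - dm (A (2 * k + 1))) * (1 / m)"
      using m by (simp add: norm_divide)
    also have "\<dots> \<le> \<tau> k * real k"
      using gd[OF k] m less_imp_le[OF tau[of k]] by (intro mult_mono) auto
    finally have b: "cmod ((dm (A (2 * k)) - dm (A (2 * k + 1))) / of_real m) \<le> real k * \<tau> k" by (simp add: mult.commute)
    have "\<delta> (2 * k) - \<delta> k = (dm (A (2 * k)) - dm (A (2 * k + 1))) / of_real m"
      unfolding e diff_divide_distrib[symmetric] by simp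
    then show "cmod (\<delta> (2 * k) - \<delta> k) \<le> real k * \<tau> k" using b by simp
    have "\<delta> (2 * k + 1) - \<delta> k = - ((dm (A (2 * k)) - dm (A (2 * k + 1))) / of_real m)"
      unfolding e diff_divide_distrib[symmetric] minus_divide_left by simp
    then show "cmod (\<delta> (2 * k + 1) - \<delta> k) \<le> real k * \<tau> k" using b by (simp only: norm_minus_cancel)
  qed
  have tk: "real k * \<tau> k \<le> \<epsilon> * (1 / 2) ^ k" "8 * real k ^ 3 * \<tau> k \<le> \<epsilon> * (1 / 2) ^ k" for k
  proof -
    have p3: "real k ^ 3 \<le> (real k + 1) ^ 3" by (intro power_mono) auto
    have p1: "(real k + 1) ^ 1 \<le> (real k + 1) ^ 3" by (intro power_increasing) auto
    define q where "q = \<epsilon> * (1 / 2) ^ k"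
    have q: "0 \<le> q" using eps by (simp add: q_def)
    have den: "0 < 8 * (real k + 1) ^ 3" by (simp add: add_nonneg_pos)
    have t: "\<tau> k = q / (8 * (real k + 1) ^ 3)" by (simp add: \<tau>_def q_def)
    have "real k * q \<le> q * (8 * (real k + 1) ^ 3)"
      using p1 q mult_left_mono[of "real k" "8 * (real k + 1) ^ 3" q] by (simp add: mult.commute)
    then show "real k * \<tau> k \<le> \<epsilon> * (1 / 2) ^ k"
      unfolding t q_def[symmetric] using den by (simp add: field_simps)
    have "8 * real k ^ 3 * q \<le> q * (8 * (real k + 1) ^ 3)"
      using p3 q mult_left_mono[of "8 * real k ^ 3" "8 * (real k + 1) ^ 3" q] by (simp add: mult.commute)
    then show "8 * real k ^ 3 * \<tau> k \<le> \<epsilon> * (1 / 2) ^ k"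
      unfolding t q_def[symmetric] using den by (simp add: pos_divide_le_eq)
  qed
  \<comment> \<open>Densities drift by a summable amount along each branch. The closed form passes
    from \<open>k\<close> to its children because their index is at least
    \<open>k + 1\<close>.\<close>
  have dclose: "cmod (\<delta> j - c) \<le> \<epsilon> * (1 - 2 * (1 / 2) ^ j)" if "1 \<le> j" for j
    using that
  proof (induction j rule: less_induct)
    case (less j)
    show ?case
    proof (cases "j = 1")
      case True
      then show ?thesis using d1 by simp
    next
      case False
      define k where "k = j div 2"
      have k: "1 \<le> k" "k < j" "j = 2 * k \<or> j = 2 * k + 1" using False less.prems by (auto simp: k_def)
      have "cmod (\<delta> j - \<delta> k) \<le> \<epsilon> * (1 / 2) ^ k"
        using k(3) dsplit(2,3)[OF k(1)] tk(1)[of k] by auto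
      moreover have "cmod (\<delta> j - c) \<le> cmod (\<delta> j - \<delta> k) + cmod (\<delta> k - c)"
        using norm_triangle_ineq[of "\<delta> j - \<delta> k" "\<delta> k - c"] by simp
      ultimately have "cmod (\<delta> j - c) \<le> \<epsilon> * (1 / 2) ^ k + \<epsilon> * (1 - 2 * (1 / 2) ^ k)"
        using less.IH[OF k(2,1)] by linarith
      also have "\<dots> = \<epsilon> * (1 - (1 / 2) ^ k)" by (simp add: algebra_simps)
      also have "\<dots> \<le> \<epsilon> * (1 - 2 * (1 / 2) ^ j)"
      proof (rule mult_left_mono)
        have "(1 / 2 :: real) ^ j \<le> (1 / 2) ^ Suc k" using k(2) by (intro power_decreasing) auto
        then show "1 - (1 / 2) ^ k \<le> 1 - 2 * (1 / 2 :: real) ^ j" by simp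
      qed (use eps in simp)
      finally show ?thesis .
    qed
  qed
  have step: "p_norm p (G (Suc k) u - G k u) \<le> \<epsilon> * (1 / 2) ^ k * p_norm p u" if k: "1 \<le> k" and u: "u \<in> vectors (Lp p)" for k u
  proof -
    have "\<delta> k * of_real (mu (dyadic k)) = dm (A k)" using mu_dyadic_pos[OF k] by (simp add: \<delta>_def)
    then have "p_norm p (G (Suc k) u - G k u) \<le> 8 * real k ^ 3 * \<tau> k * p_norm p u"
      unfolding G_def EA_def EB_def M_def
      using gd[OF k] by (intro diagonalization_step A' K k dsplit[OF k] u) auto
    also have "\<dots> \<le> \<epsilon> * (1 / 2) ^ k * p_norm p u"
      by (intro mult_right_mono tk p_norm_nonneg)
    finally show ?thesis .
  qed
  have Gdiff: "p_norm p (G k u - G 1 u) \<le> \<epsilon> * (1 - 2 * (1 / 2) ^ k) * p_norm p u" if k: "1 \<le> k" and u: "u \<in> vectors (Lp p)" for k u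
    using k
  proof (induction k rule: dec_induct)
    case base
    show ?case using Lp.nrm_zero by (simp add: nrm_Lp)
  next
    case (step k)
    have "p_norm p (G (Suc k) u - G 1 u) \<le> p_norm p (G (Suc k) u - G k u) + p_norm p (G k u - G 1 u)"
      using Lp.nrm_add[OF Lp.diff_mem[OF Gm Gm] Lp.diff_mem[OF Gm Gm], of "Suc k" u k u k u 1 u] step.hyps u by (simp add: nrm_Lp)
    also have "\<dots> \<le> \<epsilon> * (1 / 2) ^ k * p_norm p u + \<epsilon> * (1 - 2 * (1 / 2) ^ k) * p_norm p u"
      using \<open>1 \<le> k\<close> step.IH \<open>\<And>k u. 1 \<le> k \<Longrightarrow> u \<in> vectors (Lp p) \<Longrightarrow> p_norm p (G (Suc k) u - G k u) \<le> \<epsilon> * (1 / 2) ^ k * p_norm p u\<close>[OF _ u]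
      by (intro add_mono) auto
    also have "\<dots> = \<epsilon> * (1 - 2 * (1 / 2) ^ Suc k) * p_norm p u" by (simp add: algebra_simps)
    finally show ?case .
  qed
  have Mdiff: "p_norm p (M k u - c *\<^sub>C E k u) \<le> \<epsilon> * p_norm p u" if k: "1 \<le> k" and u: "u \<in> vectors (Lp p)" for k u
  proof -
    have "M k u - c *\<^sub>C E k u = averaging p {k..<2 * k} (\<lambda>j. \<delta> j - c) dyadic dyadic u"
      unfolding M_def E_def averaging_def if_P[OF u]
      by (simp add: complex_vector.scale_sum_right sum_subtractf[symmetric] scaleC_scaleC
          complex_vector.scale_left_diff_distrib[symmetric] diff_divide_distrib[symmetric] left_diff_distrib[symmetric])
    also have "p_norm p \<dots> \<le> \<epsilon> * p_norm p u"
    proof (rule averaging_nrm[OF p])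
      show "cmod (\<delta> j - c) \<le> \<epsilon>" if "j \<in> {k..<2 * k}" for j
      proof -
        have "\<epsilon> * (1 - 2 * (1 / 2) ^ j) \<le> \<epsilon> * 1" using eps by (intro mult_left_mono) auto
        then show ?thesis using dclose[of j] that k by simp
      qed
    qed (use k u eps halving_tree_leaves(1)[OF halving_tree_dyadic k] mu_dyadic_pos in auto)
    finally show ?thesis .
  qed
  obtain TA where TA: "TA \<in> vectors (operators (Lp p))" "\<And>u. u \<in> vectors (Lp p) \<Longrightarrow> converges_in (Lp p) (\<lambda>k. EA (Suc k) u) (TA u)"
    using tree_operator[OF p A halving_tree_dyadic] unfolding EA_def by auto
  obtain TB where TB: "TB \<in> vectors (operators (Lp p))" "\<And>u. u \<in> vectors (Lp p) \<Longrightarrow> converges_in (Lp p) (\<lambda>k. EB (Suc k) u) (TB u)"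
    using tree_embedding[OF p A'] unfolding EB_def by auto
  obtain TE where TE: "TE \<in> vectors (operators (Lp p))" "\<And>j. 1 \<le> j \<Longrightarrow> TE (ind (dyadic j)) = ind (dyadic j)"
    "\<And>u. u \<in> vectors (Lp p) \<Longrightarrow> converges_in (Lp p) (\<lambda>k. E (Suc k) u) (TE u)"
    using tree_embedding[OF p halving_tree_dyadic] unfolding E_def by auto
  \<comment> \<open>The limit of the dyadic conditional expectations fixes dyadic indicators, hence
    it is the identity.\<close>
  have "TE = restr_op p {0..<1}"
    by (rule Lp_op_eqI[OF p TE(1) restr_op_mem[OF p unit_sets]]) (simp add: TE(2) restr_op_def ind_mem)
  then have TEid: "TE u = u" if "u \<in> vectors (Lp p)" for u using that by (simp add: restr_op_def)
  define \<gamma> where "\<gamma> = pr {0..<1} (K (ind {0..<1})) - \<delta> 1"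
  \<comment> \<open>At index 1 the root is the only leaf, so every term factors through the integral
    of \<open>u\<close> over the whole interval.\<close>
  have G1: "G 1 u = rank_one p {0..<1} (\<gamma> *\<^sub>C ind {0..<1}) u" if u: "u \<in> vectors (Lp p)" for u
  proof -
    have one: "{1..<2::nat} = {1}" "{Suc 0..<2} = {Suc 0}" by auto
    have d1: "dyadic 1 = {0..<1}" "A 1 = {0..<1}" "dyadic (Suc 0) = {0..<1}" "A (Suc 0) = {0..<1}" using AD(1) dyadic_1 by simp_all
    have mu1: "mu {0..<1} = 1" using mu_dyadic[of 1] dyadic_1 by simp
    have Km: "K (pr {0..<1} u *\<^sub>C ind {0..<1}) = pr {0..<1} u *\<^sub>C K (ind {0..<1})" by (rule op_scale[OF K ind_mem])
    have B1: "EB 1 u = pr {0..<1} u *\<^sub>C ind {0..<1}" using u by (simp add: EB_def averaging_def d1 mu1 del: One_nat_def add: one)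
    have mm: "pr {0..<1} u *\<^sub>C K (ind {0..<1}) \<in> vectors (Lp p)" by (intro Lp.scale_mem op_maps[OF K] ind_mem)
    show ?thesis
      unfolding G_def B1 Km using u mm
      by (simp add: EA_def M_def averaging_def one d1 mu1 rank_one_def \<gamma>_def pr_scale scaleC_scaleC complex_vector.scale_left_diff_distrib
          complex_vector.scale_right_diff_distrib right_diff_distrib mult.commute)
  qed
  have final: "p_norm p (TA (K (TB u)) - c *\<^sub>C u - G 1 u) \<le> 2 * \<epsilon> * p_norm p u" if u: "u \<in> vectors (Lp p)" for u
  proof -
    have EAm: "EA (Suc k) \<in> vectors (operators (Lp p))" for k unfolding EA_def by (rule avm[OF A']) simp
    have EBm: "EB (Suc k) \<in> vectors (operators (Lp p))" for k unfolding EB_def by (rule avm[OF halving_tree_dyadic]) simp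
    have Em: "E (Suc k) \<in> vectors (operators (Lp p))" for k unfolding E_def by (rule avm[OF halving_tree_dyadic]) simp
    have EAc: "p_norm p (EA (Suc k) v) \<le> 1 * p_norm p v" if "v \<in> vectors (Lp p)" for k v
      unfolding EA_def
      by (rule averaging_nrm[OF p])
        (use that halving_tree_leaves(1)[OF A', of "Suc k"] halving_tree_leaves(1)[OF halving_tree_dyadic, of "Suc k"] mu_dyadic_pos AD(2,3) in auto)
    have Tu: "TB u \<in> vectors (Lp p)" "K (TB u) \<in> vectors (Lp p)" "TA (K (TB u)) \<in> vectors (Lp p)"
      using op_maps[OF TB(1) u] op_maps[OF K] op_maps[OF TA(1)] by blast+
    have KB: "converges_in (Lp p) (\<lambda>k. K (EB (Suc k) u)) (K (TB u))"
      by (rule converges_in_op[OF sLp[OF p] sLp[OF p] K TB(2)[OF u] op_maps[OF EBm u] Tu(1)])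
    have KBm: "K (EB (Suc k) u) \<in> vectors (Lp p)" for k by (intro op_maps[OF K] op_maps[OF EBm] u)
    \<comment> \<open>The operators \<open>EA (Suc k)\<close> are contractions, so their argument
      may be replaced by its limit.\<close>
    have c1: "converges_in (Lp p) (\<lambda>k. EA (Suc k) (K (EB (Suc k) u) - K (TB u))) 0"
      unfolding converges_in_def
    proof (rule tendsto_sandwich[OF _ _ tendsto_const KB[unfolded converges_in_def]])
      show "\<forall>\<^sub>F k in sequentially. 0 \<le> nrm (Lp p) (EA (Suc k) (K (EB (Suc k) u) - K (TB u)) - 0)"
        by (intro always_eventually allI) (simp add: nrm_Lp p_norm_nonneg)
      show "\<forall>\<^sub>F k in sequentially. nrm (Lp p) (EA (Suc k) (K (EB (Suc k) u) - K (TB u)) - 0) \<le> nrm (Lp p) (K (EB (Suc k) u) - K (TB u))"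
        using EAc[OF Lp.diff_mem[OF KBm Tu(2)]] by (intro always_eventually allI) (simp add: nrm_Lp)
    qed
    have "converges_in (Lp p) (\<lambda>k. EA (Suc k) (K (EB (Suc k) u) - K (TB u)) + EA (Suc k) (K (TB u))) (0 + TA (K (TB u)))"
      by (intro Lp.converges_in_add c1 TA(2) Tu op_maps[OF EAm] Lp.diff_mem KBm Lp.zero_mem)
    then have c2: "converges_in (Lp p) (\<lambda>k. EA (Suc k) (K (EB (Suc k) u))) (TA (K (TB u)))"
      by (simp add: op_diff[OF sLp[OF p] sLp[OF p] EAm KBm Tu(2)])
    have c3: "converges_in (Lp p) (\<lambda>k. (- c) *\<^sub>C E (Suc k) u) ((- c) *\<^sub>C u)"
      using TE(3)[OF u] unfolding TEid[OF u] by (intro Lp.converges_in_scale op_maps[OF Em] u)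
    have c4: "converges_in (Lp p) (\<lambda>k. (- 1) *\<^sub>C G 1 u) ((- 1) *\<^sub>C G 1 u)"
      by (rule Lp.converges_in_const) simp
    have G1m: "G 1 u \<in> vectors (Lp p)" by (rule Gm) (simp_all add: u)
    have "converges_in (Lp p) (\<lambda>k. EA (Suc k) (K (EB (Suc k) u)) + (- c) *\<^sub>C E (Suc k) u + (- 1) *\<^sub>C G 1 u)
        (TA (K (TB u)) + (- c) *\<^sub>C u + (- 1) *\<^sub>C G 1 u)"
      by (intro Lp.converges_in_add c2 c3 c4 Tu op_maps[OF EAm] KBm Lp.scale_mem op_maps[OF Em] u Lp.add_mem G1m)
    then have conv: "converges_in (Lp p) (\<lambda>k. EA (Suc k) (K (EB (Suc k) u)) - c *\<^sub>C E (Suc k) u - G 1 u) (TA (K (TB u)) - c *\<^sub>C u - G 1 u)"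
      by simp
    have "nrm (Lp p) (EA (Suc k) (K (EB (Suc k) u)) - c *\<^sub>C E (Suc k) u - G 1 u) \<le> 2 * \<epsilon> * p_norm p u" for k
    proof -
      have Mm: "M (Suc k) u \<in> vectors (Lp p)" unfolding M_def by (intro op_maps[OF avm] halving_tree_dyadic u) simp
      have "EA (Suc k) (K (EB (Suc k) u)) - c *\<^sub>C E (Suc k) u - G 1 u = (G (Suc k) u - G 1 u) + (M (Suc k) u - c *\<^sub>C E (Suc k) u)"
        by (simp add: G_def)
      then have "nrm (Lp p) (EA (Suc k) (K (EB (Suc k) u)) - c *\<^sub>C E (Suc k) u - G 1 u)
          \<le> p_norm p (G (Suc k) u - G 1 u) + p_norm p (M (Suc k) u - c *\<^sub>C E (Suc k) u)"
        using Lp.nrm_add[OF Lp.diff_mem[OF Gm[OF _ u] G1m] Lp.diff_mem[OF Mm Lp.scale_mem[OF op_maps[OF Em u]]], of "Suc k" c k]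
        by (simp only: nrm_Lp)
      also have "\<dots> \<le> \<epsilon> * (1 - 2 * (1 / 2) ^ Suc k) * p_norm p u + \<epsilon> * p_norm p u"
        by (intro add_mono Gdiff Mdiff u) simp_all
      also have "\<dots> \<le> \<epsilon> * 1 * p_norm p u + \<epsilon> * p_norm p u"
        using eps by (intro add_mono mult_right_mono mult_left_mono p_norm_nonneg) auto
      finally show ?thesis by simp
    qed
    then show ?thesis
      using Lp.nrm_limit_le[OF conv, of "2 * \<epsilon> * p_norm p u"]
      by (simp add: nrm_Lp Lp.diff_mem Lp.scale_mem op_maps[OF EAm] KBm op_maps[OF Em u] G1m Tu u del: One_nat_def)
  qed
  show ?thesis
    using final G1 TA(1) TB(1) unfolding c_def by (intro bexI[of _ TA] bexI[of _ TB] exI[of _ \<gamma>]) auto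
qed

end

section \<open>Triviality of \<open>M\<close>-ideals\<close>

context
  fixes p :: real
  assumes p: "1 < p"
begin

interpretation Lp: seminormed "Lp p" by (rule sLp[OF p])
interpretation Y: seminormed "operators (Lp p)" by (rule seminormed_bounded_ops[OF sLp[OF p] sLp[OF p]])

text \<open>The identity of L_p in the encoding of operators, zero outside
  \<open>vectors (Lp p)\<close>.\<close>

abbreviation (input) one_op :: "fclass \<Rightarrow> fclass"
  where "one_op \<equiv> restr_op p {0..<1}"

lemma one_op_apply: "u \<in> vectors (Lp p) \<Longrightarrow> one_op u = u"
  by (simp add: restr_op_def)

lemma comp_one_op:
  assumes T: "T \<in> vectors (operators (Lp p))"
  shows "T \<circ> one_op = T"
proof
  fix u show "(T \<circ> one_op) u = T u"
    using op_outside[OF T] op_zero[OF sLp[OF p] sLp[OF p] T] by (cases "u \<in> vectors (Lp p)") (simp_all add: restr_op_def)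
qed

text \<open>It suffices to treat the value at the identity: composing \<open>\<psi>\<close> with
  left multiplication by \<open>T\<close> stays in the annihilator and has the value
  \<open>\<psi> T\<close> there.\<close>

lemma annihilator_eq_0:
  assumes L: "L_decomp (annihilator (operators (Lp p)) J) V (dual (operators (Lp p)))"
    and J: "J \<subseteq> vectors (operators (Lp p))" and K: "K \<in> J"
    and Psi: "\<Psi> \<in> vectors (dual (operators (Lp p)))" and F: "F \<noteq> bot" "F \<le> sequentially"
    and lim: "\<And>T. ((\<lambda>N. diagonal_sum p N T) \<longlongrightarrow> \<Psi> T) F" and nz: "\<Psi> K \<noteq> 0"
    and psi: "\<psi> \<in> annihilator (operators (Lp p)) J"
  shows "\<psi> = 0"
proof -
  note sY = Y.seminormed_axioms
  have KY: "K \<in> vectors (operators (Lp p))" using J K by blast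
  have K0: "K \<noteq> 0" using nz op_zero[OF sY seminormed_scalar_field Psi] by auto
  have u1: "one_op \<in> vectors (operators (Lp p))" by (rule restr_op_mem[OF p unit_sets])
  have id0: "\<phi> one_op = 0" if phi: "\<phi> \<in> annihilator (operators (Lp p)) J" for \<phi>
  proof -
    have phiZ: "\<phi> \<in> vectors (dual (operators (Lp p)))" using phi by (simp add: annihilator_def)
    define D where "D = nrm (dual (operators (Lp p))) \<phi>"
    have D: "0 \<le> D" unfolding D_def by (rule op_nrm_nonneg[OF sY seminormed_scalar_field phiZ])
    have e: "cmod (\<Psi> K) * cmod (\<phi> one_op) \<le> D * (2 * \<epsilon>)" if eps: "0 < \<epsilon>" for \<epsilon>
    proof -
      obtain a b \<gamma> where a: "a \<in> vectors (operators (Lp p))" and b: "b \<in> vectors (operators (Lp p))"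
        and est: "\<And>u. u \<in> vectors (Lp p) \<Longrightarrow>
          p_norm p (a (K (b u)) - \<Psi> K *\<^sub>C u - rank_one p {0..<1} (\<gamma> *\<^sub>C ind {0..<1}) u) \<le> 2 * \<epsilon> * p_norm p u"
        using diagonalization[OF p Psi F lim KY eps] by blast
      define G where "G = rank_one p {0..<1} (\<gamma> *\<^sub>C ind {0..<1})"
      have G: "G \<in> vectors (operators (Lp p))"
        unfolding G_def by (intro rank_one_mem[OF p] unit_sets Lp.scale_mem ind_mem)
      have Kb: "K \<circ> b \<in> vectors (operators (Lp p))" by (rule op_comp_mem[OF sLp[OF p] sLp[OF p] sLp[OF p] b KY])
      have aKb: "a \<circ> (K \<circ> b) \<in> vectors (operators (Lp p))" by (rule op_comp_mem[OF sLp[OF p] sLp[OF p] sLp[OF p] Kb a])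
      \<comment> \<open>The remainder of the diagonalization. As \<open>\<phi>\<close> vanishes on
        the sandwiched \<open>K\<close> and on the rank one part, its value at \<open>R\<close> is
        \<open>- \<Psi> K * \<phi> one_op\<close>.\<close>
      define R where "R = (a \<circ> (K \<circ> b)) - \<Psi> K *\<^sub>C one_op - G"
      have R: "R \<in> vectors (operators (Lp p))"
        unfolding R_def by (intro Y.diff_mem Y.scale_mem aKb u1 G)
      have "nrm (operators (Lp p)) R \<le> 2 * \<epsilon>"
      proof (rule op_nrm_le[OF sLp[OF p] sLp[OF p]])
        show "nrm (Lp p) (R u) \<le> 2 * \<epsilon> * nrm (Lp p) u" if "u \<in> vectors (Lp p)" for u
          using est[OF that] by (simp add: R_def G_def scaleC_apply one_op_apply[OF that] nrm_Lp)
      qed (use eps in simp)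
      then have "cmod (\<phi> R) \<le> D * (2 * \<epsilon>)"
        using dual_bound[OF sY phiZ R] mult_left_mono[OF _ D] unfolding D_def by (meson order_trans)
      moreover have "\<phi> (a \<circ> (K \<circ> b)) = 0"
      proof -
        have "\<phi> \<circ> left_mult (Lp p) a \<circ> right_mult (Lp p) b \<in> annihilator (operators (Lp p)) J"
          by (intro Lp_bimodule[OF p L] a b phi)
        then have "(\<phi> \<circ> left_mult (Lp p) a \<circ> right_mult (Lp p) b) K = 0" using K by (simp add: annihilator_def)
        then show ?thesis by (simp add: left_mult_def right_mult_def KY Kb)
      qed
      moreover have "\<phi> G = 0"
        unfolding G_def by (intro annihilator_rank_one[OF p L J K K0 phi] unit_sets Lp.scale_mem ind_mem)
      moreover have "\<phi> R = \<phi> (a \<circ> (K \<circ> b)) - \<Psi> K * \<phi> one_op - \<phi> G"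
        unfolding R_def
        by (simp only: op_diff[OF sY seminormed_scalar_field phiZ] Y.diff_mem Y.scale_mem aKb u1 G op_scale[OF phiZ] scaleC_complex)
      ultimately show ?thesis by (simp add: norm_mult)
    qed
    have "cmod (\<Psi> K) * cmod (\<phi> one_op) \<le> 0"
    proof (rule field_le_epsilon)
      fix e :: real assume e0: "0 < e"
      have "D * (2 * (e / (2 * (D + 1)))) = e * (D / (D + 1))" using D by (simp add: field_simps)
      also have "\<dots> \<le> e * 1" using D e0 by (intro mult_left_mono) auto
      finally show "cmod (\<Psi> K) * cmod (\<phi> one_op) \<le> 0 + e"
        using e[of "e / (2 * (D + 1))"] D e0 by (simp add: add_nonneg_pos)
    qed
    then show ?thesis using nz by (simp add: mult_le_0_iff)
  qed
  have psiZ: "\<psi> \<in> vectors (dual (operators (Lp p)))" using psi by (simp add: annihilator_def)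
  show ?thesis
  proof
    fix T
    show "\<psi> T = 0 T"
    proof (cases "T \<in> vectors (operators (Lp p))")
      case True
      have "(\<psi> \<circ> left_mult (Lp p) T) one_op = 0" by (intro id0 Lp_bimodule[OF p L] True psi)
      then show ?thesis by (simp add: left_mult_def u1 comp_one_op[OF True])
    qed (simp add: op_outside[OF psiZ])
  qed
qed

section \<open>Pairing a corner functional with the diagonal functional\<close>

lemma dyadic_2_3:
  "dyadic 2 \<in> sets unit_measure" "dyadic 3 \<in> sets unit_measure" "dyadic 2 \<inter> dyadic 3 = {}"
  "mu (dyadic 2) = 1 / 2" "mu (dyadic 3) = 1 / 2" "1 \<le> N \<Longrightarrow> resolved N (dyadic 2)"
proof -
  have f: "floor_log 2 = 1" "floor_log 3 = 1" using floor_log_double[of 1] by simp_all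
  show "dyadic 2 \<inter> dyadic 3 = {}" using dyadic_split(2)[of 1] by simp
  show "mu (dyadic 2) = 1 / 2" "mu (dyadic 3) = 1 / 2" using f by (simp_all add: mu_dyadic)
  show "1 \<le> N \<Longrightarrow> resolved N (dyadic 2)" by (intro resolved_dyadic) (simp_all add: f)
qed simp_all

lemma haar_pr_haar: "1 \<le> j \<Longrightarrow> haar_pr j (haar j) = of_real (mu (dyadic j))"
proof -
  assume j: "1 \<le> j"
  then have s: "1 \<le> 2 * j" "1 \<le> 2 * j + 1" by auto
  note d = dyadic_sets[OF s(1)] dyadic_sets[OF s(2)]
  have "mu (dyadic (2 * j)) + mu (dyadic (2 * j + 1)) = mu (dyadic j)"
    using floor_log_double[OF j] by (simp only: mu_dyadic[OF s(1)] mu_dyadic[OF s(2)] mu_dyadic[OF j]) (simp add: field_simps)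
  then show ?thesis
    unfolding haar_pr_def haar_def using dyadic_split(2)[OF j]
    by (simp only: pr_diff[OF p1[OF p] ind_mem ind_mem] pr_ind[OF d(1) d(1)] pr_ind[OF d(1) d(2)] pr_ind[OF d(2) d(1)] pr_ind[OF d(2) d(2)]
        Int_absorb Int_commute[of "dyadic (2 * j + 1)"]) (simp flip: of_real_add)
qed

text \<open>Let \<open>h\<close> be a random sign combination of the Haar functions of level
  \<open>N\<close> inside \<open>dyadic 2\<close>. Averaging the pairing of
  \<open>T (ind D + h)\<close> with \<open>ind E + h\<close> gives the expression inside the left
  modulus, and some signs do not fall below it; \<open>B\<close> and \<open>C\<close> are the sets
  where \<open>h\<close> is 1 and -1.\<close>

lemma sign_pairing:
  assumes T: "T \<in> vectors (operators (Lp p))" and N: "1 \<le> N"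
  shows "\<exists>B C. B \<in> sets unit_measure \<and> C \<in> sets unit_measure \<and> B \<union> C = dyadic 2 \<and> B \<inter> C = {} \<and> mu B = 1 / 4 \<and> mu C = 1 / 4 \<and>
    cmod (pr E (T (ind D)) + (\<Sum>j\<in>cells N (dyadic 2). haar_pr j (T (haar j))))
      \<le> cmod (pr E (T (ind D + (ind B - ind C))) + (pr B (T (ind D + (ind B - ind C))) - pr C (T (ind D + (ind B - ind C)))))"
proof -
  interpret finite_measure unit_measure by (rule finite_measure_unit)
  note r = dyadic_2_3(6)[OF N]
  define L where "L = cells N (dyadic 2)"
  have L: "finite L" unfolding L_def by (rule finite_cells)
  obtain t :: "nat \<Rightarrow> complex" where t: "\<And>i. t i = 1 \<or> t i = - 1"
    "cmod (pr E (T (ind D)) + (\<Sum>i\<in>L. haar_pr i (T (haar i))))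
      \<le> cmod (pr E (T (ind D)) + (\<Sum>i\<in>L. t i * (pr E (T (haar i)) + haar_pr i (T (ind D))))
          + (\<Sum>i\<in>L. \<Sum>j\<in>L. t i * t j * haar_pr i (T (haar j))))"
    using random_signs_large[OF L, of "pr E (T (ind D))" "\<lambda>i j. haar_pr i (T (haar j))" "\<lambda>i. pr E (T (haar i)) + haar_pr i (T (ind D))"]
    by blast
  define B where "B = positive_part N t (dyadic 2)"
  define C where "C = negative_part N t (dyadic 2)"
  note parts = sign_parts[where N = N and A = "dyadic 2" and t = t, OF r t(1), folded B_def C_def L_def]
  have m: "B \<in> sets unit_measure" "C \<in> sets unit_measure"
    using parts(1,2) resolved_sets by blast+
  have "B \<inter> dyadic 2 = B" "C \<inter> dyadic 2 = C" using parts(3) by blast+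
  then have eq: "mu B = mu C" using parts(7)[OF r] by simp
  have "mu B + mu C = 1 / 2"
    using finite_measure_Union[OF m parts(4)] parts(3) dyadic_2_3(4) by simp
  then have mu4: "mu B = 1 / 4" "mu C = 1 / 4" using eq by auto
  have hm: "T (haar j) \<in> vectors (Lp p)" for j by (rule op_maps[OF T haar_mem[OF p]])
  define z where "z = T (ind D + (ind B - ind C))"
  have zm: "z \<in> vectors (Lp p)" unfolding z_def by (intro op_maps[OF T] Lp.add_mem Lp.diff_mem ind_mem)
  have z: "z = T (ind D) + (\<Sum>j\<in>L. t j *\<^sub>C T (haar j))"
    unfolding z_def parts(5)
    by (simp add: op_add[OF T ind_mem Lp.sum_mem] Lp.scale_mem haar_mem[OF p] op_sum[OF sLp[OF p] sLp[OF p] T] op_scale[OF T haar_mem[OF p]])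
  have sm: "(\<Sum>j\<in>L. t j *\<^sub>C T (haar j)) \<in> vectors (Lp p)" by (intro Lp.sum_mem Lp.scale_mem hm)
  have dm: "T (ind D) \<in> vectors (Lp p)" by (rule op_maps[OF T ind_mem])
  have "pr E z = pr E (T (ind D)) + (\<Sum>i\<in>L. t i * pr E (T (haar i)))"
    unfolding z by (simp add: pr_add[OF p1[OF p] dm sm] pr_sum[OF p1[OF p]] Lp.scale_mem hm pr_scale)
  moreover have "pr B z - pr C z = (\<Sum>i\<in>L. t i * haar_pr i z)"
    by (rule parts(6)[OF p1[OF p] zm])
  moreover have "haar_pr i z = haar_pr i (T (ind D)) + (\<Sum>j\<in>L. t j * haar_pr i (T (haar j)))" for i
    unfolding z by (simp add: haar_pr_add[OF p dm sm] haar_pr_sum[OF p] Lp.scale_mem hm haar_pr_scale[OF p])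
  ultimately have "pr E z + (pr B z - pr C z) = pr E (T (ind D)) + (\<Sum>i\<in>L. t i * (pr E (T (haar i)) + haar_pr i (T (ind D))))
          + (\<Sum>i\<in>L. \<Sum>j\<in>L. t i * t j * haar_pr i (T (haar j)))"
    by (simp add: distrib_left sum.distrib sum_distrib_left mult.assoc)
  then show ?thesis
    using t(2) m parts(3,4) mu4 unfolding z_def[symmetric] L_def[symmetric]
    by (intro exI[of _ B] exI[of _ C] conjI) (simp_all only: z_def[symmetric] L_def[symmetric])
qed

lemma sum_pr_le:
  assumes z: "z \<in> vectors (Lp p)" and "A \<in> sets unit_measure" "B \<in> sets unit_measure" "C \<in> sets unit_measure"
    and "A \<inter> B = {}" "A \<inter> C = {}" "B \<inter> C = {}"
  shows "cmod (pr A z) + cmod (pr B z) + cmod (pr C z) \<le> p_norm p z"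
proof -
  define E where "E = (\<lambda>i::nat. if i = 0 then A else if i = 1 then B else C)"
  have "(\<Sum>i\<in>{0, 1, 2}. p_norm 1 (restr (E i) z) powr 1) \<le> p_norm 1 z powr 1"
    by (rule sum_p_norm_restr_le[OF p _ _ _ _ Lp_subset_L1[OF p1[OF p] z]])
      (use assms in \<open>auto simp: E_def disjoint_family_on_def\<close>)
  then have "p_norm 1 (restr A z) + p_norm 1 (restr B z) + p_norm 1 (restr C z) \<le> p_norm 1 z"
    by (simp add: E_def p_norm_nonneg)
  then show ?thesis
    using pr_bound_L1[of A z] pr_bound_L1[of B z] pr_bound_L1[of C z] p_norm_1_le[OF p z] by linarith
qed

text \<open>The exponent 2 is excluded here, as the left side equals 1 at \<open>s = 1 / 2\<close>;
  \<open>1 / 4\<close> is the measure of the set on which the signs do not cancel.\<close>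

lemma quarter_powr_less:
  fixes s :: real
  assumes "1 / 2 < s"
  shows "2 * (1 / 4) powr s < 1"
proof -
  have "(1 / 4 :: real) powr s < (1 / 4) powr (1 / 2)" using assms by (intro powr_less_mono') auto
  also have "(1 / 4 :: real) powr (1 / 2) = 1 / 2" by (simp add: powr_half_sqrt real_sqrt_divide)
  finally show ?thesis by simp
qed

text \<open>For \<open>p < 2\<close> the signs interfere in the vector:
  \<open>ind (dyadic 2) + (ind B - ind C)\<close> is \<open>2 *\<^sub>C ind B\<close>, while the
  functional consists of disjoint pieces. For \<open>p > 2\<close> they interfere in the functional,
  which becomes twice the integral over \<open>B\<close>, while the vector is a sign function of
  norm at most 1.\<close>

lemma pairing_bound:
  assumes "p \<noteq> 2"
  shows "\<exists>a\<in>{2, 3}. \<exists>b\<in>{2, 3}. \<exists>\<rho>. 0 \<le> \<rho> \<and> \<rho> < 1 \<and> (\<forall>N\<ge>1. \<forall>T\<in>vectors (operators (Lp p)).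
    cmod (pr (dyadic b) (T (ind (dyadic a))) + (\<Sum>j\<in>cells N (dyadic 2). haar_pr j (T (haar j)))) \<le> \<rho> * nrm (operators (Lp p)) T)"
proof (cases "p < 2")
  case True
  define \<rho> where "\<rho> = 2 * (1 / 4 :: real) powr (1 / p)"
  have "\<rho> < 1" unfolding \<rho>_def by (rule quarter_powr_less) (use p True in \<open>simp add: field_simps\<close>)
  moreover have "0 \<le> \<rho>" by (simp add: \<rho>_def)
  moreover have "cmod (pr (dyadic 3) (T (ind (dyadic 2))) + (\<Sum>j\<in>cells N (dyadic 2). haar_pr j (T (haar j)))) \<le> \<rho> * nrm (operators (Lp p)) T"
    if N: "1 \<le> N" and T: "T \<in> vectors (operators (Lp p))" for N T
  proof -
    obtain B C where BC: "B \<in> sets unit_measure" "C \<in> sets unit_measure" "B \<union> C = dyadic 2" "B \<inter> C = {}" "mu B = 1 / 4" "mu C = 1 / 4"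
      and le: "cmod (pr (dyadic 3) (T (ind (dyadic 2))) + (\<Sum>j\<in>cells N (dyadic 2). haar_pr j (T (haar j))))
      \<le> cmod (pr (dyadic 3) (T (ind (dyadic 2) + (ind B - ind C))) + (pr B (T (ind (dyadic 2) + (ind B - ind C))) - pr C (T (ind (dyadic 2) + (ind B - ind C)))))"
      using sign_pairing[OF T N, of "dyadic 3" "dyadic 2"] by blast
    have "ind (dyadic 2) = ind B + ind C" using ind_Un[OF BC(1,2,4)] by (simp only: BC(3))
    then have x: "ind (dyadic 2) + (ind B - ind C) = 2 *\<^sub>C ind B"
      by (simp only: complex_vector.scale_left_distrib[of 1 1, simplified] one_add_one[symmetric] scaleC_add_left scaleC_one) simp
    define z where "z = T (2 *\<^sub>C ind B)"
    have zm: "z \<in> vectors (Lp p)" unfolding z_def by (intro op_maps[OF T] Lp.scale_mem ind_mem)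
    have d: "dyadic 3 \<inter> B = {}" "dyadic 3 \<inter> C = {}" using dyadic_2_3(3) BC(3) by blast+
    have "cmod (pr (dyadic 3) z + (pr B z - pr C z)) \<le> cmod (pr (dyadic 3) z) + cmod (pr B z) + cmod (pr C z)"
      using norm_triangle_ineq[of "pr (dyadic 3) z" "pr B z - pr C z"] norm_triangle_ineq4[of "pr B z" "pr C z"] by linarith
    also have "\<dots> \<le> p_norm p z" by (rule sum_pr_le[OF zm dyadic_2_3(2) BC(1,2) d BC(4)])
    also have "\<dots> \<le> nrm (operators (Lp p)) T * p_norm p (2 *\<^sub>C ind B)"
      unfolding z_def by (rule p_norm_op[OF p T Lp.scale_mem[OF ind_mem]])
    also have "p_norm p (2 *\<^sub>C ind B) = \<rho>"
      by (simp add: p_norm_scale[OF p ind_mem] p_norm_ind[OF p1[OF p] BC(1)] BC(5) \<rho>_def)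
    finally show ?thesis using le unfolding x z_def by (simp add: mult.commute)
  qed
  ultimately show ?thesis by (intro bexI[of _ 2] bexI[of _ 3] exI[of _ \<rho>]) auto
next
  case False
  then have p2: "2 < p" using assms by simp
  define \<rho> where "\<rho> = 2 * (1 / 4 :: real) powr (1 - 1 / p)"
  have "\<rho> < 1" unfolding \<rho>_def by (rule quarter_powr_less) (use p2 in \<open>simp add: field_simps\<close>)
  moreover have "0 \<le> \<rho>" by (simp add: \<rho>_def)
  moreover have "cmod (pr (dyadic 2) (T (ind (dyadic 3))) + (\<Sum>j\<in>cells N (dyadic 2). haar_pr j (T (haar j)))) \<le> \<rho> * nrm (operators (Lp p)) T"
    if N: "1 \<le> N" and T: "T \<in> vectors (operators (Lp p))" for N T
  proof -
    obtain B C where BC: "B \<in> sets unit_measure" "C \<in> sets unit_measure" "B \<union> C = dyadic 2" "B \<inter> C = {}" "mu B = 1 / 4" "mu C = 1 / 4"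
      and le: "cmod (pr (dyadic 2) (T (ind (dyadic 3))) + (\<Sum>j\<in>cells N (dyadic 2). haar_pr j (T (haar j))))
      \<le> cmod (pr (dyadic 2) (T (ind (dyadic 3) + (ind B - ind C))) + (pr B (T (ind (dyadic 3) + (ind B - ind C))) - pr C (T (ind (dyadic 3) + (ind B - ind C)))))"
      using sign_pairing[OF T N, of "dyadic 2" "dyadic 3"] by blast
    define x where "x = ind (dyadic 3) + (ind B - ind C)"
    have xm: "x \<in> vectors (Lp p)" unfolding x_def by (intro Lp.add_mem Lp.diff_mem ind_mem)
    define z where "z = T x"
    have zm: "z \<in> vectors (Lp p)" unfolding z_def by (rule op_maps[OF T xm])
    define E where "E = (\<lambda>i::nat. if i = 0 then dyadic 3 else if i = 1 then B else C)"
    define c where "c = (\<lambda>i::nat. if i = 2 then - 1 else (1::complex))"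
    have d: "dyadic 3 \<inter> B = {}" "dyadic 3 \<inter> C = {}" using dyadic_2_3(3) BC(3) by blast+
    have "p_norm p (\<Sum>i\<in>{0, 1, 2}. c i *\<^sub>C ind (E i)) \<le> 1 * (\<Sum>i\<in>{0, 1, 2}. mu (E i)) powr (1 / p)"
      by (rule p_norm_sum_ind_le[OF p])
        (use BC d dyadic_2_3(2) in \<open>auto simp: E_def c_def disjoint_family_on_def\<close>)
    then have "p_norm p x \<le> 1"
      by (simp add: E_def c_def x_def BC(5,6) dyadic_2_3 add_diff_eq)
    then have zn: "p_norm p z \<le> nrm (operators (Lp p)) T"
      using p_norm_op[OF p T xm] mult_left_mono[of "p_norm p x" 1, OF _ Y.nrm_nonneg[OF T]] by (simp add: z_def)
    have "pr (dyadic 2) z = pr B z + pr C z" using pr_Un[OF p1[OF p] zm BC(1,2,4)] by (simp only: BC(3))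
    then have "cmod (pr (dyadic 2) z + (pr B z - pr C z)) = 2 * cmod (pr B z)"
      by (simp flip: mult_2 add: norm_mult)
    also have "\<dots> \<le> 2 * ((1 / 4) powr (1 - 1 / p) * p_norm p z)"
    proof -
      have "(1 / 4) powr (1 - 1 / p) * p_norm p (restr B z) \<le> (1 / 4) powr (1 - 1 / p) * p_norm p z"
        by (intro mult_left_mono p_norm_restr_le[OF p1[OF p] zm BC(1)]) simp
      then show ?thesis using pr_bound[OF p zm BC(1)] unfolding BC(5) by linarith
    qed
    also have "\<dots> \<le> \<rho> * nrm (operators (Lp p)) T"
      using mult_left_mono[OF zn, of \<rho>] by (simp add: \<rho>_def)
    finally show ?thesis using le unfolding x_def z_def by simp
  qed
  ultimately show ?thesis by (intro bexI[of _ 3] bexI[of _ 2] exI[of _ \<rho>]) auto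
qed

lemma p_norm_half: "j \<in> {2, 3} \<Longrightarrow> p_norm p (ind (dyadic j)) = (1 / 2) powr (1 / p)"
  by (auto simp only: insert_iff empty_iff p_norm_ind[OF p1[OF p]] dyadic_2_3)

lemma half_powr_dual: "(1 / 2 :: real) powr (1 - 1 / p) * (1 / 2) powr (1 / p) = 1 / 2"
  by (simp flip: powr_add)

text \<open>Both bounds come from the product of \<open>(1 / 2) powr (1 - 1 / p)\<close> and
  \<open>(1 / 2) powr (1 / p)\<close>, which is \<open>1 / 2\<close>; the factor 2 in the rank one
  operator compensates for it.\<close>

lemma corner_functional:
  assumes a: "a \<in> {2, 3}" and b: "b \<in> {2, 3}"
  defines "\<phi> \<equiv> (\<lambda>T. if T \<in> vectors (operators (Lp p)) then pr (dyadic b) (T (ind (dyadic a))) else 0)"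
  shows "\<phi> \<in> vectors (dual (operators (Lp p)))" "nrm (dual (operators (Lp p))) \<phi> \<le> 1 / 2"
    "\<exists>E\<in>sets unit_measure. \<exists>y\<in>vectors (Lp p). nrm (operators (Lp p)) (rank_one p E y) \<le> 1 \<and> \<phi> (rank_one p E y) = 1 / 2"
proof -
  note sY = Y.seminormed_axioms
  have ab: "dyadic a \<in> sets unit_measure" "dyadic b \<in> sets unit_measure" "mu (dyadic a) = 1 / 2" "mu (dyadic b) = 1 / 2"
    using a b dyadic_2_3 by auto
  have bd: "cmod (\<phi> T) \<le> 1 / 2 * nrm (operators (Lp p)) T" if T: "T \<in> vectors (operators (Lp p))" for T
  proof -
    have m: "T (ind (dyadic a)) \<in> vectors (Lp p)" by (rule op_maps[OF T ind_mem])
    have "cmod (\<phi> T) \<le> (1 / 2) powr (1 - 1 / p) * p_norm p (restr (dyadic b) (T (ind (dyadic a))))"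
      using pr_bound[OF p m ab(2)] T unfolding ab(4) by (simp add: \<phi>_def)
    also have "\<dots> \<le> (1 / 2) powr (1 - 1 / p) * (nrm (operators (Lp p)) T * (1 / 2) powr (1 / p))"
      using p_norm_restr_le[OF p1[OF p] m ab(2)] p_norm_op[OF p T ind_mem, of "dyadic a"] unfolding p_norm_half[OF a]
      by (intro mult_left_mono) auto
    also have "\<dots> = ((1 / 2) powr (1 - 1 / p) * (1 / 2) powr (1 / p)) * nrm (operators (Lp p)) T" by simp
    finally show ?thesis unfolding half_powr_dual .
  qed
  show "\<phi> \<in> vectors (dual (operators (Lp p)))"
    by (rule dualI[OF sY _ _ _ bd])
      (simp_all add: \<phi>_def Y.add_mem Y.scale_mem pr_add[OF p1[OF p]] op_maps[OF _ ind_mem] pr_scale scaleC_apply)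
  show "nrm (dual (operators (Lp p))) \<phi> \<le> 1 / 2"
    by (rule dual_nrm_le[OF sY _ bd]) simp
  define R where "R = rank_one p (dyadic a) (2 *\<^sub>C ind (dyadic b))"
  have ym: "2 *\<^sub>C ind (dyadic b) \<in> vectors (Lp p)" by (intro Lp.scale_mem ind_mem)
  have R: "R \<in> vectors (operators (Lp p))" unfolding R_def by (rule rank_one_mem[OF p ab(1) ym])
  have "nrm (operators (Lp p)) R \<le> 1"
  proof (rule op_nrm_le[OF sLp[OF p] sLp[OF p]])
    fix u assume u: "u \<in> vectors (Lp p)"
    have "p_norm p (R u) \<le> (1 / 2) powr (1 - 1 / p) * (2 * (1 / 2) powr (1 / p)) * p_norm p u"
      using rank_one_nrm[OF p ab(1) ym u] unfolding R_def ab(3) p_norm_scale[OF p ind_mem] p_norm_half[OF b] by simp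
    also have "\<dots> = 2 * ((1 / 2) powr (1 - 1 / p) * (1 / 2) powr (1 / p)) * p_norm p u" by simp
    finally show "nrm (Lp p) (R u) \<le> 1 * nrm (Lp p) u" unfolding half_powr_dual by (simp add: nrm_Lp)
  qed simp
  moreover have "\<phi> R = 1 / 2"
    using R by (simp only: \<phi>_def if_True R_def rank_one_def ind_mem pr_scale pr_ind[OF ab(1) ab(1)] pr_ind[OF ab(2) ab(2)] Int_absorb ab) simp
  ultimately show "\<exists>E\<in>sets unit_measure. \<exists>y\<in>vectors (Lp p). nrm (operators (Lp p)) (rank_one p E y) \<le> 1 \<and> \<phi> (rank_one p E y) = 1 / 2"
    unfolding R_def using ab(1) ym by (intro bexI conjI)
qed

lemma M_ideal_trivial:
  assumes p2: "p \<noteq> 2" and L: "L_decomp (annihilator (operators (Lp p)) J) V (dual (operators (Lp p)))"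
    and J: "J \<subseteq> vectors (operators (Lp p))" and K0: "K\<^sub>0 \<in> J" "K\<^sub>0 \<noteq> 0"
    and psi: "\<psi> \<in> annihilator (operators (Lp p)) J" "\<psi> \<noteq> 0"
  shows False
proof -
  note sY = Y.seminormed_axioms
  interpret Z: seminormed "dual (operators (Lp p))"
    by (rule seminormed_bounded_ops[OF sY seminormed_scalar_field])
  obtain \<Psi> F where Psi: "\<Psi> \<in> vectors (dual (operators (Lp p)))" and F: "F \<noteq> bot" "F \<le> sequentially"
    and lim: "\<And>T. ((\<lambda>N. diagonal_sum p N T) \<longlongrightarrow> \<Psi> T) F"
    using cluster_functional[where g = "diagonal_sum p", OF sY diagonal_sum_dual[OF p] diagonal_sum_bound[OF p]] by blast
  have "\<Psi> K = 0" if "K \<in> J" for K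
    using annihilator_eq_0[OF L J that Psi F lim _ psi(1)] psi(2) by blast
  then have PsiW: "\<Psi> \<in> annihilator (operators (Lp p)) J" using Psi by (simp add: annihilator_def)
  note D = dyadic_2_3
  have e: "restr_op p (dyadic 2) \<in> vectors (operators (Lp p))" by (rule restr_op_mem[OF p D(1)])
  define \<Psi>' where "\<Psi>' = \<Psi> \<circ> left_mult (Lp p) (restr_op p (dyadic 2))"
  have Psi': "\<Psi>' \<in> annihilator (operators (Lp p)) J" unfolding \<Psi>'_def by (rule Lp_bimodule[OF p L e PsiW])
  then have Psi'Z: "\<Psi>' \<in> vectors (dual (operators (Lp p)))" by (simp add: annihilator_def)
  have evN: "\<forall>\<^sub>F N in F. 1 \<le> N" using F(2) filter_leD eventually_ge_at_top by blast
  have lim': "((\<lambda>N. \<Sum>j\<in>cells N (dyadic 2). haar_pr j (T (haar j))) \<longlongrightarrow> \<Psi>' T) F"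
    if T: "T \<in> vectors (operators (Lp p))" for T
  proof -
    have "((\<lambda>N. diagonal_sum p N (restr_op p (dyadic 2) \<circ> T)) \<longlongrightarrow> \<Psi>' T) F"
      using lim[of "restr_op p (dyadic 2) \<circ> T"] T by (simp add: \<Psi>'_def left_mult_def)
    moreover have "\<forall>\<^sub>F N in F. diagonal_sum p N (restr_op p (dyadic 2) \<circ> T) = (\<Sum>j\<in>cells N (dyadic 2). haar_pr j (T (haar j)))"
      using evN by (rule eventually_mono) (rule diagonal_sum_restr[OF p D(6) T])
    ultimately show ?thesis by (rule Lim_transform_eventually)
  qed
  have u1: "one_op \<in> vectors (operators (Lp p))" by (rule restr_op_mem[OF p unit_sets])
  have u1n: "nrm (operators (Lp p)) one_op \<le> 1"
    by (rule op_nrm_le[OF sLp[OF p] sLp[OF p]]) (simp_all add: one_op_apply)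
  \<comment> \<open>For the identity each cell contributes its measure, so from level 1 on the sums
    equal the measure of \<open>dyadic 2\<close>.\<close>
  have half: "\<Psi>' one_op = 1 / 2"
  proof (rule tendsto_unique[OF F(1) lim'[OF u1]])
    have "(\<Sum>j\<in>cells N (dyadic 2). haar_pr j (one_op (haar j))) = 1 / 2" if N: "1 \<le> N" for N
    proof -
      have "(\<Sum>j\<in>cells N (dyadic 2). haar_pr j (one_op (haar j))) = (\<Sum>j\<in>cells N (dyadic 2). of_real ((1 / 2) ^ N))"
      proof (rule sum.cong[OF refl])
        fix j assume j: "j \<in> cells N (dyadic 2)"
        then have "j \<in> level N" using cells_subset by blast
        then show "haar_pr j (one_op (haar j)) = of_real ((1 / 2) ^ N)"
          using haar_pr_haar[OF cells_ge_1[OF j]] mu_cell by (simp only: one_op_apply[OF haar_mem[OF p]])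
      qed
      also have "\<dots> = of_real (mu (dyadic 2))"
        unfolding mu_resolved[OF D(6)[OF N]] by (simp only: sum_constant of_real_mult of_real_of_nat_eq)
      finally show ?thesis by (simp only: D) simp
    qed
    then show "((\<lambda>N. \<Sum>j\<in>cells N (dyadic 2). haar_pr j (one_op (haar j))) \<longlongrightarrow> 1 / 2) F"
      by (intro tendsto_eventually eventually_mono[OF evN])
  qed
  have nPsi': "1 / 2 \<le> nrm (dual (operators (Lp p))) \<Psi>'"
    using arg_cong[where f = cmod, OF half] dual_bound[OF sY Psi'Z u1] mult_left_mono[OF u1n Z.nrm_nonneg[OF Psi'Z]] unfolding norm_divide by simp
  obtain a b \<rho> where ab: "a \<in> {2, 3}" "b \<in> {2, 3}" and rho: "0 \<le> \<rho>" "\<rho> < 1"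
    and pair: "\<And>N T. 1 \<le> N \<Longrightarrow> T \<in> vectors (operators (Lp p)) \<Longrightarrow>
      cmod (pr (dyadic b) (T (ind (dyadic a))) + (\<Sum>j\<in>cells N (dyadic 2). haar_pr j (T (haar j)))) \<le> \<rho> * nrm (operators (Lp p)) T"
    using pairing_bound[OF p2] by blast
  define \<phi> where "\<phi> = (\<lambda>T. if T \<in> vectors (operators (Lp p)) then pr (dyadic b) (T (ind (dyadic a))) else 0)"
  note phi = corner_functional[OF ab, folded \<phi>_def]
  obtain E y where R: "E \<in> sets unit_measure" "y \<in> vectors (Lp p)" "nrm (operators (Lp p)) (rank_one p E y) \<le> 1" "\<phi> (rank_one p E y) = 1 / 2"
    using phi(3) by (elim bexE conjE) (rule that, assumption+, simp only: \<phi>_def)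
  have Rm: "rank_one p E y \<in> vectors (operators (Lp p))" by (rule rank_one_mem[OF p R(1,2)])
  obtain w v where wv: "w \<in> annihilator (operators (Lp p)) J" "v \<in> V" "\<phi> = w + v"
    using L_decompD(3)[OF L phi(1)] by (elim bexE) (rule that)
  have VZ: "v \<in> vectors (dual (operators (Lp p)))" "w \<in> vectors (dual (operators (Lp p)))"
    using subsetD[OF L_decompD(2)[OF L] wv(2)] subsetD[OF L_decompD(1)[OF L] wv(1)] .
  have vR: "v (rank_one p E y) = 1 / 2"
    using R(4) annihilator_rank_one[OF p L J K0 wv(1) R(1,2)] unfolding wv(3) by simp
  have nv: "1 / 2 \<le> nrm (dual (operators (Lp p))) v"
    using arg_cong[where f = cmod, OF vR] dual_bound[OF sY VZ(1) Rm] mult_left_mono[OF R(3) Z.nrm_nonneg[OF VZ(1)]] unfolding norm_divide by simp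
  \<comment> \<open>\<open>w\<close> kills the rank one operator at which \<open>\<phi>\<close>
    attains its norm, so \<open>v\<close> alone has at least that norm, and additivity forces
    \<open>w = 0\<close>.\<close>
  have "nrm (dual (operators (Lp p))) \<phi> = nrm (dual (operators (Lp p))) w + nrm (dual (operators (Lp p))) v"
    unfolding wv(3) by (rule L_decompD(4)[OF L wv(1,2)])
  then have "nrm (dual (operators (Lp p))) w = 0" using phi(2) nv Z.nrm_nonneg[OF VZ(2)] by linarith
  then have phiv: "\<phi> = v" using op_nrm_zero_imp[OF sY VZ(2)] wv(3) by simp
  have "nrm (dual (operators (Lp p))) (\<Psi>' + \<phi>) = nrm (dual (operators (Lp p))) \<Psi>' + nrm (dual (operators (Lp p))) v"
    unfolding phiv by (rule L_decompD(4)[OF L Psi' wv(2)])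
  then have "1 \<le> nrm (dual (operators (Lp p))) (\<Psi>' + \<phi>)" using nPsi' nv by linarith
  moreover have "nrm (dual (operators (Lp p))) (\<Psi>' + \<phi>) \<le> \<rho>"
  proof (rule dual_nrm_le[OF sY rho(1)])
    fix T assume T: "T \<in> vectors (operators (Lp p))"
    have "((\<lambda>N. cmod (pr (dyadic b) (T (ind (dyadic a))) + (\<Sum>j\<in>cells N (dyadic 2). haar_pr j (T (haar j))))) \<longlongrightarrow>
        cmod (pr (dyadic b) (T (ind (dyadic a))) + \<Psi>' T)) F"
      by (intro tendsto_intros lim' T)
    then have "cmod (pr (dyadic b) (T (ind (dyadic a))) + \<Psi>' T) \<le> \<rho> * nrm (operators (Lp p)) T"
      by (rule tendsto_upperbound[OF _ _ F(1)]) (use pair[OF _ T] in \<open>intro eventually_mono[OF evN]\<close>)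
    then show "cmod ((\<Psi>' + \<phi>) T) \<le> \<rho> * nrm (operators (Lp p)) T"
      using T by (simp add: \<phi>_def add.commute)
  qed
  ultimately show False using rho(2) by linarith
qed

end

theorem theorem2p4:
  fixes p :: real and J :: "(fclass \<Rightarrow> fclass) set"
  assumes "1 < p" and "p \<noteq> 2"
    and "M_ideal J (operators (Lp p))"
  shows "J = {0} \<or> J = vectors (operators (Lp p))"
proof (rule ccontr)
  assume ne: "\<not> (J = {0} \<or> J = vectors (operators (Lp p)))"
  have sY: "seminormed (operators (Lp p))" by (rule seminormed_bounded_ops[OF sLp[OF assms(1)] sLp[OF assms(1)]])
  obtain V where J: "closed_subspace J (operators (Lp p))" and V: "csubspace V" "V \<subseteq> vectors (dual (operators (Lp p)))"
    "annihilator (operators (Lp p)) J \<inter> V = {0}"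
    "{f + v |f v. f \<in> annihilator (operators (Lp p)) J \<and> v \<in> V} = vectors (dual (operators (Lp p)))"
    "\<forall>f\<in>annihilator (operators (Lp p)) J. \<forall>v\<in>V. nrm (dual (operators (Lp p))) (f + v)
      = nrm (dual (operators (Lp p))) f + nrm (dual (operators (Lp p))) v"
    using assms(3) unfolding M_ideal_def by (elim conjE exE) (rule that)
  have sub: "csubspace J" "J \<subseteq> vectors (operators (Lp p))" using J unfolding closed_subspace_def by blast+
  have "L_decomp (annihilator (operators (Lp p)) J) V (dual (operators (Lp p)))"
    unfolding L_decomp_def
  proof (intro conjI V)
    interpret Z: seminormed "dual (operators (Lp p))" by (rule seminormed_bounded_ops[OF sY seminormed_scalar_field])
    show "csubspace (annihilator (operators (Lp p)) J)"
      unfolding complex_vector.subspace_def annihilator_def by (auto simp: Z.zero_mem Z.add_mem Z.scale_mem scaleC_apply)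
    show "annihilator (operators (Lp p)) J \<subseteq> vectors (dual (operators (Lp p)))" by (auto simp: annihilator_def)
    show "\<forall>z\<in>vectors (dual (operators (Lp p))). \<exists>w\<in>annihilator (operators (Lp p)) J. \<exists>v\<in>V. z = w + v"
      using V(4) by blast
  qed
  moreover obtain K where "K \<in> J" "K \<noteq> 0"
    using ne complex_vector.subspace_0[OF sub(1)] by blast
  moreover obtain \<psi> where "\<psi> \<in> annihilator (operators (Lp p)) J" "\<psi> \<noteq> 0"
    using annihilator_nontrivial[OF sY J] ne by blast
  ultimately show False using M_ideal_trivial[OF assms(1,2) _ sub(2)] by blast
qed

end
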